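(* Let $D$ be a transitive discriminant form of signature $r$ and level $N=4M$ ($M$ odd square-free) with $D_2=2^{+1}_{t}$, $t=\pm1$, and $D_p=p^{\delta_p}$, $\delta_p=\pm1$, for all primes $p\mid M$. Let $k\in\frac12+\mathbb Z$ with $2k\equiv r\pmod 4$, and let $\epsilon$, $\epsilon^*$ be the sign vectors attached to $D$ and to its dual $D^*$. Let $m,d$ be integers and assume that both of the reduced modular forms $$f_m=\sum_n a_m(n)q^n\in\mathrm A^{\epsilon}(N,k,\chi'),\qquad f^*_d=\sum_n a^*_d(n)q^n\in\mathrm A^{\epsilon^*}(N,2-k,\chi')$$ exist. Then $a_m(-d)=-a^*_d(-m)$.
   Context: A discriminant form is a finite abelian group $D$ with a quadratic form $q:D\to\mathbb Q/\mathbb Z$ with nondegenerate associated bilinear form; its level is the smallest $N\geq 1$ with $Nq=0$; its signature $r\in\mathbb Z/8\mathbb Z$ is the signature mod 8 of any even lattice $L$ with $L'/L\cong D$; it is transitive if the group $\mathrm{Aut}(D)$ of $q$-preserving automorphisms acts transitively on $\{\gamma:q(\gamma)=n\}$ for each $n\in\mathbb Q/\mathbb Z$. $D_p$ is the $p$-primary component. For odd $p$, $p^{\delta}$ is the cyclic group of order $p$ with a generator of norm $a/p$, $\delta=\left(\frac{2a}p\right)$; $2^{+1}_t$ is $\mathbb Z/2\mathbb Z$ with generator of norm $t/4$. **Sign vectors.** $\epsilon=(\epsilon_p)_{p\mid 2M}$ with $\epsilon_2=t\left(\frac{-1}N\right)$ and $\epsilon_p=\chi_p(2M/p)\delta_p$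 for $p\mid M$, where $\chi_p=\left(\frac\cdot p\right)$. $D^*$ is the dual discriminant form (same group, quadratic form $-q$); its sign vector $\epsilon^*$, computed by the same recipe, is $\epsilon^*_p=\chi_p(-1)\epsilon_p$ for $p\mid M$ and $\epsilon_2^*=-\epsilon_2$. In this setting the character $\chi'=\chi\left(\frac N\cdot\right)$ (with $\chi$ the character attached to $D$, which has $\chi_p\neq1$ for all $p\mid M$) is the trivial character mod $N$. **Spaces.** For $A=\begin{pmatrix}a&b\\c&d\end{pmatrix}\in\Gamma_0(N)$ put $\nu(A)=\left(\frac cd\right)\varepsilon_d^{-1}$, with the Kronecker symbol (Shimura's convention: $\left(\frac cd\right)=\mathrm{sign}(c)\left(\frac c{-d}\right)$ for $d<0$, $c\ne0$; $\left(\frac0{\pm1}\right)=1$) and $\varepsilon_d=1$ or $i$ for $d\equiv1$ or $3\bmod4$. For $\kappa\in\frac12+\mathbb Z$, $\mathrm A(N,\kappa,\chi')$ (with $\chi'=1$) is the space of functions $f$ holomorphic on the upper half plane and meromorphic at the cusps, with $f(A\tau)=\left(\nu(A)(c\tau+d)^{1/2}\right)^{2\kappa}f(\tau)$ for all $A\in\Gamma_0(N)$ (principal branch). With $q=e^{2\pi i\tau}$, $\mathrm A^\epsilon(N,\kappa,\chi')$ is the subspace of $f=\sum_na(n)q^n$ such that $a(n)=0$ whenever $n\equiv2$ or $-\epsilon_2\bmod 4$ or $\left(\frac np\right)=-\epsilon_p$ for some $p\mid M$; similarly for $\epsilon^*$. **Reduced forms.** For an integer $n$, $s(n)$ is the number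 of positive divisors of $\gcd(n,M)$ (with $\gcd(0,M)=M$). A form $f=\sum_n a(n)q^n\in\mathrm A^\epsilon(N,\kappa,\chi')$ is called reduced if $f=\frac1{s(m)}q^m+O(q^{m+1})$ for some integer $m$ and, for each $n>m$ with $a(n)\neq0$, there is no $g\in\mathrm A^\epsilon(N,\kappa,\chi')$ with $g=q^n+O(q^{n+1})$. For given $m$ such a form is unique if it exists; it is denoted $f_m$ (for $\mathrm A^\epsilon(N,k,\chi')$) and $f_m^*$ (for $\mathrm A^{\epsilon^*}(N,2-k,\chi')$). *)

theory Defs
  imports
    "HOL-Complex_Analysis.Complex_Analysis"
    "HOL-Number_Theory.Number_Theory"
    "HOL-Computational_Algebra.Squarefree"
    "Jordan_Normal_Form.Determinant"
begin

text \<open>The group is the additive group of a finite type.  A map into \<open>\<rat>/\<int>\<close> is represented by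
  a rational-valued lift, and every condition on it is a condition modulo \<open>\<int>\<close>.\<close>

definition qz_eq :: "rat \<Rightarrow> rat \<Rightarrow> bool" where
  "qz_eq x y \<longleftrightarrow> x - y \<in> \<int>"

definition nsmul :: "nat \<Rightarrow> 'a::ab_group_add \<Rightarrow> 'a" where
  "nsmul n \<gamma> = (\<Sum>i<n. \<gamma>)"

definition df_bilin :: "('a::ab_group_add \<Rightarrow> rat) \<Rightarrow> 'a \<Rightarrow> 'a \<Rightarrow> rat" where
  "df_bilin q \<gamma> \<eta> = q (\<gamma> + \<eta>) - q \<gamma> - q \<eta>"

definition discriminant_form :: "('a::{finite,ab_group_add} \<Rightarrow> rat) \<Rightarrow> bool" where
  "discriminant_form q \<longleftrightarrow>
     (\<forall>n \<gamma>. qz_eq (q (nsmul n \<gamma>)) (of_nat (n^2) * q \<gamma>)) \<and>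
     (\<forall>\<gamma>. qz_eq (q (- \<gamma>)) (q \<gamma>)) \<and>
     (\<forall>\<gamma> \<gamma>' \<eta>. qz_eq (df_bilin q (\<gamma> + \<gamma>') \<eta>) (df_bilin q \<gamma> \<eta> + df_bilin q \<gamma>' \<eta>)) \<and>
     (\<forall>\<gamma>. (\<forall>\<eta>. qz_eq (df_bilin q \<gamma> \<eta>) 0) \<longrightarrow> \<gamma> = 0)"

definition df_dual :: "('a \<Rightarrow> rat) \<Rightarrow> 'a \<Rightarrow> rat" where
  "df_dual q = (\<lambda>\<gamma>. - q \<gamma>)"

definition df_level :: "('a \<Rightarrow> rat) \<Rightarrow> nat" where
  "df_level q = (LEAST N. N \<ge> 1 \<and> (\<forall>\<gamma>. qz_eq (of_nat N * q \<gamma>) 0))"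

definition df_Aut :: "('a::ab_group_add \<Rightarrow> rat) \<Rightarrow> ('a \<Rightarrow> 'a) set" where
  "df_Aut q = {\<sigma>. bij \<sigma> \<and> (\<forall>\<gamma> \<eta>. \<sigma> (\<gamma> + \<eta>) = \<sigma> \<gamma> + \<sigma> \<eta>) \<and> (\<forall>\<gamma>. qz_eq (q (\<sigma> \<gamma>)) (q \<gamma>))}"

definition df_transitive :: "('a::ab_group_add \<Rightarrow> rat) \<Rightarrow> bool" where
  "df_transitive q \<longleftrightarrow>
     (\<forall>n. \<forall>\<gamma>\<in>{\<gamma>. qz_eq (q \<gamma>) n}. \<forall>\<eta>\<in>{\<gamma>. qz_eq (q \<gamma>) n}. \<exists>\<sigma>\<in>df_Aut q. \<sigma> \<gamma> = \<eta>)"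

definition df_primary :: "nat \<Rightarrow> 'a::ab_group_add set" where
  "df_primary p = {\<gamma>. \<exists>j. nsmul (p ^ j) \<gamma> = 0}"

definition df_component_cyclic :: "nat \<Rightarrow> 'a::ab_group_add \<Rightarrow> bool" where
  "df_component_cyclic p \<gamma> \<longleftrightarrow>
     card (df_primary p :: 'a set) = p \<and> df_primary p = range (\<lambda>n. nsmul n \<gamma>)"

text \<open>\<open>D\<^sub>2 = 2\<^sub>t\<^sup>+\<^sup>1\<close>, and \<open>D\<^sub>p = p\<^sup>\<delta>\<close> for odd \<open>p\<close>.\<close>

definition df_two_component :: "('a::ab_group_add \<Rightarrow> rat) \<Rightarrow> int \<Rightarrow> bool" where
  "df_two_component q t \<longleftrightarrow>
     (\<exists>\<gamma>. df_component_cyclic 2 \<gamma> \<and> qz_eq (q \<gamma>) (of_int t / 4))"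

definition df_odd_component :: "('a::ab_group_add \<Rightarrow> rat) \<Rightarrow> nat \<Rightarrow> int \<Rightarrow> bool" where
  "df_odd_component q p \<delta> \<longleftrightarrow>
     (\<exists>\<gamma> a. df_component_cyclic p \<gamma> \<and> qz_eq (q \<gamma>) (of_int a / of_nat p) \<and>
            \<delta> = Legendre (2 * a) (int p))"

text \<open>An even lattice of rank \<open>n\<close> is \<open>\<int>\<^sup>n\<close> with an integral Gram matrix \<open>S\<close>.  Its dual lattice
  lives in \<open>\<rat>\<^sup>n\<close>, and the norm of \<open>x\<close> is \<open>(x,x)/2\<close>.\<close>

definition even_gram :: "nat \<Rightarrow> int mat \<Rightarrow> bool" where
  "even_gram n S \<longleftrightarrow> S \<in> carrier_mat n n \<and> transpose_mat S = S \<and>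
     (\<forall>i<n. even (S $$ (i, i))) \<and> Determinant.det S \<noteq> 0"

definition lat_bilin :: "int mat \<Rightarrow> rat vec \<Rightarrow> rat vec \<Rightarrow> rat" where
  "lat_bilin S x y = scalar_prod x (mult_mat_vec (map_mat rat_of_int S) y)"

definition std_lattice :: "nat \<Rightarrow> rat vec set" where
  "std_lattice n = {x \<in> carrier_vec n. \<forall>i<n. vec_index x i \<in> \<int>}"

definition dual_lattice :: "nat \<Rightarrow> int mat \<Rightarrow> rat vec set" where
  "dual_lattice n S = {x \<in> carrier_vec n. \<forall>y\<in>std_lattice n. lat_bilin S x y \<in> \<int>}"

text \<open>\<open>L'/L \<cong> D\<close>: the isomorphism is given as a surjective homomorphism on \<open>L'\<close> with kernel \<open>L\<close>.\<close>

definition lattice_disc_iso :: "nat \<Rightarrow> int mat \<Rightarrow> ('a::ab_group_add \<Rightarrow> rat) \<Rightarrow> bool" where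
  "lattice_disc_iso n S q \<longleftrightarrow>
     (\<exists>\<phi> :: rat vec \<Rightarrow> 'a.
        (\<forall>x\<in>dual_lattice n S. \<forall>y\<in>dual_lattice n S. \<phi> (x + y) = \<phi> x + \<phi> y) \<and>
        \<phi> ` dual_lattice n S = UNIV \<and>
        {x \<in> dual_lattice n S. \<phi> x = 0} = std_lattice n \<and>
        (\<forall>x\<in>dual_lattice n S. qz_eq (q (\<phi> x)) (lat_bilin S x x / 2)))"

text \<open>\<open>L \<otimes> \<real>\<close> is isometric to the standard quadratic space of type \<open>(bp, n - bp)\<close>.\<close>

definition lat_type :: "nat \<Rightarrow> int mat \<Rightarrow> nat \<Rightarrow> bool" where
  "lat_type n S bp \<longleftrightarrow> bp \<le> n \<and>
     (\<exists>P \<in> carrier_mat n n. invertible_mat P \<and>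
        transpose_mat P * map_mat real_of_int S * P =
        Matrix.mat n n (\<lambda>(i, j). if i \<noteq> j then 0 else if i < bp then 1 else -1))"

definition df_signature :: "('a::ab_group_add \<Rightarrow> rat) \<Rightarrow> int \<Rightarrow> bool" where
  "df_signature q r \<longleftrightarrow>
     (\<exists>n S bp. even_gram n S \<and> lattice_disc_iso n S q \<and> lat_type n S bp \<and>
        [r = int bp - int (n - bp)] (mod 8))"

definition kronecker_prime :: "int \<Rightarrow> nat \<Rightarrow> int" where
  "kronecker_prime a p =
     (if p = 2 then (if even a then 0 else if a mod 8 \<in> {1, 7} then 1 else -1)
      else Legendre a (int p))"

text \<open>For odd \<open>n\<close> this is Shimura's symbol: the factor for the unit \<open>-1\<close> is the sign of \<open>a\<close>,
  read as \<open>1\<close> for \<open>a = 0\<close>.\<close>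

definition kronecker :: "int \<Rightarrow> int \<Rightarrow> int" where
  "kronecker a n =
     (if n = 0 then (if \<bar>a\<bar> = 1 then 1 else 0)
      else (if n < 0 \<and> a < 0 then -1 else 1) *
           (\<Prod>p\<in>prime_factors (nat \<bar>n\<bar>).
              kronecker_prime a p ^ multiplicity p (nat \<bar>n\<bar>)))"

text \<open>Only the values of \<open>\<epsilon>\<close> at \<open>2\<close> and at the primes dividing \<open>M\<close> are meaningful.\<close>

definition sign_vector :: "('a::ab_group_add \<Rightarrow> rat) \<Rightarrow> nat \<Rightarrow> (nat \<Rightarrow> int) \<Rightarrow> bool" where
  "sign_vector q M \<epsilon> \<longleftrightarrow>
     (\<exists>t\<in>{1, -1}. df_two_component q t \<and> \<epsilon> 2 = t * kronecker (-1) (4 * int M)) \<and>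
     (\<forall>p. prime p \<and> p dvd M \<longrightarrow>
        (\<exists>\<delta>\<in>{1, -1}. df_odd_component q p \<delta> \<and>
           \<epsilon> p = Legendre (int (2 * M div p)) (int p) * \<delta>))"

definition upper_half_plane :: "complex set" where
  "upper_half_plane = {\<tau>. 0 < Im \<tau>}"

definition eps_odd :: "int \<Rightarrow> complex" where
  "eps_odd d = (if d mod 4 = 1 then 1 else \<i>)"

definition theta_mult :: "int \<Rightarrow> int \<Rightarrow> complex" where
  "theta_mult c d = of_int (kronecker c d) * inverse (eps_odd d)"

definition moebius_int :: "int \<Rightarrow> int \<Rightarrow> int \<Rightarrow> int \<Rightarrow> complex \<Rightarrow> complex" where
  "moebius_int a b c d \<tau> = (of_int a * \<tau> + of_int b) / (of_int c * \<tau> + of_int d)"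

text \<open>\<open>f = \<Sum> a(n) q\<^sup>n\<^sup>/\<^sup>h\<close> with finitely many negative exponents.\<close>

definition has_q_expansion :: "nat \<Rightarrow> (complex \<Rightarrow> complex) \<Rightarrow> (int \<Rightarrow> complex) \<Rightarrow> bool" where
  "has_q_expansion h f a \<longleftrightarrow>
     (\<exists>n0. \<forall>n<n0. a n = 0) \<and>
     (\<forall>\<tau>\<in>upper_half_plane.
        ((\<lambda>n. a n * exp (2 * of_real pi * \<i> * of_int n * \<tau> / of_nat h)) has_sum f \<tau>) UNIV)"

text \<open>The weight \<open>\<kappa>\<close> lies in \<open>1/2 + \<int>\<close>, so that the exponent \<open>2\<kappa>\<close> is the integer \<open>\<lfloor>2\<kappa>\<rfloor>\<close>.
  Meromorphy at all cusps is the existence of a finite-tailed expansion, in some \<open>q\<^sup>1\<^sup>/\<^sup>h\<close>, of every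
  \<open>(c\<tau> + d)\<^sup>-\<^sup>\<kappa> f(A\<tau>)\<close> with \<open>A\<close> in \<open>SL\<^sub>2(\<int>)\<close>.\<close>

definition mod_forms :: "nat \<Rightarrow> real \<Rightarrow> (complex \<Rightarrow> complex) set" where
  "mod_forms N \<kappa> = {f.
     f holomorphic_on upper_half_plane \<and>
     (\<forall>a b c d. a * d - b * c = 1 \<and> int N dvd c \<longrightarrow>
        (\<forall>\<tau>\<in>upper_half_plane. f (moebius_int a b c d \<tau>) =
           (theta_mult c d * csqrt (of_int c * \<tau> + of_int d)) powi \<lfloor>2 * \<kappa>\<rfloor> * f \<tau>)) \<and>
     (\<forall>a b c d. a * d - b * c = 1 \<longrightarrow>
        (\<exists>h>0. \<exists>u. has_q_expansion h
           (\<lambda>\<tau>. csqrt (of_int c * \<tau> + of_int d) powi (- \<lfloor>2 * \<kappa>\<rfloor>) * f (moebius_int a b c d \<tau>)) u))}"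

definition eps_forms :: "nat \<Rightarrow> real \<Rightarrow> (nat \<Rightarrow> int) \<Rightarrow> (complex \<Rightarrow> complex) set" where
  "eps_forms M \<kappa> \<epsilon> = {f \<in> mod_forms (4 * M) \<kappa>. \<exists>a. has_q_expansion 1 f a \<and>
     (\<forall>n. [n = 2] (mod 4) \<or> [n = - \<epsilon> 2] (mod 4) \<or>
          (\<exists>p. prime p \<and> p dvd M \<and> Legendre n (int p) = - \<epsilon> p) \<longrightarrow> a n = 0)}"

definition s_num :: "nat \<Rightarrow> int \<Rightarrow> nat" where
  "s_num M n = card {e::nat. int e dvd gcd n (int M)}"

definition reduced_form ::
  "nat \<Rightarrow> real \<Rightarrow> (nat \<Rightarrow> int) \<Rightarrow> int \<Rightarrow> (complex \<Rightarrow> complex) \<Rightarrow> (int \<Rightarrow> complex) \<Rightarrow> bool" where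
  "reduced_form M \<kappa> \<epsilon> m f a \<longleftrightarrow>
     f \<in> eps_forms M \<kappa> \<epsilon> \<and> has_q_expansion 1 f a \<and>
     a m = 1 / of_nat (s_num M m) \<and> (\<forall>n<m. a n = 0) \<and>
     (\<forall>n>m. a n \<noteq> 0 \<longrightarrow>
        \<not> (\<exists>g\<in>eps_forms M \<kappa> \<epsilon>. \<exists>b. has_q_expansion 1 g b \<and> b n = 1 \<and> (\<forall>j<n. b j = 0)))"

end

theory Submission
  imports Defs "HOL-Real_Asymp.Real_Asymp"
begin

text \<open>In the variable \<open>q\<^sup>1\<^sup>/\<^sup>N\<close> an element \<open>f\<close> of \<open>A\<^sup>\<epsilon>\<close> splits into components \<open>F c\<close>, with
  exponents in the residue classes \<open>c = u x\<^sup>2\<close> modulo \<open>4 M\<close> for a unit \<open>u\<close> with the signs \<open>\<epsilon>\<close>.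
  The transformations of \<open>f\<close> under the matrices with lower left entry \<open>N\<close> and upper left entry any unit
  modulo \<open>N\<close> determine the behaviour of all \<open>F c\<close> under \<open>\<tau> \<mapsto> - 1 / \<tau>\<close>, because the values at units of
  a character sum supported on these classes determine the sum.  So \<open>F\<close> is a vector-valued form for
  \<open>SL\<^sub>2(\<int>)\<close>, and conversely every such form comes from an element of \<open>A\<^sup>\<epsilon>\<close>.

  For \<open>F\<close> of weight \<open>k\<close> and a dual \<open>F'\<close> of weight \<open>2 - k\<close> the pairing \<open>\<Sum>\<^sub>c s(c) F\<^sub>c F'\<^sub>c\<close> has weight two
  and level one, so its constant term \<open>\<Sum>\<^sub>n s(n) a(n) a'(- n)\<close> vanishes.  Conversely, a formal series
  annihilating all forms of weight \<open>k\<close> in this sense is a form: its pairings with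
  the Serre derivatives of \<open>F\<close> are level one forms, and these derivatives span at every point, so the
  series solves a convergent linear system.  Hence if no form of weight \<open>k\<close> starts with \<open>q\<^sup>n\<close>, some dual form
  starts with \<open>q\<^sup>-\<^sup>n\<close>.  For reduced \<open>f\<close>, \<open>f'\<close> this kills every term with \<open>m < n < - d\<close>, and the two
  extreme terms give \<open>a'(- m) + a(- d) = 0\<close>.\<close>

section \<open>The Eisenstein series of weight two\<close>

text \<open>The obstacle is that the dual series supplied by linear algebra is only formal: nothing
  bounds its coefficients. Serre duality on the modular curve is replaced by algebra over the
  \<open>j\<close>-line: a formal series whose products with all powers of \<open>Jfun\<close> have
  constant term zero is \<open>Omega\<close> times a level one form of weight zero, hence convergent
  (\<open>formal_weight_two\<close>). Serre derivatives need the quasi-modular Eisenstein series of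
  weight two; \<open>Delta\<close>, \<open>E4\<close> and \<open>E6\<close> are obtained from it as
  well, so its inversion law is the analytic foundation. Weights are stored as \<open>K\<close>,
  twice the weight, with automorphy factors that are powers of \<open>csqrt\<close>. The metaplectic
  cover never appears: sign ambiguities are constants, absorbed into transformation matrices or
  settled by comparison with a form that exists. The two given forms therefore serve as seeds for
  Serre derivatives, fix the multipliers of all other forms, and force the scalar
  \<open>\<gamma>\<close> of the pairing to be 1. The factors \<open>s\<close> count: the residues
  modulo \<open>2 M\<close> of norm class \<open>c\<close> number \<open>tau(M) / s(c)\<close>, with
  \<open>tau(M)\<close> the number of divisors of \<open>M\<close>.\<close>

lemma not_nonpos_Ints_of_Im: "Im z \<noteq> 0 \<Longrightarrow> z \<notin> \<int>\<^sub>\<le>\<^sub>0"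
  by (auto elim!: nonpos_Ints_cases)

lemma sin_pi_nonzero_of_Im: "Im z \<noteq> 0 \<Longrightarrow> sin (of_real pi * z) \<noteq> 0"
  by (subst sin_eq_0) (auto simp: complex_eq_iff)

text \<open>Logarithmic derivative of the reflection formula
  \<open>rGamma z * rGamma (1 - z) = sin (pi z) / pi\<close>.\<close>

lemma Digamma_reflection_complex:
  fixes z :: complex
  assumes "Im z \<noteq> 0"
  shows "Digamma (1 - z) - Digamma z = of_real pi * cot (of_real pi * z)"
proof -
  have z: "z \<notin> \<int>\<^sub>\<le>\<^sub>0" "1 - z \<notin> \<int>\<^sub>\<le>\<^sub>0"
    using assms by (auto intro!: not_nonpos_Ints_of_Im)
  have "((\<lambda>z. rGamma z * rGamma (1 - z)) has_field_derivative
      (- rGamma z * Digamma z) * rGamma (1 - z) + rGamma z * (rGamma (1 - z) * Digamma (1 - z))) (at z)"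
    using z by (auto intro!: derivative_eq_intros DERIV_chain'[where f="\<lambda>z. 1 - z" and g=rGamma]
        has_field_derivative_rGamma_no_nonpos_int)
  moreover have "((\<lambda>z::complex. sin (of_real pi * z) / of_real pi) has_field_derivative
      cos (of_real pi * z)) (at z)"
    by (auto intro!: derivative_eq_intros)
  ultimately have "(- rGamma z * Digamma z) * rGamma (1 - z) + rGamma z * (rGamma (1 - z) * Digamma (1 - z))
      = cos (of_real pi * z)"
    unfolding rGamma_reflection_complex using DERIV_unique by blast
  then have "rGamma z * rGamma (1 - z) * (Digamma (1 - z) - Digamma z) = cos (of_real pi * z)"
    by (simp add: algebra_simps)
  then show ?thesis
    unfolding rGamma_reflection_complex using sin_pi_nonzero_of_Im[OF assms]
    by (simp add: cot_def field_simps)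
qed

text \<open>The derivative of the previous identity. As \<open>Polygamma 1 z\<close> is the sum of
  \<open>1 / (z + j)^2\<close> over \<open>j \<ge> 0\<close>, this is the partial fraction expansion
  of the squared cosecant; it is used for both the rows and the columns of the Eisenstein
  series.\<close>

lemma Polygamma_1_reflection_complex:
  fixes z :: complex
  assumes "Im z \<noteq> 0"
  shows "Polygamma 1 z + Polygamma 1 (1 - z) = of_real pi ^ 2 / sin (of_real pi * z) ^ 2"
proof -
  have z: "z \<notin> \<int>\<^sub>\<le>\<^sub>0" "1 - z \<notin> \<int>\<^sub>\<le>\<^sub>0"
    using assms by (auto intro!: not_nonpos_Ints_of_Im)
  have nz: "sin (of_real pi * z) \<noteq> 0"
    by (rule sin_pi_nonzero_of_Im[OF assms])
  have ev: "\<forall>\<^sub>F w in nhds z. Digamma (1 - w) - Digamma w = of_real pi * (cos (of_real pi * w) / sin (of_real pi * w))"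
  proof -
    have "open {w. Im w \<noteq> 0}"
      by (intro open_Collect_neq continuous_intros)
    then have "\<forall>\<^sub>F w in nhds z. w \<in> {w. Im w \<noteq> 0}"
      using assms by (intro eventually_nhds_in_open) auto
    then show ?thesis
      by eventually_elim (simp add: Digamma_reflection_complex cot_def)
  qed
  have "((\<lambda>w. Digamma (1 - w) - Digamma w) has_field_derivative - Polygamma 1 (1 - z) - Polygamma 1 z) (at z)"
    using z by (auto intro!: derivative_eq_intros DERIV_chain'[where f="\<lambda>z. 1 - z" and g="Polygamma 0"])
  moreover have "((\<lambda>w. of_real pi * (cos (of_real pi * w) / sin (of_real pi * w))) has_field_derivative
     - (of_real pi ^ 2 / sin (of_real pi * z) ^ 2)) (at z)"
  proof -
    have sc: "sin (of_real pi * z) * sin (of_real pi * z) + cos (of_real pi * z) * cos (of_real pi * z) = 1"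
      using sin_cos_squared_add[of "of_real pi * z"] by (simp add: power2_eq_square)
    have "p * (((- S * p) * S - C * (C * p)) / (S * S)) = - (p\<^sup>2 * (S * S + C * C) / S\<^sup>2)"
      if "S \<noteq> 0" for p S C :: complex
      using that by (simp add: power2_eq_square divide_simps) (simp add: algebra_simps)
    from this[OF nz, of "of_real pi" "cos (of_real pi * z)"]
    have eq: "of_real pi * (((- sin (of_real pi * z) * of_real pi) * sin (of_real pi * z) -
        cos (of_real pi * z) * (cos (of_real pi * z) * of_real pi)) / (sin (of_real pi * z) * sin (of_real pi * z)))
      = - (of_real pi ^ 2 / sin (of_real pi * z) ^ 2)"
      by (simp only: sc mult_1_right)
    have "((\<lambda>w. of_real pi * (cos (of_real pi * w) / sin (of_real pi * w))) has_field_derivative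
      of_real pi * (((- sin (of_real pi * z) * of_real pi) * sin (of_real pi * z) -
        cos (of_real pi * z) * (cos (of_real pi * z) * of_real pi)) / (sin (of_real pi * z) * sin (of_real pi * z)))) (at z)"
      by (intro DERIV_cmult DERIV_divide nz) (auto intro!: derivative_eq_intros)
    then show ?thesis unfolding eq .
  qed
  ultimately have "- Polygamma 1 (1 - z) - Polygamma 1 z = - (of_real pi ^ 2 / sin (of_real pi * z) ^ 2)"
    using DERIV_cong_ev[OF refl ev refl] DERIV_unique by blast
  then show ?thesis
    by (metis add.commute add_uminus_conv_diff minus_add_distrib minus_equation_iff)
qed

text \<open>Telescoping evaluates only symmetric partial sums; this identifies their limit with an
  unconditional sum already known to exist.\<close>

lemma has_sum_int_symmetric_tendsto:
  fixes f :: "int \<Rightarrow> 'b::{comm_monoid_add,topological_space}"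
  assumes "(f has_sum S) UNIV"
  shows "(\<lambda>K. \<Sum>n=-int K..int K. f n) \<longlonglongrightarrow> S"
proof -
  have "filterlim (\<lambda>K. {-int K..int K}) (finite_subsets_at_top UNIV) sequentially"
    unfolding filterlim_finite_subsets_at_top
  proof (intro allI impI)
    fix X :: "int set" assume X: "finite X \<and> X \<subseteq> UNIV"
    define B where "B = nat (Max (insert 0 (abs ` X)))"
    have "\<forall>\<^sub>F K in sequentially. B \<le> K" by (rule eventually_ge_at_top)
    then show "\<forall>\<^sub>F K in sequentially. finite {-int K..int K} \<and> X \<subseteq> {-int K..int K} \<and> {-int K..int K} \<subseteq> UNIV"
    proof eventually_elim
      case (elim K)
      have "\<bar>x\<bar> \<le> int K" if "x \<in> X" for x
      proof -
        have "\<bar>x\<bar> \<le> Max (insert 0 (abs ` X))"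
          using X that by (intro Max_ge) auto
        then show ?thesis using elim unfolding B_def by linarith
      qed
      then show ?case by fastforce
    qed
  qed
  then show ?thesis
    using assms filterlim_compose unfolding has_sum_def by blast
qed

lemma cot_tendsto_lower:
  assumes "filterlim (\<lambda>n. Im (w n)) at_bot F"
  shows "((\<lambda>n. cot (w n)) \<longlongrightarrow> \<i>) F"
proof -
  \<comment> \<open>Written in \<open>exp (-2 i z)\<close>, which tends to 0 as \<open>Im z\<close>
    tends to minus infinity.\<close>
  have eq: "cot z = \<i> * (1 + exp (-2 * \<i> * z)) / (1 - exp (-2 * \<i> * z))" for z :: complex
  proof -
    have e: "exp (- (\<i> * z)) = exp (\<i> * z) * exp (-2 * \<i> * z)"
      by (simp flip: exp_add)
    have *: "(E + E * q) / 2 / ((E - E * q) / (2 * \<i>)) = \<i> * (1 + q) / (1 - q)" if "E \<noteq> 0" for E q :: complex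
      using that by (cases "q = 1") (auto simp: divide_simps, auto simp: algebra_simps)
    show ?thesis
      unfolding cot_def sin_exp_eq cos_exp_eq e by (rule *) simp
  qed
  have "((\<lambda>n. exp (-2 * \<i> * w n)) \<longlongrightarrow> 0) F"
  proof (rule tendsto_norm_zero_cancel)
    have "((\<lambda>n. exp (2 * Im (w n))) \<longlongrightarrow> 0) F"
      using filterlim_tendsto_pos_mult_at_bot[OF tendsto_const _ assms, of 2]
      by (intro filterlim_compose[OF exp_at_bot]) auto
    then show "((\<lambda>n. norm (exp (-2 * \<i> * w n))) \<longlongrightarrow> 0) F"
      by simp
  qed
  then have "((\<lambda>n. \<i> * (1 + exp (-2 * \<i> * w n)) / (1 - exp (-2 * \<i> * w n))) \<longlongrightarrow> \<i> * (1 + 0) / (1 - 0)) F"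
    by (intro tendsto_intros) auto
  then show ?thesis by (simp add: eq)
qed

definition csc_square :: "complex \<Rightarrow> complex" where
  "csc_square z = of_real pi ^ 2 / sin (of_real pi * z) ^ 2"

text \<open>The terms \<open>1 / z^2\<close> alone converge only conditionally over the lattice.
  Subtracting \<open>1 / (z^2 - 1/4)\<close>, written as a telescoping difference in
  \<open>n\<close>, leaves order \<open>|z|^-4\<close>, so that rows and columns may be
  interchanged. The correction contributes nothing to the rows, and to the columns the whole anomaly
  of weight two.\<close>

definition eisenstein_summand :: "complex \<Rightarrow> nat \<times> int \<Rightarrow> complex" where
  "eisenstein_summand \<tau> = (\<lambda>(k, n). let z = of_nat (Suc k) * \<tau> + of_int n
     in 1 / z^2 - (1 / (z - 1/2) - 1 / (z + 1/2)))"

lemma csc_square_minus: "csc_square (- z) = csc_square z"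
  by (simp add: csc_square_def)

text \<open>\<open>|z|\<close> dominates a multiple of \<open>m + |n|\<close>, and the fourth power
  of \<open>m + |n|\<close> splits into a product majorant with separately summable factors.\<close>

lemma eisenstein_summand_bound:
  assumes "Im \<tau> > 0"
  obtains C where "\<And>k n. norm (eisenstein_summand \<tau> (k, n)) \<le> C * (1 / real (Suc k) ^ 2 * (1 / (1 + \<bar>real_of_int n\<bar>)^2))"
proof
  define y where "y = Im \<tau>"
  \<comment> \<open>\<open>B\<close> compares \<open>|z|\<close> with \<open>m + |n|\<close>, using
    \<open>Im z = m y\<close>; \<open>D\<close> bounds the loss in \<open>|z|\<close> under the
    shifts by one half.\<close>
  define B where "B = 1 + (1 + norm \<tau>) / y"
  define D where "D = 1 + 1 / (2 * y)"
  have y: "y > 0" using assms by (simp add: y_def)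
  have BD: "B > 0" "D > 0" using y by (auto simp: B_def D_def intro!: add_pos_nonneg)
  fix k :: nat and n :: int
  define m where "m = real (Suc k)"
  define z where "z = of_nat (Suc k) * \<tau> + of_int n"
  have m: "m \<ge> 1" by (simp add: m_def)
  have Imz: "Im z = m * y" by (simp add: z_def m_def y_def)
  have my: "m * y \<ge> y" using m y by simp
  have half: "norm z \<le> D * norm w" if "w = z - 1/2 \<or> w = z + 1/2" for w
  proof -
    have "Im w = Im z" using that by auto
    then have "norm w \<ge> y"
      using abs_Im_le_cmod[of w] Imz my by linarith
    moreover have "norm z \<le> norm w + 1/2"
    proof -
      have "norm (z - w) = 1/2"
        using that by auto
      then show ?thesis
        by (metis add.commute norm_triangle_sub)
    qed
    moreover have "1/2 \<le> 1 / (2*y) * norm w"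
      using \<open>norm w \<ge> y\<close> y by (simp add: field_simps)
    ultimately show ?thesis
      unfolding D_def by (simp add: algebra_simps)
  qed
  have mz: "m \<le> norm z / y"
    using abs_Im_le_cmod[of z] Imz y by (simp add: field_simps)
  have "\<bar>real_of_int n\<bar> = norm (z - of_nat (Suc k) * \<tau>)"
    by (simp add: z_def)
  also have "\<dots> \<le> norm z + m * norm \<tau>"
    using norm_triangle_ineq4[of z "of_nat (Suc k) * \<tau>"] unfolding norm_mult norm_of_nat m_def .
  also have "\<dots> \<le> norm z + norm z / y * norm \<tau>"
    using mz by (intro add_left_mono mult_right_mono) auto
  finally have "m + \<bar>real_of_int n\<bar> \<le> B * norm z"
    using mz by (simp add: B_def algebra_simps add_divide_distrib)
  then have z1: "norm z \<ge> (m + \<bar>real_of_int n\<bar>) / B"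
    using BD by (simp add: field_simps)
  have "0 < (m + \<bar>real_of_int n\<bar>) / B"
    using m BD by (intro divide_pos_pos) auto
  then have z0: "norm z > 0" using z1 by linarith
  have w0: "norm (z - 1/2) \<ge> norm z / D" "norm (z + 1/2) \<ge> norm z / D"
    using half[of "z-1/2"] half[of "z+1/2"] BD by (auto simp: field_simps)
  have zD: "norm z / D > 0" using z0 BD by simp
  then have wpos: "norm (z - 1/2) > 0" "norm (z + 1/2) > 0"
    using w0 by linarith+
  then have nz: "z \<noteq> 0" "z - 1/2 \<noteq> 0" "z + 1/2 \<noteq> 0"
    using z0 by (metis norm_zero less_irrefl)+
  have e: "eisenstein_summand \<tau> (k, n) = - (1/4) / (z^2 * ((z - 1/2) * (z + 1/2)))"
  proof -
    have "1 / (z - 1/2) - 1 / (z + 1/2) = 1 / ((z - 1/2) * (z + 1/2))"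
      using nz(2,3) by (simp add: diff_frac_eq)
    moreover have "1/z^2 - 1/P = - (1/4) / (z^2 * P)" if "P = z^2 - 1/4" "P \<noteq> 0" for P
      using that nz by (simp add: diff_frac_eq)
    moreover have "(z - 1/2) * (z + 1/2) = z^2 - 1/4" 
      by (simp add: power2_eq_square algebra_simps)
    ultimately show ?thesis using nz
      by (simp only: eisenstein_summand_def prod.case Let_def z_def[symmetric]) (metis mult_eq_0_iff)
  qed
  have "norm (eisenstein_summand \<tau> (k, n)) = (1/4) / (norm z ^ 2 * (norm (z - 1/2) * norm (z + 1/2)))"
    by (simp add: e norm_divide norm_mult norm_power)
  also have "\<dots> \<le> (1/4) / (norm z ^ 2 * (norm z / D * (norm z / D)))"
    by (intro divide_left_mono mult_left_mono mult_mono mult_pos_pos w0 zero_less_power zD z0 wpos) (use zD in auto)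
  also have "\<dots> = D^2 / 4 / norm z ^ 4"
    using z0 BD by (simp add: field_simps power_numeral_reduce)
  also have "\<dots> \<le> D^2 / 4 / ((m + \<bar>real_of_int n\<bar>) / B) ^ 4"
    using z1 z0 m BD by (intro divide_left_mono power_mono mult_pos_pos) auto
  also have "\<dots> = D^2 * B^4 / 4 / (m + \<bar>real_of_int n\<bar>) ^ 4"
    using BD by (simp add: field_simps)
  also have "\<dots> \<le> D^2 * B^4 / 4 / (m^2 * (1 + \<bar>real_of_int n\<bar>)^2)"
  proof (intro divide_left_mono)
    have "m^2 * (1 + \<bar>real_of_int n\<bar>)^2 \<le> (m + \<bar>real_of_int n\<bar>)^2 * (m + \<bar>real_of_int n\<bar>)^2"
      using m by (intro mult_mono power_mono) auto
    then show "m^2 * (1 + \<bar>real_of_int n\<bar>)^2 \<le> (m + \<bar>real_of_int n\<bar>)^4"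
      by (simp flip: power_add)
  qed (use m BD in auto)
  finally show "norm (eisenstein_summand \<tau> (k, n)) \<le> (D^2 * B^4 / 4) * (1 / real (Suc k) ^ 2 * (1 / (1 + \<bar>real_of_int n\<bar>)^2))"
    by (simp add: m_def)
qed

lemma summable_on_inverse_square_nat: "(\<lambda>k. 1 / real (Suc k) ^ 2) summable_on UNIV"
proof -
  have "summable (\<lambda>k. 1 / real (Suc k) ^ 2)"
    using inverse_power_summable[of 2, where ?'a=real] summable_Suc_iff[of "\<lambda>n. inverse (real n ^ 2)"]
    by (simp add: inverse_eq_divide)
  then show ?thesis
    by (intro norm_summable_imp_summable_on) auto
qed

lemma summable_on_inverse_square_int: "(\<lambda>n. 1 / (1 + \<bar>real_of_int n\<bar>)^2) summable_on UNIV"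
proof -
  have "(\<lambda>n. 1 / (1 + \<bar>real_of_int n\<bar>)^2) summable_on range int"
    using summable_on_inverse_square_nat by (subst summable_on_reindex) (auto simp: o_def add.commute)
  moreover have "(\<lambda>n. 1 / (1 + \<bar>real_of_int n\<bar>)^2) summable_on range (\<lambda>k. - int k)"
    using summable_on_inverse_square_nat by (subst summable_on_reindex) (auto simp: o_def add.commute inj_on_def)
  ultimately have "(\<lambda>n. 1 / (1 + \<bar>real_of_int n\<bar>)^2) summable_on (range int \<union> range (\<lambda>k. - int k))"
    by (rule summable_on_union)
  moreover have "range int \<union> range (\<lambda>k. - int k) = UNIV"
  proof -
    have "n \<in> range int \<union> range (\<lambda>k. - int k)" for n
      by (cases "n \<ge> 0") (auto simp: image_iff intro: exI[of _ "nat n"] exI[of _ "nat (- n)"])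
    then show ?thesis by auto
  qed
  ultimately show ?thesis by simp
qed

lemma summable_on_times:
  fixes f :: "'a \<Rightarrow> real" and g :: "'b \<Rightarrow> real"
  assumes "f summable_on A" "g summable_on B" "\<And>x. x \<in> A \<Longrightarrow> f x \<ge> 0" "\<And>y. y \<in> B \<Longrightarrow> g y \<ge> 0"
  shows "(\<lambda>(x, y). f x * g y) summable_on A \<times> B"
proof (rule summable_on_SigmaI)
  show "((\<lambda>y. case (x, y) of (x, y) \<Rightarrow> f x * g y) has_sum f x * infsum g B) B" if "x \<in> A" for x
    using has_sum_cmult_right[OF has_sum_infsum[OF assms(2)]] by simp
qed (use assms in \<open>auto intro!: summable_on_cmult_left\<close>)

lemma eisenstein_summand_summable:
  assumes "Im \<tau> > 0"
  shows "eisenstein_summand \<tau> summable_on UNIV \<times> UNIV"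
proof -
  obtain C where C: "\<And>k n. norm (eisenstein_summand \<tau> (k, n)) \<le> C * (1 / real (Suc k) ^ 2 * (1 / (1 + \<bar>real_of_int n\<bar>)^2))"
    using eisenstein_summand_bound[OF assms] by blast
  have "(\<lambda>(k, n). C * (1 / real (Suc k) ^ 2 * (1 / (1 + \<bar>real_of_int n\<bar>)^2))) summable_on UNIV \<times> UNIV"
    using summable_on_cmult_right[OF summable_on_times[OF summable_on_inverse_square_nat summable_on_inverse_square_int], of C]
    by (simp add: case_prod_unfold)
  then have "(\<lambda>x. norm (eisenstein_summand \<tau> x)) summable_on UNIV \<times> UNIV"
    by (rule Infinite_Sum.abs_summable_on_comparison_test') (use C in auto)
  then show ?thesis by (rule abs_summable_summable)
qed

lemma sum_int_symmetric_Suc: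
  fixes f :: "int \<Rightarrow> 'b::comm_monoid_add"
  shows "(\<Sum>n=-int (Suc K)..int (Suc K). f n) = f (- int (Suc K)) + (\<Sum>n=-int K..int K. f n) + f (int (Suc K))"
proof -
  have "{-int (Suc K)..int (Suc K)} = insert (- int (Suc K)) (insert (int (Suc K)) {-int K..int K})"
    by auto
  then show ?thesis by (simp add: add_ac)
qed

lemma sum_int_symmetric_telescope:
  fixes g :: "int \<Rightarrow> 'b::ab_group_add"
  shows "(\<Sum>n=-int K..int K. g n - g (n + 1)) = g (- int K) - g (int K + 1)"
proof (induction K)
  case (Suc K)
  have "- int (Suc K) + 1 = - int K" "int (Suc K) = int K + 1" by auto
  then show ?case unfolding sum_int_symmetric_Suc Suc.IH by (simp add: add_ac)
qed simp

lemma sum_int_symmetric_split: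
  fixes f :: "int \<Rightarrow> 'b::comm_monoid_add"
  shows "(\<Sum>n=-int K..int K. f n) = (\<Sum>j<Suc K. f (int j)) + (\<Sum>j<K. f (- int (Suc j)))"
proof (induction K)
  case (Suc K)
  show ?case unfolding sum_int_symmetric_Suc Suc.IH by (simp add: add_ac)
qed simp

text \<open>The correction telescopes to boundary terms that tend to 0, and reflection for
  \<open>Polygamma 1\<close> sums the rest.\<close>

lemma eisenstein_summand_row:
  assumes "Im \<tau> > 0"
  shows "((\<lambda>n. eisenstein_summand \<tau> (k, n)) has_sum csc_square (of_nat (Suc k) * \<tau>)) UNIV"
proof -
  define z where "z = of_nat (Suc k) * \<tau>"
  have Imz: "Im z \<noteq> 0" using assms by (simp add: z_def)
  have "(\<lambda>n. eisenstein_summand \<tau> (k, n)) summable_on UNIV"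
    using summable_on_SigmaD1[of "\<lambda>k n. eisenstein_summand \<tau> (k, n)" UNIV "\<lambda>_. UNIV" k]
      eisenstein_summand_summable[OF assms] by (simp add: case_prod_unfold)
  then obtain S where S: "((\<lambda>n. eisenstein_summand \<tau> (k, n)) has_sum S) UNIV"
    by (auto simp: summable_on_def)
  have "(\<lambda>K. \<Sum>n=-int K..int K. eisenstein_summand \<tau> (k, n)) \<longlonglongrightarrow> csc_square z"
  proof -
    have p: "(\<lambda>j. inverse ((w + of_nat j)^2)) sums Polygamma 1 w" if "w \<noteq> 0" for w :: complex
      using Polygamma_LIMSEQ[OF that, of 1] by (simp add: numeral_2_eq_2)
    have nz: "z \<noteq> 0" "1 - z \<noteq> 0" using Imz by (auto simp: complex_eq_iff)
    have "(\<lambda>K. (\<Sum>j<Suc K. inverse ((z + of_nat j)^2)) + (\<Sum>j<K. inverse ((1 - z + of_nat j)^2)))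
        \<longlonglongrightarrow> Polygamma 1 z + Polygamma 1 (1 - z)"
      using p[OF nz(1)] p[OF nz(2)] unfolding sums_def
      by (intro tendsto_add LIMSEQ_Suc) auto
    moreover have "(\<Sum>j<Suc K. inverse ((z + of_nat j)^2)) + (\<Sum>j<K. inverse ((1 - z + of_nat j)^2))
       = (\<Sum>n=-int K..int K. 1 / (z + of_int n)^2)" for K
    proof -
      have "inverse ((1 - z + of_nat j)^2) = 1 / (z + of_int (- int (Suc j)))^2" for j
        by (simp add: inverse_eq_divide power2_eq_square algebra_simps)
      then show ?thesis
        unfolding sum_int_symmetric_split by (simp add: inverse_eq_divide)
    qed
    ultimately have 1: "(\<lambda>K. \<Sum>n=-int K..int K. 1 / (z + of_int n)^2) \<longlonglongrightarrow> csc_square z"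
      using Polygamma_1_reflection_complex[OF Imz] by (simp add: csc_square_def)
    have lim: "(\<lambda>K. 1 / (w + c * of_nat K)) \<longlonglongrightarrow> 0" if "c \<noteq> 0" for w c :: complex
    proof -
      have "filterlim (\<lambda>K. c * of_nat K + w) at_infinity sequentially"
        using that by (intro tendsto_add_filterlim_at_infinity'[where c=w] tendsto_mult_filterlim_at_infinity[where c=c] tendsto_const tendsto_of_nat)
      then show ?thesis
        using tendsto_inverse_0 filterlim_compose by (force simp: add.commute inverse_eq_divide)
    qed
    have "(\<Sum>n=-int K..int K. 1 / (z + of_int n - 1/2) - 1 / (z + of_int n + 1/2)) =
        1 / ((z - 1/2) + (-1) * of_nat K) - 1 / ((z + 1/2) + 1 * of_nat K)" for K
      using sum_int_symmetric_telescope[of "\<lambda>n. 1 / (z + of_int n - 1/2)" K] by (simp add: algebra_simps)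
    then have 2: "(\<lambda>K. \<Sum>n=-int K..int K. 1 / (z + of_int n - 1/2) - 1 / (z + of_int n + 1/2)) \<longlonglongrightarrow> 0"
      using tendsto_diff[OF lim[of "-1" "z-1/2"] lim[of "1" "z+1/2"]] by simp
    have e: "eisenstein_summand \<tau> (k, n) = 1 / (z + of_int n)^2 - (1 / (z + of_int n - 1/2) - 1 / (z + of_int n + 1/2))" for n
      by (simp add: eisenstein_summand_def z_def Let_def)
    show ?thesis
      using tendsto_diff[OF 1 2] unfolding e sum_subtractf by simp
  qed
  then have "S = csc_square z"
    using has_sum_int_symmetric_tendsto[OF S] LIMSEQ_unique by blast
  then show ?thesis using S by (simp add: z_def)
qed

lemma Digamma_diff_sums:
  fixes a b :: complex
  assumes "a \<noteq> 0" "b \<noteq> 0"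
  shows "(\<lambda>k. inverse (a + of_nat k) - inverse (b + of_nat k)) sums (Digamma b - Digamma a)"
  using tendsto_diff[OF Digamma_LIMSEQ[OF assms(2)] Digamma_LIMSEQ[OF assms(1)]]
  by (simp add: sums_def sum_subtractf)

text \<open>After division by \<open>\<tau>\<close> a column runs over
  \<open>1 + n / \<tau> + k\<close>: the square term is a trigamma series and the correction a
  difference of digamma series.\<close>

lemma eisenstein_summand_column:
  assumes "Im \<tau> > 0"
  shows "((\<lambda>k. eisenstein_summand \<tau> (k, n)) has_sum
     (Polygamma 1 (1 + of_int n / \<tau>) / \<tau>^2
       - (Digamma (1 + (of_int n + 1/2) / \<tau>) - Digamma (1 + (of_int n - 1/2) / \<tau>)) / \<tau>)) UNIV"
proof -
  have t0: "\<tau> \<noteq> 0" using assms by auto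
  have nz: "1 + of_real x / \<tau> \<noteq> 0" for x
  proof
    assume "1 + of_real x / \<tau> = 0"
    then have "\<tau> = of_real (- x)" using t0 by (simp add: field_simps add_eq_0_iff)
    then show False using assms by simp
  qed
  have "(\<lambda>k. eisenstein_summand \<tau> (k, n)) summable_on UNIV"
  proof -
    have "(\<lambda>(n, k). eisenstein_summand \<tau> (k, n)) summable_on (UNIV \<times> UNIV)"
      using eisenstein_summand_summable[OF assms] by (subst (asm) summable_on_swap)
    from summable_on_SigmaD1[OF this, of n] show ?thesis by simp
  qed
  then obtain S where S: "((\<lambda>k. eisenstein_summand \<tau> (k, n)) has_sum S) UNIV"
    by (auto simp: summable_on_def)
  have 1: "(\<lambda>k. inverse ((1 + of_int n / \<tau> + of_nat k)^2) / \<tau>^2) sums (Polygamma 1 (1 + of_int n / \<tau>) / \<tau>^2)"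
    using Polygamma_LIMSEQ[of "1 + of_int n / \<tau>" 1] nz[of "of_int n"]
    by (intro sums_divide) (simp add: numeral_2_eq_2)
  have 2: "(\<lambda>k. (inverse (1 + (of_int n - 1/2) / \<tau> + of_nat k) - inverse (1 + (of_int n + 1/2) / \<tau> + of_nat k)) / \<tau>)
     sums ((Digamma (1 + (of_int n + 1/2) / \<tau>) - Digamma (1 + (of_int n - 1/2) / \<tau>)) / \<tau>)"
    using nz[of "of_int n - 1/2"] nz[of "of_int n + 1/2"]
    by (intro sums_divide Digamma_diff_sums) auto
  have e: "inverse ((1 + of_int n / \<tau> + of_nat k)^2) / \<tau>^2
     - (inverse (1 + (of_int n - 1/2) / \<tau> + of_nat k) - inverse (1 + (of_int n + 1/2) / \<tau> + of_nat k)) / \<tau>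
     = eisenstein_summand \<tau> (k, n)" for k
  proof -
    have r: "1 + w / \<tau> + of_nat k = (of_nat (Suc k) * \<tau> + w) / \<tau>" for w
      using t0 by (simp add: field_simps)
    have "inverse ((w / \<tau>)^2) / \<tau>^2 = 1 / w^2" "inverse (w / \<tau>) / \<tau> = 1 / w" for w
      using t0 by (simp_all add: power_divide inverse_eq_divide)
    then show ?thesis
      unfolding r by (subst diff_divide_distrib) (simp only: eisenstein_summand_def Let_def prod.case add_diff_eq add.assoc)
  qed
  have "(\<lambda>k. eisenstein_summand \<tau> (k, n)) sums (Polygamma 1 (1 + of_int n / \<tau>) / \<tau>^2
       - (Digamma (1 + (of_int n + 1/2) / \<tau>) - Digamma (1 + (of_int n - 1/2) / \<tau>)) / \<tau>)"
    using sums_diff[OF 1 2] unfolding e .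
  with has_sum_imp_sums[OF S] have "S = (Polygamma 1 (1 + of_int n / \<tau>) / \<tau>^2
       - (Digamma (1 + (of_int n + 1/2) / \<tau>) - Digamma (1 + (of_int n - 1/2) / \<tau>)) / \<tau>)"
    by (rule sums_unique2)
  with S show ?thesis by simp
qed

lemma csc_square_has_sum:
  assumes "Im \<tau> > 0"
  shows "((\<lambda>k. csc_square (of_nat (Suc k) * \<tau>)) has_sum infsum (eisenstein_summand \<tau>) (UNIV \<times> UNIV)) UNIV"
  by (rule has_sum_SigmaD[OF has_sum_infsum[OF eisenstein_summand_summable[OF assms]] eisenstein_summand_row[OF assms]])

text \<open>Eisenstein's order of summation: \<open>2 * Polygamma 1 1\<close>, which is
  \<open>2 zeta(2)\<close>, is the row through 0, and the rows \<open>m\<close> and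
  \<open>- m\<close> agree because \<open>csc_square\<close> is even.\<close>

definition G2 :: "complex \<Rightarrow> complex" where
  "G2 \<tau> = 2 * Polygamma 1 1 + 2 * (\<Sum>k. csc_square (of_nat (Suc k) * \<tau>))"

lemma suminf_csc_square:
  assumes "Im \<tau> > 0"
  shows "(\<Sum>k. csc_square (of_nat (Suc k) * \<tau>)) = infsum (eisenstein_summand \<tau>) (UNIV \<times> UNIV)"
  using has_sum_imp_sums[OF csc_square_has_sum[OF assms]] by (rule sums_unique[symmetric])

text \<open>The absolutely convergent corrected double sum, read by columns, gives the series at
  \<open>- 1 / \<tau>\<close> plus the column sums of the correction. Those telescope to a cotangent
  at a point moving down to infinity in the lower half plane, and its limit \<open>\<i>\<close> is
  the source of the term \<open>- 2 pi i \<tau>\<close>.\<close>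

lemma G2_S:
  assumes "Im \<tau> > 0"
  shows "G2 (- 1 / \<tau>) = \<tau>^2 * G2 \<tau> - 2 * of_real pi * \<i> * \<tau>"
proof -
  have t0: "\<tau> \<noteq> 0" using assms by auto
  define T where "T = infsum (eisenstein_summand \<tau>) (UNIV \<times> UNIV)"
  define T' where "T' = infsum (eisenstein_summand (- 1 / \<tau>)) (UNIV \<times> UNIV)"
  have Im': "Im (- 1 / \<tau>) > 0" using assms by (auto simp: Im_divide sum_power2_gt_zero_iff)
  define P where "P = (Polygamma 1 1 :: complex)"
  define col where "col n = Polygamma 1 (1 + of_int n / \<tau>) / \<tau>^2
       - (Digamma (1 + (of_int n + 1/2) / \<tau>) - Digamma (1 + (of_int n - 1/2) / \<tau>)) / \<tau>" for n :: int
  have "(col has_sum T) UNIV"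
    unfolding T_def
  proof (rule has_sum_SigmaD)
    show "((\<lambda>(n, k). eisenstein_summand \<tau> (k, n)) has_sum infsum (eisenstein_summand \<tau>) (UNIV \<times> UNIV)) (UNIV \<times> UNIV)"
      using has_sum_infsum[OF eisenstein_summand_summable[OF assms]] by (subst (asm) has_sum_swap)
    show "((\<lambda>k. case (n, k) of (n, k) \<Rightarrow> eisenstein_summand \<tau> (k, n)) has_sum col n) UNIV" for n
      using eisenstein_summand_column[OF assms, of n] by (simp add: col_def)
  qed
  then have lim: "(\<lambda>K. \<Sum>n=-int K..int K. col n) \<longlonglongrightarrow> T"
    by (rule has_sum_int_symmetric_tendsto)
  have csc: "(\<lambda>j. csc_square (of_nat (Suc j) / \<tau>)) sums T'"
  proof -
    have "of_nat (Suc j) / \<tau> = - (of_nat (Suc j) * (- 1 / \<tau>))" for j by simp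
    then show ?thesis
      using has_sum_imp_sums[OF csc_square_has_sum[OF Im']] by (simp only: csc_square_minus T'_def)
  qed
  have P: "(\<lambda>j. 1 / of_nat (Suc j) ^ 2) sums P"
    using Polygamma_LIMSEQ[of "1::complex" 1] by (simp add: P_def inverse_eq_divide numeral_2_eq_2 add.commute)
  have "(\<lambda>K. P + (\<Sum>j<K. csc_square (of_nat (Suc j) / \<tau>) - \<tau>^2 * (1 / of_nat (Suc j) ^ 2))) \<longlonglongrightarrow> P + (T' - \<tau>^2 * P)"
    using sums_diff[OF csc sums_mult[OF P, of "\<tau>^2"]] unfolding sums_def by (intro tendsto_add tendsto_const)
  moreover have "P + (\<Sum>j<K. csc_square (of_nat (Suc j) / \<tau>) - \<tau>^2 * (1 / of_nat (Suc j) ^ 2))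
     = (\<Sum>n=-int K..int K. Polygamma 1 (1 + of_int n / \<tau>))" for K
  proof -
    \<comment> \<open>The columns \<open>n = j + 1\<close> and \<open>n = - (j + 1)\<close> form the
      pair at \<open>w + 1\<close> and \<open>1 - w\<close>; the shift from \<open>w\<close> to
      \<open>w + 1\<close> costs \<open>1 / w^2\<close>.\<close>
    have s: "csc_square (of_nat (Suc j) / \<tau>) - \<tau>^2 * (1 / of_nat (Suc j) ^ 2)
       = Polygamma 1 (1 + of_int (int (Suc j)) / \<tau>) + Polygamma 1 (1 + of_int (- int (Suc j)) / \<tau>)" for j
    proof -
      define w where "w = of_nat (Suc j) / \<tau>"
      have w0: "w \<noteq> 0" using t0 by (simp add: w_def del: of_nat_Suc)
      have "Im w \<noteq> 0"
        using assms by (auto simp: w_def Im_divide simp del: of_nat_Suc)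
      then have "csc_square w = Polygamma 1 w + Polygamma 1 (1 - w)"
        using Polygamma_1_reflection_complex by (simp add: csc_square_def)
      moreover have "Polygamma 1 (w + 1) = Polygamma 1 w - 1 / w^2"
        using Polygamma_plus1[OF w0, of 1] by (simp add: numeral_2_eq_2)
      moreover have "\<tau>^2 * (1 / of_nat (Suc j) ^ 2) = 1 / w^2"
        by (simp add: w_def power_divide del: of_nat_Suc)
      moreover have "1 + of_int (int (Suc j)) / \<tau> = w + 1" "1 + of_int (- int (Suc j)) / \<tau> = 1 - w"
        by (simp_all add: w_def del: of_nat_Suc) 
      ultimately show ?thesis by (simp only: w_def[symmetric]) simp
    qed
    show ?thesis
      unfolding sum_int_symmetric_split s sum.distrib sum.lessThan_Suc_shift
      by (simp add: P_def add.assoc)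
  qed
  ultimately have l1: "(\<lambda>K. (\<Sum>n=-int K..int K. Polygamma 1 (1 + of_int n / \<tau>)) / \<tau>^2) \<longlonglongrightarrow> (P + (T' - \<tau>^2 * P)) / \<tau>^2"
    by (intro tendsto_divide tendsto_const) (use t0 in auto)
  define w where "w K = (of_nat K + 1/2) / \<tau>" for K :: nat
  \<comment> \<open>Consecutive columns share a digamma value, so only the two ends survive, and
    reflection combines them into a cotangent.\<close>
  have tel: "(\<Sum>n=-int K..int K. Digamma (1 + (of_int n + 1/2) / \<tau>) - Digamma (1 + (of_int n - 1/2) / \<tau>))
      = 1 / w K - of_real pi * cot (of_real pi * w K)" for K
  proof -
    have Im: "Im (w K) \<noteq> 0" 
    proof -
      have "Im (w K) = - ((real K + 1/2) * Im \<tau> / norm \<tau> ^ 2)"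
        by (simp add: w_def Im_divide cmod_power2)
      moreover have "(real K + 1/2) * Im \<tau> / norm \<tau> ^ 2 > 0"
        using assms t0 by (intro divide_pos_pos mult_pos_pos) auto
      ultimately show ?thesis by linarith
    qed
    then have w0: "w K \<noteq> 0" by auto
    define h where "h n = Digamma (1 + (of_int n - 1/2) / \<tau>)" for n :: int
    have h1: "h (n + 1) = Digamma (1 + (of_int n + 1/2) / \<tau>)" for n
      by (simp add: h_def add.commute)
    have h2: "h (- int K) = Digamma (1 - w K)" "h (int K + 1) = Digamma (w K + 1)"
      by (simp_all add: h_def w_def add_divide_distrib diff_divide_distrib algebra_simps)
    have "(\<Sum>n=-int K..int K. Digamma (1 + (of_int n + 1/2) / \<tau>) - Digamma (1 + (of_int n - 1/2) / \<tau>))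
       = - (\<Sum>n=-int K..int K. h n - h (n + 1))"
      unfolding h1 by (simp add: h_def sum_subtractf)
    also have "\<dots> = Digamma (w K + 1) - Digamma (1 - w K)"
      unfolding sum_int_symmetric_telescope h2 by simp
    also have "Digamma (w K + 1) = Digamma (w K) + 1 / w K"
      using Digamma_plus1[OF w0] .
    finally show ?thesis
      using Digamma_reflection_complex[OF Im] by (simp add: algebra_simps)
  qed
  have "(\<lambda>K. 1 / w K - of_real pi * cot (of_real pi * w K)) \<longlonglongrightarrow> 0 - of_real pi * \<i>"
  proof (intro tendsto_diff tendsto_mult tendsto_const cot_tendsto_lower)
    have "filterlim (\<lambda>K. of_nat K + (1/2::complex)) at_infinity sequentially"
      by (rule tendsto_add_filterlim_at_infinity'[OF tendsto_of_nat tendsto_const])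
    then have "((\<lambda>K. \<tau> * inverse (of_nat K + (1/2::complex))) \<longlongrightarrow> \<tau> * 0) sequentially"
      by (intro tendsto_mult tendsto_const filterlim_compose[OF tendsto_inverse_0])
    then show "(\<lambda>K. 1 / w K) \<longlonglongrightarrow> 0"
      by (simp add: w_def inverse_eq_divide)
    have "Im (of_real pi * w K) = (real K + 1/2) * (- (pi * Im \<tau> / norm \<tau> ^ 2))" for K
      by (simp add: w_def Im_divide cmod_power2 )
    moreover have "filterlim (\<lambda>K. (real K + 1/2) * (- (pi * Im \<tau> / norm \<tau> ^ 2))) at_bot sequentially"
      using assms t0
      by real_asymp
    ultimately show "filterlim (\<lambda>K. Im (of_real pi * w K)) at_bot sequentially"
      by simp
  qed
  then have l2: "(\<lambda>K. (1 / w K - of_real pi * cot (of_real pi * w K)) / \<tau>) \<longlonglongrightarrow> (0 - of_real pi * \<i>) / \<tau>"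
    by (intro tendsto_divide tendsto_const) (use t0 in auto)
  have "(\<Sum>n=-int K..int K. (A n - B n) / c) = (\<Sum>n=-int K..int K. A n - B n) / c" for A B :: "int \<Rightarrow> complex" and c K
    by (simp add: sum_divide_distrib)
  note col_sum = this
  have "(\<Sum>n=-int K..int K. col n) = (\<Sum>n=-int K..int K. Polygamma 1 (1 + of_int n / \<tau>)) / \<tau>^2 - (1 / w K - of_real pi * cot (of_real pi * w K)) / \<tau>" for K
    unfolding tel[symmetric] col_sum[symmetric] by (simp add: col_def sum_subtractf sum_divide_distrib)
  with lim have "(\<lambda>K. (\<Sum>n=-int K..int K. Polygamma 1 (1 + of_int n / \<tau>)) / \<tau>^2 - (1 / w K - of_real pi * cot (of_real pi * w K)) / \<tau>) \<longlonglongrightarrow> T"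
    by simp
  from LIMSEQ_unique[OF this tendsto_diff[OF l1 l2]]
  have "T = (P + (T' - \<tau>^2 * P)) / \<tau>^2 - (0 - of_real pi * \<i>) / \<tau>" .
  then have T: "\<tau>^2 * T = P + T' - \<tau>^2 * P + of_real pi * \<i> * \<tau>"
    using t0 by (simp add: field_simps power2_eq_square)
  have "2 * P + 2 * T' = \<tau>^2 * (2 * P) + 2 * (\<tau>^2 * T) - 2 * of_real pi * \<i> * \<tau>"
    unfolding T by (simp add: algebra_simps)
  then show ?thesis
    unfolding G2_def suminf_csc_square[OF assms] suminf_csc_square[OF Im'] T_def[symmetric] T'_def[symmetric] P_def[symmetric]
    by (simp add: algebra_simps)
qed

lemma csc_square_add_of_nat: "csc_square (z + of_nat n) = csc_square z"
proof (induction n)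
  case (Suc n)
  have "of_real pi * (z + of_nat (Suc n)) = of_real pi * (z + of_nat n) + of_real pi"
    by (simp add: algebra_simps)
  then have "csc_square (z + of_nat (Suc n)) = csc_square (z + of_nat n)"
    unfolding csc_square_def by (simp only: sin_plus_pi) simp
  with Suc.IH show ?case by simp
qed simp

lemma G2_T: "G2 (\<tau> + 1) = G2 \<tau>"
  by (simp only: G2_def ring_distribs mult_1_right csc_square_add_of_nat)

lemma exp_diff_exp_minus_ge:
  fixes x :: real
  assumes "x \<ge> 0"
  shows "exp x - exp (- x) \<ge> 2 * x"
proof -
  have "exp 0 - exp (- 0) - 2 * 0 \<le> exp x - exp (- x) - 2 * x"
  proof (rule DERIV_nonneg_imp_nondecreasing[OF assms])
    fix t :: real
    have "0 \<le> (exp (t/2) - exp (- t/2))^2" by simp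
    also have "\<dots> = exp t + exp (- t) - 2"
      by (simp add: power2_eq_square algebra_simps flip: exp_add)
    finally show "\<exists>y. ((\<lambda>x. exp x - exp (- x) - 2 * x) has_real_derivative y) (at t) \<and> 0 \<le> y"
      by (intro exI[of _ "exp t + exp (- t) - 2"] conjI) (auto intro!: derivative_eq_intros)
  qed
  then show ?thesis by simp
qed

text \<open>\<open>|sin w|\<close> is at least \<open>sinh (Im w)\<close>, hence at least
  \<open>Im w\<close>.\<close>

lemma norm_csc_square_le:
  assumes "Im z > 0"
  shows "norm (csc_square z) \<le> 1 / Im z ^ 2"
proof -
  define w where "w = of_real pi * z"
  have w: "Im w > 0" using assms by (simp add: w_def)
  have "2 * Im w \<le> exp (Im w) - exp (- Im w)"
    using exp_diff_exp_minus_ge[of "Im w"] w by simp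
  also have "\<dots> = norm (exp (- (\<i> * w))) - norm (exp (\<i> * w))"
    by simp
  also have "\<dots> \<le> norm (exp (\<i> * w) - exp (- (\<i> * w)))"
    by (metis norm_minus_commute norm_triangle_ineq2)
  also have "\<dots> = 2 * norm (sin w)"
    by (simp add: sin_exp_eq norm_divide norm_mult)
  finally have "pi * Im z \<le> norm (sin w)" by (simp add: w_def)
  then have "(pi * Im z)^2 \<le> norm (sin w)^2"
    using assms by (intro power_mono) auto
  then have "pi^2 / norm (sin w)^2 \<le> pi^2 / (pi * Im z)^2"
    using assms sin_pi_nonzero_of_Im[of z] by (intro divide_left_mono mult_pos_pos) (auto simp: w_def)
  then show ?thesis
    by (simp add: csc_square_def w_def norm_divide norm_power power_mult_distrib)
qed

lemma norm_csc_square_multiple_le: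
  assumes "y > 0" "Im \<tau> \<ge> y"
  shows "norm (csc_square (of_nat (Suc k) * \<tau>)) \<le> 1 / y^2 * (1 / real (Suc k) ^ 2)"
proof -
  have "norm (csc_square (of_nat (Suc k) * \<tau>)) \<le> 1 / (real (Suc k) * Im \<tau>) ^ 2"
    using norm_csc_square_le[of "of_nat (Suc k) * \<tau>"] assms by (simp del: of_nat_Suc)
  also have "\<dots> \<le> 1 / (real (Suc k) * y) ^ 2"
    using assms by (intro divide_left_mono power_mono mult_left_mono mult_pos_pos zero_less_power) auto
  finally show ?thesis by (simp add: power_mult_distrib mult.commute)
qed

lemma summable_inverse_square: "summable (\<lambda>k. 1 / real (Suc k) ^ 2)"
  using inverse_power_summable[of 2, where ?'a=real] summable_Suc_iff[of "\<lambda>n. inverse (real n ^ 2)"]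
  by (simp add: inverse_eq_divide)

lemma norm_G2_le:
  assumes "Im \<tau> \<ge> 1"
  shows "norm (G2 \<tau>) \<le> 2 * norm (Polygamma 1 1 :: complex) + 2 * (\<Sum>k. 1 / real (Suc k) ^ 2)"
proof -
  have "norm (\<Sum>k. csc_square (of_nat (Suc k) * \<tau>)) \<le> (\<Sum>k. 1 / real (Suc k) ^ 2)"
    using norm_csc_square_multiple_le[of 1 \<tau>] assms
    by (intro norm_suminf_le summable_inverse_square) (simp del: of_nat_Suc)
  moreover have "norm (G2 \<tau>) \<le> norm (2 * Polygamma 1 1 :: complex) + norm (2 * (\<Sum>k. csc_square (of_nat (Suc k) * \<tau>)))"
    unfolding G2_def by (rule norm_triangle_ineq)
  ultimately show ?thesis by (simp only: norm_mult norm_numeral)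
qed

lemma G2_holomorphic: "G2 holomorphic_on {\<tau>. Im \<tau> > 0}"
proof -
  have op: "open {\<tau>. Im \<tau> > 0}"
    by (intro open_Collect_less continuous_intros)
  have "(\<lambda>\<tau>. \<Sum>k. csc_square (of_nat (Suc k) * \<tau>)) holomorphic_on {\<tau>. Im \<tau> > 0}"
  proof (rule holomorphic_uniform_sequence[OF op])
    show "(\<lambda>\<tau>. \<Sum>k<n. csc_square (of_nat (Suc k) * \<tau>)) holomorphic_on {\<tau>. Im \<tau> > 0}" for n
      unfolding csc_square_def
      by (intro holomorphic_intros) (auto intro!: sin_pi_nonzero_of_Im simp del: of_nat_Suc)
  next
    fix x :: complex assume x: "x \<in> {\<tau>. Im \<tau> > 0}"
    define y where "y = Im x / 2"
    have y: "y > 0" using x by (simp add: y_def)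
    have sub: "Im w \<ge> y" if "w \<in> cball x y" for w
    proof -
      have "\<bar>Im x - Im w\<bar> \<le> dist x w"
        using abs_Im_le_cmod[of "x - w"] by (simp add: dist_norm)
      then show ?thesis using that by (auto simp: y_def)
    qed
    have "uniform_limit (cball x y) (\<lambda>n w. \<Sum>k<n. csc_square (of_nat (Suc k) * w)) (\<lambda>w. \<Sum>k. csc_square (of_nat (Suc k) * w)) sequentially"
      by (rule Weierstrass_m_test[where M="\<lambda>k. 1 / y^2 * (1 / real (Suc k) ^ 2)"])
        (intro norm_csc_square_multiple_le y sub, assumption, intro summable_mult summable_inverse_square)
    then show "\<exists>d>0. cball x d \<subseteq> {\<tau>. 0 < Im \<tau>} \<and>
      uniform_limit (cball x d) (\<lambda>n w. \<Sum>k<n. csc_square (of_nat (Suc k) * w)) (\<lambda>w. \<Sum>k. csc_square (of_nat (Suc k) * w)) sequentially"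
      using y sub by (intro exI[of _ y]) force
  qed
  then show ?thesis
    unfolding G2_def[abs_def] by (intro holomorphic_intros)
qed

text \<open>The factor turns the anomaly \<open>- 2 pi i \<tau>\<close> into
  \<open>12 \<tau>\<close>. The result is \<open>2 pi i E2\<close>, the logarithmic derivative of
  \<open>Delta\<close>.\<close>

definition G2_phi :: "complex \<Rightarrow> complex" where
  "G2_phi \<tau> = (6 * \<i> / of_real pi) * G2 \<tau>"

lemma G2_phi_holomorphic: "G2_phi holomorphic_on {\<tau>. Im \<tau> > 0}"
  unfolding G2_phi_def[abs_def] by (intro holomorphic_intros G2_holomorphic) auto

lemma G2_phi_T: "G2_phi (\<tau> + 1) = G2_phi \<tau>"
  by (simp add: G2_phi_def G2_T)

lemma G2_phi_S:
  assumes "Im \<tau> > 0"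
  shows "G2_phi (- 1 / \<tau>) = \<tau>^2 * G2_phi \<tau> + 12 * \<tau>"
  unfolding G2_phi_def G2_S[OF assms] by (simp add: algebra_simps)

lemma G2_phi_bounded: "\<exists>B. \<forall>\<tau>. Im \<tau> \<ge> 1 \<longrightarrow> norm (G2_phi \<tau>) \<le> B"
proof (intro exI allI impI)
  fix \<tau> assume "Im \<tau> \<ge> 1"
  then show "norm (G2_phi \<tau>) \<le> norm (6 * \<i> / of_real pi :: complex) *
     (2 * norm (Polygamma 1 1 :: complex) + 2 * (\<Sum>k. 1 / real (Suc k) ^ 2))"
    unfolding G2_phi_def norm_mult by (intro mult_left_mono norm_G2_le) auto
qed

section \<open>Laurent series in the local parameter at the cusp\<close>

no_notation index_mat (infixl "$$" 100)
notation fls_nth (infixl "$$" 75)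

lemma open_upper_half_plane: "open upper_half_plane"
  unfolding upper_half_plane_def by (intro open_Collect_less continuous_intros)

lemma convex_upper_half_plane: "convex upper_half_plane"
  unfolding upper_half_plane_def by (rule convex_halfspace_Im_gt)

lemma uhp_S: "\<tau> \<in> upper_half_plane \<Longrightarrow> - 1 / \<tau> \<in> upper_half_plane"
  by (auto simp: upper_half_plane_def Im_divide sum_power2_gt_zero_iff)

lemma uhp_S': "\<tau> \<in> upper_half_plane \<Longrightarrow> - (1 / \<tau>) \<in> upper_half_plane"
  using uhp_S[of \<tau>] by simp

lemma uhp_add_of_int: "\<tau> + of_int n \<in> upper_half_plane \<longleftrightarrow> \<tau> \<in> upper_half_plane"
  by (simp add: upper_half_plane_def)

lemma uhp_T: "\<tau> + 1 \<in> upper_half_plane \<longleftrightarrow> \<tau> \<in> upper_half_plane"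
  by (simp add: upper_half_plane_def)

lemma uhp_nonzero: "\<tau> \<in> upper_half_plane \<Longrightarrow> \<tau> \<noteq> 0"
  by (auto simp: upper_half_plane_def)

text \<open>An \<open>fls\<close> has finitely many negative exponents, so radius at least 1 means
  convergence on the punctured unit disc, the image of the upper half plane under the local
  parameter.\<close>

definition fls_conv_disc :: "complex fls \<Rightarrow> bool" where
  "fls_conv_disc A \<longleftrightarrow> fls_conv_radius A \<ge> 1"

lemma norm_less_fls_conv_radius:
  assumes "fls_conv_disc A" "norm x < 1"
  shows "ereal (norm x) < fls_conv_radius A"
  using assms by (auto simp: fls_conv_disc_def one_ereal_def intro: less_le_trans[of _ "ereal 1"])

lemma fls_conv_disc_const [simp, intro]: "fls_conv_disc (fls_const c)"
  and fls_conv_disc_0 [simp, intro]: "fls_conv_disc 0"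
  and fls_conv_disc_1 [simp, intro]: "fls_conv_disc 1"
  by (auto simp: fls_conv_disc_def)

lemma fls_conv_disc_add: "fls_conv_disc A \<Longrightarrow> fls_conv_disc B \<Longrightarrow> fls_conv_disc (A + B)"
  and fls_conv_disc_diff: "fls_conv_disc A \<Longrightarrow> fls_conv_disc B \<Longrightarrow> fls_conv_disc (A - B)"
  and fls_conv_disc_mult: "fls_conv_disc A \<Longrightarrow> fls_conv_disc B \<Longrightarrow> fls_conv_disc (A * B)"
  and fls_conv_disc_uminus: "fls_conv_disc A \<Longrightarrow> fls_conv_disc (- A)"
  by (auto simp: fls_conv_disc_def intro: fls_conv_radius_add_ge fls_conv_radius_diff_ge fls_conv_radius_mult_ge)

lemma fls_conv_disc_power: "fls_conv_disc A \<Longrightarrow> fls_conv_disc (A ^ n)"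
  by (induction n) (auto intro: fls_conv_disc_mult)

lemma fls_conv_disc_sum: "(\<And>i. i \<in> I \<Longrightarrow> fls_conv_disc (A i)) \<Longrightarrow> fls_conv_disc (\<Sum>i\<in>I. A i)"
  by (induction I rule: infinite_finite_induct) (auto intro: fls_conv_disc_add)

lemma fls_conv_disc_prod: "(\<And>i. i \<in> I \<Longrightarrow> fls_conv_disc (A i)) \<Longrightarrow> fls_conv_disc (\<Prod>i\<in>I. A i)"
  by (induction I rule: infinite_finite_induct) (auto intro: fls_conv_disc_mult)

lemma fls_conv_disc_deriv: "fls_conv_disc A \<Longrightarrow> fls_conv_disc (fls_deriv A)"
  unfolding fls_conv_disc_def using fls_conv_radius_deriv order_trans by blast

lemma fls_conv_disc_X [simp, intro]: "fls_conv_disc fls_X"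
  by (auto simp: fls_conv_disc_def)

lemmas fls_conv_disc_intros = fls_conv_disc_add fls_conv_disc_diff fls_conv_disc_mult fls_conv_disc_uminus
  fls_conv_disc_power fls_conv_disc_sum fls_conv_disc_prod fls_conv_disc_const fls_conv_disc_0 fls_conv_disc_1

lemma fls_conv_disc_iff_summable:
  "fls_conv_disc A \<longleftrightarrow> (\<forall>x. norm x < 1 \<longrightarrow> summable (\<lambda>n. A $$ int n * x ^ n))"
proof
  assume "fls_conv_disc A"
  then show "\<forall>x. norm x < 1 \<longrightarrow> summable (\<lambda>n. A $$ int n * x ^ n)"
    using summable_fls norm_less_fls_conv_radius by blast
next
  assume *: "\<forall>x. norm x < 1 \<longrightarrow> summable (\<lambda>n. A $$ int n * x ^ n)"
  have "conv_radius (\<lambda>n. A $$ int n) \<ge> 1"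
  proof (rule conv_radius_geI_ex)
    fix r :: real assume "0 < r" "ereal r < 1"
    then show "\<exists>z. norm z = r \<and> summable (\<lambda>n. A $$ int n * z ^ n)"
      using *[rule_format, of "of_real r"] by (intro exI[of _ "of_real r"]) auto
  qed
  then show "fls_conv_disc A"
    by (simp add: fls_conv_disc_def fls_conv_radius_def fps_conv_radius_def)
qed

lemma fls_conv_disc_comparison:
  assumes "fls_conv_disc A" "\<And>n. norm (B $$ n) \<le> C * norm (A $$ n)"
  shows "fls_conv_disc B"
  unfolding fls_conv_disc_iff_summable
proof (intro allI impI)
  fix x :: complex assume x: "norm x < 1"
  have "summable (\<lambda>n. C * norm (A $$ int n * x ^ n))"
    using norm_summable_fls[OF norm_less_fls_conv_radius[OF assms(1) x]] by (rule summable_mult)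
  then show "summable (\<lambda>n. B $$ int n * x ^ n)"
  proof (rule summable_comparison_test[rotated], intro exI allI impI)
    fix n :: nat
    have "norm (B $$ int n) * norm (x ^ n) \<le> (C * norm (A $$ int n)) * norm (x ^ n)"
      by (intro mult_right_mono assms(2)) auto
    then show "norm (B $$ int n * x ^ n) \<le> C * norm (A $$ int n * x ^ n)"
      by (simp add: norm_mult mult.assoc)
  qed
qed

lemma fls_has_sum:
  assumes "fls_conv_disc A" "norm x < 1" "x \<noteq> 0"
  shows "((\<lambda>n. A $$ n * x powi n) has_sum eval_fls A x) UNIV"
proof -
  define s where "s = fls_subdegree A"
  have sums: "(\<lambda>k. A $$ (int k + s) * x powi (int k + s)) sums eval_fls A x"
    unfolding s_def by (intro sums_eval_fls norm_less_fls_conv_radius assms disjI1)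
  have "summable (\<lambda>k. norm (A $$ (int k + s) * x ^ k) * norm (x powi s))"
    using norm_summable_fls'[OF norm_less_fls_conv_radius[OF assms(1,2)]] unfolding s_def by (intro summable_mult2)
  also have "(\<lambda>k. norm (A $$ (int k + s) * x ^ k) * norm (x powi s)) = (\<lambda>k. norm (A $$ (int k + s) * x powi (int k + s)))"
    using assms(3) by (auto simp: norm_mult power_int_add)
  finally have "summable (\<lambda>k. norm (A $$ (int k + s) * x powi (int k + s)))" .
  then have "((\<lambda>k. A $$ (int k + s) * x powi (int k + s)) has_sum eval_fls A x) UNIV"
    using norm_summable_imp_has_sum[OF _ sums] by simp
  then have "((\<lambda>n. A $$ n * x powi n) has_sum eval_fls A x) (range (\<lambda>k. int k + s))"
    by (subst has_sum_reindex) (auto simp: inj_on_def o_def)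
  also have "?this \<longleftrightarrow> ((\<lambda>n. A $$ n * x powi n) has_sum eval_fls A x) UNIV"
  proof (rule has_sum_cong_neutral)
    fix n assume "n \<in> UNIV - range (\<lambda>k. int k + s)"
    moreover have "n = int (nat (n - s)) + s" if "n \<ge> s" using that by simp
    ultimately have "n < s" by (metis DiffD2 not_less rangeI)
    then show "A $$ n * x powi n = 0" by (simp add: s_def)
  qed auto
  finally show ?thesis .
qed

lemma fls_of_has_sum:
  fixes a :: "int \<Rightarrow> complex"
  assumes "\<forall>n<n0. a n = 0" "\<And>x. norm x < 1 \<Longrightarrow> x \<noteq> 0 \<Longrightarrow> (\<lambda>n. a n * x powi n) summable_on UNIV"
  shows "\<exists>A. fls_conv_disc A \<and> fls_nth A = a"
proof (intro exI conjI)
  have ev: "\<forall>\<^sub>\<infinity>n. a (- int n) = 0"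
    unfolding MOST_nat
  proof (intro exI[of _ "nat (- n0)"] allI impI)
    fix n assume "nat (- n0) < n"
    then have "- int n < n0" by linarith
    then show "a (- int n) = 0" using assms(1) by blast
  qed
  then show nth: "fls_nth (Abs_fls a) = a"
    by (intro ext nth_Abs_fls)
  show "fls_conv_disc (Abs_fls a)"
    unfolding fls_conv_disc_iff_summable nth
  proof (intro allI impI)
    fix x :: complex assume x: "norm x < 1"
    show "summable (\<lambda>n. a (int n) * x ^ n)"
    proof (cases "x = 0")
      case False
      then have "(\<lambda>n. a n * x powi n) summable_on range int"
        using assms(2)[OF x] summable_on_subset_banach by blast
      then have "(\<lambda>n. a (int n) * x ^ n) summable_on UNIV"
        by (subst (asm) summable_on_reindex) (auto simp: o_def)
      then show ?thesis by (rule summable_on_imp_summable)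
    qed (auto intro: summable_finite[of "{0}"])
  qed
qed

definition fls_scale_coeffs :: "(int \<Rightarrow> complex) \<Rightarrow> complex fls \<Rightarrow> complex fls" where
  "fls_scale_coeffs f A = Abs_fls (\<lambda>n. f n * A $$ n)"

lemma fls_scale_coeffs_nth [simp]: "fls_scale_coeffs f A $$ n = f n * A $$ n"
proof -
  have "\<forall>\<^sub>\<infinity>k. f (- int k) * A $$ (- int k) = 0"
    unfolding MOST_nat
  proof (intro exI[of _ "nat (- fls_subdegree A)"] allI impI)
    fix k assume "nat (- fls_subdegree A) < k"
    then have "- int k < fls_subdegree A" by linarith
    then show "f (- int k) * A $$ (- int k) = 0" by (simp add: fls_eq0_below_subdegree)
  qed
  then show ?thesis unfolding fls_scale_coeffs_def by (rule nth_Abs_fls)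
qed

lemma fls_conv_disc_scale_coeffs:
  assumes "fls_conv_disc A" "\<And>n. norm (f n) \<le> C"
  shows "fls_conv_disc (fls_scale_coeffs f A)"
  by (rule fls_conv_disc_comparison[OF assms(1), of _ C])
     (use assms(2) in \<open>auto simp: norm_mult intro: mult_right_mono\<close>)

lemma fls_conv_disc_holomorphic:
  assumes "fls_conv_disc A"
  shows "eval_fls A holomorphic_on ball 0 1 - {0}"
proof (rule holomorphic_on_eval_fls, rule subsetI)
  fix x :: complex assume "x \<in> ball 0 1 - {0}"
  then show "x \<in> eball 0 (fls_conv_radius A) - (if 0 \<le> fls_subdegree A then {} else {0})"
    using norm_less_fls_conv_radius[OF assms, of x] by simp
qed

lemma fls_conv_disc_has_laurent:
  assumes "fls_conv_disc A"
  shows "eval_fls A has_laurent_expansion A"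
  using assms by (intro eval_fls_has_laurent_expansion) (auto simp: fls_conv_disc_def intro: less_le_trans[of _ 1])

lemma fls_conv_disc_eqI:
  assumes "fls_conv_disc A" "fls_conv_disc B" "\<And>x. norm x < 1 \<Longrightarrow> x \<noteq> 0 \<Longrightarrow> eval_fls A x = eval_fls B x"
  shows "A = B"
proof -
  have "\<forall>\<^sub>F x in at 0. x \<in> ball 0 1 - {0::complex}"
    by (intro eventually_at_in_open) auto
  then have "\<forall>\<^sub>F x in at 0. eval_fls A x = eval_fls B x"
    by eventually_elim (use assms(3) in auto)
  then have "eval_fls B has_laurent_expansion A"
    using fls_conv_disc_has_laurent[OF assms(1)] has_laurent_expansion_cong by blast
  then show ?thesis
    using fls_conv_disc_has_laurent[OF assms(2)] has_laurent_expansion_unique by blast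
qed

lemma fls_conv_disc_of_holomorphic:
  assumes "g holomorphic_on ball 0 1 - {0}" "g has_laurent_expansion A"
  shows "fls_conv_disc A" "\<And>x. norm x < 1 \<Longrightarrow> x \<noteq> 0 \<Longrightarrow> eval_fls A x = g x"
proof -
  have eb: "eball 0 1 = (ball 0 1 :: complex set)"
    by (metis eball_ereal one_ereal_def)
  show "fls_conv_disc A"
    unfolding fls_conv_disc_def by (rule fls_conv_radius_ge[OF assms(2)]) (use assms(1) eb in simp)
  show "eval_fls A x = g x" if "norm x < 1" "x \<noteq> 0" for x
    by (rule eval_fls_eqI[OF assms(2), of 1]) (use assms(1) eb that in simp_all)
qed

text \<open>Local quotients \<open>E / d\<close> agree wherever both make sense, because
  \<open>d x * E y = d y * E x\<close> already holds formally. They glue to a holomorphic function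
  on the punctured disc whose expansion at 0 is \<open>b\<close>. This is how a purely formal series
  acquires convergence.\<close>

lemma fls_conv_disc_quotient:
  assumes "\<And>x. norm x < 1 \<Longrightarrow> x \<noteq> 0 \<Longrightarrow>
    \<exists>d E. fls_conv_disc d \<and> fls_conv_disc E \<and> d * b = E \<and> eval_fls d x \<noteq> 0"
  shows "fls_conv_disc b"
proof -
  have "\<forall>x. \<exists>d E. norm x < 1 \<and> x \<noteq> 0 \<longrightarrow>
    fls_conv_disc d \<and> fls_conv_disc E \<and> d * b = E \<and> eval_fls d x \<noteq> 0"
    using assms by blast
  then obtain d E where "\<forall>x. norm x < 1 \<and> x \<noteq> 0 \<longrightarrow>
    fls_conv_disc (d x) \<and> fls_conv_disc (E x) \<and> d x * b = E x \<and> eval_fls (d x) x \<noteq> 0"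
    unfolding choice_iff by blast
  then have dE: "fls_conv_disc (d x) \<and> fls_conv_disc (E x) \<and> d x * b = E x \<and> eval_fls (d x) x \<noteq> 0"
    if "norm x < 1" "x \<noteq> 0" for x using that by blast
  define g where "g x = eval_fls (E x) x / eval_fls (d x) x" for x
  have g: "g x = eval_fls (E y) x / eval_fls (d y) x"
    if x: "norm x < 1" "x \<noteq> 0" and y: "norm y < 1" "y \<noteq> 0" "eval_fls (d y) x \<noteq> 0" for x y
  proof -
    have "d x * E y = d y * E x"
      using dE[OF x] dE[OF y(1,2)] by (metis mult.left_commute)
    then have "eval_fls (d x * E y) x = eval_fls (d y * E x) x" by simp
    then have "eval_fls (d x) x * eval_fls (E y) x = eval_fls (d y) x * eval_fls (E x) x"
      using dE[OF x] dE[OF y(1,2)] x by (simp add: eval_fls_mult norm_less_fls_conv_radius)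
    then show ?thesis
      using dE[OF x] y(3) by (simp add: g_def field_simps)
  qed
  have "g holomorphic_on ball 0 1 - {0}"
  proof (rule analytic_imp_holomorphic, rule analytic_on_analytic_at[THEN iffD2], rule ballI)
      fix y :: complex assume y': "y \<in> ball 0 1 - {0}"
      then have y: "norm y < 1" "y \<noteq> 0" by auto
      have hol: "eval_fls (d y) holomorphic_on ball 0 1 - {0}" "eval_fls (E y) holomorphic_on ball 0 1 - {0}"
        using dE[OF y] by (auto intro: fls_conv_disc_holomorphic)
      define U where "U = (ball 0 1 - {0}) \<inter> eval_fls (d y) -` (- {0})"
      have "open U"
        unfolding U_def by (intro continuous_open_preimage holomorphic_on_imp_continuous_on hol) auto
      moreover have "y \<in> U" using y dE[OF y] by (auto simp: U_def)
      moreover have "(\<lambda>x. eval_fls (E y) x / eval_fls (d y) x) holomorphic_on U"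
        by (intro holomorphic_on_divide holomorphic_on_subset[OF hol(1)] holomorphic_on_subset[OF hol(2)]) (auto simp: U_def)
      then have "g holomorphic_on U"
        by (rule holomorphic_transform) (use g y in \<open>auto simp: U_def\<close>)
      ultimately show "g analytic_on {y}"
        using analytic_at by blast
  qed
  moreover have "g has_laurent_expansion b"
  proof -
    \<comment> \<open>One quotient represents \<open>g\<close> near 0, because a nonzero
      \<open>d y\<close> has no zeros in a small punctured neighbourhood of 0. The point
      \<open>1/2\<close> is arbitrary.\<close>
    define y :: complex where "y = 1/2"
    have y: "norm y < 1" "y \<noteq> 0" by (auto simp: y_def)
    have dy: "d y \<noteq> 0" using dE[OF y] by auto
    have ld: "eval_fls (d y) has_laurent_expansion d y" "eval_fls (E y) has_laurent_expansion E y"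
      using dE[OF y] by (auto intro: fls_conv_disc_has_laurent)
    have "(\<lambda>x. eval_fls (E y) x / eval_fls (d y) x) has_laurent_expansion E y / d y"
      by (intro has_laurent_expansion_divide ld)
    moreover have "E y / d y = b"
      using dE[OF y] dy by (auto simp: field_simps)
    moreover have "\<forall>\<^sub>F x in at 0. x \<in> ball 0 1 - {0::complex}"
      by (intro eventually_at_in_open) auto
    then have "\<forall>\<^sub>F x in at 0. g x = eval_fls (E y) x / eval_fls (d y) x"
      using has_laurent_expansion_nonzero_imp_eventually_nonzero[OF ld(1) dy]
      by eventually_elim (use g y in auto)
    ultimately show ?thesis
      using has_laurent_expansion_cong[of g "\<lambda>x. eval_fls (E y) x / eval_fls (d y) x" b b] by simp
  qed
  ultimately show ?thesis by (rule fls_conv_disc_of_holomorphic)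
qed

section \<open>Laurent series evaluated at \<open>q^(1/N)\<close>\<close>

locale q_width =
  fixes N :: nat
  assumes N_pos: "N > 0"
begin

definition qx :: "complex \<Rightarrow> complex" where
  "qx \<tau> = exp (2 * of_real pi * \<i> * \<tau> / of_nat N)"

definition ev :: "complex fls \<Rightarrow> complex \<Rightarrow> complex" where
  "ev A \<tau> = eval_fls A (qx \<tau>)"

lemma qx_nonzero [simp]: "qx \<tau> \<noteq> 0"
  by (simp add: qx_def)

lemma norm_qx: "norm (qx \<tau>) = exp (- (2 * pi * Im \<tau> / N))"
proof -
  have "Re (2 * of_real pi * \<i> * \<tau> / of_nat N) = - (2 * pi * Im \<tau> / N)"
    by (simp add: Re_divide_of_nat)
  then show ?thesis by (simp add: qx_def)
qed

lemma norm_qx_less: "\<tau> \<in> upper_half_plane \<Longrightarrow> norm (qx \<tau>) < 1"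
  using N_pos by (simp add: norm_qx upper_half_plane_def)

lemma qx_powi: "qx \<tau> powi n = exp (2 * of_real pi * \<i> * of_int n * \<tau> / of_nat N)"
  unfolding qx_def exp_power_int by (simp add: mult_ac)

lemma qx_surj:
  assumes "norm x < 1" "x \<noteq> 0"
  obtains \<tau> where "\<tau> \<in> upper_half_plane" "qx \<tau> = x"
proof
  define \<tau> where "\<tau> = of_nat N * Ln x / (2 * of_real pi * \<i>)"
  show q: "qx \<tau> = x"
    using assms N_pos by (simp add: qx_def \<tau>_def)
  have "exp (- (2 * pi * Im \<tau> / N)) < 1"
    using assms q by (simp flip: norm_qx)
  then show "\<tau> \<in> upper_half_plane"
    using N_pos by (simp add: upper_half_plane_def zero_less_divide_iff zero_less_mult_iff)
qed

context
  fixes \<tau> assumes \<tau>: "\<tau> \<in> upper_half_plane"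
begin

lemma ev_add: "fls_conv_disc A \<Longrightarrow> fls_conv_disc B \<Longrightarrow> ev (A + B) \<tau> = ev A \<tau> + ev B \<tau>"
  and ev_diff: "fls_conv_disc A \<Longrightarrow> fls_conv_disc B \<Longrightarrow> ev (A - B) \<tau> = ev A \<tau> - ev B \<tau>"
  and ev_mult: "fls_conv_disc A \<Longrightarrow> fls_conv_disc B \<Longrightarrow> ev (A * B) \<tau> = ev A \<tau> * ev B \<tau>"
  and ev_uminus: "fls_conv_disc A \<Longrightarrow> ev (- A) \<tau> = - ev A \<tau>"
  and ev_power: "fls_conv_disc A \<Longrightarrow> ev (A ^ n) \<tau> = ev A \<tau> ^ n"
  using norm_qx_less[OF \<tau>]
  by (auto simp: ev_def eval_fls_add eval_fls_diff eval_fls_mult eval_fls_minus eval_fls_power norm_less_fls_conv_radius)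

lemma ev_sum: "(\<And>i. i \<in> I \<Longrightarrow> fls_conv_disc (A i)) \<Longrightarrow> ev (\<Sum>i\<in>I. A i) \<tau> = (\<Sum>i\<in>I. ev (A i) \<tau>)"
proof (induction I rule: infinite_finite_induct)
  case (insert x F)
  then show ?case by (simp add: ev_add fls_conv_disc_sum)
qed (auto simp: ev_def)

lemma ev_has_sum:
  assumes "fls_conv_disc A"
  shows "((\<lambda>n. A $$ n * exp (2 * of_real pi * \<i> * of_int n * \<tau> / of_nat N)) has_sum ev A \<tau>) UNIV"
  using fls_has_sum[OF assms norm_qx_less[OF \<tau>] qx_nonzero] by (simp add: qx_powi ev_def)

lemma ev_eqI:
  assumes "fls_conv_disc A" "((\<lambda>n. A $$ n * exp (2 * of_real pi * \<i> * of_int n * \<tau> / of_nat N)) has_sum S) UNIV"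
  shows "ev A \<tau> = S"
  using ev_has_sum[OF assms(1)] assms(2) has_sum_unique by blast

end

lemma ev_0 [simp]: "ev 0 \<tau> = 0"
  and ev_1 [simp]: "ev 1 \<tau> = 1"
  and ev_const [simp]: "ev (fls_const c) \<tau> = c"
  by (simp_all add: ev_def)

lemma ev_cong_fls:
  assumes "fls_conv_disc A" "fls_conv_disc B" "\<And>\<tau>. \<tau> \<in> upper_half_plane \<Longrightarrow> ev A \<tau> = ev B \<tau>"
  shows "A = B"
proof (rule fls_conv_disc_eqI[OF assms(1,2)])
  fix x :: complex assume "norm x < 1" "x \<noteq> 0"
  then obtain \<tau> where "\<tau> \<in> upper_half_plane" "qx \<tau> = x" by (rule qx_surj)
  with assms(3)[of \<tau>] show "eval_fls A x = eval_fls B x" by (simp add: ev_def)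
qed

lemma ev_holomorphic:
  assumes "fls_conv_disc A"
  shows "ev A holomorphic_on upper_half_plane"
proof -
  have "(\<lambda>\<tau>. eval_fls A (qx \<tau>)) holomorphic_on upper_half_plane"
  proof (rule holomorphic_on_compose_gen[unfolded o_def, OF _ fls_conv_disc_holomorphic[OF assms]])
    show "qx holomorphic_on upper_half_plane"
      unfolding qx_def[abs_def] divide_inverse by (intro holomorphic_intros)
    show "qx ` upper_half_plane \<subseteq> ball 0 1 - {0}"
      using norm_qx_less by auto
  qed
  then show ?thesis by (simp add: ev_def[abs_def])
qed

text \<open>Differentiation in \<open>\<tau>\<close> rather than the normalised Euler operator: the
  constant is the chain rule factor of \<open>qx\<close>.\<close>

definition fls_theta :: "complex fls \<Rightarrow> complex fls" where
  "fls_theta A = fls_const (2 * of_real pi * \<i> / of_nat N) * (fls_X * fls_deriv A)"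

lemma fls_theta_nth: "fls_theta A $$ n = 2 * of_real pi * \<i> * of_int n / of_nat N * A $$ n"
  by (simp add: fls_theta_def fls_X_times_conv_shift)

lemma fls_theta_conv: "fls_conv_disc A \<Longrightarrow> fls_conv_disc (fls_theta A)"
  unfolding fls_theta_def by (intro fls_conv_disc_intros fls_conv_disc_deriv fls_conv_disc_X)

lemma ev_deriv:
  assumes "fls_conv_disc A" "\<tau> \<in> upper_half_plane"
  shows "(ev A has_field_derivative ev (fls_theta A) \<tau>) (at \<tau>)"
proof -
  have "qx \<tau> \<in> eball 0 (fls_conv_radius A) - {0}"
    using norm_less_fls_conv_radius[OF assms(1) norm_qx_less[OF assms(2)]] by simp
  moreover have "(qx has_field_derivative 2 * of_real pi * \<i> / of_nat N * qx \<tau>) (at \<tau>)"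
    unfolding qx_def using N_pos by (auto intro!: derivative_eq_intros)
  ultimately have "((\<lambda>\<tau>. eval_fls A (qx \<tau>)) has_field_derivative
      eval_fls (fls_deriv A) (qx \<tau>) * (2 * of_real pi * \<i> / of_nat N * qx \<tau>)) (at \<tau>)"
    by (intro DERIV_chain'[OF _ has_field_derivative_eval_fls])
  moreover have "eval_fls (fls_deriv A) (qx \<tau>) * (2 * of_real pi * \<i> / of_nat N * qx \<tau>) = ev (fls_theta A) \<tau>"
  proof -
    have "ev (fls_theta A) \<tau> = ev (fls_const (2 * of_real pi * \<i> / of_nat N)) \<tau> * (ev fls_X \<tau> * ev (fls_deriv A) \<tau>)"
      unfolding fls_theta_def using assms
      by (simp add: ev_mult fls_conv_disc_mult fls_conv_disc_deriv)
    then show ?thesis by (simp add: ev_def)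
  qed
  ultimately show ?thesis by (simp add: ev_def[abs_def])
qed

lemma ev_shift_twist:
  assumes "fls_conv_disc A" "\<tau> \<in> upper_half_plane"
  shows "ev (fls_scale_coeffs (\<lambda>n. exp (2 * of_real pi * \<i> * of_int n * of_int j / of_nat N)) A) \<tau> = ev A (\<tau> + of_int j)"
proof (rule ev_eqI[OF assms(2)])
  let ?f = "\<lambda>n. exp (2 * of_real pi * \<i> * of_int n * of_int j / of_nat N)"
  have "norm (?f n) \<le> 1" for n
  proof -
    have "?f n = exp (\<i> * of_real (2 * pi * of_int n * of_int j / of_nat N))"
      by (simp add: field_simps)
    then show ?thesis by (simp only: norm_exp_i_times)
  qed
  then show "fls_conv_disc (fls_scale_coeffs ?f A)"
    by (rule fls_conv_disc_scale_coeffs[OF assms(1)])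
  have t: "\<tau> + of_int j \<in> upper_half_plane" using assms(2) by (simp add: uhp_add_of_int)
  have e: "A $$ n * exp (2 * of_real pi * \<i> * of_int n * (\<tau> + of_int j) / of_nat N)
      = fls_scale_coeffs ?f A $$ n * exp (2 * of_real pi * \<i> * of_int n * \<tau> / of_nat N)" for n
    by (simp add: ring_distribs add_divide_distrib exp_add mult_ac)
  show "((\<lambda>n. fls_scale_coeffs ?f A $$ n * exp (2 * of_real pi * \<i> * of_int n * \<tau> / of_nat N)) has_sum ev A (\<tau> + of_int j)) UNIV"
    using ev_has_sum[OF t assms(1)] unfolding e .
qed

text \<open>These are the eigenvectors of the translation \<open>\<tau> + 1\<close>: see
  \<open>ev_T_class\<close> and its converse \<open>fls_class_of_T\<close>.\<close>

definition fls_class :: "int \<Rightarrow> complex fls \<Rightarrow> bool" where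
  "fls_class c A \<longleftrightarrow> (\<forall>n. A $$ n \<noteq> 0 \<longrightarrow> [n = c] (mod int N))"

lemma exp_cong_mod:
  assumes "[n = c] (mod int N)"
  shows "exp (2 * of_real pi * \<i> * of_int n / of_nat N) = exp (2 * of_real pi * \<i> * of_int c / of_nat N)"
proof -
  have "int N dvd n - c" using assms by (simp add: cong_iff_dvd_diff)
  then obtain k where k: "n - c = int N * k" by (elim dvdE)
  then have "n = c + int N * k" by simp
  then have "(of_int n :: complex) = of_int c + of_nat N * of_int k" by simp
  then have "2 * of_real pi * \<i> * of_int n / of_nat N = 2 * of_real pi * \<i> * of_int c / of_nat N + \<i> * (of_int k * (of_real pi * 2))"
    using N_pos by (simp add: add_divide_distrib ring_distribs)
  then show ?thesis by (simp only: exp_plus_2pin)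
qed

lemma exp_mod_eq_iff:
  "exp (2 * of_real pi * \<i> * of_int n / of_nat N) = exp (2 * of_real pi * \<i> * of_int c / of_nat N) \<longleftrightarrow> [n = c] (mod int N)"
proof
  assume "exp (2 * of_real pi * \<i> * of_int n / of_nat N) = exp (2 * of_real pi * \<i> * of_int c / of_nat N)"
  then obtain k :: int where k: "2 * of_real pi * \<i> * of_int n / of_nat N = 2 * of_real pi * \<i> * of_int c / of_nat N + (of_int (2 * k) * pi) * \<i>"
    unfolding exp_eq by blast
  then have "(2 * of_real pi * \<i>) * of_int n = (2 * of_real pi * \<i>) * (of_int c + of_int k * of_nat N)"
    using N_pos by (simp add: field_simps)
  then have "(of_int n :: complex) = of_int (c + k * int N)"
    by simp
  then have "n = c + k * int N" unfolding of_int_eq_iff .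
  then show "[n = c] (mod int N)" by (simp add: cong_def)
qed (rule exp_cong_mod)

lemma ev_T_class:
  assumes "fls_conv_disc A" "fls_class c A" "\<tau> \<in> upper_half_plane"
  shows "ev A (\<tau> + of_int j) = exp (2 * of_real pi * \<i> * of_int (c * j) / of_nat N) * ev A \<tau>"
proof -
  have "fls_scale_coeffs (\<lambda>n. exp (2 * of_real pi * \<i> * of_int n * of_int j / of_nat N)) A
      = fls_const (exp (2 * of_real pi * \<i> * of_int (c * j) / of_nat N)) * A"
  proof (rule fls_eqI)
    fix n
    show "fls_scale_coeffs (\<lambda>n. exp (2 * of_real pi * \<i> * of_int n * of_int j / of_nat N)) A $$ n =
      (fls_const (exp (2 * of_real pi * \<i> * of_int (c * j) / of_nat N)) * A) $$ n"
    proof (cases "A $$ n = 0")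
      case False
      then have "[n * j = c * j] (mod int N)"
        using assms(2) by (auto simp: fls_class_def intro: cong_mult)
      from exp_cong_mod[OF this] show ?thesis by (simp add: mult_ac)
    qed simp
  qed
  then show ?thesis
    using ev_shift_twist[OF assms(1,3), of j] ev_mult[OF assms(3), of "fls_const _" A] assms(1) by simp
qed

lemma fls_class_of_T:
  assumes "fls_conv_disc A" "\<And>\<tau>. \<tau> \<in> upper_half_plane \<Longrightarrow> ev A (\<tau> + 1) = exp (2 * of_real pi * \<i> * of_int c / of_nat N) * ev A \<tau>"
  shows "fls_class c A"
proof -
  let ?B = "fls_scale_coeffs (\<lambda>n. exp (2 * of_real pi * \<i> * of_int n * of_int 1 / of_nat N)) A"
  have "norm (exp (2 * of_real pi * \<i> * of_int n * of_int 1 / of_nat N)) \<le> 1" for n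
  proof -
    have "exp (2 * of_real pi * \<i> * of_int n * of_int 1 / of_nat N) = exp (\<i> * of_real (2 * pi * of_int n / of_nat N))"
      by (simp add: field_simps)
    then show ?thesis by (simp only: norm_exp_i_times)
  qed
  then have "fls_conv_disc ?B" by (rule fls_conv_disc_scale_coeffs[OF assms(1)])
  then have eq: "?B = fls_const (exp (2 * of_real pi * \<i> * of_int c / of_nat N)) * A"
  proof (rule ev_cong_fls)
    show "ev ?B \<tau> = ev (fls_const (exp (2 * of_real pi * \<i> * of_int c / of_nat N)) * A) \<tau>" if "\<tau> \<in> upper_half_plane" for \<tau>
      using ev_shift_twist[OF assms(1) that, of 1] assms(2)[OF that] ev_mult[OF that, of "fls_const _" A] assms(1) by simp
  qed (use assms(1) in \<open>auto intro: fls_conv_disc_mult\<close>)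
  show ?thesis unfolding fls_class_def
  proof (intro allI impI)
    fix n assume "A $$ n \<noteq> 0"
    moreover have "?B $$ n = exp (2 * of_real pi * \<i> * of_int c / of_nat N) * A $$ n"
      unfolding eq by simp
    ultimately show "[n = c] (mod int N)"
      unfolding exp_mod_eq_iff[symmetric] by simp
  qed
qed

end

text \<open>The differences of \<open>P\<close>, the second corrected by
  \<open>\<kappa> * Ln\<close>, are constant on the half plane. The fixed point \<open>\<i>\<close>
  of the inversion gives the second constant. At the cube root of unity \<open>\<rho>\<close>
  inversion and translation agree, which then gives the first.\<close>

lemma weight_two_period:
  assumes hf: "f holomorphic_on upper_half_plane"
    and T: "\<And>\<tau>. \<tau> \<in> upper_half_plane \<Longrightarrow> f (\<tau> + 1) = f \<tau>"
    and S: "\<And>\<tau>. \<tau> \<in> upper_half_plane \<Longrightarrow> f (- 1 / \<tau>) = \<tau>^2 * f \<tau> + \<kappa> * \<tau>"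
    and P: "\<And>\<tau>. \<tau> \<in> upper_half_plane \<Longrightarrow> (P has_field_derivative f \<tau>) (at \<tau>)"
    and \<tau>: "\<tau> \<in> upper_half_plane"
  shows "P (\<tau> + 1) = P \<tau> + \<kappa> * of_real pi * \<i> / 6"
    and "P (- 1 / \<tau>) = P \<tau> + \<kappa> * Ln \<tau> - \<kappa> * of_real pi * \<i> / 2"
proof -
  have "\<exists>c. \<forall>x\<in>upper_half_plane. P (x + 1) - P x = c"
  proof (rule has_field_derivative_zero_constant[OF convex_upper_half_plane])
    fix x assume x: "x \<in> upper_half_plane"
    have "((\<lambda>x. P (x + 1) - P x) has_field_derivative f (x + 1) * 1 - f x) (at x)"
      by (intro DERIV_diff DERIV_chain'[where f="\<lambda>x. x + 1" and g=P] P x) (use x in \<open>auto intro!: derivative_eq_intros simp: uhp_T\<close>)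
    then show "((\<lambda>x. P (x + 1) - P x) has_field_derivative 0) (at x within upper_half_plane)"
      using T[OF x] by (auto intro: has_field_derivative_at_within)
  qed
  then obtain c where c: "\<And>x. x \<in> upper_half_plane \<Longrightarrow> P (x + 1) - P x = c" by blast
  have "\<exists>s. \<forall>x\<in>upper_half_plane. P (- 1 / x) - P x - \<kappa> * Ln x = s"
  proof (rule has_field_derivative_zero_constant[OF convex_upper_half_plane])
    fix x assume x: "x \<in> upper_half_plane"
    then have x0: "x \<noteq> 0" and xn: "x \<notin> \<real>\<^sub>\<le>\<^sub>0"
      by (auto simp: upper_half_plane_def elim!: nonpos_Reals_cases)
    have "((\<lambda>x. P (- 1 / x) - P x - \<kappa> * Ln x) has_field_derivative f (- 1 / x) * (1 / x^2) - f x - \<kappa> * (1 / x)) (at x)"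
      by (intro DERIV_diff DERIV_cmult DERIV_chain'[where f="\<lambda>x. - 1 / x" and g=P] P x uhp_S has_field_derivative_Ln[THEN DERIV_cong] xn)
         (use x0 in \<open>auto intro!: derivative_eq_intros simp: power2_eq_square inverse_eq_divide\<close>)
    moreover have "f (- 1 / x) * (1 / x^2) - f x - \<kappa> * (1 / x) = 0"
      using S[OF x] x0 by (simp add: field_simps power2_eq_square)
    ultimately show "((\<lambda>x. P (- 1 / x) - P x - \<kappa> * Ln x) has_field_derivative 0) (at x within upper_half_plane)"
      by (auto intro: has_field_derivative_at_within)
  qed
  then obtain s where s: "\<And>x. x \<in> upper_half_plane \<Longrightarrow> P (- 1 / x) - P x - \<kappa> * Ln x = s" by blast
  have "P (- 1 / \<i>) - P \<i> - \<kappa> * Ln \<i> = s"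
    by (rule s) (simp add: upper_half_plane_def)
  then have sv: "s = - (\<kappa> * (of_real pi * \<i> / 2))"
    by (simp add: divide_i mult.commute)
  define \<rho> where "\<rho> = (- 1 / 2 + \<i> * of_real (sqrt 3 / 2) :: complex)"
  have \<rho>u: "\<rho> \<in> upper_half_plane" by (simp add: \<rho>_def upper_half_plane_def)
  have r2: "\<rho> * (\<rho> + 1) = - 1"
    by (simp add: \<rho>_def complex_eq_iff field_simps)
  have \<rho>0: "\<rho> \<noteq> 0" using \<rho>u uhp_nonzero by blast
  have \<rho>S: "- 1 / \<rho> = \<rho> + 1"
    using r2 \<rho>0 by (simp add: field_simps)
  have "Ln \<rho> = of_real (2 * pi / 3) * \<i>"
  proof (rule Ln_unique)
    show "exp (of_real (2 * pi / 3) * \<i>) = \<rho>"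
      by (simp add: \<rho>_def exp_Euler cos_of_real sin_of_real cos_120 sin_120 complex_eq_iff Re_exp Im_exp)
  qed (auto simp: )
  with s[OF \<rho>u] c[OF \<rho>u] sv have "c = \<kappa> * (of_real (2 * pi / 3) * \<i>) - \<kappa> * (of_real pi * \<i> / 2)"
    unfolding \<rho>S by (simp add: algebra_simps)
  then have "c = \<kappa> * of_real pi * \<i> / 6"
    by (simp add: field_simps)
  with c[OF \<tau>] show "P (\<tau> + 1) = P \<tau> + \<kappa> * of_real pi * \<i> / 6"
    by (metis add.commute diff_add_cancel)
  show "P (- 1 / \<tau>) = P \<tau> + \<kappa> * Ln \<tau> - \<kappa> * of_real pi * \<i> / 2"
    using s[OF \<tau>] sv by (simp add: algebra_simps)
qed

lemma uhp_primitive: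
  assumes "f holomorphic_on upper_half_plane"
  obtains P where "\<And>\<tau>. \<tau> \<in> upper_half_plane \<Longrightarrow> (P has_field_derivative f \<tau>) (at \<tau>)"
proof -
  obtain P where "\<And>\<tau>. \<tau> \<in> upper_half_plane \<Longrightarrow> (P has_field_derivative f \<tau>) (at \<tau> within upper_half_plane)"
    using holomorphic_convex_primitive'[OF convex_upper_half_plane open_upper_half_plane assms] by blast
  then show ?thesis
    using that at_within_open[OF _ open_upper_half_plane] by metis
qed

context q_width
begin

text \<open>By periodicity \<open>f\<close> descends to the punctured disc, and the bound near the
  cusp makes 0 a removable singularity.\<close>

lemma q_expansion_exists:
  assumes hf: "f holomorphic_on upper_half_plane"
    and per: "\<And>\<tau>. \<tau> \<in> upper_half_plane \<Longrightarrow> f (\<tau> + of_nat N) = f \<tau>"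
    and bd: "\<And>\<tau>. Im \<tau> \<ge> 1 \<Longrightarrow> norm (f \<tau>) \<le> B"
  obtains A where "fls_conv_disc A" "\<And>\<tau>. \<tau> \<in> upper_half_plane \<Longrightarrow> ev A \<tau> = f \<tau>" "\<And>n. n < 0 \<Longrightarrow> A $$ n = 0"
proof -
  have pern: "f (\<tau> + of_nat N * of_nat k) = f \<tau>" if "\<tau> \<in> upper_half_plane" for \<tau> k
  proof (induction k)
    case (Suc k)
    have "\<tau> + of_nat N * of_nat k \<in> upper_half_plane"
      using that by (simp add: upper_half_plane_def)
    from per[OF this] Suc.IH show ?case by (simp add: algebra_simps)
  qed simp
  have peri: "f (\<tau> + of_nat N * of_int k) = f \<tau>" if "\<tau> \<in> upper_half_plane" for \<tau> k
  proof (cases "k \<ge> 0")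
    case True
    then show ?thesis using pern[OF that, of "nat k"] by simp
  next
    case False
    have u: "\<tau> + of_nat N * of_int k \<in> upper_half_plane"
      using that by (simp add: upper_half_plane_def)
    have "of_nat (nat (- k)) = (- of_int k :: complex)"
      using False by (simp add: of_nat_nat)
    then show ?thesis using pern[OF u, of "nat (- k)"] by simp
  qed
  define g where "g x = f (of_nat N * Ln x / (2 * of_real pi * \<i>))" for x
  have gq: "g (qx \<tau>) = f \<tau>" if \<tau>: "\<tau> \<in> upper_half_plane" for \<tau>
  proof -
    have "exp (Ln (qx \<tau>)) = exp (2 * of_real pi * \<i> * \<tau> / of_nat N)"
      by (simp add: qx_def)
    then obtain k :: int where k: "Ln (qx \<tau>) = 2 * of_real pi * \<i> * \<tau> / of_nat N + (of_int (2 * k) * pi) * \<i>"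
      unfolding exp_eq by blast
    have "of_nat N * Ln (qx \<tau>) / (2 * of_real pi * \<i>) = \<tau> + of_nat N * of_int k"
      unfolding k using N_pos by (simp add: field_simps)
    then show ?thesis using peri[OF \<tau>] by (simp add: g_def)
  qed
  have "g holomorphic_on ball 0 1 - {0}"
  proof (rule analytic_imp_holomorphic, rule analytic_on_analytic_at[THEN iffD2], rule ballI)
    fix x0 :: complex assume "x0 \<in> ball 0 1 - {0}"
    then have x0: "norm x0 < 1" "x0 \<noteq> 0" by auto
    then obtain \<tau>0 where \<tau>0: "\<tau>0 \<in> upper_half_plane" "qx \<tau>0 = x0" by (rule qx_surj)
    define U where "U = ball x0 (norm x0) \<inter> ball 0 1"
    \<comment> \<open>A local inverse of \<open>qx\<close> near \<open>x0\<close>. Dividing by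
      \<open>x0\<close> keeps the argument of \<open>Ln\<close> off its cut, as \<open>x\<close>
      stays within distance \<open>|x0|\<close> of \<open>x0\<close>.\<close>
    define \<sigma> where "\<sigma> x = \<tau>0 + of_nat N * Ln (x / x0) / (2 * of_real pi * \<i>)" for x
    have Ux: "x / x0 \<notin> \<real>\<^sub>\<le>\<^sub>0" if "x \<in> U" for x
    proof
      assume "x / x0 \<in> \<real>\<^sub>\<le>\<^sub>0"
      then have "1 \<le> norm (1 - x / x0)"
        by (auto elim!: nonpos_Reals_cases simp: complex_eq_iff cmod_def)
      also have "1 - x / x0 = (x0 - x) / x0" using x0 by (simp add: field_simps)
      finally have "norm x0 \<le> norm (x0 - x)" using x0 by (simp add: norm_divide field_simps)
      then show False using that by (simp add: U_def dist_norm)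
    qed
    have "x \<noteq> 0" if "x \<in> U" for x
      using Ux[OF that] by auto
    then have q\<sigma>: "qx (\<sigma> x) = x" if "x \<in> U" for x
    proof -
      have "x / x0 \<noteq> 0" using \<open>\<And>x. x \<in> U \<Longrightarrow> x \<noteq> 0\<close>[OF that] x0 by simp
      have "qx (\<sigma> x) = exp (2 * of_real pi * \<i> * \<tau>0 / of_nat N + Ln (x / x0))"
      proof -
        have "2 * of_real pi * \<i> * \<sigma> x / of_nat N = 2 * of_real pi * \<i> * \<tau>0 / of_nat N + Ln (x / x0)"
          unfolding \<sigma>_def using N_pos by (simp add: ring_distribs add_divide_distrib)
        then show ?thesis by (simp only: qx_def)
      qed
      also have "\<dots> = qx \<tau>0 * (x / x0)"
        using \<open>x / x0 \<noteq> 0\<close> by (simp only: exp_add exp_Ln[OF \<open>x / x0 \<noteq> 0\<close>] qx_def)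
      finally show ?thesis using \<tau>0 x0 by simp
    qed
    have \<sigma>u: "\<sigma> x \<in> upper_half_plane" if "x \<in> U" for x
    proof -
      have "exp (- (2 * pi * Im (\<sigma> x) / N)) < 1"
        using q\<sigma>[OF that] that by (simp add: U_def flip: norm_qx)
      then show ?thesis
        using N_pos by (simp add: upper_half_plane_def zero_less_divide_iff zero_less_mult_iff)
    qed
    have "\<sigma> holomorphic_on U"
      unfolding \<sigma>_def[abs_def] by (intro holomorphic_intros) (use x0 Ux in auto)
    then have "(\<lambda>x. f (\<sigma> x)) holomorphic_on U"
      by (rule holomorphic_on_compose_gen[unfolded o_def, OF _ hf]) (use \<sigma>u in auto)
    then have "g holomorphic_on U"
      by (rule holomorphic_transform) (use gq[OF \<sigma>u] q\<sigma> in auto)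
    moreover have "open U" "x0 \<in> U" using x0 by (auto simp: U_def)
    ultimately show "g analytic_on {x0}" using analytic_at by blast
  qed
  moreover have "\<forall>\<^sub>F x in at 0. norm (g x) \<le> B"
  proof -
    have "\<forall>\<^sub>F x in at 0. x \<in> ball 0 (exp (- (2 * pi / N))) - {0::complex}"
      by (intro eventually_at_in_open) auto
    then show ?thesis
    proof eventually_elim
      case (elim x)
      have "exp (- (2 * pi / N)) < exp 0" unfolding exp_less_cancel_iff using N_pos by simp
      moreover have "norm x < exp (- (2 * pi / N))" "x \<noteq> 0" using elim by auto
      ultimately have "norm x < 1" "x \<noteq> 0"
        unfolding exp_zero by linarith+
      then obtain \<tau> where \<tau>: "\<tau> \<in> upper_half_plane" "qx \<tau> = x" by (rule qx_surj)
      have "exp (- (2 * pi * Im \<tau> / N)) < exp (- (2 * pi / N))"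
        using elim \<tau>(2) by (simp flip: norm_qx)
      then have "2 * pi / N < 2 * pi * Im \<tau> / N" unfolding exp_less_cancel_iff by simp
      then have "Im \<tau> \<ge> 1" using N_pos by (simp add: divide_less_cancel)
      then show ?case using bd gq[OF \<tau>(1)] \<tau>(2) by simp
    qed
  qed
  ultimately obtain G where G: "G holomorphic_on ball 0 1" "\<And>x. x \<in> ball 0 1 - {0} \<Longrightarrow> G x = g x"
    using holomorphic_on_extend_bounded[of g "ball 0 1" 0] by auto
  have "G analytic_on {0}"
    unfolding analytic_at using G(1) by (intro exI[of _ "ball 0 1"]) auto
  then have F: "G has_fps_expansion fps_expansion G 0"
    by (rule analytic_at_imp_has_fps_expansion_0)
  define A where "A = fps_to_fls (fps_expansion G 0)"
  have GA: "G has_laurent_expansion A"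
    unfolding A_def by (rule has_laurent_expansion_fps[OF F])
  have Gh: "G holomorphic_on ball 0 1 - {0}" using G(1) by (rule holomorphic_on_subset) auto
  show ?thesis
  proof (rule that[of A])
    show "fls_conv_disc A" by (rule fls_conv_disc_of_holomorphic[OF Gh GA])
    show "ev A \<tau> = f \<tau>" if \<tau>: "\<tau> \<in> upper_half_plane" for \<tau>
      using fls_conv_disc_of_holomorphic(2)[OF Gh GA norm_qx_less[OF \<tau>]] G(2)[of "qx \<tau>"] norm_qx_less[OF \<tau>] gq[OF \<tau>]
      by (simp add: ev_def)
    show "A $$ n = 0" if "n < 0" for n
      using that by (simp add: A_def)
  qed
qed

text \<open>Termwise primitive. The constant term has none among Laurent series; it reappears as the
  linear term in \<open>primitive_expansion\<close>.\<close>

definition fls_antitheta :: "complex fls \<Rightarrow> complex fls" where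
  "fls_antitheta A = fls_scale_coeffs (\<lambda>n. if n = 0 then 0 else of_nat N / (2 * of_real pi * \<i> * of_int n)) A"

lemma fls_antitheta_conv:
  assumes "fls_conv_disc A"
  shows "fls_conv_disc (fls_antitheta A)"
  unfolding fls_antitheta_def
proof (rule fls_conv_disc_scale_coeffs[OF assms, of _ "real N"])
  fix n :: int
  show "norm (if n = 0 then 0 else of_nat N / (2 * of_real pi * \<i> * of_int n) :: complex) \<le> real N"
  proof (cases "n = 0")
    case False
    have "1 * 1 \<le> (2 * pi) * \<bar>real_of_int n\<bar>"
      using False pi_gt3 by (intro mult_mono) auto
    then have "real N / ((2 * pi) * \<bar>real_of_int n\<bar>) \<le> real N / 1"
      by (intro divide_left_mono) auto
    then show ?thesis using False by (simp add: norm_divide norm_mult)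
  qed simp
qed

lemma fls_theta_antitheta: "fls_theta (fls_antitheta A) = A - fls_const (A $$ 0)"
  by (rule fls_eqI) (use N_pos in \<open>auto simp: fls_theta_nth fls_antitheta_def\<close>)

lemma primitive_expansion:
  assumes A: "fls_conv_disc A"
    and P: "\<And>\<tau>. \<tau> \<in> upper_half_plane \<Longrightarrow> (P has_field_derivative ev A \<tau>) (at \<tau>)"
  obtains c where "\<And>\<tau>. \<tau> \<in> upper_half_plane \<Longrightarrow> P \<tau> = A $$ 0 * \<tau> + ev (fls_antitheta A) \<tau> + c"
proof -
  have "\<exists>c. \<forall>\<tau>\<in>upper_half_plane. P \<tau> - A $$ 0 * \<tau> - ev (fls_antitheta A) \<tau> = c"
  proof (rule has_field_derivative_zero_constant[OF convex_upper_half_plane])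
    fix \<tau> assume \<tau>: "\<tau> \<in> upper_half_plane"
    have "((\<lambda>\<tau>. P \<tau> - A $$ 0 * \<tau> - ev (fls_antitheta A) \<tau>) has_field_derivative
       ev A \<tau> - A $$ 0 - ev (fls_theta (fls_antitheta A)) \<tau>) (at \<tau>)"
      by (intro DERIV_diff P \<tau> ev_deriv fls_antitheta_conv A) (auto intro!: derivative_eq_intros)
    moreover have "ev A \<tau> - A $$ 0 - ev (fls_theta (fls_antitheta A)) \<tau> = 0"
      unfolding fls_theta_antitheta using A \<tau> by (simp add: ev_diff)
    ultimately show "((\<lambda>\<tau>. P \<tau> - A $$ 0 * \<tau> - ev (fls_antitheta A) \<tau>) has_field_derivative 0) (at \<tau> within upper_half_plane)"
      by (auto intro: has_field_derivative_at_within)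
  qed
  then obtain c where "\<And>\<tau>. \<tau> \<in> upper_half_plane \<Longrightarrow> P \<tau> - A $$ 0 * \<tau> - ev (fls_antitheta A) \<tau> = c" by blast
  then show ?thesis by (intro that[of c]) (simp add: algebra_simps)
qed

lemma ev_T_class_0:
  assumes "fls_conv_disc A" "fls_class 0 A" "\<tau> \<in> upper_half_plane"
  shows "ev A (\<tau> + 1) = ev A \<tau>"
  using ev_T_class[OF assms, of 1] by simp

lemma fls_class_antitheta: "fls_class c A \<Longrightarrow> fls_class c (fls_antitheta A)"
  by (auto simp: fls_class_def fls_antitheta_def)

text \<open>The period of a primitive under translation is the constant term on the one hand and is
  given by \<open>weight_two_period\<close> on the other. With \<open>\<kappa> = 0\<close> this
  plays the part of the residue theorem on the modular curve; with \<open>\<kappa> = 12\<close> it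
  gives the constant term of \<open>Phi\<close>.\<close>

lemma weight_two_constant_term:
  assumes A: "fls_conv_disc A" "fls_class 0 A"
    and S: "\<And>\<tau>. \<tau> \<in> upper_half_plane \<Longrightarrow> ev A (- 1 / \<tau>) = \<tau>^2 * ev A \<tau> + \<kappa> * \<tau>"
  shows "A $$ 0 = \<kappa> * of_real pi * \<i> / 6"
proof -
  obtain P where P: "\<And>\<tau>. \<tau> \<in> upper_half_plane \<Longrightarrow> (P has_field_derivative ev A \<tau>) (at \<tau>)"
    using uhp_primitive[OF ev_holomorphic[OF A(1)]] by blast
  obtain c where c: "\<And>\<tau>. \<tau> \<in> upper_half_plane \<Longrightarrow> P \<tau> = A $$ 0 * \<tau> + ev (fls_antitheta A) \<tau> + c"
    using primitive_expansion[OF A(1) P] by blast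
  have i: "\<i> \<in> upper_half_plane" by (simp add: upper_half_plane_def)
  have "P (\<i> + 1) = P \<i> + \<kappa> * of_real pi * \<i> / 6"
    by (rule weight_two_period(1)[OF ev_holomorphic[OF A(1)] ev_T_class_0[OF A] S P i])
  moreover have "P (\<i> + 1) = P \<i> + A $$ 0"
    using c[OF i] c[of "\<i> + 1"] i ev_T_class_0[OF fls_antitheta_conv[OF A(1)] fls_class_antitheta[OF A(2)] i]
    by (simp add: uhp_T algebra_simps)
  ultimately show ?thesis by simp
qed

end

context q_width
begin

lemma fls_class_mult:
  assumes "fls_class c A" "fls_class c' B"
  shows "fls_class (c + c') (A * B)"
  unfolding fls_class_def
proof (intro allI impI)
  fix n assume "(A * B) $$ n \<noteq> 0"
  then obtain i where "A $$ (i - fls_subdegree B) * B $$ (fls_subdegree B + n - i) \<noteq> 0"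
    unfolding fls_times_nth(1) using sum.not_neutral_contains_not_neutral by blast
  moreover obtain j where "i = j + fls_subdegree B" by (metis diff_add_cancel)
  ultimately have i: "A $$ j * B $$ (n - j) \<noteq> 0" by simp
  then have "[j = c] (mod int N)" "[n - j = c'] (mod int N)"
    using assms by (auto simp: fls_class_def)
  from cong_add[OF this] show "[n = c + c'] (mod int N)" by simp
qed

lemma fls_class_add: "fls_class c A \<Longrightarrow> fls_class c B \<Longrightarrow> fls_class c (A + B)"
  and fls_class_diff: "fls_class c A \<Longrightarrow> fls_class c B \<Longrightarrow> fls_class c (A - B)"
  unfolding fls_class_def by (metis add.right_neutral add.left_neutral fls_plus_nth, metis diff_self fls_minus_nth)

lemma fls_class_const: "fls_class 0 (fls_const x)"
  by (simp add: fls_class_def)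

lemma fls_class_const_mult: "fls_class c A \<Longrightarrow> fls_class c (fls_const x * A)"
  by (auto simp: fls_class_def)

lemma fls_class_theta: "fls_class c A \<Longrightarrow> fls_class c (fls_theta A)"
  by (auto simp: fls_class_def fls_theta_nth)

lemma fls_class_sum: "(\<And>i. i \<in> I \<Longrightarrow> fls_class c (A i)) \<Longrightarrow> fls_class c (\<Sum>i\<in>I. A i)"
proof (induction I rule: infinite_finite_induct)
  case (insert x F)
  then show ?case by (simp add: fls_class_add)
qed (auto simp: fls_class_def)

section \<open>Forms of level one\<close>

definition Phi :: "complex fls" where
  "Phi = (SOME A. fls_conv_disc A \<and> (\<forall>\<tau>\<in>upper_half_plane. ev A \<tau> = G2_phi \<tau>) \<and> (\<forall>n<0. A $$ n = 0))"

lemma Phi_conv: "fls_conv_disc Phi"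
  and ev_Phi: "\<tau> \<in> upper_half_plane \<Longrightarrow> ev Phi \<tau> = G2_phi \<tau>"
  and Phi_neg: "n < 0 \<Longrightarrow> Phi $$ n = 0"
proof -
  have per: "G2_phi (\<tau> + of_nat k) = G2_phi \<tau>" for \<tau> k
  proof (induction k)
    case (Suc k)
    have "\<tau> + of_nat (Suc k) = (\<tau> + of_nat k) + 1" by simp
    then show ?case using G2_phi_T[of "\<tau> + of_nat k"] Suc.IH by (simp only:)
  qed simp
  obtain B where "\<And>\<tau>. Im \<tau> \<ge> 1 \<Longrightarrow> norm (G2_phi \<tau>) \<le> B" using G2_phi_bounded by blast
  moreover have "G2_phi holomorphic_on upper_half_plane"
    unfolding upper_half_plane_def by (rule G2_phi_holomorphic)
  ultimately obtain A where "fls_conv_disc A" "\<And>\<tau>. \<tau> \<in> upper_half_plane \<Longrightarrow> ev A \<tau> = G2_phi \<tau>" "\<And>n. n < 0 \<Longrightarrow> A $$ n = 0"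
    using q_expansion_exists[of G2_phi B] per by blast
  then have "\<exists>A. fls_conv_disc A \<and> (\<forall>\<tau>\<in>upper_half_plane. ev A \<tau> = G2_phi \<tau>) \<and> (\<forall>n<0. A $$ n = 0)" by blast
  from someI_ex[OF this, folded Phi_def]
  show "fls_conv_disc Phi" "\<tau> \<in> upper_half_plane \<Longrightarrow> ev Phi \<tau> = G2_phi \<tau>" "n < 0 \<Longrightarrow> Phi $$ n = 0"
    by auto
qed

lemma ev_Phi_S:
  assumes "\<tau> \<in> upper_half_plane"
  shows "ev Phi (- 1 / \<tau>) = \<tau>^2 * ev Phi \<tau> + 12 * \<tau>"
  using G2_phi_S[of \<tau>] assms ev_Phi[OF assms] ev_Phi[OF uhp_S[OF assms]] by (simp add: upper_half_plane_def)

lemma Phi_class: "fls_class 0 Phi"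
  by (rule fls_class_of_T[OF Phi_conv]) (simp add: ev_Phi uhp_T G2_phi_T)

lemma Phi_0: "Phi $$ 0 = 2 * of_real pi * \<i>"
  using weight_two_constant_term[OF Phi_conv Phi_class ev_Phi_S] by simp

text \<open>\<open>K\<close> is twice the weight, so that half-integral weights need only integral
  powers of \<open>csqrt\<close>.\<close>

definition slaw :: "int set \<Rightarrow> (int \<Rightarrow> int \<Rightarrow> complex) \<Rightarrow> int \<Rightarrow> (int \<Rightarrow> complex fls) \<Rightarrow> bool" where
  "slaw C S K F \<longleftrightarrow> (\<forall>c\<in>C. \<forall>\<tau>\<in>upper_half_plane.
     ev (F c) (- 1 / \<tau>) = csqrt \<tau> powi K * (\<Sum>c'\<in>C. S c c' * ev (F c') \<tau>))"

text \<open>\<open>K / 24\<close> is the weight over 12, matching \<open>Phi = 2 pi i E2\<close>.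
  The weight rises by 2, hence \<open>K\<close> by 4.\<close>

definition serre :: "int \<Rightarrow> complex fls \<Rightarrow> complex fls" where
  "serre K A = fls_theta A - fls_const (of_int K / 24) * (Phi * A)"

lemma serre_conv: "fls_conv_disc A \<Longrightarrow> fls_conv_disc (serre K A)"
  unfolding serre_def by (intro fls_conv_disc_intros fls_theta_conv Phi_conv)

lemma serre_class: "fls_class c A \<Longrightarrow> fls_class c (serre K A)"
  unfolding serre_def using fls_class_mult[OF Phi_class, of c A]
  by (intro fls_class_diff fls_class_theta fls_class_const_mult) auto

lemma ev_serre:
  assumes "fls_conv_disc A" "\<tau> \<in> upper_half_plane"
  shows "ev (serre K A) \<tau> = ev (fls_theta A) \<tau> - of_int K / 24 * (ev Phi \<tau> * ev A \<tau>)"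
  unfolding serre_def using assms
  by (simp add: ev_diff ev_mult fls_theta_conv Phi_conv fls_conv_disc_mult)

lemma csqrt_uhp_nonzero: "\<tau> \<in> upper_half_plane \<Longrightarrow> csqrt \<tau> \<noteq> 0"
  by (auto simp: upper_half_plane_def)

lemma csqrt_powi_add4:
  assumes "\<tau> \<in> upper_half_plane"
  shows "csqrt \<tau> powi (K + 4) = csqrt \<tau> powi K * \<tau>^2"
proof -
  have "csqrt \<tau> powi (K + 4) = csqrt \<tau> powi K * csqrt \<tau> ^ 4"
    using csqrt_uhp_nonzero[OF assms] by (simp add: power_int_add)
  also have "csqrt \<tau> ^ 4 = (csqrt \<tau> ^ 2) ^ 2" by (simp only: power_mult[symmetric]) simp
  finally show ?thesis by simp
qed

lemma uhp_not_nonpos_Reals: "\<tau> \<in> upper_half_plane \<Longrightarrow> \<tau> \<notin> \<real>\<^sub>\<le>\<^sub>0"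
  by (auto simp: upper_half_plane_def elim!: nonpos_Reals_cases)

lemma csqrt_powi_deriv:
  assumes "\<tau> \<in> upper_half_plane"
  shows "((\<lambda>\<tau>. csqrt \<tau> powi K) has_field_derivative of_int K / (2 * \<tau>) * csqrt \<tau> powi K) (at \<tau>)"
proof -
  have nz: "csqrt \<tau> \<noteq> 0" by (rule csqrt_uhp_nonzero[OF assms])
  have "((\<lambda>\<tau>. csqrt \<tau> powi K) has_field_derivative of_int K * csqrt \<tau> powi (K - 1) * inverse (2 * csqrt \<tau>)) (at \<tau>)"
    by (rule DERIV_power_int[OF has_field_derivative_csqrt[OF uhp_not_nonpos_Reals[OF assms]] disjI2[OF nz]])
  moreover have "of_int K * csqrt \<tau> powi (K - 1) * inverse (2 * csqrt \<tau>) = of_int K / (2 * csqrt \<tau> ^ 2) * csqrt \<tau> powi K"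
    using nz by (simp add: power_int_diff power2_eq_square field_simps del: csqrt_eq_0)
  ultimately show ?thesis by (simp only: power2_csqrt)
qed

text \<open>Differentiating the transformation law creates the term \<open>K / (2 \<tau>)\<close>, which the
  inhomogeneous term \<open>12 \<tau>\<close> in the law of \<open>Phi\<close> cancels.\<close>

lemma slaw_serre:
  assumes conv: "\<And>c. c \<in> C \<Longrightarrow> fls_conv_disc (F c)" and F: "slaw C S K F"
  shows "slaw C S (K + 4) (\<lambda>c. serre K (F c))"
  unfolding slaw_def
proof (intro ballI)
  fix c \<tau> assume c: "c \<in> C" and \<tau>: "\<tau> \<in> upper_half_plane"
  have \<tau>0: "\<tau> \<noteq> 0" using uhp_nonzero[OF \<tau>] .
  have S\<tau>: "- 1 / \<tau> \<in> upper_half_plane" by (rule uhp_S[OF \<tau>])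
  define E where "E = (\<Sum>c'\<in>C. S c c' * ev (F c') \<tau>)"
  define E' where "E' = (\<Sum>c'\<in>C. S c c' * ev (fls_theta (F c')) \<tau>)"
  define s where "s = csqrt \<tau> powi K"
  have law: "ev (F c) (- 1 / x) = csqrt x powi K * (\<Sum>c'\<in>C. S c c' * ev (F c') x)" if "x \<in> upper_half_plane" for x
    using F c that by (auto simp: slaw_def)
  have d1: "((\<lambda>x. ev (F c) (- 1 / x)) has_field_derivative ev (fls_theta (F c)) (- 1 / \<tau>) * (1 / \<tau>^2)) (at \<tau>)"
    by (intro DERIV_chain'[where f="\<lambda>x. - 1 / x" and g="ev (F c)"] ev_deriv conv c S\<tau>)
       (use \<tau>0 in \<open>auto intro!: derivative_eq_intros simp: power2_eq_square\<close>)
  have d2: "((\<lambda>x. csqrt x powi K * (\<Sum>c'\<in>C. S c c' * ev (F c') x)) has_field_derivative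
     (of_int K / (2 * \<tau>) * s) * E + E' * s) (at \<tau>)"
    unfolding s_def E_def E'_def
    by (intro DERIV_mult csqrt_powi_deriv \<tau> DERIV_sum DERIV_cmult ev_deriv conv)
  have d3: "\<forall>\<^sub>F x in nhds \<tau>. ev (F c) (- 1 / x) = csqrt x powi K * (\<Sum>c'\<in>C. S c c' * ev (F c') x)"
    using eventually_nhds_in_open[OF open_upper_half_plane \<tau>] by eventually_elim (rule law)
  have "ev (fls_theta (F c)) (- 1 / \<tau>) * (1 / \<tau>^2) = (of_int K / (2 * \<tau>) * s) * E + E' * s"
    by (rule DERIV_unique[OF DERIV_cong_ev[OF refl d3 refl, THEN iffD1, OF d1] d2])
  then have d: "ev (fls_theta (F c)) (- 1 / \<tau>) = \<tau>^2 * s * (of_int K / (2 * \<tau>) * E + E')"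
    using \<tau>0 by (simp add: field_simps)
  have "ev (serre K (F c)) (- 1 / \<tau>) = \<tau>^2 * s * (of_int K / (2 * \<tau>) * E + E')
      - of_int K / 24 * ((\<tau>^2 * ev Phi \<tau> + 12 * \<tau>) * (s * E))"
    unfolding ev_serre[OF conv[OF c] S\<tau>] d ev_Phi_S[OF \<tau>] law[OF \<tau>] s_def E_def ..
  also have "\<dots> = (s * \<tau>^2) * (E' - of_int K / 24 * ev Phi \<tau> * E)"
    using \<tau>0 by (simp add: field_simps power2_eq_square)
  also have "E' - of_int K / 24 * ev Phi \<tau> * E = (\<Sum>c'\<in>C. S c c' * ev (serre K (F c')) \<tau>)"
    unfolding E_def E'_def sum_distrib_left sum_subtractf[symmetric]
    by (intro sum.cong refl) (simp add: ev_serre[OF conv \<tau>] algebra_simps)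
  finally show "ev (serre K (F c)) (- 1 / \<tau>) = csqrt \<tau> powi (K + 4) * (\<Sum>c'\<in>C. S c c' * ev (serre K (F c')) \<tau>)"
    unfolding csqrt_powi_add4[OF \<tau>] s_def .
qed

end

context q_width
begin

definition level_one :: "int \<Rightarrow> complex fls \<Rightarrow> bool" where
  "level_one L A \<longleftrightarrow> fls_conv_disc A \<and> fls_class 0 A \<and>
     (\<forall>\<tau>\<in>upper_half_plane. ev A (- 1 / \<tau>) = csqrt \<tau> powi L * ev A \<tau>)"

lemma level_oneD:
  assumes "level_one L A"
  shows "fls_conv_disc A" "fls_class 0 A" "\<tau> \<in> upper_half_plane \<Longrightarrow> ev A (- 1 / \<tau>) = csqrt \<tau> powi L * ev A \<tau>"
  using assms by (auto simp: level_one_def)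

lemma level_one_iff_slaw:
  "level_one L A \<longleftrightarrow> fls_conv_disc A \<and> fls_class 0 A \<and> slaw {0} (\<lambda>_ _. 1) L (\<lambda>_. A)"
  by (simp add: level_one_def slaw_def)

lemma level_one_mult:
  assumes "level_one L A" "level_one L' B"
  shows "level_one (L + L') (A * B)"
  using fls_class_mult[OF level_oneD(2)[OF assms(1)] level_oneD(2)[OF assms(2)]] assms
  by (auto simp: level_one_def fls_conv_disc_mult ev_mult uhp_S uhp_S' uhp_nonzero power_int_add)

lemma level_one_const: "level_one 0 (fls_const x)"
  by (simp add: level_one_def fls_class_const)

lemma level_one_1: "level_one 0 1"
  using level_one_const[of 1] by simp

lemma level_one_power: "level_one L A \<Longrightarrow> level_one (int n * L) (A ^ n)"
proof (induction n)
  case (Suc n)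
  then show ?case using level_one_mult[of L A "int n * L" "A ^ n"] by (simp add: ring_distribs)
qed (simp add: level_one_1)

lemma level_one_add: "level_one L A \<Longrightarrow> level_one L B \<Longrightarrow> level_one L (A + B)"
  by (auto simp: level_one_def fls_conv_disc_add ev_add uhp_S uhp_S' ring_distribs fls_class_add)

lemma level_one_cmult: "level_one L A \<Longrightarrow> level_one L (fls_const x * A)"
  using level_one_mult[OF level_one_const[of x]] by fastforce

lemma level_one_serre: "level_one L A \<Longrightarrow> level_one (L + 4) (serre L A)"
  unfolding level_one_iff_slaw using slaw_serre[of "{0}" "\<lambda>_. A"]
  by (auto simp: serre_conv serre_class)

lemma level_one_inverse:
  assumes "level_one L A" "\<And>\<tau>. \<tau> \<in> upper_half_plane \<Longrightarrow> ev A \<tau> \<noteq> 0"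
  shows "level_one (- L) (inverse A)"
proof -
  note A = level_oneD[OF assms(1)]
  have A0: "A \<noteq> 0"
    using assms(2)[of \<i>] by (auto simp: upper_half_plane_def)
  have conv: "fls_conv_disc (inverse A)"
  proof (rule fls_conv_disc_quotient)
    fix x :: complex assume "norm x < 1" "x \<noteq> 0"
    then obtain \<tau> where "\<tau> \<in> upper_half_plane" "qx \<tau> = x" by (rule qx_surj)
    with assms(2)[of \<tau>] have "eval_fls A x \<noteq> 0" by (simp add: ev_def)
    then show "\<exists>d E. fls_conv_disc d \<and> fls_conv_disc E \<and> d * inverse A = E \<and> eval_fls d x \<noteq> 0"
      using A(1) A0 by (intro exI[of _ A] exI[of _ 1]) (auto simp: )
  qed
  have ev: "ev (inverse A) \<tau> = inverse (ev A \<tau>)" if "\<tau> \<in> upper_half_plane" for \<tau>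
  proof -
    have "ev A \<tau> * ev (inverse A) \<tau> = ev (A * inverse A) \<tau>"
      using ev_mult[OF that A(1) conv] by simp
    then have "ev A \<tau> * ev (inverse A) \<tau> = 1" using A0 by simp
    then show ?thesis by (metis inverse_unique)
  qed
  show ?thesis unfolding level_one_def
  proof (intro conjI ballI)
    show "fls_class 0 (inverse A)"
      by (rule fls_class_of_T[OF conv]) (simp add: ev uhp_T ev_T_class_0[OF A(1,2)])
    show "ev (inverse A) (- 1 / \<tau>) = csqrt \<tau> powi (- L) * ev (inverse A) \<tau>" if "\<tau> \<in> upper_half_plane" for \<tau>
      using A(3)[OF that] by (simp add: ev that uhp_S uhp_S' power_int_minus)
  qed (rule conv)
qed

lemma level_one_weight_two_constant_term:
  assumes "level_one 4 A"
  shows "A $$ 0 = 0"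
proof -
  have "ev A (- 1 / \<tau>) = \<tau>^2 * ev A \<tau> + 0 * \<tau>" if "\<tau> \<in> upper_half_plane" for \<tau>
    using level_oneD(3)[OF assms that] csqrt_powi_add4[OF that, of 0] by simp
  from weight_two_constant_term[OF level_oneD(1,2)[OF assms] this] show ?thesis by simp
qed

text \<open>The exponential of a primitive of \<open>Phi\<close>. Nonvanishing is then automatic;
  the period \<open>2 pi i\<close> gives invariance under translation, and the term
  \<open>12 Ln \<tau>\<close> gives the factor \<open>\<tau>^12\<close>.\<close>

lemma Delta_exists:
  "\<exists>D. level_one 24 D \<and> (\<forall>\<tau>\<in>upper_half_plane. ev D \<tau> \<noteq> 0) \<and> fls_theta D = Phi * D \<and> (\<forall>n<0. D $$ n = 0)"
proof -
  obtain P where P: "\<And>\<tau>. \<tau> \<in> upper_half_plane \<Longrightarrow> (P has_field_derivative ev Phi \<tau>) (at \<tau>)"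
    using uhp_primitive[OF ev_holomorphic[OF Phi_conv]] by blast
  obtain c where c: "\<And>\<tau>. \<tau> \<in> upper_half_plane \<Longrightarrow> P \<tau> = Phi $$ 0 * \<tau> + ev (fls_antitheta Phi) \<tau> + c"
    using primitive_expansion[OF Phi_conv P] by blast
  define f where "f \<tau> = exp (P \<tau>)" for \<tau>
  note w2 = weight_two_period[OF ev_holomorphic[OF Phi_conv] ev_T_class_0[OF Phi_conv Phi_class] ev_Phi_S P]
  have two_pi: "exp (2 * of_real pi * \<i>) = 1" by (rule exp_two_pi_i)
  have fT: "f (\<tau> + 1) = f \<tau>" if "\<tau> \<in> upper_half_plane" for \<tau>
  proof -
    have "P (\<tau> + 1) = P \<tau> + 2 * of_real pi * \<i>"
      using w2(1)[of \<tau>] that by simp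
    then show ?thesis by (simp only: f_def exp_add two_pi) simp
  qed
  have fS: "f (- 1 / \<tau>) = csqrt \<tau> powi 24 * f \<tau>" if \<tau>: "\<tau> \<in> upper_half_plane" for \<tau>
  proof -
    have "P (- 1 / \<tau>) = P \<tau> + 12 * Ln \<tau> - (3 * (2 * of_real pi * \<i>))"
      using w2(2)[of \<tau>] \<tau> by (simp add: mult_ac)
    moreover have "exp (3 * (2 * of_real pi * \<i>)) = 1"
      using exp_of_nat_mult[of 3 "2 * of_real pi * \<i>"] by (simp add: exp_two_pi_i)
    ultimately have "f (- 1 / \<tau>) = f \<tau> * exp (of_nat 12 * Ln \<tau>)"
      by (simp add: f_def exp_diff exp_add)
    also have "exp (of_nat 12 * Ln \<tau>) = \<tau> ^ 12"
      unfolding exp_of_nat_mult using uhp_nonzero[OF \<tau>] by simp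
    also have "\<tau> ^ 12 = (csqrt \<tau> ^ 2) ^ 12" by simp
    also have "\<dots> = csqrt \<tau> powi 24" by (simp only: power_mult[symmetric]) simp
    finally show ?thesis by simp
  qed
  have fh: "f holomorphic_on upper_half_plane"
    unfolding f_def[abs_def]
    by (intro holomorphic_intros) (use P in \<open>auto simp: holomorphic_on_open[OF open_upper_half_plane]\<close>)
  define B where "B = fls_antitheta Phi"
  have Bconv: "fls_conv_disc B" unfolding B_def by (rule fls_antitheta_conv[OF Phi_conv])
  have Bneg: "B $$ n = 0" if "n < 0" for n using Phi_neg[OF that] by (simp add: B_def fls_antitheta_def)
  define r where "r = exp (- (2 * pi / N))"
  have r: "r < 1"
  proof -
    have "r < exp 0" unfolding r_def exp_less_cancel_iff using N_pos by simp
    then show ?thesis by simp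
  qed
  have sub: "fls_subdegree B \<ge> 0"
    using Bneg by (metis fls_subdegree_geI fls_zero_subdegree order_refl)
  have "continuous_on (cball 0 r) (eval_fls B)"
    by (rule holomorphic_on_imp_continuous_on, rule holomorphic_on_eval_fls)
       (use r sub in \<open>auto intro!: norm_less_fls_conv_radius[OF Bconv]\<close>)
  then have "compact (eval_fls B ` cball 0 r)" by (rule compact_continuous_image) auto
  then obtain M where "\<forall>y\<in>eval_fls B ` cball 0 r. norm y \<le> M"
    using compact_imp_bounded bounded_iff by metis
  then have M: "norm (eval_fls B x) \<le> M" if "norm x \<le> r" for x
    using that by simp
  \<comment> \<open>The linear term \<open>2 pi i \<tau>\<close> of the primitive has nonpositive
    real part, and the remaining power series is bounded on a closed disc of radius
    \<open>r < 1\<close>.\<close>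
  have bd: "norm (f \<tau>) \<le> exp (M + norm c)" if "Im \<tau> \<ge> 1" for \<tau>
  proof -
    have u: "\<tau> \<in> upper_half_plane" using that by (simp add: upper_half_plane_def)
    have "norm (qx \<tau>) \<le> r"
      unfolding norm_qx r_def using that N_pos by (simp add: divide_le_cancel)
    then have "norm (ev B \<tau>) \<le> M" using M by (simp add: ev_def)
    then have "Re (ev B \<tau>) \<le> M" using complex_Re_le_cmod order_trans by blast
    moreover have "Re (Phi $$ 0 * \<tau>) \<le> 0" using that by (simp add: Phi_0)
    moreover have "Re c \<le> norm c" by (rule complex_Re_le_cmod)
    ultimately have "Re (P \<tau>) \<le> M + norm c"
      using c[OF u] by (simp add: B_def)
    then show ?thesis by (simp add: f_def)
  qed
  have perN: "f (\<tau> + of_nat k) = f \<tau>" if "\<tau> \<in> upper_half_plane" for \<tau> k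
  proof (induction k)
    case (Suc k)
    have "\<tau> + of_nat (Suc k) = (\<tau> + of_nat k) + 1" by simp
    moreover have "\<tau> + of_nat k \<in> upper_half_plane" using that by (simp add: upper_half_plane_def)
    ultimately show ?case using fT[of "\<tau> + of_nat k"] Suc.IH by (simp only:)
  qed simp
  obtain D where D: "fls_conv_disc D" "\<And>\<tau>. \<tau> \<in> upper_half_plane \<Longrightarrow> ev D \<tau> = f \<tau>" "\<And>n. n < 0 \<Longrightarrow> D $$ n = 0"
    using q_expansion_exists[OF fh perN bd] by blast
  have "level_one 24 D"
    unfolding level_one_def
  proof (intro conjI ballI D(1))
    show "fls_class 0 D"
      by (rule fls_class_of_T[OF D(1)]) (simp add: D(2) uhp_T fT)
    show "ev D (- 1 / \<tau>) = csqrt \<tau> powi 24 * ev D \<tau>" if "\<tau> \<in> upper_half_plane" for \<tau>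
      using fS[OF that] D(2)[OF that] D(2)[OF uhp_S[OF that]] by simp
  qed
  moreover have "ev D \<tau> \<noteq> 0" if "\<tau> \<in> upper_half_plane" for \<tau>
    using D(2)[OF that] by (simp add: f_def)
  moreover have "fls_theta D = Phi * D"
  proof (rule ev_cong_fls)
    fix \<tau> assume \<tau>: "\<tau> \<in> upper_half_plane"
    have "(f has_field_derivative f \<tau> * ev Phi \<tau>) (at \<tau>)"
      unfolding f_def[abs_def] by (intro DERIV_chain'[where g=exp] P \<tau>) (auto intro!: derivative_eq_intros)
    moreover have "\<forall>\<^sub>F x in nhds \<tau>. ev D x = f x"
      using eventually_nhds_in_open[OF open_upper_half_plane \<tau>] by eventually_elim (rule D(2))
    ultimately have "(ev D has_field_derivative f \<tau> * ev Phi \<tau>) (at \<tau>)"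
      using DERIV_cong_ev[OF refl, of "ev D" f \<tau>] by blast
    from DERIV_unique[OF ev_deriv[OF D(1) \<tau>] this]
    show "ev (fls_theta D) \<tau> = ev (Phi * D) \<tau>"
      using \<tau> by (simp add: ev_mult Phi_conv D)
  qed (intro fls_theta_conv fls_conv_disc_mult Phi_conv D)+
  ultimately show ?thesis using D(3) by blast
qed

end

lemma fls_subdegree_0I:
  fixes A :: "complex fls"
  shows "A $$ 0 \<noteq> 0 \<Longrightarrow> (\<And>n. n < 0 \<Longrightarrow> A $$ n = 0) \<Longrightarrow> fls_subdegree A = 0"
  by (rule fls_subdegree_eqI)

lemma fls_mult_nth_0:
  fixes A B :: "complex fls"
  assumes "\<And>n. n < 0 \<Longrightarrow> A $$ n = 0" "\<And>n. n < 0 \<Longrightarrow> B $$ n = 0"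
  shows "(A * B) $$ 0 = A $$ 0 * B $$ 0" "\<And>n. n < 0 \<Longrightarrow> (A * B) $$ n = 0"
proof -
  have eq: "A = fps_to_fls (fls_regpart A)" "B = fps_to_fls (fls_regpart B)"
    using assms by (auto simp: fls_eq_iff)
  have "A * B = fps_to_fls (fls_regpart A * fls_regpart B)"
    by (subst eq(1), subst eq(2)) (simp add: fls_times_fps_to_fls)
  then show "(A * B) $$ 0 = A $$ 0 * B $$ 0" "\<And>n. n < 0 \<Longrightarrow> (A * B) $$ n = 0"
    by simp_all
qed

context q_width
begin

section \<open>The forms \<open>Delta\<close>, \<open>E4\<close>, \<open>E6\<close> and the
  \<open>j\<close>-function\<close>

definition Delta :: "complex fls" where
  "Delta = (SOME D. level_one 24 D \<and> (\<forall>\<tau>\<in>upper_half_plane. ev D \<tau> \<noteq> 0) \<and> fls_theta D = Phi * D \<and> (\<forall>n<0. D $$ n = 0))"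

lemma Delta: "level_one 24 Delta" "\<tau> \<in> upper_half_plane \<Longrightarrow> ev Delta \<tau> \<noteq> 0"
  "fls_theta Delta = Phi * Delta" "n < 0 \<Longrightarrow> Delta $$ n = 0"
  using someI_ex[OF Delta_exists, folded Delta_def] by auto

lemma Delta_nonzero: "Delta \<noteq> 0"
  using Delta(2)[of \<i>] by (auto simp: upper_half_plane_def)

text \<open>Compare leading coefficients in \<open>fls_theta Delta = Phi * Delta\<close>: the lowest
  exponent \<open>s\<close> satisfies \<open>2 pi i s / N = 2 pi i\<close>.\<close>

lemma Delta_subdegree: "fls_subdegree Delta = int N"
proof -
  define s where "s = fls_subdegree Delta"
  have sd: "fls_subdegree Phi = 0"
    by (rule fls_subdegree_0I) (auto simp: Phi_0 Phi_neg)
  have "Delta $$ s \<noteq> 0" using Delta_nonzero by (simp add: s_def nth_fls_subdegree_nonzero)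
  moreover have "fls_theta Delta $$ s = Phi $$ 0 * Delta $$ s"
    unfolding Delta(3) using fls_times_base[of Phi Delta] sd by (simp add: s_def)
  ultimately have "2 * of_real pi * \<i> * of_int s / of_nat N = 2 * of_real pi * \<i>"
    unfolding fls_theta_nth Phi_0 by (metis mult_right_cancel)
  then have "(of_int s :: complex) = of_int (int N)" using N_pos by (simp add: field_simps)
  then show ?thesis unfolding of_int_eq_iff by (simp add: s_def)
qed

text \<open>By Ramanujan's identity this is the classical Eisenstein series of weight four,
  normalised to constant term \<open>pi^2 / 3\<close> instead of 1.\<close>

definition E4 :: "complex fls" where
  "E4 = fls_theta Phi - fls_const (1 / 12) * Phi ^ 2"

definition E6 :: "complex fls" where
  "E6 = serre 8 E4"

lemma level_one_E4: "level_one 8 E4"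
proof -
  have conv: "fls_conv_disc E4"
    unfolding E4_def by (intro fls_conv_disc_intros fls_theta_conv Phi_conv)
  have ev: "ev E4 \<tau> = ev (fls_theta Phi) \<tau> - ev Phi \<tau> ^ 2 / 12" if "\<tau> \<in> upper_half_plane" for \<tau>
    unfolding E4_def using that
    by (simp add: ev_diff ev_mult ev_power fls_theta_conv Phi_conv fls_conv_disc_power fls_conv_disc_mult)
  have cl: "fls_class 0 E4"
    unfolding E4_def power2_eq_square using fls_class_mult[OF Phi_class Phi_class]
    by (intro fls_class_diff fls_class_theta fls_class_const_mult Phi_class) simp
  have "ev E4 (- 1 / \<tau>) = csqrt \<tau> powi 8 * ev E4 \<tau>" if \<tau>: "\<tau> \<in> upper_half_plane" for \<tau>
  proof -
    have \<tau>0: "\<tau> \<noteq> 0" by (rule uhp_nonzero[OF \<tau>])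
    have d1: "((\<lambda>x. ev Phi (- 1 / x)) has_field_derivative ev (fls_theta Phi) (- 1 / \<tau>) * (1 / \<tau>^2)) (at \<tau>)"
      by (intro DERIV_chain'[where f="\<lambda>x. - 1 / x" and g="ev Phi"] ev_deriv Phi_conv uhp_S \<tau>)
         (use \<tau>0 in \<open>auto intro!: derivative_eq_intros simp: power2_eq_square\<close>)
    have d2: "((\<lambda>x. x^2 * ev Phi x + 12 * x) has_field_derivative
       2 * \<tau> * ev Phi \<tau> + \<tau>^2 * ev (fls_theta Phi) \<tau> + 12) (at \<tau>)"
      by (auto intro!: derivative_eq_intros ev_deriv Phi_conv \<tau>)
    have d3: "\<forall>\<^sub>F x in nhds \<tau>. ev Phi (- 1 / x) = x^2 * ev Phi x + 12 * x"
      using eventually_nhds_in_open[OF open_upper_half_plane \<tau>] by eventually_elim (rule ev_Phi_S)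
    have "ev (fls_theta Phi) (- 1 / \<tau>) * (1 / \<tau>^2) = 2 * \<tau> * ev Phi \<tau> + \<tau>^2 * ev (fls_theta Phi) \<tau> + 12"
      by (rule DERIV_unique[OF DERIV_cong_ev[OF refl d3 refl, THEN iffD1, OF d1] d2])
    then have d: "ev (fls_theta Phi) (- 1 / \<tau>) = \<tau>^2 * (2 * \<tau> * ev Phi \<tau> + \<tau>^2 * ev (fls_theta Phi) \<tau> + 12)"
      using \<tau>0 by (simp add: field_simps)
    have "ev E4 (- 1 / \<tau>) = \<tau>^2 * (2 * \<tau> * ev Phi \<tau> + \<tau>^2 * ev (fls_theta Phi) \<tau> + 12) - (\<tau>^2 * ev Phi \<tau> + 12 * \<tau>)^2 / 12"
      unfolding ev[OF uhp_S[OF \<tau>]] d ev_Phi_S[OF \<tau>] ..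
    also have "\<dots> = (1 * \<tau>^2 * \<tau>^2) * (ev (fls_theta Phi) \<tau> - ev Phi \<tau> ^ 2 / 12)"
      by (simp add: field_simps power2_eq_square)
    also have "1 * \<tau>^2 * \<tau>^2 = csqrt \<tau> powi 8"
      using csqrt_powi_add4[OF \<tau>, of 4] csqrt_powi_add4[OF \<tau>, of 0] by simp
    finally show ?thesis using ev[OF \<tau>] by simp
  qed
  with conv cl show ?thesis by (simp add: level_one_def)
qed

lemma E4_nth: "E4 $$ 0 = of_real pi ^ 2 / 3" "n < 0 \<Longrightarrow> E4 $$ n = 0"
  using fls_mult_nth_0[OF Phi_neg Phi_neg] Phi_neg
  by (auto simp: E4_def fls_theta_nth power2_eq_square Phi_0)

lemma level_one_E6: "level_one 12 E6"
  using level_one_serre[OF level_one_E4] by (simp add: E6_def)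

lemma E6_nth: "E6 $$ 0 \<noteq> 0" "n < 0 \<Longrightarrow> E6 $$ n = 0"
  using fls_mult_nth_0[OF Phi_neg E4_nth(2)] E4_nth
  by (auto simp: E6_def serre_def fls_theta_nth Phi_0)

lemma E4_E6_subdegree: "fls_subdegree E4 = 0" "fls_subdegree E6 = 0" "E4 \<noteq> 0" "E6 \<noteq> 0"
  using E4_nth E6_nth by (auto intro!: fls_subdegree_0I)

definition Jfun :: "complex fls" where
  "Jfun = E4 ^ 3 * inverse Delta"

text \<open>Up to a scalar the derivative of \<open>j\<close>: weight two, with a simple pole in
  \<open>q\<close>, that is, of order \<open>N\<close> in the local parameter.\<close>

definition Omega :: "complex fls" where
  "Omega = E4 ^ 2 * E6 * inverse Delta"

lemma level_one_inverse_Delta: "level_one (- 24) (inverse Delta)"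
  by (rule level_one_inverse[OF Delta(1,2)])

lemma level_one_Jfun: "level_one 0 Jfun"
  using level_one_mult[OF level_one_power[OF level_one_E4, of 3] level_one_inverse_Delta]
  by (simp add: Jfun_def)

lemma level_one_Omega: "level_one 4 Omega"
  using level_one_mult[OF level_one_mult[OF level_one_power[OF level_one_E4, of 2] level_one_E6] level_one_inverse_Delta]
  by (simp add: Omega_def)

lemma Jfun_Omega_nonzero: "Jfun \<noteq> 0" "Omega \<noteq> 0"
  using E4_E6_subdegree Delta_nonzero by (auto simp: Jfun_def Omega_def)

lemma Jfun_subdegree: "fls_subdegree Jfun = - int N"
  using E4_E6_subdegree Delta_nonzero Delta_subdegree by (simp add: Jfun_def fls_subdegree_pow)

lemma Omega_subdegree: "fls_subdegree Omega = - int N"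
  using E4_E6_subdegree Delta_nonzero Delta_subdegree by (simp add: Omega_def fls_subdegree_pow)

text \<open>Every weight has a form dividing \<open>Omega\<close>; this replaces information on the zeros of \<open>E4\<close> and \<open>E6\<close>.\<close>

lemma level_one_divides_Omega:
  "\<exists>\<phi> \<psi>. level_one (- 4 * int l) \<phi> \<and> level_one (4 + 4 * int l) \<psi> \<and> \<phi> * \<psi> = Omega"
proof -
  define m where "m = l div 6"
  define i where "i = l mod 6"
  have l: "l = 6 * m + i" by (simp add: m_def i_def)
  have "i < 6" by (simp add: i_def)
  then consider "i = 0" | "i = 1" | "i = 2" | "i = 3" | "i = 4" | "i = 5" by linarith
  \<comment> \<open>The equation is the weight condition for \<open>\<phi>\<close>. The bounds
    \<open>b \<le> 2\<close> and \<open>c \<le> 1\<close> leave nonnegative exponents of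
    \<open>E4\<close> and \<open>E6\<close> for the complementary factor of
    \<open>Omega\<close>.\<close>
  then obtain b c e :: nat where bce: "b \<le> 2" "c \<le> 1" "2 * int b + 3 * int c - 6 * int e = - int i"
  proof cases
    case 1 show ?thesis by (rule that[of 0 0 0]) (use 1 in auto)
  next
    case 2 show ?thesis by (rule that[of 1 1 1]) (use 2 in auto)
  next
    case 3 show ?thesis by (rule that[of 2 0 1]) (use 3 in auto)
  next
    case 4 show ?thesis by (rule that[of 0 1 1]) (use 4 in auto)
  next
    case 5 show ?thesis by (rule that[of 1 0 1]) (use 5 in auto)
  next
    case 6 show ?thesis by (rule that[of 2 1 2]) (use 6 in auto)
  qed
  define \<phi> where "\<phi> = E4 ^ b * E6 ^ c * inverse Delta ^ (m + e)"
  define \<psi> where "\<psi> = E4 ^ (2 - b) * E6 ^ (1 - c) * (inverse Delta * Delta ^ (m + e))"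
  have "level_one (int b * 8 + int c * 12 + int (m + e) * (- 24)) \<phi>"
    unfolding \<phi>_def by (intro level_one_mult level_one_power level_one_E4 level_one_E6 level_one_inverse_Delta)
  moreover have "int b * 8 + int c * 12 + int (m + e) * (- 24) = - 4 * int l"
    using bce l by simp
  moreover have "level_one (int (2 - b) * 8 + int (1 - c) * 12 + (- 24 + int (m + e) * 24)) \<psi>"
    unfolding \<psi>_def by (intro level_one_mult level_one_power level_one_E4 level_one_E6 level_one_inverse_Delta Delta)
  moreover have "int (2 - b) * 8 + int (1 - c) * 12 + (- 24 + int (m + e) * 24) = 4 + 4 * int l"
    using bce l by (simp add: of_nat_diff)
  moreover have "\<phi> * \<psi> = Omega"
  proof -
    have "\<phi> * \<psi> = (E4 ^ b * E4 ^ (2 - b)) * (E6 ^ c * E6 ^ (1 - c)) * inverse Delta * (inverse Delta * Delta) ^ (m + e)"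
      by (simp add: \<phi>_def \<psi>_def mult_ac power_mult_distrib)
    then show ?thesis
      using bce Delta_nonzero by (simp add: Omega_def flip: power_add)
  qed
  ultimately show ?thesis by metis
qed

text \<open>A formal residue duality: convergence of \<open>h\<close> is a conclusion, not an
  assumption. Poles are removed by subtracting multiples of \<open>Omega * Jfun ^ s\<close>, which
  satisfy the same orthogonality because level one forms of weight two have no constant term. A
  nonzero remainder without poles would start at some exponent \<open>N e \<ge> 0\<close>, and
  multiplication by \<open>Jfun ^ e\<close> would move its leading term to the constant
  term.\<close>

lemma formal_weight_two:
  assumes "fls_class 0 h" "\<And>e. (Jfun ^ e * h) $$ 0 = 0"
  shows "\<exists>P. level_one 0 P \<and> h = Omega * P"
proof -
  have "\<exists>P. level_one 0 P \<and> h = Omega * P"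
    if "fls_class 0 h" "\<And>e. (Jfun ^ e * h) $$ 0 = 0" "\<And>n. n < - int N * int s \<Longrightarrow> h $$ n = 0" for h s
    using that
  proof (induction s arbitrary: h)
    case 0
    have "h = 0"
    proof (rule ccontr)
      assume h0: "h \<noteq> 0"
      define n where "n = fls_subdegree h"
      have hn: "h $$ n \<noteq> 0" using h0 by (simp add: n_def)
      then have "[n = 0] (mod int N)" using 0(1) by (simp add: fls_class_def)
      then obtain e where e: "n = int N * e" by (auto simp: cong_0_iff)
      have "n \<ge> 0" using hn 0(3)[of n] by (cases "n < 0") auto
      then have "e \<ge> 0" using e N_pos by (simp add: zero_le_mult_iff)
      have "fls_subdegree (Jfun ^ nat e) = - n"
        using \<open>e \<ge> 0\<close> e by (simp add: fls_subdegree_pow Jfun_subdegree)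
      then have "(Jfun ^ nat e * h) $$ 0 = (Jfun ^ nat e) $$ (- n) * h $$ n"
        using fls_times_base[of "Jfun ^ nat e" h] by (simp add: n_def)
      moreover have "(Jfun ^ nat e) $$ (- n) \<noteq> 0"
        using Jfun_Omega_nonzero \<open>fls_subdegree (Jfun ^ nat e) = - n\<close>
        by (metis nth_fls_subdegree_nonzero power_not_zero)
      ultimately show False using hn 0(2)[of "nat e"] by simp
    qed
    then show ?case by (intro exI[of _ 0]) (use level_one_const[of 0] in simp)
  next
    case (Suc s)
    define Q where "Q = Omega * Jfun ^ s"
    define n where "n = - int N * int (Suc s)"
    have sQ: "fls_subdegree Q = n"
      using Jfun_Omega_nonzero by (simp add: Q_def fls_subdegree_pow Jfun_subdegree Omega_subdegree n_def algebra_simps)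
    have Q0: "Q $$ n \<noteq> 0"
      using sQ Jfun_Omega_nonzero unfolding Q_def by (metis nth_fls_subdegree_nonzero power_not_zero mult_eq_0_iff)
    define x where "x = h $$ n / Q $$ n"
    define h' where "h' = h - fls_const x * Q"
    have lQ: "level_one 4 (Jfun ^ e * Q)" for e
      unfolding Q_def using level_one_mult[OF level_one_power[OF level_one_Jfun, of e] level_one_mult[OF level_one_Omega level_one_power[OF level_one_Jfun, of s]]]
      by simp
    have clQ: "fls_class 0 Q" using level_oneD(2)[OF lQ[of 0]] by simp
    have "\<exists>P. level_one 0 P \<and> h' = Omega * P"
    proof (rule Suc.IH)
      show "fls_class 0 h'"
        unfolding h'_def by (intro fls_class_diff Suc.prems fls_class_const_mult clQ)
      show "(Jfun ^ e * h') $$ 0 = 0" for e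
      proof -
        have "Jfun ^ e * h' = Jfun ^ e * h - fls_const x * (Jfun ^ e * Q)"
          by (simp add: h'_def algebra_simps)
        then show ?thesis
          using Suc.prems(2)[of e] level_one_weight_two_constant_term[OF lQ[of e]] by simp
      qed
      show "h' $$ i = 0" if i: "i < - int N * int s" for i
      proof (cases "i = n")
        case True
        then show ?thesis using Q0 by (simp add: h'_def x_def)
      next
        case False
        show ?thesis
        proof (cases "i < n")
          case True
          then show ?thesis using Suc.prems(3)[of i] sQ by (simp add: h'_def n_def)
        next
          case ge: False
          \<comment> \<open>Exponents strictly between consecutive multiples of \<open>N\<close> are
            excluded by the class of \<open>h'\<close>.\<close>
          have "\<not> [i = 0] (mod int N)"
          proof
            assume "[i = 0] (mod int N)"
            then obtain e where e: "i = int N * e" by (auto simp: cong_0_iff)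
            have "int N * (- int (Suc s)) < int N * e" "int N * e < int N * (- int s)"
            proof -
              have "n < i" using ge False by simp
              then show "int N * (- int (Suc s)) < int N * e" using e by (simp add: n_def algebra_simps)
              show "int N * e < int N * (- int s)" using i e by simp
            qed
            then show False
              unfolding mult_less_cancel_left using N_pos by auto
          qed
          then show ?thesis
            using \<open>fls_class 0 h'\<close> by (auto simp: fls_class_def)
        qed
      qed
    qed
    then obtain P where P: "level_one 0 P" "h' = Omega * P" by blast
    have "level_one 0 (P + fls_const x * Jfun ^ s)"
      using level_one_power[OF level_one_Jfun, of s] by (intro level_one_add P level_one_cmult) simp
    moreover have "h = Omega * (P + fls_const x * Jfun ^ s)"
      using P(2) by (simp add: h'_def Q_def algebra_simps)
    ultimately show ?case by blast
  qed
  from this[OF assms, of "nat (- fls_subdegree h)"] show ?thesis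
  proof -
    assume *: "(\<And>n. n < - int N * int (nat (- fls_subdegree h)) \<Longrightarrow> h $$ n = 0) \<Longrightarrow> \<exists>P. level_one 0 P \<and> h = Omega * P"
    show ?thesis
    proof (rule *)
      fix n assume n: "n < - int N * int (nat (- fls_subdegree h))"
      have "int N * int (nat (- fls_subdegree h)) \<ge> 1 * int (nat (- fls_subdegree h))"
        using N_pos by (intro mult_right_mono) auto
      moreover have "- int N * int (nat (- fls_subdegree h)) = - (int N * int (nat (- fls_subdegree h)))" by simp
      ultimately have "n < - int (nat (- fls_subdegree h))" using n by linarith
      then have "n < fls_subdegree h" by linarith
      then show "h $$ n = 0" by auto
    qed
  qed
qed

end

section \<open>Vector-valued forms\<close>

context q_width
begin

text \<open>Series in different residue classes have disjoint sets of exponents.\<close>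

lemma fls_class_sum_eq_0:
  assumes "finite C" "\<And>c. c \<in> C \<Longrightarrow> fls_class (k c) (A c)"
    and "\<And>c c'. c \<in> C \<Longrightarrow> c' \<in> C \<Longrightarrow> [k c = k c'] (mod int N) \<Longrightarrow> c = c'"
    and "(\<Sum>c\<in>C. A c) = 0" "c \<in> C"
  shows "A c = 0"
proof (rule fls_eqI)
  fix n
  show "A c $$ n = 0 $$ n"
  proof (rule ccontr)
    assume "A c $$ n \<noteq> 0 $$ n"
    then have n: "A c $$ n \<noteq> 0" by simp
    then have nc: "[n = k c] (mod int N)" using assms(2,5) by (auto simp: fls_class_def)
    have "A c' $$ n = 0" if "c' \<in> C - {c}" for c'
    proof (rule ccontr)
      assume "A c' $$ n \<noteq> 0"
      then have "[n = k c'] (mod int N)" using assms(2)[of c'] that by (auto simp: fls_class_def)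
      then have "[k c = k c'] (mod int N)" using nc cong_sym cong_trans by blast
      then show False using assms(3)[of c c'] assms(5) that by auto
    qed
    then have "(\<Sum>c\<in>C. A c $$ n) = A c $$ n"
      using assms(1,5) by (subst sum.remove[of _ c]) auto
    then show False using assms(4) n by (metis fls_nth_sum fls_zero_nth)
  qed
qed

end

text \<open>The matrix of the inversion has entries \<open>P c c' * w c'\<close>, and
  \<open>\<sigma>\<close> tells forms from dual forms by the sign of their exponent classes. That
  the row and column of 0 in \<open>P\<close> have no zeros is a substitute for irreducibility of
  the representation.\<close>

locale vv_side = q_width +
  fixes C :: "int set" and \<sigma> :: int and w :: "int \<Rightarrow> complex" and P :: "int \<Rightarrow> int \<Rightarrow> complex"
  assumes fin: "finite C"
    and dist: "\<And>c c'. c \<in> C \<Longrightarrow> c' \<in> C \<Longrightarrow> [c = c'] (mod int N) \<Longrightarrow> c = c'"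
    and sigma: "\<sigma> = 1 \<or> \<sigma> = - 1"
    and w_nonzero: "\<And>c. c \<in> C \<Longrightarrow> w c \<noteq> 0"
    and zero_in: "0 \<in> C"
    and P_zero: "\<And>c. c \<in> C \<Longrightarrow> P c 0 \<noteq> 0" "\<And>c. c \<in> C \<Longrightarrow> P 0 c \<noteq> 0"
begin

definition VV :: "int \<Rightarrow> (int \<Rightarrow> complex fls) \<Rightarrow> bool" where
  "VV L F \<longleftrightarrow> (\<forall>c\<in>C. fls_conv_disc (F c) \<and> fls_class (\<sigma> * c) (F c)) \<and> slaw C (\<lambda>c c'. P c c' * w c') L F"

lemma VV_D:
  assumes "VV L F" "c \<in> C"
  shows "fls_conv_disc (F c)" "fls_class (\<sigma> * c) (F c)"
    "\<tau> \<in> upper_half_plane \<Longrightarrow> ev (F c) (- 1 / \<tau>) = csqrt \<tau> powi L * (\<Sum>c'\<in>C. P c c' * w c' * ev (F c') \<tau>)"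
  using assms by (auto simp: VV_def slaw_def)

lemma VV_conv: "VV L F \<Longrightarrow> \<forall>c\<in>C. fls_conv_disc (F c)"
  and VV_class: "VV L F \<Longrightarrow> \<forall>c\<in>C. fls_class (\<sigma> * c) (F c)"
  by (auto simp: VV_def)

lemma dist_sigma: "c \<in> C \<Longrightarrow> c' \<in> C \<Longrightarrow> [\<sigma> * c = \<sigma> * c'] (mod int N) \<Longrightarrow> c = c'"
  using sigma dist by (auto simp: cong_minus_minus_iff)

lemma VV_serre: "VV L F \<Longrightarrow> VV (L + 4) (\<lambda>c. serre L (F c))"
  using slaw_serre[of C F] by (auto simp: VV_def serre_conv serre_class)

lemma VV_level_one_mult:
  assumes "level_one L' A" "VV L F"
  shows "VV (L' + L) (\<lambda>c. A * F c)"
  unfolding VV_def slaw_def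
proof (intro conjI ballI)
  fix c assume c: "c \<in> C"
  note A = level_oneD[OF assms(1)] and F = VV_D[OF assms(2)]
  show "fls_conv_disc (A * F c)" by (intro fls_conv_disc_mult A F c)
  show "fls_class (\<sigma> * c) (A * F c)" using fls_class_mult[OF A(2) F(2)[OF c]] by simp
  fix \<tau> assume \<tau>: "\<tau> \<in> upper_half_plane"
  have "ev (A * F c) (- 1 / \<tau>) = csqrt \<tau> powi L' * ev A \<tau> * (csqrt \<tau> powi L * (\<Sum>c'\<in>C. P c c' * w c' * ev (F c') \<tau>))"
    using ev_mult[OF uhp_S[OF \<tau>] A(1) F(1)[OF c]] A(3)[OF \<tau>] F(3)[OF c \<tau>] by simp
  also have "\<dots> = csqrt \<tau> powi (L' + L) * (\<Sum>c'\<in>C. P c c' * w c' * ev (A * F c') \<tau>)"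
    using csqrt_uhp_nonzero[OF \<tau>] ev_mult[OF \<tau> A(1) F(1)]
    by (simp add: power_int_add sum_distrib_left mult_ac)
  finally show "ev (A * F c) (- 1 / \<tau>) = csqrt \<tau> powi (L' + L) * (\<Sum>c'\<in>C. P c c' * w c' * ev (A * F c') \<tau>)" .
qed

lemma VV_cmult: "VV L F \<Longrightarrow> VV L (\<lambda>c. fls_const x * F c)"
  using VV_level_one_mult[OF level_one_const, of L F x] by simp

lemma VV_diff:
  assumes "VV L F" "VV L G"
  shows "VV L (\<lambda>c. F c - G c)"
  unfolding VV_def slaw_def
proof (intro conjI ballI)
  fix c assume c: "c \<in> C"
  note G = VV_D[OF assms(2)] and F = VV_D[OF assms(1)]
  show "fls_conv_disc (F c - G c)" by (intro fls_conv_disc_diff G F c)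
  show "fls_class (\<sigma> * c) (F c - G c)" by (intro fls_class_diff G F c)
  fix \<tau> assume \<tau>: "\<tau> \<in> upper_half_plane"
  show "ev (F c - G c) (- 1 / \<tau>) = csqrt \<tau> powi L * (\<Sum>c'\<in>C. P c c' * w c' * ev (F c' - G c') \<tau>)"
    unfolding ev_diff[OF uhp_S[OF \<tau>] F(1)[OF c] G(1)[OF c]] F(3)[OF c \<tau>] G(3)[OF c \<tau>]
    using ev_diff[OF \<tau> F(1) G(1)] by (simp add: sum_subtractf right_diff_distrib)
qed

text \<open>If \<open>F c = 0\<close>, its transformation law is a linear relation between
  components in different residue classes, so every component with nonzero coefficient vanishes.
  Passing from \<open>c\<close> to 0 and from 0 to all classes kills \<open>F\<close>.\<close>

lemma VV_components_nonzero:
  assumes F: "VV L F" and nz: "\<exists>c\<in>C. F c \<noteq> 0" and c: "c \<in> C"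
  shows "F c \<noteq> 0"
proof
  have propagate: "F c' = 0" if "c1 \<in> C" "F c1 = 0" "c' \<in> C" "P c1 c' \<noteq> 0" for c1 c'
  proof -
    have z: "(\<Sum>c'\<in>C. fls_const (P c1 c' * w c') * F c') = 0"
    proof (rule ev_cong_fls)
      fix \<tau> assume \<tau>: "\<tau> \<in> upper_half_plane"
      have "0 = csqrt \<tau> powi L * (\<Sum>c'\<in>C. P c1 c' * w c' * ev (F c') \<tau>)"
        using VV_D(3)[OF F that(1) \<tau>] that(2) by simp
      then have "(\<Sum>c'\<in>C. P c1 c' * w c' * ev (F c') \<tau>) = 0"
        using csqrt_uhp_nonzero[OF \<tau>] by simp
      then show "ev (\<Sum>c'\<in>C. fls_const (P c1 c' * w c') * F c') \<tau> = ev 0 \<tau>"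
        using \<tau> VV_D(1)[OF F] by (simp add: ev_sum ev_mult fls_conv_disc_mult)
    qed (auto intro!: fls_conv_disc_intros VV_D(1)[OF F])
    have "fls_const (P c1 c' * w c') * F c' = 0"
      by (rule fls_class_sum_eq_0[OF fin _ dist_sigma z that(3)]) (rule fls_class_const_mult, rule VV_D(2)[OF F])
    then show ?thesis using that w_nonzero[of c'] by simp
  qed
  assume "F c = 0"
  then have "F 0 = 0" using propagate[OF c] zero_in P_zero c by blast
  then have "F c' = 0" if "c' \<in> C" for c' using propagate[OF zero_in] P_zero(2)[OF that] that by blast
  then show False using nz by blast
qed

lemma VV_independent:
  assumes F: "VV L F" and nz: "\<exists>c\<in>C. F c \<noteq> 0"
    and v: "\<And>\<tau>. \<tau> \<in> upper_half_plane \<Longrightarrow> (\<Sum>c\<in>C. v c * ev (F c) \<tau>) = 0" and c: "c \<in> C"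
  shows "v c = 0"
proof -
  have z: "(\<Sum>c\<in>C. fls_const (v c) * F c) = 0"
  proof (rule ev_cong_fls)
    fix \<tau> assume \<tau>: "\<tau> \<in> upper_half_plane"
    show "ev (\<Sum>c\<in>C. fls_const (v c) * F c) \<tau> = ev 0 \<tau>"
      using v[OF \<tau>] \<tau> VV_D(1)[OF F] by (simp add: ev_sum ev_mult fls_conv_disc_mult)
  qed (auto intro!: fls_conv_disc_intros VV_D(1)[OF F])
  have "fls_const (v c) * F c = 0"
    by (rule fls_class_sum_eq_0[OF fin _ dist_sigma z c]) (rule fls_class_const_mult, rule VV_D(2)[OF F])
  then show ?thesis using VV_components_nonzero[OF F nz c] by simp
qed

text \<open>Serre derivatives lower the order of vanishing of \<open>v \<bullet> F\<close> at a point by exactly one.\<close>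

lemma VV_spanning:
  assumes F: "VV L F" and nz: "\<exists>c\<in>C. F c \<noteq> 0" and \<tau>0: "\<tau>0 \<in> upper_half_plane" and v: "\<exists>c\<in>C. v c \<noteq> 0"
  shows "\<exists>j F'. VV (L + 4 * int j) F' \<and> (\<Sum>c\<in>C. v c * ev (F' c) \<tau>0) \<noteq> 0"
proof -
  define u where "u F \<tau> = (\<Sum>c\<in>C. v c * ev (F c) \<tau>)" for F \<tau>
  have uh: "u F holomorphic_on upper_half_plane" if "VV L F" for L F
    unfolding u_def[abs_def] by (intro holomorphic_intros ev_holomorphic VV_D(1)[OF that])
  have step: "\<exists>j F'. VV (L + 4 * int j) F' \<and> u F' \<tau>0 \<noteq> 0"
    if "VV L F" "(deriv ^^ n) (u F) \<tau>0 \<noteq> 0" "\<And>i. i < n \<Longrightarrow> (deriv ^^ i) (u F) \<tau>0 = 0" for L F n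
    using that
  proof (induction n arbitrary: L F)
    case 0
    then show ?case by (intro exI[of _ 0] exI[of _ F]) auto
  next
    case (Suc n)
    define F1 where "F1 c = serre L (F c)" for c
    have V1: "VV (L + 4) F1" unfolding F1_def by (rule VV_serre[OF Suc.prems(1)])
    have dh: "deriv (u F) holomorphic_on upper_half_plane"
      by (rule holomorphic_deriv[OF uh[OF Suc.prems(1)] open_upper_half_plane])
    have ph: "(\<lambda>\<tau>. of_int L / 24 * ev Phi \<tau>) holomorphic_on upper_half_plane"
      by (intro holomorphic_intros ev_holomorphic Phi_conv)
    have u1: "u F1 \<tau> = deriv (u F) \<tau> - of_int L / 24 * ev Phi \<tau> * u F \<tau>" if \<tau>: "\<tau> \<in> upper_half_plane" for \<tau>
    proof -
      have "(u F has_field_derivative (\<Sum>c\<in>C. v c * ev (fls_theta (F c)) \<tau>)) (at \<tau>)"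
        unfolding u_def[abs_def] by (intro DERIV_sum DERIV_cmult ev_deriv VV_D(1)[OF Suc.prems(1)] \<tau>)
      then have "deriv (u F) \<tau> = (\<Sum>c\<in>C. v c * ev (fls_theta (F c)) \<tau>)" by (rule DERIV_imp_deriv)
      moreover have "u F1 \<tau> = (\<Sum>c\<in>C. v c * (ev (fls_theta (F c)) \<tau> - of_int L / 24 * (ev Phi \<tau> * ev (F c) \<tau>)))"
        unfolding u_def F1_def by (intro sum.cong refl) (simp add: ev_serre[OF VV_D(1)[OF Suc.prems(1)] \<tau>])
      moreover have "(\<Sum>c\<in>C. v c * (of_int L / 24 * (ev Phi \<tau> * ev (F c) \<tau>))) = of_int L / 24 * ev Phi \<tau> * u F \<tau>"
        unfolding u_def sum_distrib_left by (intro sum.cong refl) (simp add: mult_ac)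
      ultimately show ?thesis
        by (simp only: right_diff_distrib sum_subtractf)
    qed
    \<comment> \<open>By the Leibniz rule the correction term of the Serre derivative involves only
      derivatives of \<open>u F\<close> of order at most \<open>i\<close>, which vanish at
      \<open>\<tau>0\<close>.\<close>
    have d1: "(deriv ^^ i) (u F1) \<tau>0 = (deriv ^^ Suc i) (u F) \<tau>0" if i: "i \<le> n" for i
    proof -
      have "(deriv ^^ i) (u F1) \<tau>0 = (deriv ^^ i) (\<lambda>\<tau>. deriv (u F) \<tau> - of_int L / 24 * ev Phi \<tau> * u F \<tau>) \<tau>0"
        by (rule higher_deriv_transform_within_open[OF uh[OF V1] _ open_upper_half_plane \<tau>0 u1])
           (intro holomorphic_intros dh ev_holomorphic Phi_conv uh[OF Suc.prems(1)])
      also have "\<dots> = (deriv ^^ i) (deriv (u F)) \<tau>0 - (deriv ^^ i) (\<lambda>\<tau>. of_int L / 24 * ev Phi \<tau> * u F \<tau>) \<tau>0"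
        by (rule higher_deriv_diff[OF dh _ open_upper_half_plane \<tau>0])
           (intro holomorphic_intros ev_holomorphic Phi_conv uh[OF Suc.prems(1)])
      also have "(deriv ^^ i) (\<lambda>\<tau>. of_int L / 24 * ev Phi \<tau> * u F \<tau>) \<tau>0 = 0"
        unfolding higher_deriv_mult[OF ph uh[OF Suc.prems(1)] open_upper_half_plane \<tau>0]
        using Suc.prems(3) i by (intro sum.neutral) auto
      finally show ?thesis by (simp add: funpow_swap1)
    qed
    have "\<exists>j F'. VV (L + 4 + 4 * int j) F' \<and> u F' \<tau>0 \<noteq> 0"
    proof (rule Suc.IH[OF V1])
      show "(deriv ^^ n) (u F1) \<tau>0 \<noteq> 0" using d1[of n] Suc.prems(2) by simp
      show "(deriv ^^ i) (u F1) \<tau>0 = 0" if "i < n" for i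
        using d1[of i] Suc.prems(3)[of "Suc i"] that by simp
    qed
    then obtain j F' where "VV (L + 4 + 4 * int j) F'" "u F' \<tau>0 \<noteq> 0" by blast
    then show ?case by (intro exI[of _ "Suc j"] exI[of _ F']) (auto simp: algebra_simps)
  qed
  \<comment> \<open>A zero of infinite order would produce a linear relation between the
    components.\<close>
  have "\<exists>n. (deriv ^^ n) (u F) \<tau>0 \<noteq> 0"
  proof (rule ccontr)
    assume "\<not> ?thesis"
    then have "u F \<tau> = 0" if "\<tau> \<in> upper_half_plane" for \<tau>
      using holomorphic_fun_eq_0_on_connected[OF uh[OF F] open_upper_half_plane convex_connected[OF convex_upper_half_plane] _ \<tau>0 that] by blast
    then have "v c = 0" if "c \<in> C" for c
      using VV_independent[OF F nz _ that, of v] by (simp add: u_def)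
    then show False using v by blast
  qed
  then have "\<exists>n. (deriv ^^ n) (u F) \<tau>0 \<noteq> 0 \<and> (\<forall>i<n. (deriv ^^ i) (u F) \<tau>0 = 0)"
    by (subst (asm) exists_least_iff) auto
  then obtain n where "(deriv ^^ n) (u F) \<tau>0 \<noteq> 0" "\<And>i. i < n \<Longrightarrow> (deriv ^^ i) (u F) \<tau>0 = 0" by blast
  from step[OF F this] show ?thesis by (simp add: u_def)
qed

end

section \<open>Duality of vector-valued forms\<close>

fun back_substitution :: "(nat \<Rightarrow> nat \<Rightarrow> complex) \<Rightarrow> (nat \<Rightarrow> bool) \<Rightarrow> nat \<Rightarrow> complex" where
  "back_substitution g Q i = (if i = 0 then 1
     else if Q i then - (\<Sum>i'<i. back_substitution g Q i' * g i i') else 0)"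

declare back_substitution.simps [simp del]

text \<open>As \<open>n\<close> is not a leading exponent of \<open>A\<close>, the value of the
  functional there is free and put equal to 1. Going down from \<open>n\<close>, each leading
  exponent of \<open>A\<close> gives one equation, solved by the coefficient at that exponent; all
  other elements reduce to these by subtraction. The sums are finite because elements vanish below
  \<open>n0\<close> and the functional above \<open>n\<close>.\<close>

lemma annihilating_functional:
  fixes A :: "(int \<Rightarrow> complex) set"
  assumes lin: "\<And>f g x. f \<in> A \<Longrightarrow> g \<in> A \<Longrightarrow> (\<lambda>j. f j - x * g j) \<in> A"
    and cmult: "\<And>f x. f \<in> A \<Longrightarrow> (\<lambda>j. x * f j) \<in> A"
    and n: "\<And>f. f \<in> A \<Longrightarrow> (\<And>i. i < n \<Longrightarrow> f i = 0) \<Longrightarrow> f n = 0"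
  obtains b :: "int \<Rightarrow> complex" where "b n = 1" "\<And>j. j > n \<Longrightarrow> b j = 0"
    "\<And>j. j \<noteq> n \<Longrightarrow> b j \<noteq> 0 \<Longrightarrow> \<exists>f\<in>A. f j \<noteq> 0"
    "\<And>f n0. f \<in> A \<Longrightarrow> (\<And>i. i < n0 \<Longrightarrow> f i = 0) \<Longrightarrow> (\<Sum>j=n0..n. b j * f j) = 0"
proof -
  \<comment> \<open>\<open>Q i\<close> says that \<open>n - i\<close> is a leading exponent of
    \<open>A\<close>; \<open>G i\<close> is then a normalised element realising it.\<close>
  define Q where "Q i \<longleftrightarrow> (\<exists>f\<in>A. f (n - int i) = 1 \<and> (\<forall>j<n - int i. f j = 0))" for i
  define G where "G i = (SOME f. f \<in> A \<and> f (n - int i) = 1 \<and> (\<forall>j<n - int i. f j = 0))" for i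
  have G: "G i \<in> A" "G i (n - int i) = 1" "\<And>j. j < n - int i \<Longrightarrow> G i j = 0" if "Q i" for i
    using someI_ex[of "\<lambda>f. f \<in> A \<and> f (n - int i) = 1 \<and> (\<forall>j<n - int i. f j = 0)"] that
    by (auto simp: Q_def G_def)
  define lam where "lam = back_substitution (\<lambda>i i'. G i (n - int i')) Q"
  have lam: "lam i = (if i = 0 then 1 else if Q i then - (\<Sum>i'<i. lam i' * G i (n - int i')) else 0)" for i
    unfolding lam_def by (subst back_substitution.simps) simp
  have main: "(\<Sum>i\<le>m. lam i * f (n - int i)) = 0"
    if "f \<in> A" "\<And>j. j < n - int m \<Longrightarrow> f j = 0" for f m
    using that
  proof (induction m arbitrary: f)
    case 0
    then show ?case using n[OF 0(1)] by simp
  next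
    case (Suc m)
    show ?case
    proof (cases "f (n - int (Suc m)) = 0")
      case True
      have "f j = 0" if "j < n - int m" for j
      proof -
        have "j < n - int (Suc m) \<or> j = n - int (Suc m)" using that by auto
        then show ?thesis using True Suc.prems(2) by auto
      qed
      then show ?thesis using Suc.IH[OF Suc.prems(1)] True by simp
    next
      case False
      define x where "x = f (n - int (Suc m))"
      have "(\<lambda>j. inverse x * f j) \<in> A" by (rule cmult[OF Suc.prems(1)])
      then have QS: "Q (Suc m)"
        unfolding Q_def using False Suc.prems(2) by (intro bexI[of _ "\<lambda>j. inverse x * f j"]) (auto simp: x_def)
      note g = G[OF QS]
      define h where "h j = f j - x * G (Suc m) j" for j
      have "h \<in> A" unfolding h_def[abs_def] by (rule lin[OF Suc.prems(1) g(1)])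
      moreover have "h j = 0" if "j < n - int m" for j
      proof -
        have "j < n - int (Suc m) \<or> j = n - int (Suc m)" using that by auto
        then show ?thesis using g Suc.prems(2) by (auto simp: h_def x_def)
      qed
      ultimately have "(\<Sum>i\<le>m. lam i * h (n - int i)) = 0" by (rule Suc.IH)
      then have f: "(\<Sum>i\<le>m. lam i * f (n - int i)) = x * (\<Sum>i\<le>m. lam i * G (Suc m) (n - int i))"
        by (simp add: h_def sum_subtractf sum_distrib_left algebra_simps)
      have "lam (Suc m) = - (\<Sum>i\<le>m. lam i * G (Suc m) (n - int i))"
        using QS by (subst lam) (simp add: lessThan_Suc_atMost)
      then show ?thesis using f by (simp add: x_def)
    qed
  qed
  define b where "b j = (if j \<le> n then lam (nat (n - j)) else 0)" for j
  show ?thesis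
  proof (rule that[of b])
    show "b n = 1" by (simp add: b_def lam)
    show "b j = 0" if "j > n" for j using that by (simp add: b_def)
    show "\<exists>f\<in>A. f j \<noteq> 0" if "j \<noteq> n" "b j \<noteq> 0" for j
    proof -
      have j: "j \<le> n" using that(2) by (auto simp: b_def split: if_splits)
      then have "Q (nat (n - j))"
        using that by (auto simp: b_def lam[of "nat (n - j)"] split: if_splits)
      then show ?thesis using G(1,2)[of "nat (n - j)"] j by (intro bexI[of _ "G (nat (n - j))"]) auto
    qed
    show "(\<Sum>j=n0..n. b j * f j) = 0" if f: "f \<in> A" "\<And>i. i < n0 \<Longrightarrow> f i = 0" for f n0
    proof (cases "n0 \<le> n")
      case True
      have "(\<Sum>j=n0..n. b j * f j) = (\<Sum>i\<le>nat (n - n0). lam i * f (n - int i))"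
        by (rule sum.reindex_bij_witness[of _ "\<lambda>i. n - int i" "\<lambda>j. nat (n - j)"]) (use True in \<open>auto simp: b_def\<close>)
      also have "\<dots> = 0"
        by (rule main[OF f(1)]) (use True f(2) in auto)
      finally show ?thesis .
    qed simp
  qed
qed

lemma fls_mult_nth_0_sum:
  fixes A B :: "complex fls"
  assumes "\<And>i. i < n0 \<Longrightarrow> A $$ i = 0" "\<And>i. i < - n \<Longrightarrow> B $$ i = 0"
  shows "(A * B) $$ 0 = (\<Sum>j=n0..n. A $$ j * B $$ (- j))"
proof (cases "A = 0 \<or> B = 0")
  case False
  have sA: "n0 \<le> fls_subdegree A" using assms(1) False by (metis nth_fls_subdegree_nonzero not_le)
  have sB: "- n \<le> fls_subdegree B" using assms(2) False by (metis nth_fls_subdegree_nonzero not_le)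
  have "(A * B) $$ 0 = (\<Sum>i=fls_subdegree A..0 - fls_subdegree B. A $$ i * B $$ (0 - i))"
    by (rule fls_times_nth(2))
  also have "\<dots> = (\<Sum>j=n0..n. A $$ j * B $$ (- j))"
    by (rule sum.mono_neutral_cong_left) (use sA sB in auto)
  finally show ?thesis .
qed auto

context q_width
begin

text \<open>Gaussian elimination over the ring of convergent series localised at a point.\<close>

lemma elimination_at_point:
  assumes \<tau>: "\<tau> \<in> upper_half_plane" and fin: "finite (D :: int set)"
    and conv: "\<And>F c. FF F \<Longrightarrow> c \<in> C \<Longrightarrow> fls_conv_disc (F c)" and DC: "D \<subseteq> C"
    and add: "\<And>F G. FF F \<Longrightarrow> FF G \<Longrightarrow> FF (\<lambda>c. F c + G c)"
    and mult: "\<And>F A. FF F \<Longrightarrow> fls_conv_disc A \<Longrightarrow> FF (\<lambda>c. A * F c)"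
    and zero: "FF (\<lambda>c. 0)"
    and span: "\<And>v. \<exists>c\<in>D. v c \<noteq> 0 \<Longrightarrow> \<exists>F. FF F \<and> (\<Sum>c\<in>D. v c * ev (F c) \<tau>) \<noteq> 0"
  shows "\<exists>d. fls_conv_disc d \<and> ev d \<tau> \<noteq> 0 \<and> (\<forall>c\<in>D. \<exists>F. FF F \<and> (\<forall>c'\<in>D. F c' = (if c' = c then d else 0)))"
  using fin DC span
proof (induction D rule: finite_induct)
  case empty
  show ?case by (intro exI[of _ 1]) auto
next
  case (insert e D)
  have sum_FF: "FF (\<lambda>c. \<Sum>i\<in>I. G i c)" if "\<And>i. i \<in> I \<Longrightarrow> FF (G i)" for G and I :: "int set"
    using that by (induction I rule: infinite_finite_induct) (auto intro: add zero)
  have "\<exists>d. fls_conv_disc d \<and> ev d \<tau> \<noteq> 0 \<and> (\<forall>c\<in>D. \<exists>F. FF F \<and> (\<forall>c'\<in>D. F c' = (if c' = c then d else 0)))"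
  proof (rule insert.IH)
    show "\<exists>F. FF F \<and> (\<Sum>c\<in>D. v c * ev (F c) \<tau>) \<noteq> 0" if v: "\<exists>c\<in>D. v c \<noteq> 0" for v
    proof -
      have "\<exists>c\<in>insert e D. (v(e := 0)) c \<noteq> 0" using v insert.hyps by auto
      from insert.prems(2)[OF this] obtain F where "FF F" "(\<Sum>c\<in>insert e D. (v(e := 0)) c * ev (F c) \<tau>) \<noteq> 0" by blast
      moreover have "(\<Sum>c\<in>insert e D. (v(e := 0)) c * ev (F c) \<tau>) = (\<Sum>c\<in>D. v c * ev (F c) \<tau>)"
        using insert.hyps by (auto intro!: sum.cong)
      ultimately show ?thesis by auto
    qed
  qed (use insert.prems in auto)
  then obtain d where d: "fls_conv_disc d" "ev d \<tau> \<noteq> 0"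
    and "\<forall>c\<in>D. \<exists>F. FF F \<and> (\<forall>c'\<in>D. F c' = (if c' = c then d else 0))" by blast
  then obtain G where G: "\<And>c. c \<in> D \<Longrightarrow> FF (G c)"
    and G': "\<And>c c'. c \<in> D \<Longrightarrow> c' \<in> D \<Longrightarrow> G c c' = (if c' = c then d else 0)" by metis
  have conv': "fls_conv_disc (F c)" if "FF F" "c \<in> insert e D" for F c
    using conv[OF that(1), of c] that(2) insert.prems(1) by auto
  \<comment> \<open>At \<open>\<tau>\<close> this linear form annihilates every \<open>G c\<close>
    with \<open>c \<in> D\<close>, so a vector on which it does not vanish contributes something new
    in the coordinate \<open>e\<close>.\<close>
  define v where "v c = (if c = e then 1 else - ev (G c e) \<tau> / ev d \<tau>)" for c
  have "\<exists>c\<in>insert e D. v c \<noteq> 0" by (auto simp: v_def)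
  from insert.prems(2)[OF this] obtain F where F: "FF F" "(\<Sum>c\<in>insert e D. v c * ev (F c) \<tau>) \<noteq> 0" by blast
  \<comment> \<open>The coordinates in \<open>D\<close> are cleared; the one at \<open>e\<close>
    becomes, at \<open>\<tau>\<close>, the value of the linear form \<open>v\<close> times
    \<open>ev d \<tau>\<close>.\<close>
  define H where "H c' = d * F c' + (\<Sum>c\<in>D. (- F c) * G c c')" for c'
  have "FF (\<lambda>c'. \<Sum>c\<in>D. (- F c) * G c c')"
  proof (rule sum_FF)
    show "FF (\<lambda>c'. (- F c) * G c c')" if "c \<in> D" for c
      by (rule mult[OF G[OF that] fls_conv_disc_uminus[OF conv'[OF F(1)]]]) (use that in simp)
  qed
  then have HF: "FF H"
    unfolding H_def[abs_def] by (rule add[OF mult[OF F(1) d(1)]])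
  have HD: "H c' = 0" if "c' \<in> D" for c'
  proof -
    have "(\<Sum>c\<in>D. (- F c) * G c c') = (\<Sum>c\<in>D. if c = c' then - F c * d else 0)"
      by (intro sum.cong refl) (use G' that in auto)
    also have "\<dots> = - F c' * d" using that insert.hyps by simp
    finally show ?thesis by (simp add: H_def)
  qed
  have "ev (H e) \<tau> = ev d \<tau> * ev (F e) \<tau> + (\<Sum>c\<in>D. - ev (F c) \<tau> * ev (G c e) \<tau>)"
  proof -
    have cv: "fls_conv_disc (F c)" "fls_conv_disc (- F c)" "fls_conv_disc (G c e)" if "c \<in> D" for c
      using conv'[OF F(1)] conv'[OF G] that by (auto intro: fls_conv_disc_uminus)
    have Fe: "fls_conv_disc (F e)" using conv'[OF F(1)] by simp
    have "ev (\<Sum>c\<in>D. (- F c) * G c e) \<tau> = (\<Sum>c\<in>D. ev ((- F c) * G c e) \<tau>)"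
      by (rule ev_sum[OF \<tau> fls_conv_disc_mult[OF cv(2,3)]])
    also have "\<dots> = (\<Sum>c\<in>D. - ev (F c) \<tau> * ev (G c e) \<tau>)"
      by (intro sum.cong refl) (simp only: ev_mult[OF \<tau> cv(2,3)] ev_uminus[OF \<tau> cv(1)])
    finally show ?thesis
      unfolding H_def using ev_mult[OF \<tau> d(1) Fe]
      by (simp only: ev_add[OF \<tau> fls_conv_disc_mult[OF d(1) Fe] fls_conv_disc_sum[OF fls_conv_disc_mult[OF cv(2,3)]]])
  qed
  also have "\<dots> = ev d \<tau> * (\<Sum>c\<in>insert e D. v c * ev (F c) \<tau>)"
  proof -
    have "(\<Sum>c\<in>D. - ev (F c) \<tau> * ev (G c e) \<tau>) = ev d \<tau> * (\<Sum>c\<in>D. v c * ev (F c) \<tau>)"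
      unfolding sum_distrib_left by (intro sum.cong refl) (use d insert.hyps in \<open>auto simp: v_def\<close>)
    then show ?thesis using insert.hyps by (simp add: v_def ring_distribs)
  qed
  finally have He: "ev (H e) \<tau> \<noteq> 0" using F(2) d by simp
  have Hec: "fls_conv_disc (H e)" using conv'[OF HF] by simp
  \<comment> \<open>Multiplying the old vectors by \<open>H e\<close> allows their coordinate at
    \<open>e\<close> to be cleared without division.\<close>
  show ?case
  proof (intro exI[of _ "H e * d"] conjI ballI)
    show "fls_conv_disc (H e * d)" by (intro fls_conv_disc_mult Hec d)
    show "ev (H e * d) \<tau> \<noteq> 0" using ev_mult[OF \<tau> Hec d(1)] He d by simp
    fix c assume c: "c \<in> insert e D"
    show "\<exists>F. FF F \<and> (\<forall>c'\<in>insert e D. F c' = (if c' = c then H e * d else 0))"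
    proof (cases "c = e")
      case True
      show ?thesis
        by (intro exI[of _ "\<lambda>c. d * H c"] conjI mult HF d) (use True HD in auto)
    next
      case False
      with c have cD: "c \<in> D" by simp
      have "FF (\<lambda>c'. H e * G c c' + (- G c e) * H c')"
        by (intro add mult HF G cD Hec fls_conv_disc_uminus conv') auto
      then show ?thesis
        by (intro exI[of _ "\<lambda>c'. H e * G c c' + (- G c e) * H c'"] conjI) (use False HD G' cD insert.hyps in auto)
    qed
  qed
qed

end

text \<open>By \<open>orth\<close> the matrices \<open>P\<close> and \<open>Ps\<close> are inverse
  to each other with respect to the weights \<open>w\<close>, up to \<open>\<gamma>\<close>. So the
  two representations are contragredient for the weighted pairing, apart from a scalar still to be
  determined.\<close>

locale vv_pair =
  pos: vv_side N C 1 w P + neg: vv_side N C "- 1" w Ps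
  for N C w P Ps +
  fixes \<gamma> :: complex
  assumes P_sym: "\<And>c c'. c \<in> C \<Longrightarrow> c' \<in> C \<Longrightarrow> P c c' = P c' c" "\<And>c c'. c \<in> C \<Longrightarrow> c' \<in> C \<Longrightarrow> Ps c c' = Ps c' c"
    and orth: "\<And>c c'. c \<in> C \<Longrightarrow> c' \<in> C \<Longrightarrow> (\<Sum>c1\<in>C. P c c1 * w c1 * Ps c1 c') = (if c = c' then \<gamma> / w c else 0)"
begin

abbreviation ev where "ev \<equiv> pos.ev"

definition pairing :: "(int \<Rightarrow> complex fls) \<Rightarrow> (int \<Rightarrow> complex fls) \<Rightarrow> complex fls" where
  "pairing F G = (\<Sum>c\<in>C. fls_const (w c) * (F c * G c))"

lemma pairing_mult_left: "pairing (\<lambda>c. A * F c) G = A * pairing F G"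
  by (simp add: pairing_def sum_distrib_left mult_ac)

lemma pairing_class:
  assumes "\<forall>c\<in>C. pos.fls_class (1 * c) (F c)" "\<forall>c\<in>C. pos.fls_class (- 1 * c) (G c)"
  shows "pos.fls_class 0 (pairing F G)"
  unfolding pairing_def
proof (rule pos.fls_class_sum, rule pos.fls_class_const_mult)
  fix c assume "c \<in> C"
  from pos.fls_class_mult[OF assms(1)[rule_format, OF this] assms(2)[rule_format, OF this]]
  show "pos.fls_class 0 (F c * G c)" by simp
qed

lemma pairing_conv:
  assumes "\<forall>c\<in>C. fls_conv_disc (F c)" "\<forall>c\<in>C. fls_conv_disc (G c)"
  shows "fls_conv_disc (pairing F G)"
  unfolding pairing_def using assms by (intro fls_conv_disc_intros) auto

lemma ev_pairing:
  assumes "\<forall>c\<in>C. fls_conv_disc (F c)" "\<forall>c\<in>C. fls_conv_disc (G c)" "\<tau> \<in> upper_half_plane"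
  shows "ev (pairing F G) \<tau> = (\<Sum>c\<in>C. w c * (ev (F c) \<tau> * ev (G c) \<tau>))"
  unfolding pairing_def using assms
  by (simp add: pos.ev_sum pos.ev_mult fls_conv_disc_mult)

text \<open>Symmetry of \<open>P\<close> brings the two matrices into the order in which
  \<open>orth\<close> contracts them.\<close>

lemma pairing_S:
  assumes F: "pos.VV L F" and G: "neg.VV L' G" and \<tau>: "\<tau> \<in> upper_half_plane"
  shows "ev (pairing F G) (- 1 / \<tau>) = \<gamma> * csqrt \<tau> powi (L + L') * ev (pairing F G) \<tau>"
proof -
  note FD = pos.VV_D[OF F] and GD = neg.VV_D[OF G] and cv = pos.VV_conv[OF F] neg.VV_conv[OF G] and cl = pos.VV_class[OF F] neg.VV_class[OF G]
  have "ev (pairing F G) (- 1 / \<tau>) = (\<Sum>c\<in>C. w c *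
     ((csqrt \<tau> powi L * (\<Sum>c'\<in>C. P c c' * w c' * ev (F c') \<tau>)) *
      (csqrt \<tau> powi L' * (\<Sum>c''\<in>C. Ps c c'' * w c'' * ev (G c'') \<tau>))))"
    unfolding ev_pairing[OF cv uhp_S[OF \<tau>]]
    by (intro sum.cong refl) (simp only: FD(3)[OF _ \<tau>] GD(3)[OF _ \<tau>])
  also have "\<dots> = csqrt \<tau> powi L * csqrt \<tau> powi L' *
     (\<Sum>c\<in>C. \<Sum>c'\<in>C. \<Sum>c''\<in>C. (P c' c * w c * Ps c c'') * (w c' * ev (F c') \<tau> * (w c'' * ev (G c'') \<tau>)))"
  proof -
    have "(\<Sum>c'\<in>C. P c c' * w c' * ev (F c') \<tau>) * (\<Sum>c''\<in>C. Ps c c'' * w c'' * ev (G c'') \<tau>)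
      = (\<Sum>c'\<in>C. \<Sum>c''\<in>C. (P c' c * Ps c c'') * (w c' * ev (F c') \<tau> * (w c'' * ev (G c'') \<tau>)))" if "c \<in> C" for c
      unfolding sum_product using that by (intro sum.cong refl) (simp add: P_sym(1) mult_ac)
    then have "w c * ((\<Sum>c'\<in>C. P c c' * w c' * ev (F c') \<tau>) * (\<Sum>c''\<in>C. Ps c c'' * w c'' * ev (G c'') \<tau>))
      = (\<Sum>c'\<in>C. \<Sum>c''\<in>C. (P c' c * w c * Ps c c'') * (w c' * ev (F c') \<tau> * (w c'' * ev (G c'') \<tau>)))" if "c \<in> C" for c
      using that by (simp add: sum_distrib_left mult_ac)
    note split = this
    have "w c * ((csqrt \<tau> powi L * A) * (csqrt \<tau> powi L' * B)) = (csqrt \<tau> powi L * csqrt \<tau> powi L') * (w c * (A * B))" for c A B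
      by (simp only: mult_ac)
    then show ?thesis
      by (subst sum_distrib_left, intro sum.cong refl) (simp only: split)
  qed
  also have "(\<Sum>c\<in>C. \<Sum>c'\<in>C. \<Sum>c''\<in>C. (P c' c * w c * Ps c c'') * (w c' * ev (F c') \<tau> * (w c'' * ev (G c'') \<tau>)))
     = (\<Sum>c'\<in>C. \<Sum>c''\<in>C. (\<Sum>c\<in>C. P c' c * w c * Ps c c'') * (w c' * ev (F c') \<tau> * (w c'' * ev (G c'') \<tau>)))"
    unfolding sum_distrib_right by (subst sum.swap, rule sum.cong[OF refl], subst sum.swap) simp
  also have "\<dots> = (\<Sum>c'\<in>C. \<Sum>c''\<in>C. if c' = c'' then \<gamma> / w c' * (w c' * ev (F c') \<tau> * (w c'' * ev (G c'') \<tau>)) else 0)"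
    by (intro sum.cong refl) (simp add: orth)
  also have "\<dots> = (\<Sum>c'\<in>C. \<gamma> * (w c' * (ev (F c') \<tau> * ev (G c') \<tau>)))"
    using pos.fin pos.w_nonzero by (auto intro!: sum.cong)
  also have "\<dots> = \<gamma> * ev (pairing F G) \<tau>"
    unfolding ev_pairing[OF cv \<tau>] sum_distrib_left ..
  finally show ?thesis using pos.csqrt_uhp_nonzero[OF \<tau>] by (simp add: power_int_add)
qed

lemma csqrt_powi_4:
  assumes "\<tau> \<in> upper_half_plane"
  shows "csqrt \<tau> powi (4 * int m) = (\<tau>^2) ^ m"
proof (induction m)
  case (Suc m)
  have "4 * int (Suc m) = 4 * int m + 4" by simp
  then show ?case using Suc.IH pos.csqrt_powi_add4[OF assms, of "4 * int m"] by (simp only: power_Suc mult.commute)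
qed simp

text \<open>The relations \<open>S\<^sup>2 = (TS)\<^sup>3 = - 1\<close> leave only the trivial multiplier.\<close>

lemma gamma_eq_1:
  assumes F: "pos.VV K F" "\<exists>c\<in>C. F c \<noteq> 0" and G: "neg.VV (4 - K) G" "\<exists>c\<in>C. G c \<noteq> 0"
  shows "\<gamma> = 1"
proof -
  have i: "\<i> \<in> upper_half_plane" by (simp add: upper_half_plane_def)
  have "\<exists>\<tau>0\<in>upper_half_plane. \<exists>c\<in>C. w c * ev (G c) \<tau>0 \<noteq> 0"
  proof (rule ccontr)
    assume "\<not> ?thesis"
    then have *: "ev (G c) \<tau> = 0" if "\<tau> \<in> upper_half_plane" "c \<in> C" for \<tau> c
      using that pos.w_nonzero by auto
    have "G c = 0" if "c \<in> C" for c
      by (rule pos.ev_cong_fls) (use * that neg.VV_D(1)[OF G(1)] in auto)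
    then show False using G(2) by blast
  qed
  then obtain \<tau>0 where \<tau>0: "\<tau>0 \<in> upper_half_plane" "\<exists>c\<in>C. w c * ev (G c) \<tau>0 \<noteq> 0" by blast
  \<comment> \<open>The pairing of the given forms may vanish identically, so \<open>F\<close> is
    exchanged for a form, possibly of higher weight, whose pairing with \<open>G\<close> is nonzero
    at \<open>\<tau>0\<close>.\<close>
  obtain j F' where F': "pos.VV (K + 4 * int j) F'" "(\<Sum>c\<in>C. (w c * ev (G c) \<tau>0) * ev (F' c) \<tau>0) \<noteq> 0"
    using pos.VV_spanning[OF F \<tau>0] by blast
  define h where "h = ev (pairing F' G)"
  note cv = pos.VV_conv[OF F'(1)] neg.VV_conv[OF G(1)] and cl = pos.VV_class[OF F'(1)] neg.VV_class[OF G(1)]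
  have h0: "h \<tau>0 \<noteq> 0"
    unfolding h_def ev_pairing[OF cv \<tau>0(1)] using F'(2) by (simp add: mult_ac)
  have hS: "h (- 1 / \<tau>) = \<gamma> * (\<tau>^2) ^ Suc j * h \<tau>" if "\<tau> \<in> upper_half_plane" for \<tau>
  proof -
    have "K + 4 * int j + (4 - K) = 4 * int (Suc j)" by simp
    then show ?thesis using pairing_S[OF F'(1) G(1) that] csqrt_powi_4[OF that, of "Suc j"] by (simp only: h_def)
  qed
  have hT: "h (\<tau> + 1) = h \<tau>" if "\<tau> \<in> upper_half_plane" for \<tau>
    unfolding h_def by (rule pos.ev_T_class_0[OF pairing_conv[OF cv] pairing_class[OF cl] that])
  have \<tau>00: "\<tau>0 \<noteq> 0" by (rule uhp_nonzero[OF \<tau>0(1)])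
  \<comment> \<open>Two inversions return to \<open>\<tau>0\<close>; the automorphy factors cancel
    and leave \<open>\<gamma>^2\<close>.\<close>
  have "h \<tau>0 = h (- 1 / (- 1 / \<tau>0))" using \<tau>00 by simp
  also have "\<dots> = \<gamma> * ((- 1 / \<tau>0)^2) ^ Suc j * (\<gamma> * (\<tau>0^2) ^ Suc j * h \<tau>0)"
    by (simp only: hS[OF uhp_S[OF \<tau>0(1)]] hS[OF \<tau>0(1)])
  also have "\<dots> = \<gamma>^2 * ((- 1 / \<tau>0)^2 * \<tau>0^2) ^ Suc j * h \<tau>0"
    by (simp only: power_mult_distrib power2_eq_square mult_ac)
  also have "(- 1 / \<tau>0)^2 * \<tau>0^2 = 1" using \<tau>00 by (simp add: power_divide)
  finally have g2: "\<gamma>^2 = 1" using h0 by simp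
  have hTS: "h ((\<tau> - 1) / \<tau>) = \<gamma> * (\<tau>^2) ^ Suc j * h \<tau>" "(\<tau> - 1) / \<tau> \<in> upper_half_plane" if "\<tau> \<in> upper_half_plane" for \<tau>
  proof -
    have e: "(\<tau> - 1) / \<tau> = - 1 / \<tau> + 1" using uhp_nonzero[OF that] by (simp add: field_simps)
    show "h ((\<tau> - 1) / \<tau>) = \<gamma> * (\<tau>^2) ^ Suc j * h \<tau>"
      unfolding e using hT[OF uhp_S[OF that]] hS[OF that] by simp
    show "(\<tau> - 1) / \<tau> \<in> upper_half_plane"
      unfolding e uhp_T by (rule uhp_S[OF that])
  qed
  define \<tau>1 where "\<tau>1 = (\<tau>0 - 1) / \<tau>0"
  define \<tau>2 where "\<tau>2 = (\<tau>1 - 1) / \<tau>1"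
  have u: "\<tau>1 \<in> upper_half_plane" "\<tau>2 \<in> upper_half_plane"
    unfolding \<tau>2_def \<tau>1_def by (intro hTS \<tau>0)+
  have \<tau>01: "\<tau>0 - 1 \<noteq> 0" using \<tau>0(1) by (auto simp: upper_half_plane_def)
  have t2: "\<tau>2 = - 1 / (\<tau>0 - 1)" using \<tau>00 \<tau>01 by (simp add: \<tau>2_def \<tau>1_def field_simps)
  have t3: "(\<tau>2 - 1) / \<tau>2 = \<tau>0" using \<tau>01 by (simp add: t2 field_simps)
  \<comment> \<open>The map \<open>(\<tau> - 1) / \<tau>\<close> has order three and the points of
    its orbit have product \<open>- 1\<close>, so only \<open>\<gamma>^3\<close> is left.\<close>
  have "h \<tau>0 = \<gamma> * (\<tau>2^2) ^ Suc j * (\<gamma> * (\<tau>1^2) ^ Suc j * (\<gamma> * (\<tau>0^2) ^ Suc j * h \<tau>0))"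
    using hTS(1)[OF \<tau>0(1)] hTS(1)[OF u(1)] hTS(1)[OF u(2)] by (simp only: t3 flip: \<tau>1_def \<tau>2_def)
  also have "\<dots> = \<gamma>^2 * \<gamma> * ((\<tau>2 * \<tau>1 * \<tau>0)^2) ^ Suc j * h \<tau>0"
    by (simp only: power_mult_distrib power2_eq_square mult_ac)
  also have "\<tau>2 * \<tau>1 * \<tau>0 = - 1" using \<tau>00 \<tau>01 by (simp add: t2 \<tau>1_def field_simps)
  finally show ?thesis using g2 h0 by simp
qed

context
  assumes gam: "\<gamma> = 1"
begin

theorem pairing_constant_term:
  assumes F: "pos.VV K F" and G: "neg.VV (4 - K) G"
  shows "pairing F G $$ 0 = 0"
proof (rule pos.level_one_weight_two_constant_term)
  note FD = pos.VV_D[OF F] and GD = neg.VV_D[OF G] and cv = pos.VV_conv[OF F] neg.VV_conv[OF G] and cl = pos.VV_class[OF F] neg.VV_class[OF G]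
  show "pos.level_one 4 (pairing F G)"
    unfolding pos.level_one_def
    using pairing_S[OF F G] gam pairing_conv[OF cv] pairing_class[OF cl] by simp
qed

text \<open>A form \<open>\<phi>\<close> of nonpositive weight dividing \<open>Omega\<close> brings
  \<open>F\<close> back to the weight in which \<open>B\<close> is orthogonal to everything. Then
  \<open>formal_weight_two\<close> writes \<open>\<phi>\<close> times the pairing as
  \<open>\<phi> * \<psi> * Q\<close>, and \<open>\<phi>\<close> cancels in the field of Laurent
  series.\<close>

lemma pairing_convergent_weight:
  assumes perp: "\<And>F. pos.VV K F \<Longrightarrow> pairing F B $$ 0 = 0"
    and B: "\<forall>c\<in>C. pos.fls_class (- 1 * c) (B c)"
    and F: "pos.VV (K + 4 * int l) F"
  shows "pos.level_one (4 + 4 * int l) (pairing F B)"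
proof -
  obtain \<phi> \<psi> where \<phi>: "pos.level_one (- 4 * int l) \<phi>" "pos.level_one (4 + 4 * int l) \<psi>" "\<phi> * \<psi> = pos.Omega"
    using pos.level_one_divides_Omega by blast
  have \<phi>0: "\<phi> \<noteq> 0" using \<phi>(3) pos.Jfun_Omega_nonzero by auto
  have V: "pos.VV K (\<lambda>c. \<phi> * F c)"
    using pos.VV_level_one_mult[OF \<phi>(1) F] by simp
  have cl: "pos.fls_class 0 (pairing (\<lambda>c. \<phi> * F c) B)"
    by (rule pairing_class[OF pos.VV_class[OF V] B])
  have "\<exists>Q. pos.level_one 0 Q \<and> pairing (\<lambda>c. \<phi> * F c) B = pos.Omega * Q"
  proof (rule pos.formal_weight_two[OF cl])
    fix e
    have "pos.VV K (\<lambda>c. pos.Jfun ^ e * (\<phi> * F c))"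
      using pos.VV_level_one_mult[OF pos.level_one_power[OF pos.level_one_Jfun, of e] V] by simp
    from perp[OF this] show "(pos.Jfun ^ e * pairing (\<lambda>c. \<phi> * F c) B) $$ 0 = 0"
      by (simp only: pairing_mult_left)
  qed
  then obtain Q where Q: "pos.level_one 0 Q" "\<phi> * pairing F B = \<phi> * \<psi> * Q"
    unfolding pairing_mult_left \<phi>(3) by blast
  then have "pairing F B = \<psi> * Q" using \<phi>0 by (simp add: mult.assoc)
  then show ?thesis using pos.level_one_mult[OF \<phi>(2) Q(1)] by simp
qed

text \<open>Pairings with forms of the weights reached by Serre derivatives are convergent level one
  forms. At each point such forms span, so elimination isolates \<open>B c0\<close> with a
  denominator that is nonzero there, which gives convergence. The same spanning property then forces
  the transformation law.\<close>

lemma formal_annihilator_is_form: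
  assumes F0: "pos.VV K F0" "\<exists>c\<in>C. F0 c \<noteq> 0"
    and perp: "\<And>F. pos.VV K F \<Longrightarrow> pairing F B $$ 0 = 0"
    and B: "\<forall>c\<in>C. pos.fls_class (- 1 * c) (B c)"
  shows "neg.VV (4 - K) B"
proof -
  have lev: "pos.level_one (4 + 4 * int l) (pairing F B)" if "pos.VV (K + 4 * int l) F" for F l
    by (rule pairing_convergent_weight[OF _ B that]) (rule perp)
  \<comment> \<open>The convergent vectors whose pairing with \<open>B\<close> converges form a
    module over the convergent series, which is what elimination needs.\<close>
  define FF where "FF F \<longleftrightarrow> (\<forall>c\<in>C. fls_conv_disc (F c)) \<and> fls_conv_disc (pairing F B)" for F
  have Bconv: "fls_conv_disc (B c0)" if c0: "c0 \<in> C" for c0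
  proof (rule fls_conv_disc_quotient)
    fix x :: complex assume "norm x < 1" "x \<noteq> 0"
    then obtain \<tau> where \<tau>: "\<tau> \<in> upper_half_plane" "pos.qx \<tau> = x" by (rule pos.qx_surj)
    have "\<exists>d. fls_conv_disc d \<and> ev d \<tau> \<noteq> 0 \<and> (\<forall>c\<in>C. \<exists>F. FF F \<and> (\<forall>c'\<in>C. F c' = (if c' = c then d else 0)))"
    proof (rule pos.elimination_at_point[OF \<tau>(1) pos.fin, where C=C])
      show "fls_conv_disc (F c)" if "FF F" "c \<in> C" for F c using that by (simp add: FF_def)
      show "FF (\<lambda>c. F c + G c)" if "FF F" "FF G" for F G
      proof -
        have "pairing (\<lambda>c. F c + G c) B = pairing F B + pairing G B"
          by (simp add: pairing_def sum.distrib ring_distribs)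
        then show ?thesis using that by (auto simp: FF_def intro: fls_conv_disc_add)
      qed
      show "FF (\<lambda>c. A * F c)" if "FF F" "fls_conv_disc A" for F A
        using that by (auto simp: FF_def pairing_mult_left intro: fls_conv_disc_mult)
      show "FF (\<lambda>c. 0)" by (simp add: FF_def pairing_def)
      show "\<exists>F. FF F \<and> (\<Sum>c\<in>C. v c * ev (F c) \<tau>) \<noteq> 0" if v: "\<exists>c\<in>C. v c \<noteq> 0" for v
      proof -
        obtain j F where F: "pos.VV (K + 4 * int j) F" "(\<Sum>c\<in>C. v c * ev (F c) \<tau>) \<noteq> 0"
          using pos.VV_spanning[OF F0 \<tau>(1) v] by blast
        have "FF F"
          unfolding FF_def using pos.VV_D(1)[OF F(1)] pos.level_oneD(1)[OF lev[OF F(1)]] by blast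
        with F(2) show ?thesis by blast
      qed
    qed simp
    then obtain d F where d: "fls_conv_disc d" "ev d \<tau> \<noteq> 0" "FF F" "\<forall>c'\<in>C. F c' = (if c' = c0 then d else 0)"
      using c0 by meson
    have "pairing F B = (\<Sum>c\<in>C. if c = c0 then fls_const (w c0) * (d * B c0) else 0)"
      unfolding pairing_def by (intro sum.cong refl) (use d(4) in auto)
    also have "\<dots> = fls_const (w c0) * (d * B c0)" using c0 pos.fin by simp
    finally have pF: "pairing F B = fls_const (w c0) * (d * B c0)" .
    have "d * B c0 = fls_const (inverse (w c0)) * pairing F B"
      unfolding pF using pos.w_nonzero[OF c0] by (simp add: mult.assoc[symmetric] fls_const_mult_const)
    then show "\<exists>d E. fls_conv_disc d \<and> fls_conv_disc E \<and> d * B c0 = E \<and> eval_fls d x \<noteq> 0"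
      using d \<tau>(2) by (intro exI[of _ d] exI[of _ "fls_const (inverse (w c0)) * pairing F B"])
        (auto simp: FF_def pos.ev_def intro: fls_conv_disc_mult)
  qed
  then have Bconv': "\<forall>c\<in>C. fls_conv_disc (B c)" by blast
  have law: "ev (B c'') (- 1 / \<tau>) = csqrt \<tau> powi (4 - K) * (\<Sum>c'\<in>C. Ps c'' c' * w c' * ev (B c') \<tau>)"
    if \<tau>: "\<tau> \<in> upper_half_plane" and c'': "c'' \<in> C" for \<tau> c''
  proof -
    define s where "s = csqrt \<tau> powi (4 - K)"
    \<comment> \<open>\<open>v\<close> measures the failure of the law at \<open>\<tau>\<close>.
      Invariance of the pairings makes it orthogonal to the values at \<open>\<tau>\<close> of all
      these forms, so it vanishes by spanning.\<close>
    define v where "v c' = w c' * ((\<Sum>c\<in>C. P c' c * w c * ev (B c) (- 1 / \<tau>)) - s * ev (B c') \<tau>)" for c'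
    have "(\<Sum>c\<in>C. v c * ev (F c) \<tau>) = 0" if F: "pos.VV (K + 4 * int l) F" for F l
    proof -
      define t where "t = csqrt \<tau> powi (K + 4 * int l)"
      have t0: "t \<noteq> 0" using pos.csqrt_uhp_nonzero[OF \<tau>] by (simp add: t_def)
      have st: "csqrt \<tau> powi (4 + 4 * int l) = t * s"
      proof -
        have "4 + 4 * int l = (K + 4 * int l) + (4 - K)" by simp
        moreover have "csqrt \<tau> powi ((K + 4 * int l) + (4 - K)) = t * s"
          unfolding t_def s_def by (rule power_int_add) (use pos.csqrt_uhp_nonzero[OF \<tau>] in simp)
        ultimately show ?thesis by (simp only:)
      qed
      note FD = pos.VV_D[OF F]
      have "t * s * (\<Sum>c\<in>C. w c * (ev (F c) \<tau> * ev (B c) \<tau>)) = ev (pairing F B) (- 1 / \<tau>)"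
        using pos.level_oneD(3)[OF lev[OF F] \<tau>] ev_pairing[OF pos.VV_conv[OF F] Bconv' \<tau>] by (simp only: st)
      also have "\<dots> = (\<Sum>c\<in>C. w c * (t * (\<Sum>c'\<in>C. P c c' * w c' * ev (F c') \<tau>) * ev (B c) (- 1 / \<tau>)))"
        unfolding ev_pairing[OF pos.VV_conv[OF F] Bconv' uhp_S[OF \<tau>]]
        by (intro sum.cong refl) (simp only: FD(3)[OF _ \<tau>] t_def)
      also have "\<dots> = t * (\<Sum>c\<in>C. \<Sum>c'\<in>C. w c' * (P c' c * w c * ev (B c) (- 1 / \<tau>)) * ev (F c') \<tau>)"
        unfolding sum_distrib_left sum_distrib_right
        by (intro sum.cong refl) (simp add: P_sym(1) mult_ac)
      also have "(\<Sum>c\<in>C. \<Sum>c'\<in>C. w c' * (P c' c * w c * ev (B c) (- 1 / \<tau>)) * ev (F c') \<tau>)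
         = (\<Sum>c'\<in>C. w c' * (\<Sum>c\<in>C. P c' c * w c * ev (B c) (- 1 / \<tau>)) * ev (F c') \<tau>)"
        unfolding sum_distrib_left sum_distrib_right by (rule sum.swap)
      finally have "(\<Sum>c'\<in>C. w c' * (\<Sum>c\<in>C. P c' c * w c * ev (B c) (- 1 / \<tau>)) * ev (F c') \<tau>)
         = s * (\<Sum>c\<in>C. w c * (ev (F c) \<tau> * ev (B c) \<tau>))"
        using t0 by simp
      then show ?thesis
        by (simp add: v_def right_diff_distrib left_diff_distrib sum_subtractf sum_distrib_left mult_ac)
    qed
    then have v0: "v c' = 0" if "c' \<in> C" for c'
      using pos.VV_spanning[OF F0 \<tau>, of v] that by blast
    have Pw: "(\<Sum>c\<in>C. P c' c * w c * ev (B c) (- 1 / \<tau>)) = s * ev (B c') \<tau>" if "c' \<in> C" for c'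
      using v0[OF that] pos.w_nonzero[OF that] by (simp add: v_def)
    \<comment> \<open>Applying the inverse matrix \<open>Ps\<close> solves these equations for the
      values at \<open>- 1 / \<tau>\<close>.\<close>
    have "s * (\<Sum>c'\<in>C. Ps c'' c' * w c' * ev (B c') \<tau>) = (\<Sum>c'\<in>C. Ps c'' c' * w c' * (\<Sum>c\<in>C. P c' c * w c * ev (B c) (- 1 / \<tau>)))"
      unfolding sum_distrib_left[of s] by (intro sum.cong refl) (simp only: Pw, simp only: mult_ac)
    also have "\<dots> = (\<Sum>c\<in>C. (\<Sum>c'\<in>C. P c c' * w c' * Ps c' c'') * (w c * ev (B c) (- 1 / \<tau>)))"
      unfolding sum_distrib_left sum_distrib_right
      by (subst sum.swap, intro sum.cong refl) (use c'' in \<open>simp add: P_sym mult_ac\<close>)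
    also have "\<dots> = (\<Sum>c\<in>C. if c = c'' then 1 / w c * (w c * ev (B c) (- 1 / \<tau>)) else 0)"
      by (intro sum.cong refl) (simp add: orth c'' gam)
    also have "\<dots> = ev (B c'') (- 1 / \<tau>)"
      using pos.fin c'' pos.w_nonzero[OF c''] by simp
    finally show ?thesis by (simp add: s_def)
  qed
  show ?thesis
    unfolding neg.VV_def pos.slaw_def
    using Bconv B law by auto
qed

end

end

context vv_pair
begin

text \<open>If no form starts at \<open>n\<close>, some functional with value 1 at \<open>n\<close>
  and 0 above annihilates the expansions of all forms. With exponents reflected it is the expansion
  of a dual form, by \<open>formal_annihilator_is_form\<close>.\<close>

theorem dual_leading_form_exists:
  assumes gam: "\<gamma> = 1" and F0: "pos.VV K F0" "\<exists>c\<in>C. F0 c \<noteq> 0"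
    and c0: "c0 \<in> C" "[n = c0] (mod int N)"
    and no: "\<And>F. pos.VV K F \<Longrightarrow> (\<And>i. i < n \<Longrightarrow> (\<Sum>c\<in>C. F c) $$ i = 0) \<Longrightarrow> (\<Sum>c\<in>C. F c) $$ n = 0"
  shows "\<exists>G. neg.VV (4 - K) G \<and> (\<forall>i<(- n). (\<Sum>c\<in>C. G c) $$ i = 0) \<and> (\<Sum>c\<in>C. G c) $$ (- n) \<noteq> 0"
proof -
  define A where "A = {fls_nth (\<Sum>c\<in>C. F c) |F. pos.VV K F}"
  obtain b where b: "b n = 1" "\<And>j. j > n \<Longrightarrow> b j = (0::complex)"
    "\<And>f n0. f \<in> A \<Longrightarrow> (\<And>i. i < n0 \<Longrightarrow> f i = 0) \<Longrightarrow> (\<Sum>j=n0..n. b j * f j) = 0"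
  proof (rule annihilating_functional[of A n])
    show "(\<lambda>j. f j - x * g j) \<in> A" if fg: "f \<in> A" "g \<in> A" for f g x
    proof -
      obtain F G where FG: "pos.VV K F" "f = fls_nth (\<Sum>c\<in>C. F c)" "pos.VV K G" "g = fls_nth (\<Sum>c\<in>C. G c)"
        using fg unfolding A_def by blast
      have "pos.VV K (\<lambda>c. F c - fls_const x * G c)"
        by (intro pos.VV_diff pos.VV_cmult FG)
      moreover have "(\<lambda>j. f j - x * g j) = fls_nth (\<Sum>c\<in>C. F c - fls_const x * G c)"
        by (auto simp: FG fls_nth_sum sum_subtractf sum_distrib_left)
      ultimately show ?thesis by (auto simp: A_def)
    qed
    show "(\<lambda>j. x * f j) \<in> A" if f: "f \<in> A" for f x
    proof -
      obtain F where F: "pos.VV K F" "f = fls_nth (\<Sum>c\<in>C. F c)" using f unfolding A_def by blast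
      have "(\<lambda>j. x * f j) = fls_nth (\<Sum>c\<in>C. fls_const x * F c)"
        by (auto simp: F fls_nth_sum sum_distrib_left)
      then show ?thesis using pos.VV_cmult[OF F(1), of x] by (auto simp: A_def)
    qed
    show "f n = 0" if "f \<in> A" "\<And>i. i < n \<Longrightarrow> f i = 0" for f
      using that no by (auto simp: A_def)
  qed (use that in blast)
  \<comment> \<open>The functional, split into residue classes with reflected exponents. The
    division by \<open>w c\<close> cancels the weight in \<open>pairing\<close>, so that the
    constant term of the pairing is the functional applied to the sum of the components.\<close>
  define B where "B c = Abs_fls (\<lambda>j. if [j = - c] (mod int N) then b (- j) / w c else 0)" for c
  have B_nth: "B c $$ j = (if [j = - c] (mod int N) then b (- j) / w c else 0)" for c j
  proof -
    have "\<forall>\<^sub>\<infinity>k. (if [- int k = - c] (mod int N) then b (- (- int k)) / w c else 0) = 0"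
      unfolding MOST_nat
    proof (intro exI[of _ "nat n"] allI impI)
      fix k assume "nat n < k"
      then have "int k > n" by linarith
      then show "(if [- int k = - c] (mod int N) then b (- (- int k)) / w c else 0) = 0" using b(2) by simp
    qed
    then show ?thesis unfolding B_def by (rule nth_Abs_fls)
  qed
  have Blow: "B c $$ i = 0" if "i < - n" for c i
    using that b(2)[of "- i"] by (simp add: B_nth)
  have "neg.VV (4 - K) B"
  proof (rule formal_annihilator_is_form[OF gam F0])
    show "\<forall>c\<in>C. pos.fls_class (- 1 * c) (B c)"
      by (auto simp: pos.fls_class_def B_nth)
    fix F assume F: "pos.VV K F"
    define n0 where "n0 = Min (fls_subdegree ` F ` C)"
    have low: "F c $$ i = 0" if "c \<in> C" "i < n0" for c i
    proof -
      have "n0 \<le> fls_subdegree (F c)" unfolding n0_def using that pos.fin by (intro Min_le) auto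
      then show ?thesis using that by (intro fls_eq0_below_subdegree) simp
    qed
    have "w c * (F c * B c) $$ 0 = (\<Sum>j=n0..n. b j * F c $$ j)" if c: "c \<in> C" for c
    proof -
      have "(F c * B c) $$ 0 = (\<Sum>j=n0..n. F c $$ j * B c $$ (- j))"
        by (rule fls_mult_nth_0_sum) (use low[OF c] Blow in auto)
      also have "\<dots> = (\<Sum>j=n0..n. F c $$ j * (b j / w c))"
      proof (intro sum.cong refl)
        fix j
        show "F c $$ j * B c $$ (- j) = F c $$ j * (b j / w c)"
        proof (cases "F c $$ j = 0")
          case False
          then have "[j = c] (mod int N)" using pos.VV_D(2)[OF F c] by (auto simp: pos.fls_class_def)
          then have "[- j = - c] (mod int N)" by (simp add: cong_minus_minus_iff)
          then show ?thesis by (simp add: B_nth)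
        qed simp
      qed
      finally show ?thesis using pos.w_nonzero[OF c] by (simp add: sum_distrib_left mult_ac)
    qed
    then have "pairing F B $$ 0 = (\<Sum>c\<in>C. \<Sum>j=n0..n. b j * F c $$ j)"
      by (simp add: pairing_def fls_nth_sum)
    also have "\<dots> = (\<Sum>j=n0..n. b j * (\<Sum>c\<in>C. F c) $$ j)"
      by (subst sum.swap) (simp add: fls_nth_sum sum_distrib_left)
    also have "\<dots> = 0"
    proof (rule b(3))
      show "fls_nth (\<Sum>c\<in>C. F c) \<in> A" using F unfolding A_def by blast
    qed (simp add: fls_nth_sum low)
    finally show "pairing F B $$ 0 = 0" .
  qed
  moreover have "(\<Sum>c\<in>C. B c) $$ i = 0" if "i < - n" for i
    using Blow[OF that] by (simp add: fls_nth_sum)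
  moreover have "(\<Sum>c\<in>C. B c) $$ (- n) \<noteq> 0"
  proof -
    have "B c $$ (- n) = (if c = c0 then 1 / w c0 else 0)" if c: "c \<in> C" for c
    proof (cases "c = c0")
      case True
      then show ?thesis using c0 b(1) by (simp add: B_nth cong_minus_minus_iff)
    next
      case False
      have "\<not> [- n = - c] (mod int N)"
        using pos.dist[OF c c0(1)] c0(2) False cong_trans cong_sym cong_minus_minus_iff by metis
      then show ?thesis using False by (simp add: B_nth)
    qed
    then have "(\<Sum>c\<in>C. B c) $$ (- n) = (\<Sum>c\<in>C. if c = c0 then 1 / w c0 else 0)"
      unfolding fls_nth_sum by (intro sum.cong refl) auto
    also have "\<dots> = 1 / w c0" using c0 pos.fin by simp
    finally show ?thesis using pos.w_nonzero[OF c0(1)] by simp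
  qed
  ultimately show ?thesis by blast
qed

end

section \<open>Gauss sums and quadratic symbols\<close>

definition root_exp :: "nat \<Rightarrow> int \<Rightarrow> complex" where
  "root_exp d n = exp (2 * of_real pi * \<i> * of_int n / of_nat d)"

lemma root_exp_0 [simp]: "root_exp d 0 = 1"
  by (simp add: root_exp_def)

lemma root_exp_add: "root_exp d (m + n) = root_exp d m * root_exp d n"
  by (simp add: root_exp_def ring_distribs add_divide_distrib exp_add)

lemma root_exp_nonzero [simp]: "root_exp d n \<noteq> 0"
  by (simp add: root_exp_def)

lemma root_exp_minus: "root_exp d (- n) = inverse (root_exp d n)"
  by (simp add: root_exp_def exp_minus)

lemma root_exp_cong:
  assumes "d > 0" "[m = n] (mod int d)"
  shows "root_exp d m = root_exp d n"
proof -
  interpret q_width d by standard (rule assms)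
  show ?thesis using exp_cong_mod[OF assms(2)] by (simp add: root_exp_def)
qed

lemma root_exp_eq_iff:
  assumes "d > 0"
  shows "root_exp d m = root_exp d n \<longleftrightarrow> [m = n] (mod int d)"
proof -
  interpret q_width d by standard (rule assms)
  show ?thesis using exp_mod_eq_iff by (simp add: root_exp_def)
qed

lemma root_exp_mult_cancel: "k > 0 \<Longrightarrow> root_exp (d * k) (n * int k) = root_exp d n"
  by (simp add: root_exp_def mult.assoc)

lemma sum_mod_reindex:
  fixes f :: "int \<Rightarrow> 'b::comm_monoid_add"
  assumes d: "d > 0" and f: "\<And>x y. [x = y] (mod int d) \<Longrightarrow> f x = f y"
    and g: "\<And>x y. [g x = g y] (mod int d) \<Longrightarrow> [x = y] (mod int d)"
  shows "(\<Sum>x=0..<int d. f (g x)) = (\<Sum>x=0..<int d. f x)"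
proof -
  have inj: "inj_on (\<lambda>x. g x mod int d) {0..<int d}"
  proof (rule inj_onI)
    fix x y assume "x \<in> {0..<int d}" "y \<in> {0..<int d}" "g x mod int d = g y mod int d"
    then show "x = y" using g[of x y] by (auto simp: cong_def)
  qed
  have "(\<lambda>x. g x mod int d) ` {0..<int d} = {0..<int d}"
    by (rule endo_inj_surj[OF _ _ inj]) (use d in auto)
  then have "(\<Sum>x=0..<int d. f x) = (\<Sum>x=0..<int d. f (g x mod int d))"
    using sum.reindex[OF inj, of f] by (simp add: o_def)
  also have "\<dots> = (\<Sum>x=0..<int d. f (g x))"
    by (intro sum.cong refl f) (simp add: cong_def)
  finally show ?thesis ..
qed

text \<open>The Chinese remainder theorem in the form \<open>x = n y + m z\<close>.\<close>

lemma sum_mod_product: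
  fixes f :: "int \<Rightarrow> 'b::comm_monoid_add"
  assumes d: "m > 0" "n > 0" "coprime m n" and f: "\<And>x y. [x = y] (mod int (m * n)) \<Longrightarrow> f x = f y"
  shows "(\<Sum>x=0..<int (m * n). f x) = (\<Sum>y=0..<int m. \<Sum>z=0..<int n. f (int n * y + int m * z))"
proof -
  let ?h = "\<lambda>(y, z). (int n * y + int m * z) mod int (m * n)"
  have inj: "inj_on ?h ({0..<int m} \<times> {0..<int n})"
  proof (rule inj_onI, clarify)
    fix y z y' z' assume r: "y \<in> {0..<int m}" "z \<in> {0..<int n}" "y' \<in> {0..<int m}" "z' \<in> {0..<int n}"
      and "(int n * y + int m * z) mod int (m * n) = (int n * y' + int m * z') mod int (m * n)"
    then have "int (m * n) dvd (int n * y + int m * z) - (int n * y' + int m * z')"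
      by (simp add: mod_eq_dvd_iff)
    then have D: "int m * int n dvd int n * (y - y') + int m * (z - z')" by (simp add: algebra_simps)
    have "int m dvd int n * (y - y')" using D
      by (metis dvd_add_times_triv_right_iff dvd_mult_left mult.commute)
    then have "int m dvd y - y'" using d(3) by (simp add: coprime_dvd_mult_right_iff)
    then have "[y = y'] (mod int m)" by (simp add: cong_iff_dvd_diff)
    then have "y = y'" using r by (auto simp: cong_def)
    have "int n dvd int m * (z - z')" using D
      by (metis dvd_add_times_triv_left_iff dvd_mult_right mult.commute)
    then have "int n dvd z - z'" using d(3) by (simp add: coprime_dvd_mult_right_iff coprime_commute)
    then have "[z = z'] (mod int n)" by (simp add: cong_iff_dvd_diff)
    then have "z = z'" using r by (auto simp: cong_def)
    with \<open>y = y'\<close> show "y = y' \<and> z = z'" by simp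
  qed
  have "?h ` ({0..<int m} \<times> {0..<int n}) = {0..<int (m * n)}"
  proof (rule card_subset_eq)
    show "?h ` ({0..<int m} \<times> {0..<int n}) \<subseteq> {0..<int (m * n)}" using d by auto
    show "card (?h ` ({0..<int m} \<times> {0..<int n})) = card {0..<int (m * n)}"
      unfolding card_image[OF inj] by (simp add: nat_mult_distrib)
  qed simp
  then have "(\<Sum>x=0..<int (m * n). f x) = (\<Sum>p\<in>{0..<int m} \<times> {0..<int n}. f (?h p))"
    using sum.reindex[OF inj, of f] by (simp add: o_def)
  also have "\<dots> = (\<Sum>(y, z)\<in>{0..<int m} \<times> {0..<int n}. f (int n * y + int m * z))"
    by (intro sum.cong refl) (auto intro!: f simp: cong_def)
  finally show ?thesis by (simp add: sum.cartesian_product)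
qed

lemma sum_root_exp:
  assumes d: "d > 0"
  shows "(\<Sum>x=0..<int d. root_exp d (k * x)) = (if int d dvd k then of_nat d else 0)"
proof (cases "int d dvd k")
  case True
  then have "root_exp d (k * x) = 1" for x
    using root_exp_cong[OF d, of "k * x" 0] by (simp add: cong_0_iff)
  then show ?thesis using True by simp
next
  case False
  let ?S = "\<Sum>x=0..<int d. root_exp d (k * x)"
  have "?S = (\<Sum>x=0..<int d. root_exp d (k * (x + 1)))"
  proof (rule sum_mod_reindex[OF d, where f="\<lambda>x. root_exp d (k * x)" and g="\<lambda>x. x + 1", symmetric])
    show "root_exp d (k * x) = root_exp d (k * y)" if "[x = y] (mod int d)" for x y
      using that by (intro root_exp_cong[OF d] cong_mult) auto
    show "[x = y] (mod int d)" if "[x + 1 = y + 1] (mod int d)" for x y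
      using that by (simp add: cong_add_rcancel)
  qed
  also have "\<dots> = root_exp d k * ?S"
    by (simp add: ring_distribs root_exp_add sum_distrib_left mult.commute)
  finally have "(root_exp d k - 1) * ?S = 0" by (simp add: algebra_simps)
  moreover have "root_exp d k \<noteq> 1"
    using root_exp_eq_iff[OF d, of k 0] False by (simp add: cong_0_iff)
  ultimately show ?thesis using False by simp
qed

definition gauss_sum :: "nat \<Rightarrow> int \<Rightarrow> complex" where
  "gauss_sum m a = (\<Sum>x=0..<int m. root_exp m (a * x^2))"

text \<open>With \<open>x = n y + m z\<close> the mixed term of \<open>x^2\<close> is divisible by
  \<open>m n\<close>.\<close>

lemma gauss_sum_product:
  assumes "m > 0" "n > 0" "coprime m n"
  shows "gauss_sum (m * n) a = gauss_sum m (a * int n) * gauss_sum n (a * int m)"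
proof -
  have "gauss_sum (m * n) a = (\<Sum>y=0..<int m. \<Sum>z=0..<int n. root_exp (m * n) (a * (int n * y + int m * z)^2))"
    unfolding gauss_sum_def
  proof (rule sum_mod_product[OF assms, where f="\<lambda>x. root_exp (m * n) (a * x^2)"])
    show "root_exp (m * n) (a * x^2) = root_exp (m * n) (a * y^2)" if "[x = y] (mod int (m * n))" for x y
      using that assms by (intro root_exp_cong cong_mult cong_pow) auto
  qed
  also have "\<dots> = (\<Sum>y=0..<int m. \<Sum>z=0..<int n. root_exp m (a * int n * y^2) * root_exp n (a * int m * z^2))"
  proof (intro sum.cong refl)
    fix y z
    have "[a * (int n * y + int m * z)^2 = (a * int n * y^2) * int n + (a * int m * z^2) * int m] (mod int (m * n))"
      unfolding cong_iff_dvd_diff by (intro dvdI[of _ _ "2 * a * y * z"]) (simp add: power2_eq_square algebra_simps)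
    then have "root_exp (m * n) (a * (int n * y + int m * z)^2)
        = root_exp (m * n) ((a * int n * y^2) * int n) * root_exp (m * n) ((a * int m * z^2) * int m)"
      unfolding root_exp_add[symmetric] using assms by (intro root_exp_cong) auto
    also have "root_exp (m * n) ((a * int n * y^2) * int n) = root_exp m (a * int n * y^2)"
      by (rule root_exp_mult_cancel[OF assms(2)])
    also have "root_exp (m * n) ((a * int m * z^2) * int m) = root_exp n (a * int m * z^2)"
      using root_exp_mult_cancel[OF assms(1), of n "a * int m * z^2"] by (simp only: mult.commute[of n m])
    finally show "root_exp (m * n) (a * (int n * y + int m * z)^2) = root_exp m (a * int n * y^2) * root_exp n (a * int m * z^2)" .
  qed
  finally show ?thesis
    by (simp add: gauss_sum_def sum_product)
qed

lemma gauss_sum_square: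
  assumes "m > 0" "coprime t (int m)" "[j = t^2] (mod int m)"
  shows "gauss_sum m (a * j) = gauss_sum m a"
proof -
  have "gauss_sum m a = (\<Sum>x=0..<int m. root_exp m (a * (t * x)^2))"
    unfolding gauss_sum_def
  proof (rule sum_mod_reindex[OF assms(1), where f="\<lambda>x. root_exp m (a * x^2)" and g="\<lambda>x. t * x", symmetric])
    show "root_exp m (a * x^2) = root_exp m (a * y^2)" if "[x = y] (mod int m)" for x y
      using that assms by (intro root_exp_cong cong_mult cong_pow) auto
    show "[x = y] (mod int m)" if "[t * x = t * y] (mod int m)" for x y
      using that assms(2) by (simp add: cong_mult_lcancel)
  qed
  also have "\<dots> = gauss_sum m (a * j)"
    unfolding gauss_sum_def
  proof (intro sum.cong refl root_exp_cong assms)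
    fix x
    have "[a * (t * x)^2 = a * (t^2 * x^2)] (mod int m)" by (simp add: power_mult_distrib)
    also have "[a * (t^2 * x^2) = a * (j * x^2)] (mod int m)"
      using assms(3) cong_sym by (intro cong_mult) auto
    finally show "[a * (t * x)^2 = a * j * x^2] (mod int m)" by (simp add: mult_ac)
  qed
  finally show ?thesis ..
qed

section \<open>Legendre symbols and Gauss sums\<close>

lemma Legendre_values: "Legendre a p \<in> {-1, 0, 1}"
  by (simp add: Legendre_def)

lemma Legendre_cong: "[a = b] (mod p) \<Longrightarrow> Legendre a p = Legendre b p"
  by (simp add: Legendre_def QuadRes_def cong_def)

lemma Legendre_eq_0_iff: "Legendre a p = 0 \<longleftrightarrow> p dvd a"
  by (simp add: Legendre_def cong_0_iff)

lemma Legendre_mult: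
  assumes "prime p" "2 < p"
  shows "Legendre (a * b) (int p) = Legendre a (int p) * Legendre b (int p)"
proof -
  have "[Legendre (a * b) (int p) = (a * b) ^ ((p - 1) div 2)] (mod int p)"
    by (rule euler_criterion[OF assms])
  moreover have "[Legendre a (int p) * Legendre b (int p) = a ^ ((p - 1) div 2) * b ^ ((p - 1) div 2)] (mod int p)"
    by (intro cong_mult euler_criterion assms)
  ultimately have "[Legendre (a * b) (int p) = Legendre a (int p) * Legendre b (int p)] (mod int p)"
    by (metis cong_sym cong_trans power_mult_distrib)
  then have "int p dvd Legendre (a * b) (int p) - Legendre a (int p) * Legendre b (int p)"
    by (simp add: cong_iff_dvd_diff)
  moreover have "\<bar>Legendre (a * b) (int p) - Legendre a (int p) * Legendre b (int p)\<bar> \<le> 2"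
    using Legendre_values[of "a * b" "int p"] Legendre_values[of a "int p"] Legendre_values[of b "int p"] by auto
  ultimately have "Legendre (a * b) (int p) - Legendre a (int p) * Legendre b (int p) = 0"
    using assms(2) zdvd_imp_le[of "int p" "\<bar>Legendre (a * b) (int p) - Legendre a (int p) * Legendre b (int p)\<bar>"]
    by force
  then show ?thesis by simp
qed

lemma Legendre_1I: "Legendre a p = 1 \<Longrightarrow> \<exists>t. [a = t^2] (mod p)"
proof -
  assume "Legendre a p = 1"
  then have "QuadRes p a" by (simp add: Legendre_def split: if_splits)
  then obtain y where "[y^2 = a] (mod p)" unfolding QuadRes_def by blast
  then show ?thesis using cong_sym by blast
qed

lemma prime_dvd_square:
  assumes "prime p" shows "int p dvd a^2 \<longleftrightarrow> int p dvd a"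
  using assms by (simp add: prime_dvd_power_iff)

lemma Legendre_square_prime:
  assumes "prime p" "\<not> int p dvd a"
  shows "Legendre (a^2) (int p) = 1"
proof -
  have "QuadRes (int p) (a^2)" unfolding QuadRes_def by (rule exI[of _ a]) (rule cong_refl)
  then show ?thesis using assms by (simp add: Legendre_def cong_0_iff prime_dvd_square)
qed

lemma coprime_int_prime:
  assumes "prime p"
  shows "coprime a (int p) \<longleftrightarrow> \<not> int p dvd a"
proof
  assume c: "coprime a (int p)"
  show "\<not> int p dvd a"
  proof
    assume "int p dvd a"
    then have "is_unit (int p)" using coprime_common_divisor[OF c _ dvd_refl] by simp
    then show False using assms not_prime_unit[of "int p"] by simp
  qed
next
  assume "\<not> int p dvd a"
  then show "coprime a (int p)"
    using prime_imp_coprime[of "int p" a] assms by (simp add: coprime_commute)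
qed

text \<open>On units the sum depends only on the quadratic character of its argument. Its Fourier
  coefficients in the argument count square roots: the coefficient at 0 makes the values at residues
  and nonresidues opposite, and the coefficient at 1 keeps them from being zero, since 1 has two
  square roots.\<close>

lemma gauss_sum_prime:
  assumes p: "prime p" "2 < p" and a: "\<not> int p dvd a"
  shows "gauss_sum p a = of_int (Legendre a (int p)) * gauss_sum p 1" and "gauss_sum p a \<noteq> 0"
proof -
  have p0: "p > 0" using p by simp
  have cg: "gauss_sum p x = gauss_sum p y" if "[x = y] (mod int p)" for x y
    unfolding gauss_sum_def using that by (intro sum.cong refl root_exp_cong p0 cong_mult) auto
  have res: "gauss_sum p (x * y) = gauss_sum p x" if y: "Legendre y (int p) = 1" for x y
  proof -
    obtain t where t: "[y = t^2] (mod int p)" using Legendre_1I[OF y] by blast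
    have "\<not> int p dvd y" using y Legendre_eq_0_iff[of y "int p"] by simp
    then have "\<not> int p dvd t^2" using t cong_dvd_iff by blast
    then have "coprime t (int p)" using p by (simp add: coprime_int_prime prime_dvd_square)
    from gauss_sum_square[OF p0 this t] show ?thesis .
  qed
  have total: "(\<Sum>x=0..<int p. gauss_sum p x * root_exp p (- (k * x))) = of_nat p * of_nat (card {y\<in>{0..<int p}. int p dvd y^2 - k})" for k
  proof -
    have "(\<Sum>x=0..<int p. gauss_sum p x * root_exp p (- (k * x))) = (\<Sum>y=0..<int p. \<Sum>x=0..<int p. root_exp p ((y^2 - k) * x))"
      unfolding gauss_sum_def sum_distrib_right
      by (subst sum.swap, intro sum.cong refl) (simp add: algebra_simps flip: root_exp_add)
    also have "\<dots> = (\<Sum>y=0..<int p. if int p dvd y^2 - k then of_nat p else 0)"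
      by (intro sum.cong refl sum_root_exp p0)
    also have "\<dots> = of_nat p * of_nat (card {y\<in>{0..<int p}. int p dvd y^2 - k})"
      by (simp add: sum.If_cases Int_def)
    finally show ?thesis .
  qed
  have split0: "{0..<int p} = insert 0 {1..<int p}" using p by auto
  have g0: "gauss_sum p 0 = of_nat p" by (simp add: gauss_sum_def)
  have nd: "\<not> int p dvd x" if "x \<in> {1..<int p}" for x using that zdvd_not_zless by auto
  have nr: "gauss_sum p 1 + gauss_sum p n = 0" if n: "Legendre n (int p) = - 1" for n
  proof -
    have nn: "\<not> int p dvd n" using n Legendre_eq_0_iff[of n "int p"] by simp
    have cn: "coprime n (int p)" using nn p by (simp add: coprime_int_prime)
    \<comment> \<open>Multiplication by \<open>n\<close> exchanges the two square classes, so the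
      sum of the two values does not depend on the unit \<open>x\<close>.\<close>
    have c: "gauss_sum p x + gauss_sum p (n * x) = gauss_sum p 1 + gauss_sum p n" if "x \<in> {1..<int p}" for x
    proof (cases "Legendre x (int p) = 1")
      case True
      then show ?thesis using res[of x 1] res[of x n] by simp
    next
      case False
      then have x: "Legendre x (int p) = - 1"
        using Legendre_values[of x "int p"] nd[OF that] Legendre_eq_0_iff[of x "int p"] by auto
      have "Legendre (n * x) (int p) = 1" using n x Legendre_mult[OF p] by simp
      then have "gauss_sum p (n * x) = gauss_sum p 1" "gauss_sum p (n * (n * x)) = gauss_sum p n"
        using res[of "n * x" 1] res[of "n * x" n] by simp_all
      moreover have "gauss_sum p (x * n^2) = gauss_sum p x"
        by (rule gauss_sum_square[OF p0 cn]) simp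
      then have "gauss_sum p (n * (n * x)) = gauss_sum p x" by (simp add: power2_eq_square mult_ac)
      ultimately show ?thesis by simp
    qed
    have t0: "(\<Sum>x=0..<int p. gauss_sum p x) = of_nat p"
    proof -
      have "{y\<in>{0..<int p}. int p dvd y^2 - 0} = {0}"
        using p nd by (auto simp: prime_dvd_square split0)
      then show ?thesis using total[of 0] by simp
    qed
    have "(\<Sum>x=0..<int p. gauss_sum p (n * x)) = (\<Sum>x=0..<int p. gauss_sum p x)"
      by (rule sum_mod_reindex[OF p0 cg]) (use cn in \<open>auto simp: cong_mult_lcancel\<close>)
    with t0 have "(\<Sum>x=0..<int p. gauss_sum p x + gauss_sum p (n * x)) = 2 * of_nat p"
      by (simp add: sum.distrib)
    moreover have "(\<Sum>x=0..<int p. gauss_sum p x + gauss_sum p (n * x)) = 2 * of_nat p + (of_nat p - 1) * (gauss_sum p 1 + gauss_sum p n)"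
    proof -
      have "(\<Sum>x\<in>{1..<int p}. gauss_sum p x + gauss_sum p (n * x)) = (of_nat p - 1) * (gauss_sum p 1 + gauss_sum p n)"
        using c p by (simp add: of_nat_diff)
      then show ?thesis unfolding split0 by (simp add: g0)
    qed
    ultimately have "(of_nat p - 1 :: complex) * (gauss_sum p 1 + gauss_sum p n) = 0" by simp
    moreover have "(of_nat p :: complex) \<noteq> of_nat 1" unfolding of_nat_eq_iff using p by simp
    ultimately show ?thesis by simp
  qed
  have leg: "gauss_sum p x = of_int (Legendre x (int p)) * gauss_sum p 1" if "\<not> int p dvd x" for x
  proof (cases "Legendre x (int p) = 1")
    case True
    then show ?thesis using res[of x 1] by simp
  next
    case False
    then have "Legendre x (int p) = - 1"
      using Legendre_values[of x "int p"] that Legendre_eq_0_iff[of x "int p"] by auto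
    then show ?thesis using nr[of x] by (simp add: add_eq_0_iff)
  qed
  show 1: "gauss_sum p a = of_int (Legendre a (int p)) * gauss_sum p 1" by (rule leg[OF a])
  have "gauss_sum p 1 \<noteq> 0"
  proof
    assume "gauss_sum p 1 = 0"
    then have "gauss_sum p x = 0" if "x \<in> {1..<int p}" for x using leg[OF nd[OF that]] by simp
    then have "(\<Sum>x=0..<int p. gauss_sum p x * root_exp p (- (1 * x))) = of_nat p"
      unfolding split0 by (simp add: g0)
    then have "of_nat p * of_nat (card {y\<in>{0..<int p}. int p dvd y^2 - 1}) = (of_nat p :: complex)"
      unfolding total .
    then have "of_nat (p * card {y\<in>{0..<int p}. int p dvd y^2 - 1}) = (of_nat p :: complex)" by simp
    then have "p * card {y\<in>{0..<int p}. int p dvd y^2 - 1} = p" unfolding of_nat_eq_iff .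
    then have "card {y\<in>{0..<int p}. int p dvd y^2 - 1} = 1" using p0 by simp
    moreover have "{1, int p - 1} \<subseteq> {y\<in>{0..<int p}. int p dvd y^2 - 1}"
    proof -
      have "(int p - 1)^2 - 1 = int p * (int p - 2)" by (simp add: power2_eq_square algebra_simps)
      then show ?thesis using p by auto
    qed
    then have "card {1, int p - 1} \<le> card {y\<in>{0..<int p}. int p dvd y^2 - 1}"
      by (rule card_mono[OF finite_subset[of _ "{0..<int p}"], rotated 2]) auto
    ultimately show False using p by simp
  qed
  then show "gauss_sum p a \<noteq> 0"
    using 1 a Legendre_eq_0_iff[of a "int p"] by simp
qed

text \<open>The Jacobi symbol for squarefree \<open>m\<close>; each prime counts once, in contrast
  to \<open>jacobi\<close>.\<close>

definition legendre_prod :: "int \<Rightarrow> nat \<Rightarrow> int" where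
  "legendre_prod a m = (\<Prod>p\<in>prime_factors m. Legendre a (int p))"

lemma odd_squarefree_induct [consumes 2, case_names one prime]:
  assumes "odd (m::nat)" "squarefree m" and one: "P 1"
    and step: "\<And>p n. prime p \<Longrightarrow> 2 < p \<Longrightarrow> odd n \<Longrightarrow> squarefree n \<Longrightarrow> coprime p n \<Longrightarrow> P n \<Longrightarrow> P (p * n)"
  shows "P m"
  using assms(1,2)
proof (induction m rule: less_induct)
  case (less m)
  have m0: "m > 0" using less.prems(1) by (cases m) auto
  show ?case
  proof (cases "m = 1")
    case False
    then obtain p where p: "prime p" "p dvd m" using prime_factor_nat by blast
    then obtain n where m: "m = p * n" by (elim dvdE)
    have n0: "n > 0" using m m0 by (cases n) auto
    have "coprime p n"
    proof (rule ccontr)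
      assume "\<not> coprime p n"
      then have "p dvd n" using prime_imp_coprime[OF p(1), of n] by blast
      then have "p^2 dvd m" unfolding m power2_eq_square by (rule mult_dvd_mono[OF dvd_refl])
      then show False using less.prems(2) p(1) by (auto simp: squarefree_def)
    qed
    moreover have "p \<noteq> 2" "odd n" using less.prems(1) m by auto
    moreover have "squarefree n" using less.prems(2) m squarefree_mono[of n m] by auto
    moreover have "n < m" using m n0 prime_gt_1_nat[OF p(1)] by simp
    ultimately show ?thesis
      using step[OF p(1)] less.IH[of n] prime_ge_2_nat[OF p(1)] m by simp
  qed (metis one)
qed

lemma prime_factors_prime_mult:
  fixes p n :: nat
  assumes "prime p" "coprime p n" "n > 0"
  shows "prime_factors (p * n) = insert p (prime_factors n)" "p \<notin> prime_factors n"
proof -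
  show "prime_factors (p * n) = insert p (prime_factors n)"
    using assms prime_gt_0_nat[OF assms(1)] by (simp add: prime_factors_product prime_prime_factors)
  show "p \<notin> prime_factors n"
  proof
    assume "p \<in> prime_factors n"
    then have "p dvd n" by (rule in_prime_factors_imp_dvd)
    then have "is_unit p" by (rule coprime_common_divisor[OF assms(2) dvd_refl])
    then show False using assms(1) not_prime_unit by blast
  qed
qed

lemma legendre_prod_prime_mult:
  assumes "prime p" "coprime p n" "n > 0"
  shows "legendre_prod a (p * n) = Legendre a (int p) * legendre_prod a n"
  using prime_factors_prime_mult[OF assms] by (simp add: legendre_prod_def)

text \<open>Multiplicativity reduces this to prime moduli, where each factor contributes its
  Legendre symbol.\<close>

lemma gauss_sum_twist:
  assumes "odd m" "squarefree m" "coprime a (int m)" "coprime j (int m)"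
  shows "gauss_sum m (a * j) = of_int (legendre_prod j m) * gauss_sum m a \<and> gauss_sum m a \<noteq> 0"
  using assms
proof (induction m arbitrary: a rule: odd_squarefree_induct)
  case one
  have "{0..<1::int} = {0}" by auto
  then show ?case by (simp add: gauss_sum_def legendre_prod_def)
next
  case (prime p n)
  have n0: "n > 0" using prime.hyps(3) by (cases n) auto
  have p0: "p > 0" using prime.hyps(2) by simp
  have nd: "\<not> int p dvd a" "\<not> int p dvd j"
    using prime.prems prime.hyps(1) by (auto simp: coprime_int_prime[symmetric])
  have pn: "\<not> int p dvd int n"
    using prime.hyps(1,5) coprime_int_prime[of p "int n"] by (simp add: coprime_commute)
  have pr: "prime (int p)" using prime.hyps(1) by simp
  have an: "\<not> int p dvd a * int n" "\<not> int p dvd a * int n * j"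
    using nd pn prime_dvd_mult_iff[OF pr] by auto
  have "gauss_sum p (a * j * int n) = of_int (Legendre (a * int n * j) (int p)) * gauss_sum p 1"
    using gauss_sum_prime(1)[OF prime.hyps(1,2) an(2)] by (simp add: mult_ac)
  also have "\<dots> = of_int (Legendre j (int p)) * gauss_sum p (a * int n)"
    using gauss_sum_prime(1)[OF prime.hyps(1,2) an(1)] Legendre_mult[OF prime.hyps(1,2), of "a * int n" j] by simp
  finally have 1: "gauss_sum p (a * j * int n) = of_int (Legendre j (int p)) * gauss_sum p (a * int n)" .
  have "coprime (a * int p) (int n)" "coprime j (int n)"
    using prime.prems prime.hyps(5) by auto
  from prime.IH[OF this] have 2: "gauss_sum n (a * j * int p) = of_int (legendre_prod j n) * gauss_sum n (a * int p)"
    "gauss_sum n (a * int p) \<noteq> 0" by (simp_all add: mult_ac)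
  show ?case
    unfolding gauss_sum_product[OF p0 n0 prime.hyps(5)] 1 2(1) legendre_prod_prime_mult[OF prime.hyps(1,5) n0]
    using 2(2) gauss_sum_prime(2)[OF prime.hyps(1,2) an(1)] by simp
qed

section \<open>Quadratic reciprocity for Jacobi symbols\<close>

definition sgn34 :: "nat \<Rightarrow> nat \<Rightarrow> int" where
  "sgn34 m n = (if m mod 4 = 3 \<and> n mod 4 = 3 then - 1 else 1)"

lemma sgn34_mult:
  assumes "odd n" "odd n'"
  shows "sgn34 m (n * n') = sgn34 m n * sgn34 m n'" "sgn34 (n * n') m = sgn34 n m * sgn34 n' m"
proof -
  have c: "n mod 4 = 1 \<or> n mod 4 = 3" "n' mod 4 = 1 \<or> n' mod 4 = 3" using assms by presburger+
  have "(n * n') mod 4 = (n mod 4) * (n' mod 4) mod 4" by (rule mod_mult_eq[symmetric])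
  then have p: "(n * n') mod 4 = (if n mod 4 = n' mod 4 then 1 else 3)"
    using c by (elim disjE) simp_all
  show "sgn34 m (n * n') = sgn34 m n * sgn34 m n'" "sgn34 (n * n') m = sgn34 n m * sgn34 n' m"
    unfolding sgn34_def p using c by (elim disjE; simp)+
qed

lemma Legendre_reciprocity:
  assumes "prime p" "2 < p" "prime q" "2 < q" "p \<noteq> q"
  shows "Legendre (int p) (int q) = sgn34 p q * Legendre (int q) (int p)"
proof -
  have "(- 1 :: int) ^ ((p - 1) div 2 * ((q - 1) div 2)) = sgn34 p q"
  proof -
    have o: "odd p" "odd q" using assms prime_odd_nat by auto
    then have "even ((p - 1) div 2) \<longleftrightarrow> p mod 4 \<noteq> 3" "even ((q - 1) div 2) \<longleftrightarrow> q mod 4 \<noteq> 3" by presburger+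
    then show ?thesis by (simp add: sgn34_def minus_one_power_iff)
  qed
  then have "Legendre (int p) (int q) * Legendre (int q) (int p) = sgn34 p q"
    using Quadratic_Reciprocity[OF assms] by simp
  moreover have "\<not> int p dvd int q" using assms primes_dvd_imp_eq by auto
  then have "Legendre (int q) (int p) \<in> {1, - 1}"
    using Legendre_values[of "int q" "int p"] Legendre_eq_0_iff[of "int q" "int p"] by auto
  ultimately show ?thesis by auto
qed

definition jacobi :: "int \<Rightarrow> nat \<Rightarrow> int" where
  "jacobi a n = (\<Prod>p\<in>prime_factors n. Legendre a (int p) ^ multiplicity p n)"

lemma jacobi_eq_prod_mset:
  "jacobi a n = prod_mset (image_mset (\<lambda>p. Legendre a (int p)) (prime_factorization n))"
  unfolding jacobi_def image_prod_mset_multiplicity by (simp add: count_prime_factorization_prime prime_factors_multiplicity)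

lemma jacobi_prime_mult:
  assumes "prime p" "n > 0"
  shows "jacobi a (p * n) = Legendre a (int p) * jacobi a n"
  using assms prime_gt_0_nat[OF assms(1)]
  by (simp add: jacobi_eq_prod_mset prime_factorization_mult prime_factorization_prime)

lemma odd_nat_prime_induct [consumes 1, case_names one prime]:
  assumes "odd (m::nat)" and one: "P 1"
    and step: "\<And>p n. prime p \<Longrightarrow> 2 < p \<Longrightarrow> odd n \<Longrightarrow> P n \<Longrightarrow> P (p * n)"
  shows "P m"
  using assms(1)
proof (induction m rule: less_induct)
  case (less m)
  show ?case
  proof (cases "m = 1")
    case False
    then obtain p where p: "prime p" "p dvd m" using prime_factor_nat by blast
    then obtain n where m: "m = p * n" by (elim dvdE)
    have "n > 0" using m less.prems by (cases n) auto
    moreover have "p \<noteq> 2" "odd n" using less.prems m by auto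
    ultimately show ?thesis
      using step[OF p(1)] less.IH[of n] prime_ge_2_nat[OF p(1)] prime_gt_1_nat[OF p(1)] m by simp
  qed (metis one)
qed

lemma jacobi_mult:
  assumes "odd n"
  shows "jacobi (a * b) n = jacobi a n * jacobi b n"
  using assms
proof (induction n rule: odd_nat_prime_induct)
  case (prime p n)
  then have "n > 0" by (cases n) auto
  with prime show ?case by (simp add: jacobi_prime_mult Legendre_mult)
qed (simp add: jacobi_def)

lemma jacobi_square:
  assumes "odd n" "coprime a (int n)"
  shows "jacobi (a^2) n = 1"
  using assms
proof (induction n rule: odd_nat_prime_induct)
  case (prime p n)
  then have n: "n > 0" by (cases n) auto
  have "\<not> int p dvd a" using prime by (auto simp: coprime_int_prime[symmetric])
  with prime n show ?case by (simp add: jacobi_prime_mult Legendre_square_prime)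
qed (simp add: jacobi_def)

lemma jacobi_prime_reciprocity:
  assumes "odd n" "prime p" "2 < p" "coprime p n"
  shows "jacobi (int p) n = sgn34 p n * Legendre (int n) (int p)"
  using assms(1,4)
proof (induction n rule: odd_nat_prime_induct)
  case one
  have "Legendre 1 (int p) = 1" using Legendre_square_prime[OF assms(2), of 1] assms(3) by simp
  then show ?case by (simp add: jacobi_def sgn34_def)
next
  case (prime q n)
  then have n: "n > 0" by (cases n) auto
  have "p \<noteq> q" using prime assms(2) by auto
  then have "Legendre (int p) (int q) = sgn34 p q * Legendre (int q) (int p)"
    using Legendre_reciprocity[OF assms(2,3)] prime.hyps by blast
  moreover have "odd q" using prime.hyps prime_odd_nat by auto
  ultimately show ?case
    using prime n Legendre_mult[OF assms(2,3), of "int q" "int n"]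
    by (simp add: jacobi_prime_mult sgn34_mult)
qed

lemma jacobi_reciprocity:
  assumes "odd m" "squarefree m" "odd n" "coprime m n"
  shows "jacobi (int m) n = sgn34 m n * legendre_prod (int n) m"
  using assms(1,2,4)
proof (induction m rule: odd_squarefree_induct)
  case one
  have "jacobi 1 n = 1" using jacobi_square[OF assms(3), of 1] by simp
  then show ?case by (simp add: legendre_prod_def sgn34_def)
next
  case (prime p m)
  then have m: "m > 0" by (cases m) auto
  have "odd p" using prime prime_odd_nat by auto
  with prime m assms(3) show ?case
    by (simp add: jacobi_mult jacobi_prime_reciprocity legendre_prod_prime_mult sgn34_mult)
qed

section \<open>Square roots modulo \<open>4 M\<close>\<close>

lemma square_mod_4: "(x::int)^2 mod 4 = 0 \<or> x^2 mod 4 = 1"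
proof (cases "even x")
  case True then show ?thesis by (auto elim!: evenE simp: power2_eq_square)
next
  case False
  then obtain k where "x = 2 * k + 1" by (auto elim: oddE)
  then have "x^2 = 1 + 4 * (k * k + k)" by (simp add: power2_eq_square algebra_simps)
  then show ?thesis by (simp only: mod_mult_self2) simp
qed

lemma coprime_4_odd: "odd m \<Longrightarrow> coprime (4::nat) m"
  using coprime_power_left_iff[of 2 2 m] by simp

lemma coprime_4_mult_odd:
  assumes "coprime v (int (4 * m))"
  shows "odd v"
proof -
  have "coprime v 2" by (rule coprime_divisors[OF dvd_refl _ assms]) simp
  then show ?thesis by (simp add: coprime_right_2_iff_odd)
qed

lemma odd_prime_divisor:
  assumes "odd m" "prime p" "p dvd (m::nat)"
  shows "2 < p"
  using assms prime_ge_2_nat[of p] by (cases "p = 2") auto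

text \<open>Shifting \<open>y\<close> by \<open>2 M k\<close> changes \<open>y^2\<close> by
  \<open>4 M (k y + M k^2)\<close>, so norms are well defined on residues modulo
  \<open>2 M\<close>.\<close>

lemma cong_square_mod_4M:
  assumes "[x = y] (mod int (2 * M))"
  shows "[x^2 = y^2] (mod int (4 * M))"
proof -
  obtain k where "x - y = int (2 * M) * k" using assms by (auto simp: cong_iff_dvd_diff)
  then have "x = y + 2 * int M * k" by simp
  then have "x^2 - y^2 = int (4 * M) * (k * y + int M * k^2)"
    by (simp add: power2_eq_square algebra_simps)
  then show ?thesis by (simp add: cong_iff_dvd_diff)
qed

text \<open>Multiplication by \<open>\<rho>\<close> is an automorphism of the form that carries
  \<open>x\<close> to \<open>x'\<close>: it is 1 at the odd primes where \<open>x\<close> and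
  \<open>x'\<close> agree and \<open>- 1\<close> at the others. Squarefreeness makes these two parts
  of \<open>M\<close> coprime.\<close>

lemma square_root_unit:
  fixes x x' :: int
  assumes M: "odd M" "squarefree M" and sq: "[x^2 = x'^2] (mod int (4 * M))"
  obtains \<rho> where "coprime \<rho> (int (2 * M))" "odd \<rho>" "[\<rho>^2 = 1] (mod int (4 * M))" "[x' = \<rho> * x] (mod int (2 * M))"
proof -
  define M1 where "M1 = nat (gcd (int M) (x - x'))"
  have M0: "M > 0" using M(1) by (cases M) auto
  have M1: "int M1 = gcd (int M) (x - x')" by (simp add: M1_def)
  have M1d: "M1 dvd M" using M1 by (metis gcd_dvd1 int_dvd_int_iff)
  then obtain M2 where M2: "M = M1 * M2" by (elim dvdE)
  have pos: "M1 > 0" "M2 > 0" using M2 M0 by auto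
  obtain z where z: "x - x' = int M1 * z" using M1 by (metis dvdE gcd_dvd2)
  have cop: "coprime M1 M2"
  proof (rule coprimeI)
    fix e assume "e dvd M1" "e dvd M2"
    then have "e^2 dvd M" unfolding M2 power2_eq_square by (rule mult_dvd_mono)
    then show "is_unit e" using M(2) by (auto simp: squarefree_def)
  qed
  have cz: "coprime (int M2) z"
  proof -
    have "int M1 * gcd (int M2) z = int M1 * 1"
      using M1 gcd_mult_distrib_int[of "int M1" "int M2" z] by (simp add: M2 z)
    then show ?thesis using pos by (simp add: coprime_iff_gcd_eq_1)
  qed
  have d4: "int (4 * M) dvd (x - x') * (x + x')"
    using sq by (simp add: cong_iff_dvd_diff power2_eq_square algebra_simps)
  then have "int M dvd (x - x') * (x + x')" by (rule dvd_trans[rotated]) simp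
  then have "int M1 * int M2 dvd int M1 * (z * (x + x'))" by (simp add: M2 z mult.assoc)
  then have "int M2 dvd z * (x + x')" using pos by simp
  then have dM2: "int M2 dvd x + x'" using cz by (simp add: coprime_dvd_mult_right_iff)
  have par: "even (x - x')"
  proof -
    have "even ((x - x') * (x + x'))" using d4 by (rule dvd_trans[rotated]) simp
    then show ?thesis by auto
  qed
  have oM: "odd M1" "odd M2" using M(1) M2 by auto
  have c4: "coprime (4 * int M1) (int M2)"
  proof -
    have "coprime (2 * 2 :: int) (int M2)" using oM by (simp only: coprime_mult_left_iff) (simp add: coprime_commute coprime_right_2_iff_odd)
    then show ?thesis using cop by simp
  qed
  \<comment> \<open>The choice 1 modulo 4 is harmless, because \<open>x\<close> and
    \<open>x'\<close> have the same parity.\<close>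
  obtain \<rho> where \<rho>: "[\<rho> = 1] (mod (4 * int M1))" "[\<rho> = - 1] (mod (int M2))"
    using binary_chinese_remainder_int[OF c4, of 1 "- 1"] by blast
  have MM: "int (4 * M) = (4 * int M1) * int M2" "int (2 * M) = (2 * int M1) * int M2"
    by (simp_all add: M2)
  have r2: "[\<rho>^2 = 1] (mod int (4 * M))"
    unfolding MM(1)
  proof (rule coprime_cong_mult[OF _ _ c4])
    show "[\<rho>^2 = 1] (mod (4 * int M1))" using cong_pow[OF \<rho>(1), of 2] by simp
    show "[\<rho>^2 = 1] (mod (int M2))" using cong_pow[OF \<rho>(2), of 2] by simp
  qed
  have odd\<rho>: "odd \<rho>"
  proof -
    have "4 dvd \<rho> - 1" using \<rho>(1) by (auto simp: cong_iff_dvd_diff intro: dvd_mult_left)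
    then show ?thesis by presburger
  qed
  have c2: "coprime (2 * int M1) (int M2)" using c4 by (auto simp: coprime_mult_left_iff)
  have xr: "[x' = \<rho> * x] (mod int (2 * M))"
    unfolding MM(2)
  proof (rule coprime_cong_mult[OF _ _ c2])
    have "2 * int M1 dvd x - x'"
      using par z oM(1) by (simp add: divides_mult coprime_left_2_iff_odd)
    then have "[x' = 1 * x] (mod (2 * int M1))" by (simp add: cong_iff_dvd_diff dvd_diff_commute)
    moreover have "[\<rho> = 1] (mod (2 * int M1))"
      using \<rho>(1) by (auto simp: cong_iff_dvd_diff intro: dvd_trans[rotated])
    then have "[1 * x = \<rho> * x] (mod (2 * int M1))" by (intro cong_mult cong_refl) (rule cong_sym)
    ultimately show "[x' = \<rho> * x] (mod (2 * int M1))" by (rule cong_trans)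
    have "[x' = (- 1) * x] (mod (int M2))" using dM2 by (simp add: cong_iff_dvd_diff add.commute)
    moreover have "[(- 1) * x = \<rho> * x] (mod (int M2))" by (intro cong_mult cong_refl) (rule cong_sym[OF \<rho>(2)])
    ultimately show "[x' = \<rho> * x] (mod (int M2))" by (rule cong_trans)
  qed
  have "coprime \<rho> (int (2 * M))"
  proof -
    have "[\<rho> * \<rho> = 1] (mod int (2 * M))"
      using r2 by (auto simp: cong_iff_dvd_diff power2_eq_square intro: dvd_trans[rotated])
    then show ?thesis unfolding coprime_iff_invertible_int by (rule exI)
  qed
  from that[OF this odd\<rho> r2 xr] show ?thesis .
qed

lemma card_as_sum_int: "int (card {x\<in>A. Q x}) = (\<Sum>x\<in>A. if Q x then 1 else 0)" if "finite A"
  using that by (simp add: sum.If_cases Int_def)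

lemma s_num_alt: "s_num m c = card {e. e dvd m \<and> int e dvd c}"
  unfolding s_num_def by (rule arg_cong[where f=card]) auto

lemma finite_divisors_with: "m > 0 \<Longrightarrow> finite {e::nat. e dvd m \<and> Q e}"
  by (rule finite_subset[of _ "{..m}"]) (auto dest: dvd_imp_le)

lemma s_num_prime_mult:
  assumes "prime p" "coprime p m" "m > 0"
  shows "s_num (p * m) c = (if int p dvd c then 2 else 1) * s_num m c"
proof -
  let ?A = "{e. e dvd m \<and> int e dvd c}"
  have p0: "p > 0" using assms(1) prime_gt_0_nat by blast
  have copr: "coprime p e" if "e dvd m" for e by (rule coprime_divisors[OF dvd_refl that assms(2)])
  have split: "e dvd p * m \<longleftrightarrow> e dvd m \<or> (\<exists>f. e = p * f \<and> f dvd m)" for e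
  proof
    assume e: "e dvd p * m"
    show "e dvd m \<or> (\<exists>f. e = p * f \<and> f dvd m)"
    proof (cases "p dvd e")
      case True
      then obtain f where "e = p * f" by (elim dvdE)
      then show ?thesis using e p0 by auto
    next
      case False
      then have "coprime e p" using prime_imp_coprime[OF assms(1)] coprime_commute by blast
      then show ?thesis using e by (simp add: coprime_dvd_mult_right_iff)
    qed
  qed auto
  show ?thesis
  proof (cases "int p dvd c")
    case False
    have "{e. e dvd p * m \<and> int e dvd c} = ?A"
      using False split by (auto dest: dvd_mult_left)
    then show ?thesis using False by (simp add: s_num_alt)
  next
    case True
    have "{e. e dvd p * m \<and> int e dvd c} = ?A \<union> (\<lambda>f. p * f) ` ?A"
    proof (intro equalityI subsetI)
      fix e assume "e \<in> {e. e dvd p * m \<and> int e dvd c}"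
      then have e: "e dvd p * m" "int e dvd c" by auto
      show "e \<in> ?A \<union> (\<lambda>f. p * f) ` ?A"
      proof (cases "e dvd m")
        case False
        then obtain f where f: "e = p * f" "f dvd m" using e(1) split by blast
        have "int f dvd c" using e(2) f(1) by (metis dvd_mult_right of_nat_mult)
        then show ?thesis using f by blast
      qed (use e in blast)
    next
      fix e assume e: "e \<in> ?A \<union> (\<lambda>f. p * f) ` ?A"
      show "e \<in> {e. e dvd p * m \<and> int e dvd c}"
      proof (cases "e \<in> ?A")
        case False
        then obtain f where f: "e = p * f" "f dvd m" "int f dvd c" using e by auto
        have "coprime (int p) (int f)" using copr[OF f(2)] by simp
        then have "int p * int f dvd c" using True f(3) by (rule divides_mult[rotated 2])
        then show ?thesis using f by auto
      qed auto
    qed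
    moreover have "?A \<inter> (\<lambda>f. p * f) ` ?A = {}"
    proof -
      have "\<not> p dvd e" if "e \<in> ?A" for e
      proof
        assume "p dvd e"
        then have "is_unit p" using copr[of e] that by (intro coprime_common_divisor[of p e]) auto
        then show False using assms(1) not_prime_unit by blast
      qed
      then show ?thesis by (metis (no_types, lifting) disjoint_iff dvd_triv_left imageE)
    qed
    moreover have "card ((\<lambda>f. p * f) ` ?A) = card ?A"
      by (rule card_image) (use p0 in \<open>auto simp: inj_on_def\<close>)
    ultimately show ?thesis
      using True finite_divisors_with[OF assms(3), of "\<lambda>e. int e dvd c"] by (simp add: s_num_alt card_Un_disjoint)
  qed
qed

definition sqrt_count :: "nat \<Rightarrow> int \<Rightarrow> nat" where
  "sqrt_count m c = card {x\<in>{0..<int (2 * m)}. [x^2 = c] (mod int (4 * m))}"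

text \<open>Chinese remainder theorem. Residues run modulo \<open>2 m\<close> while squares are
  compared modulo \<open>4 m\<close>, which \<open>cong_square_mod_4M\<close> permits.\<close>

lemma sqrt_count_prime_mult:
  assumes p: "prime p" "2 < p" "coprime p m" "odd m"
  shows "sqrt_count (p * m) c = card {y\<in>{0..<int p}. [y^2 = c] (mod int p)} * sqrt_count m c"
proof -
  have pos: "p > 0" "2 * m > 0" using p by (auto intro: Nat.gr0I)
  have op: "odd p" using p prime_odd_nat by auto
  have cop: "coprime p (2 * m)" using p(3) op by simp
  have cop4: "coprime (int p) (4 * int m)"
  proof -
    have "coprime (int p) (2 * 2)" using op by (simp only: coprime_mult_right_iff) simp
    then show ?thesis using p(3) by simp
  qed
  define f where "f x = (if [x^2 = c] (mod int (4 * (p * m))) then 1 else 0 :: int)" for x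
  define g where "g y = (if [y^2 = c] (mod int p) then 1 else 0 :: int)" for y
  define h where "h z = (if [z^2 = c] (mod int (4 * m)) then 1 else 0 :: int)" for z
  have fper: "f x = f y" if "[x = y] (mod int (p * (2 * m)))" for x y
  proof -
    have "[x^2 = y^2] (mod int (4 * (p * m)))" using that by (intro cong_square_mod_4M) (simp add: mult_ac)
    then have "[x^2 = c] (mod int (4 * (p * m))) \<longleftrightarrow> [y^2 = c] (mod int (4 * (p * m)))"
      using cong_trans cong_sym by blast
    then show ?thesis by (simp add: f_def)
  qed
  have "int (sqrt_count (p * m) c) = (\<Sum>x=0..<int (p * (2 * m)). f x)"
    unfolding sqrt_count_def f_def by (subst card_as_sum_int) (simp_all add: mult_ac)
  also have "\<dots> = (\<Sum>y=0..<int p. \<Sum>z=0..<int (2 * m). f (int (2 * m) * y + int p * z))"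
    by (rule sum_mod_product[OF pos cop fper])
  also have "\<dots> = (\<Sum>y=0..<int p. \<Sum>z=0..<int (2 * m). g (int (2 * m) * y) * h (int p * z))"
  proof (intro sum.cong refl)
    fix y z
    let ?x = "int (2 * m) * y + int p * z"
    have "[?x^2 = c] (mod int (4 * (p * m))) \<longleftrightarrow> [?x^2 = c] (mod int p) \<and> [?x^2 = c] (mod int (4 * m))"
    proof -
      have eq: "int (4 * (p * m)) = int p * (4 * int m)" "int (4 * m) = 4 * int m" by simp_all
      show ?thesis
        unfolding eq
        using coprime_cong_mult[OF _ _ cop4, of "?x^2" c] cong_modulus_mult[of "?x^2" c "int p" "4 * int m"]
          cong_modulus_mult[of "?x^2" c "4 * int m" "int p", unfolded mult.commute[of "4 * int m" "int p"]]
        by blast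
    qed
    moreover have "[?x^2 = (int (2 * m) * y)^2] (mod int p)"
      by (intro cong_pow) (simp add: cong_iff_dvd_diff)
    then have "[?x^2 = c] (mod int p) \<longleftrightarrow> [(int (2 * m) * y)^2 = c] (mod int p)"
      using cong_trans cong_sym by blast
    moreover have "[?x^2 = (int p * z)^2] (mod int (4 * m))"
      by (rule cong_square_mod_4M) (simp add: cong_iff_dvd_diff)
    then have "[?x^2 = c] (mod int (4 * m)) \<longleftrightarrow> [(int p * z)^2 = c] (mod int (4 * m))"
      using cong_trans cong_sym by blast
    ultimately show "f ?x = g (int (2 * m) * y) * h (int p * z)"
      by (simp add: f_def g_def h_def)
  qed
  also have "\<dots> = (\<Sum>y=0..<int p. g (int (2 * m) * y)) * (\<Sum>z=0..<int (2 * m). h (int p * z))"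
    by (simp add: sum_product)
  also have "(\<Sum>y=0..<int p. g (int (2 * m) * y)) = (\<Sum>y=0..<int p. g y)"
  proof (rule sum_mod_reindex[OF pos(1)])
    show "g x = g y" if "[x = y] (mod int p)" for x y
      using cong_pow[OF that, of 2] cong_trans cong_sym unfolding g_def by metis
    show "[x = y] (mod int p)" if "[int (2 * m) * x = int (2 * m) * y] (mod int p)" for x y
      using that cop cong_mult_lcancel[of "int (2 * m)" "int p" x y] by (simp add: coprime_commute)
  qed
  also have "(\<Sum>z=0..<int (2 * m). h (int p * z)) = (\<Sum>z=0..<int (2 * m). h z)"
  proof (rule sum_mod_reindex[OF pos(2)])
    show "h x = h y" if "[x = y] (mod int (2 * m))" for x y
      using cong_square_mod_4M[OF that] cong_trans cong_sym unfolding h_def by metis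
    show "[x = y] (mod int (2 * m))" if "[int p * x = int p * y] (mod int (2 * m))" for x y
      using that cop cong_mult_lcancel[of "int p" "int (2 * m)" x y] by simp
  qed
  also have "(\<Sum>y=0..<int p. g y) = int (card {y\<in>{0..<int p}. [y^2 = c] (mod int p)})"
    unfolding g_def by (subst card_as_sum_int) simp_all
  also have "(\<Sum>z=0..<int (2 * m). h z) = int (sqrt_count m c)"
    unfolding h_def sqrt_count_def by (subst card_as_sum_int) simp_all
  finally show ?thesis by (simp flip: of_nat_mult)
qed

lemma card_sqrt_mod_prime:
  assumes p: "prime p" "2 < p" and ne: "{y\<in>{0..<int p}. [y^2 = c] (mod int p)} \<noteq> {}"
  shows "card {y\<in>{0..<int p}. [y^2 = c] (mod int p)} * (if int p dvd c then 2 else 1) = 2"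
proof -
  let ?Y = "{y\<in>{0..<int p}. [y^2 = c] (mod int p)}"
  have small: "int p dvd y \<longleftrightarrow> y = 0" if "y \<in> {0..<int p}" for y
    using that zdvd_not_zless[of y "int p"] by (cases "y = 0") auto
  show ?thesis
  proof (cases "int p dvd c")
    case True
    then have "[y^2 = c] (mod int p) \<longleftrightarrow> int p dvd y" for y
      using p(1) by (metis cong_0_iff cong_sym cong_trans prime_dvd_square)
    then have "?Y = {0}" using small p by auto
    then show ?thesis using True by simp
  next
    case False
    obtain y0 where y0: "y0 \<in> {0..<int p}" "[y0^2 = c] (mod int p)" using ne by blast
    have "\<not> int p dvd y0^2" using False y0(2) cong_dvd_iff by blast
    then have y00: "y0 \<noteq> 0" by auto
    have "?Y = {y0, int p - y0}"
    proof (intro equalityI subsetI)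
      fix y assume y: "y \<in> ?Y"
      then have "[y^2 = y0^2] (mod int p)" using y0(2) cong_trans cong_sym by blast
      then have "int p dvd (y - y0) * (y + y0)" by (simp add: cong_iff_dvd_diff power2_eq_square algebra_simps)
      then have "int p dvd y - y0 \<or> int p dvd y + y0" using p(1) prime_dvd_mult_iff[of "int p"] by simp
      then show "y \<in> {y0, int p - y0}"
      proof
        assume "int p dvd y - y0"
        then have "[y = y0] (mod int p)" by (simp add: cong_iff_dvd_diff)
        then have "y = y0" using y y0(1) by (intro cong_less_imp_eq_int[of y "int p" y0]) auto
        then show ?thesis by simp
      next
        assume "int p dvd y + y0"
        then have "int p dvd (y + y0) - int p" by (rule dvd_diff) simp
        moreover have "(y + y0) - int p = y - (int p - y0)" by simp
        ultimately have "[y = int p - y0] (mod int p)" by (simp only: cong_iff_dvd_diff)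
        moreover have "int p - y0 \<in> {0..<int p}" using y0(1) y00 by auto
        ultimately have "y = int p - y0" using y by (intro cong_less_imp_eq_int[of y "int p" "int p - y0"]) auto
        then show ?thesis by simp
      qed
    next
      fix y assume "y \<in> {y0, int p - y0}"
      moreover have "[(int p - y0)^2 = y0^2] (mod int p)"
        unfolding cong_iff_dvd_diff by (rule dvdI[of _ _ "int p - 2 * y0"]) (simp add: power2_eq_square algebra_simps)
      then have "[(int p - y0)^2 = c] (mod int p)" using y0(2) cong_trans by blast
      ultimately show "y \<in> ?Y" using y0 y00 by auto
    qed
    moreover have "y0 \<noteq> int p - y0"
    proof
      assume "y0 = int p - y0"
      then have "even (int p)" by presburger
      then show False using p prime_odd_nat by auto
    qed
    ultimately show ?thesis using False by simp
  qed
qed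

text \<open>At an odd prime a solvable congruence has one root if \<open>p\<close> divides
  \<open>c\<close> and two otherwise, and \<open>s\<close> supplies the complementary factor. This
  is the origin of the weights \<open>s\<close> in the pairing.\<close>

lemma sqrt_count_s_num:
  assumes "odd m" "squarefree m" "sqrt_count m c > 0"
  shows "sqrt_count m c * s_num m c = card {e. e dvd m}"
  using assms
proof (induction m rule: odd_squarefree_induct)
  case one
  have r: "{0..<int (2 * 1)} = {0, 1}" by auto
  have "sqrt_count 1 c \<le> 1"
  proof -
    have "\<not> ([0 = c] (mod 4) \<and> [1 = c] (mod (4::int)))" by (auto simp: cong_def)
    then have "{x \<in> {0..<int (2 * 1)}. [x^2 = c] (mod int (4 * 1))} \<subseteq> {0} \<or> {x \<in> {0..<int (2 * 1)}. [x^2 = c] (mod int (4 * 1))} \<subseteq> {1}"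
      unfolding r by auto
    then show ?thesis unfolding sqrt_count_def using card_mono[of "{_}"] by fastforce
  qed
  moreover have "{e::nat. e dvd 1 \<and> int e dvd c} = {1}" "{e::nat. e dvd 1} = {1}" by auto
  ultimately show ?case using one.prems by (simp only: s_num_alt) simp
next
  case (prime p m)
  have m: "m > 0" using prime.hyps(3) by (cases m) auto
  let ?Y = "{y\<in>{0..<int p}. [y^2 = c] (mod int p)}"
  note e = sqrt_count_prime_mult[OF prime.hyps(1,2,5,3), of c]
  then have "card ?Y > 0" "sqrt_count m c > 0" using prime.prems by auto
  then have "?Y \<noteq> {}" by (metis card.empty less_numeral_extra(3))
  note Y = card_sqrt_mod_prime[OF prime.hyps(1,2) this]
  have tau: "card {e. e dvd p * m} = 2 * card {e. e dvd m}"
    using s_num_prime_mult[OF prime.hyps(1,5) m, of 0] by (simp add: s_num_alt)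
  have "sqrt_count (p * m) c * s_num (p * m) c = (card ?Y * (if int p dvd c then 2 else 1)) * (sqrt_count m c * s_num m c)"
    unfolding e s_num_prime_mult[OF prime.hyps(1,5) m] by (simp only: mult_ac)
  then show ?case
    unfolding Y using prime.IH[OF \<open>sqrt_count m c > 0\<close>] tau by simp
qed

section \<open>Square classes and the Weil kernel\<close>

lemma squarefree_dvd_square:
  assumes "odd m" "squarefree m" "int m dvd x^2"
  shows "int m dvd x"
  using assms
proof (induction m rule: odd_squarefree_induct)
  case (prime p n)
  have "int p dvd x^2" "int n dvd x^2" using prime.prems by (auto intro: dvd_trans[rotated])
  then have "int p dvd x" "int n dvd x" using prime.IH prime_dvd_square[OF prime.hyps(1)] by auto
  then show ?case using prime.hyps(5) by (simp add: divides_mult)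
qed simp

text \<open>A residue \<open>x\<close> modulo \<open>2 M\<close> stands for an element of the discriminant form, and \<open>u x\<^sup>2 / 4 M\<close>
  for its norm.  The sign \<open>\<eta>\<close> is \<open>1\<close> if twice the weight agrees with the signature modulo \<open>4\<close>, and
  \<open>- 1\<close> for the remaining half-integral weights.\<close>

locale square_classes =
  fixes M :: nat and u :: int and \<eta> :: complex
  assumes odd_M: "odd M" and squarefree_M: "squarefree M"
    and coprime_u: "coprime u (int (4 * M))" and eta: "\<eta> = 1 \<or> \<eta> = - 1"
begin

lemma M_pos: "M > 0" using odd_M by (cases M) auto

lemma odd_u: "odd u"
  by (rule coprime_4_mult_odd[OF coprime_u])

definition cls :: "int \<Rightarrow> int" where "cls x = u * x^2 mod int (4 * M)"

definition sqs :: "int set" where "sqs = cls ` {0..<int (2 * M)}"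

definition fibre :: "int \<Rightarrow> int set" where "fibre c = {x\<in>{0..<int (2 * M)}. cls x = c}"

definition parity_sign :: "int \<Rightarrow> complex" where "parity_sign x = (if even x then 1 else \<eta>)"

text \<open>Up to a scalar, the entries of \<open>S\<close> in the Weil representation; \<open>kernel\<close> is its restriction to
  the functions constant on the fibres of the norm.\<close>

definition phase :: "int \<Rightarrow> int \<Rightarrow> int \<Rightarrow> complex" where
  "phase v x y = parity_sign (x + y) * root_exp (2 * M) (- (v * x * y))"

definition weight :: "int \<Rightarrow> complex" where "weight c = of_nat (s_num M c)"

definition kernel :: "int \<Rightarrow> complex \<Rightarrow> int \<Rightarrow> int \<Rightarrow> complex" where
  "kernel v \<kappa> c c' = \<kappa> / of_nat (card {e. e dvd M}) * (\<Sum>x\<in>fibre c. \<Sum>y\<in>fibre c'. phase v x y)"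

lemma finite_fibre [simp]: "finite (fibre c)"
  unfolding fibre_def by (rule finite_subset[of _ "{0..<int (2 * M)}"]) auto

lemma finite_sqs [simp]: "finite sqs"
  unfolding sqs_def by simp

lemma cls_cong: "[x = y] (mod int (2 * M)) \<Longrightarrow> cls x = cls y"
  unfolding cls_def using cong_scalar_left[OF cong_square_mod_4M, of x y M u] by (simp add: cong_def)

lemma cls_mod: "[c = u * x^2] (mod int (4 * M))" if "cls x = c"
  using that unfolding cls_def by (auto simp: cong_def)

lemma cls_eq_iff: "cls x = cls y \<longleftrightarrow> [x^2 = y^2] (mod int (4 * M))"
  unfolding cls_def using cong_mult_lcancel[OF coprime_u, of "x^2" "y^2"] by (simp add: cong_def)

lemma cls_in_sqs: "cls x \<in> sqs"
proof -
  have "cls x = cls (x mod int (2 * M))" by (rule cls_cong) (simp add: cong_def)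
  moreover have "x mod int (2 * M) \<in> {0..<int (2 * M)}" using M_pos by simp
  ultimately show ?thesis unfolding sqs_def by (metis imageI)
qed

lemma sqs_bounds: "c \<in> sqs \<Longrightarrow> 0 \<le> c \<and> c < int (4 * M)"
  unfolding sqs_def cls_def using M_pos by auto

lemma sqs_dist: "c \<in> sqs \<Longrightarrow> c' \<in> sqs \<Longrightarrow> [c = c'] (mod int (4 * M)) \<Longrightarrow> c = c'"
  using sqs_bounds[of c] sqs_bounds[of c'] by (simp add: cong_def)

lemma sum_class_indicator:
  assumes "\<sigma> = 1 \<or> \<sigma> = (- 1::int)" and supp: "z \<noteq> (0::complex) \<Longrightarrow> \<exists>c\<in>sqs. [n = \<sigma> * c] (mod int (4 * M))"
  shows "(\<Sum>c\<in>sqs. if [n = \<sigma> * c] (mod int (4 * M)) then z else 0) = z"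
proof (cases "z = 0")
  case False
  then obtain c0 where c0: "c0 \<in> sqs" "[n = \<sigma> * c0] (mod int (4 * M))" using supp by blast
  have "[n = \<sigma> * c] (mod int (4 * M)) \<longleftrightarrow> c = c0" if c: "c \<in> sqs" for c
  proof
    assume "[n = \<sigma> * c] (mod int (4 * M))"
    then have "[\<sigma> * c = \<sigma> * c0] (mod int (4 * M))" using c0(2) by (meson cong_sym cong_trans)
    then have "[c = c0] (mod int (4 * M))" using assms(1) by (auto simp: cong_minus_minus_iff)
    then show "c = c0" by (rule sqs_dist[OF c c0(1)])
  qed (use c0 in simp)
  then have "(\<Sum>c\<in>sqs. if [n = \<sigma> * c] (mod int (4 * M)) then z else 0) = (\<Sum>c\<in>sqs. if c = c0 then z else 0)"
    by (intro sum.cong refl) auto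
  then show ?thesis using c0 by (simp add: sum.delta)
qed (auto intro!: sum.neutral)

lemma cls_0: "cls 0 = 0"
  by (simp add: cls_def)

lemma zero_in_sqs: "0 \<in> sqs"
  using cls_in_sqs[of 0] by (simp add: cls_0)

lemma sum_fibres: "(\<Sum>c\<in>sqs. \<Sum>x\<in>fibre c. g x) = (\<Sum>x=0..<int (2 * M). (g x :: complex))"
  unfolding sqs_def fibre_def by (rule sum.image_gen[symmetric]) simp

lemma fibre_nonempty: "c \<in> sqs \<Longrightarrow> fibre c \<noteq> {}"
  unfolding sqs_def fibre_def by auto

text \<open>The fibre consists of the square roots of \<open>ui * c\<close> with \<open>ui\<close>
  inverse to \<open>u\<close>, and a unit factor does not affect \<open>s\<close>.\<close>

lemma card_fibre:
  assumes "c \<in> sqs"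
  shows "of_nat (card (fibre c)) * weight c = of_nat (card {e. e dvd M})"
proof -
  obtain ui where ui: "[u * ui = 1] (mod int (4 * M))"
    using coprime_u by (auto simp: coprime_iff_invertible_int)
  have cui: "coprime ui (int (4 * M))"
    unfolding coprime_iff_invertible_int using ui by (metis mult.commute)
  have f: "fibre c = {x\<in>{0..<int (2 * M)}. [x^2 = ui * c] (mod int (4 * M))}"
  proof -
    have "cls x = c \<longleftrightarrow> [x^2 = ui * c] (mod int (4 * M))" for x
    proof -
      have "cls x = c \<longleftrightarrow> [u * x^2 = c] (mod int (4 * M))"
        using sqs_bounds[OF assms] by (auto simp: cls_def cong_def)
      also have "\<dots> \<longleftrightarrow> [ui * (u * x^2) = ui * c] (mod int (4 * M))"
        by (rule cong_mult_lcancel[OF cui, symmetric])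
      also have "\<dots> \<longleftrightarrow> [x^2 = ui * c] (mod int (4 * M))"
      proof -
        have "[ui * (u * x^2) = x^2] (mod int (4 * M))"
          using cong_scalar_right[OF ui, of "x^2"] by (simp add: mult_ac)
        then show ?thesis by (simp add: cong_def)
      qed
      finally show ?thesis .
    qed
    then show ?thesis unfolding fibre_def by simp
  qed
  have s: "s_num M (ui * c) = s_num M c"
  proof -
    have "e dvd M \<and> int e dvd ui * c \<longleftrightarrow> e dvd M \<and> int e dvd c" for e
    proof -
      have "coprime (int e) ui" if "e dvd M"
        using coprime_divisors[of ui ui "int e", OF dvd_refl _ cui] that
        by (simp add: coprime_commute)
      then show ?thesis by (auto simp: coprime_dvd_mult_right_iff)
    qed
    then show ?thesis unfolding s_num_alt by simp
  qed
  have "card (fibre c) = sqrt_count M (ui * c)" unfolding f sqrt_count_def ..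
  moreover have "card (fibre c) > 0" using fibre_nonempty[OF assms] by (simp add: card_gt_0_iff)
  ultimately have "card (fibre c) * s_num M c = card {e. e dvd M}"
    using sqrt_count_s_num[OF odd_M squarefree_M, of "ui * c"] s by simp
  then show ?thesis unfolding weight_def by (metis of_nat_mult)
qed

lemma card_divisors_nonzero: "of_nat (card {e. e dvd M}) \<noteq> (0::complex)"
proof -
  have "1 \<in> {e. e dvd M}" by simp
  then have "card {e. e dvd M} > 0" using finite_divisors_nat[OF M_pos] card_gt_0_iff by blast
  then show ?thesis by simp
qed

lemma weight_nonzero: "c \<in> sqs \<Longrightarrow> weight c \<noteq> 0"
  using card_fibre[of c] card_divisors_nonzero by auto

lemma parity_sign_square [simp]: "parity_sign x * parity_sign x = 1"
  using eta by (auto simp: parity_sign_def)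

lemma parity_sign_cong: "even (x - y) \<Longrightarrow> parity_sign x = parity_sign y"
  unfolding parity_sign_def by (auto simp: even_diff)

lemma parity_sign_nonzero [simp]: "parity_sign x \<noteq> 0"
  using parity_sign_square[of x] by (metis mult_zero_left zero_neq_one)

lemma phase_commute: "phase v x y = phase v y x"
  by (simp add: phase_def add.commute mult_ac)

lemma even_diff_cong: "[x = y] (mod int (2 * M)) \<Longrightarrow> even (x - y)"
proof -
  assume "[x = y] (mod int (2 * M))"
  then have "int (2 * M) dvd x - y" by (simp only: cong_iff_dvd_diff)
  then show "even (x - y)" by (rule dvd_trans[rotated]) simp
qed

lemma phase_cong:
  assumes "[x = x'] (mod int (2 * M))" "[y = y'] (mod int (2 * M))"
  shows "phase v x y = phase v x' y'"
proof -
  have "parity_sign (x + y) = parity_sign (x' + y')"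
  proof (rule parity_sign_cong)
    have "x + y - (x' + y') = (x - x') + (y - y')" by simp
    then show "even (x + y - (x' + y'))" using even_diff_cong[OF assms(1)] even_diff_cong[OF assms(2)] by simp
  qed
  moreover have "root_exp (2 * M) (- (v * x * y)) = root_exp (2 * M) (- (v * x' * y'))"
  proof (rule root_exp_cong)
    show "2 * M > 0" using M_pos by simp
    show "[- (v * x * y) = - (v * x' * y')] (mod int (2 * M))"
      by (intro cong_uminus cong_mult cong_refl assms)
  qed
  ultimately show ?thesis unfolding phase_def by simp
qed

lemma phase_unit:
  assumes "odd \<rho>" "[\<rho>^2 = 1] (mod int (4 * M))"
  shows "phase v (\<rho> * x) (\<rho> * y) = phase v x y"
proof -
  have "parity_sign (\<rho> * x + \<rho> * y) = parity_sign (x + y)"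
    using assms(1) by (simp add: parity_sign_def)
  moreover have "root_exp (2 * M) (- (v * (\<rho> * x) * (\<rho> * y))) = root_exp (2 * M) (- (v * x * y))"
  proof (rule root_exp_cong)
    show "2 * M > 0" using M_pos by simp
    have "[\<rho>^2 = 1] (mod int (2 * M))" by (rule cong_dvd_modulus[OF assms(2)]) simp
    then have "[- (v * x * y) * \<rho>^2 = - (v * x * y) * 1] (mod int (2 * M))" by (rule cong_scalar_left)
    then show "[- (v * (\<rho> * x) * (\<rho> * y)) = - (v * x * y)] (mod int (2 * M))"
      by (simp add: power2_eq_square mult_ac)
  qed
  ultimately show ?thesis unfolding phase_def by simp
qed

text \<open>An automorphism \<open>\<rho>\<close> carrying \<open>x\<close> to \<open>x'\<close>
  permutes the fibre of \<open>c'\<close> and preserves \<open>phase\<close>.\<close>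

lemma sum_fibre_phase_const:
  assumes "x \<in> fibre c" "x' \<in> fibre c"
  shows "(\<Sum>y\<in>fibre c'. phase v x' y) = (\<Sum>y\<in>fibre c'. phase v x y)"
proof -
  have "cls x = cls x'" using assms by (simp add: fibre_def)
  then have "[x^2 = x'^2] (mod int (4 * M))" by (simp add: cls_eq_iff)
  from square_root_unit[OF odd_M squarefree_M this]
  obtain \<rho> where \<rho>: "coprime \<rho> (int (2 * M))" "odd \<rho>" "[\<rho>^2 = 1] (mod int (4 * M))"
    "[x' = \<rho> * x] (mod int (2 * M))" by metis
  have s: "(\<Sum>y\<in>fibre c'. g y) = (\<Sum>y=0..<int (2 * M). if cls y = c' then g y else 0)" for g :: "int \<Rightarrow> complex"
    unfolding fibre_def by (rule sum.inter_filter) simp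
  have "(\<Sum>y=0..<int (2 * M). if cls y = c' then phase v x' y else 0) =
      (\<Sum>y=0..<int (2 * M). if cls (\<rho> * y) = c' then phase v x' (\<rho> * y) else 0)"
  proof (rule sum_mod_reindex[symmetric, where f="\<lambda>y. if cls y = c' then phase v x' y else 0"])
    show "2 * M > 0" using M_pos by simp
    show "(if cls a = c' then phase v x' a else 0) = (if cls b = c' then phase v x' b else 0)"
      if "[a = b] (mod int (2 * M))" for a b
      using cls_cong[OF that] phase_cong[OF cong_refl that] by simp
    show "[a = b] (mod int (2 * M))" if "[\<rho> * a = \<rho> * b] (mod int (2 * M))" for a b
      using that by (simp only: cong_mult_lcancel[OF \<rho>(1)])
  qed
  also have "\<dots> = (\<Sum>y=0..<int (2 * M). if cls y = c' then phase v x y else 0)"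
  proof (rule sum.cong[OF refl])
    fix y
    have "[(\<rho> * y)^2 = y^2] (mod int (4 * M))"
      using cong_scalar_right[OF \<rho>(3), of "y^2"] by (simp add: power_mult_distrib)
    then have "cls (\<rho> * y) = cls y" by (simp add: cls_eq_iff)
    moreover have "phase v x' (\<rho> * y) = phase v x y"
      using phase_cong[OF \<rho>(4) cong_refl[of "\<rho> * y"]] phase_unit[OF \<rho>(2,3)] by simp
    ultimately show "(if cls (\<rho> * y) = c' then phase v x' (\<rho> * y) else 0) = (if cls y = c' then phase v x y else 0)"
      by simp
  qed
  finally show ?thesis unfolding s .
qed

text \<open>All rows over the fibre of \<open>c\<close> have the same sum, and their number times
  \<open>weight c\<close> cancels the denominator of \<open>kernel\<close>. So
  \<open>weight c\<close> times the component at \<open>c\<close> transforms like the component at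
  any single \<open>x\<close> of that norm in the Weil representation.\<close>

lemma weight_kernel:
  assumes "c \<in> sqs" "x \<in> fibre c"
  shows "kernel v \<kappa> c c' * weight c = \<kappa> * (\<Sum>y\<in>fibre c'. phase v x y)"
proof -
  have "(\<Sum>x'\<in>fibre c. \<Sum>y\<in>fibre c'. phase v x' y) = (\<Sum>x'\<in>fibre c. \<Sum>y\<in>fibre c'. phase v x y)"
    by (rule sum.cong[OF refl]) (rule sum_fibre_phase_const[OF assms(2)])
  also have "\<dots> = of_nat (card (fibre c)) * (\<Sum>y\<in>fibre c'. phase v x y)" by (rule sum_constant)
  finally have "kernel v \<kappa> c c' * weight c =
      \<kappa> * (\<Sum>y\<in>fibre c'. phase v x y) * (of_nat (card (fibre c)) * weight c) / of_nat (card {e. e dvd M})"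
    unfolding kernel_def by simp
  then show ?thesis unfolding card_fibre[OF assms(1)] using card_divisors_nonzero by simp
qed

lemma kernel_commute: "kernel v \<kappa> c c' = kernel v \<kappa> c' c"
proof -
  have "(\<Sum>x\<in>fibre c. \<Sum>y\<in>fibre c'. phase v x y) = (\<Sum>y\<in>fibre c'. \<Sum>x\<in>fibre c. phase v x y)"
    by (rule sum.swap)
  also have "\<dots> = (\<Sum>y\<in>fibre c'. \<Sum>x\<in>fibre c. phase v y x)"
    by (intro sum.cong refl) (rule phase_commute)
  finally show ?thesis unfolding kernel_def by simp
qed

lemma fibre_0: "fibre 0 = {0}"
proof -
  have "x = 0" if x: "x \<in> {0..<int (2 * M)}" "cls x = 0" for x
  proof -
    have "int (4 * M) dvd u * x^2" using x(2) by (simp add: cls_def mod_eq_0_iff_dvd)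
    then have d: "int (4 * M) dvd x^2"
      using coprime_u by (simp add: coprime_dvd_mult_right_iff coprime_commute)
    have "int M dvd x^2" by (rule dvd_trans[OF _ d]) simp
    then have 1: "int M dvd x" by (rule squarefree_dvd_square[OF odd_M squarefree_M])
    have "2 dvd x^2" by (rule dvd_trans[OF _ d]) simp
    then have 2: "2 dvd x" by simp
    have "coprime 2 (int M)" using odd_M by simp
    with 1 2 have "2 * int M dvd x" by (simp add: divides_mult)
    with x(1) show "x = 0" using zdvd_not_zless[of x "2 * int M"] by force
  qed
  then show ?thesis unfolding fibre_def using M_pos by (auto simp: cls_0)
qed

text \<open>\<open>phase v 0 y\<close> is a sign that depends only on the parity of
  \<open>y\<close>, and parity is constant on a fibre, so no cancellation occurs.\<close>

lemma kernel_0_nonzero: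
  assumes "c \<in> sqs" "\<kappa> \<noteq> 0"
  shows "kernel v \<kappa> 0 c \<noteq> 0"
proof -
  obtain x0 where x0: "x0 \<in> fibre c" using fibre_nonempty[OF assms(1)] by auto
  have "kernel v \<kappa> 0 c * weight 0 = \<kappa> * (\<Sum>y\<in>fibre c. phase v 0 y)"
    by (rule weight_kernel[OF zero_in_sqs]) (simp add: fibre_0)
  also have "(\<Sum>y\<in>fibre c. phase v 0 y) = (\<Sum>y\<in>fibre c. parity_sign x0)"
  proof (rule sum.cong[OF refl])
    fix y assume "y \<in> fibre c"
    then have "cls y = cls x0" using x0 by (simp add: fibre_def)
    then have "[y^2 = x0^2] (mod int (4 * M))" by (simp add: cls_eq_iff)
    then have "int (4 * M) dvd y^2 - x0^2" by (simp only: cong_iff_dvd_diff)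
    then have "2 dvd y^2 - x0^2" by (rule dvd_trans[rotated]) simp
    then have "even (y - x0)" by simp
    then have "parity_sign y = parity_sign x0" by (rule parity_sign_cong)
    then show "phase v 0 y = parity_sign x0" by (simp add: phase_def)
  qed
  also have "\<dots> = of_nat (card (fibre c)) * parity_sign x0" by simp
  finally have e: "kernel v \<kappa> 0 c * weight 0 = \<kappa> * (of_nat (card (fibre c)) * parity_sign x0)" .
  have "card (fibre c) \<noteq> 0" using fibre_nonempty[OF assms(1)] by simp
  with e assms(2) show ?thesis by auto
qed

lemma phase_orthogonal:
  assumes "x \<in> {0..<int (2 * M)}" "y \<in> {0..<int (2 * M)}"
  shows "(\<Sum>z=0..<int (2 * M). phase u x z * phase (- u) z y) = (if x = y then of_nat (2 * M) else 0)"
proof -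
  have "phase u x z * phase (- u) z y = parity_sign (x + y) * root_exp (2 * M) (u * (y - x) * z)" for z
  proof -
    have "parity_sign (x + z) * parity_sign (z + y) = parity_sign (x + y)"
      using eta by (auto simp: parity_sign_def)
    moreover have "root_exp (2 * M) (- (u * x * z)) * root_exp (2 * M) (- (- u * z * y)) = root_exp (2 * M) (u * (y - x) * z)"
      by (simp add: root_exp_add[symmetric] algebra_simps)
    moreover have "phase u x z * phase (- u) z y = (parity_sign (x + z) * parity_sign (z + y)) *
        (root_exp (2 * M) (- (u * x * z)) * root_exp (2 * M) (- (- u * z * y)))"
      unfolding phase_def by (simp only: mult_ac)
    ultimately show ?thesis by simp
  qed
  then have "(\<Sum>z=0..<int (2 * M). phase u x z * phase (- u) z y) =
      parity_sign (x + y) * (\<Sum>z=0..<int (2 * M). root_exp (2 * M) (u * (y - x) * z))"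
    by (simp add: sum_distrib_left)
  also have "\<dots> = parity_sign (x + y) * (if int (2 * M) dvd u * (y - x) then of_nat (2 * M) else 0)"
    using M_pos by (subst sum_root_exp) simp_all
  also have "int (2 * M) dvd u * (y - x) \<longleftrightarrow> x = y"
  proof -
    have "coprime (int (2 * M)) u"
      using coprime_divisors[of "int (2 * M)" "int (4 * M)" u u] coprime_u
      by (simp add: coprime_commute)
    then have "int (2 * M) dvd u * (y - x) \<longleftrightarrow> int (2 * M) dvd y - x"
      by (simp only: coprime_dvd_mult_right_iff)
    also have "\<dots> \<longleftrightarrow> y mod int (2 * M) = x mod int (2 * M)" by (simp only: mod_eq_dvd_iff)
    also have "\<dots> \<longleftrightarrow> x = y" using assms by auto
    finally show ?thesis .
  qed
  finally show ?thesis using assms by (auto simp: parity_sign_def)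
qed

text \<open>The weighted sum over the middle class unfolds to a sum over all residues modulo
  \<open>2 M\<close>, where the phases are orthogonal as in a discrete Fourier transform.\<close>

lemma kernel_orthogonal:
  assumes c: "c \<in> sqs" "c' \<in> sqs"
  shows "(\<Sum>c1\<in>sqs. kernel u \<kappa> c c1 * weight c1 * kernel (- u) \<kappa>' c1 c') =
    (if c = c' then of_nat (2 * M) * \<kappa> * \<kappa>' / weight c else 0)"
proof -
  let ?t = "of_nat (card {e. e dvd M}) :: complex"
  have "(\<Sum>c1\<in>sqs. kernel u \<kappa> c c1 * weight c1 * kernel (- u) \<kappa>' c1 c') =
     (\<Sum>c1\<in>sqs. \<Sum>z\<in>fibre c1. \<kappa> * \<kappa>' / ?t * (\<Sum>x\<in>fibre c. \<Sum>y\<in>fibre c'. phase u x z * phase (- u) z y))"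
  proof (rule sum.cong[OF refl])
    fix c1 assume c1: "c1 \<in> sqs"
    have k: "kernel u \<kappa> c c1 * weight c1 = \<kappa> * (\<Sum>x\<in>fibre c. phase u x z)" if "z \<in> fibre c1" for z
      unfolding kernel_commute[of u \<kappa> c c1] weight_kernel[OF c1 that] by (simp add: phase_commute)
    have "kernel u \<kappa> c c1 * weight c1 * kernel (- u) \<kappa>' c1 c' =
        (\<Sum>z\<in>fibre c1. kernel u \<kappa> c c1 * weight c1 * (\<kappa>' / ?t * (\<Sum>y\<in>fibre c'. phase (- u) z y)))"
      unfolding kernel_def[of "- u"] sum_distrib_left[symmetric] ..
    also have "\<dots> = (\<Sum>z\<in>fibre c1. \<kappa> * \<kappa>' / ?t * ((\<Sum>x\<in>fibre c. phase u x z) * (\<Sum>y\<in>fibre c'. phase (- u) z y)))"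
      by (rule sum.cong[OF refl]) (simp add: k)
    also have "\<dots> = (\<Sum>z\<in>fibre c1. \<kappa> * \<kappa>' / ?t * (\<Sum>x\<in>fibre c. \<Sum>y\<in>fibre c'. phase u x z * phase (- u) z y))"
      by (simp only: sum_product)
    finally show "kernel u \<kappa> c c1 * weight c1 * kernel (- u) \<kappa>' c1 c' =
      (\<Sum>z\<in>fibre c1. \<kappa> * \<kappa>' / ?t * (\<Sum>x\<in>fibre c. \<Sum>y\<in>fibre c'. phase u x z * phase (- u) z y))" .
  qed
  also have "\<dots> = (\<Sum>z=0..<int (2 * M). \<kappa> * \<kappa>' / ?t * (\<Sum>x\<in>fibre c. \<Sum>y\<in>fibre c'. phase u x z * phase (- u) z y))"
    by (rule sum_fibres)
  also have "\<dots> = \<kappa> * \<kappa>' / ?t * (\<Sum>z=0..<int (2 * M). \<Sum>x\<in>fibre c. \<Sum>y\<in>fibre c'. phase u x z * phase (- u) z y)"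
    by (rule sum_distrib_left[symmetric])
  also have "(\<Sum>z=0..<int (2 * M). \<Sum>x\<in>fibre c. \<Sum>y\<in>fibre c'. phase u x z * phase (- u) z y) =
      (\<Sum>x\<in>fibre c. \<Sum>y\<in>fibre c'. \<Sum>z=0..<int (2 * M). phase u x z * phase (- u) z y)"
    by (subst sum.swap, rule sum.cong[OF refl], rule sum.swap)
  also have "\<dots> = (\<Sum>x\<in>fibre c. \<Sum>y\<in>fibre c'. if x = y then of_nat (2 * M) else 0)"
    by (intro sum.cong refl phase_orthogonal) (simp_all add: fibre_def)
  also have "\<dots> = (if c = c' then of_nat (2 * M) * of_nat (card (fibre c)) else 0)"
  proof -
    have "(\<Sum>x\<in>fibre c. \<Sum>y\<in>fibre c'. if x = y then of_nat (2 * M) else 0) =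
      (\<Sum>x\<in>fibre c. if c = c' then of_nat (2 * M) else (0::complex))"
    proof (rule sum.cong[OF refl])
      fix x assume "x \<in> fibre c"
      then have "x \<in> fibre c' \<longleftrightarrow> c = c'" by (auto simp: fibre_def)
      then show "(\<Sum>y\<in>fibre c'. if x = y then of_nat (2 * M) else 0) = (if c = c' then of_nat (2 * M) else (0::complex))"
        by (simp add: sum.delta)
    qed
    then show ?thesis by simp
  qed
  also have "\<kappa> * \<kappa>' / ?t * (if c = c' then of_nat (2 * M) * of_nat (card (fibre c)) else 0) =
    (if c = c' then of_nat (2 * M) * \<kappa> * \<kappa>' / weight c else 0)"
  proof -
    have n0: "card (fibre c) \<noteq> 0" using fibre_nonempty[OF c(1)] by simp
    show ?thesis
      unfolding card_fibre[OF c(1), symmetric] using n0 weight_nonzero[OF c(1)] by (cases "c = c'") simp_all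
  qed
  finally show ?thesis .
qed

sublocale q_width "4 * M"
  by standard (use M_pos in simp)

lemma vv_side:
  assumes "\<kappa> \<noteq> 0" "\<sigma> = 1 \<or> \<sigma> = - 1"
  shows "vv_side (4 * M) sqs \<sigma> weight (kernel v \<kappa>)"
proof
  show "finite sqs" by simp
  show "c = c'" if "c \<in> sqs" "c' \<in> sqs" "[c = c'] (mod int (4 * M))" for c c'
    by (rule sqs_dist[OF that])
  show "kernel v \<kappa> 0 c \<noteq> 0" if "c \<in> sqs" for c by (rule kernel_0_nonzero[OF that assms(1)])
  then show "kernel v \<kappa> c 0 \<noteq> 0" if "c \<in> sqs" for c using that kernel_commute[of v \<kappa> c 0] by simp
qed (use assms weight_nonzero zero_in_sqs in auto)

lemma vv_pair:
  assumes "\<kappa> \<noteq> 0" "\<kappa>' \<noteq> 0"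
  shows "vv_pair (4 * M) sqs weight (kernel u \<kappa>) (kernel (- u) \<kappa>') (of_nat (2 * M) * \<kappa> * \<kappa>')"
proof -
  interpret pos: vv_side "4 * M" sqs 1 weight "kernel u \<kappa>" by (rule vv_side) (use assms in auto)
  interpret neg: vv_side "4 * M" sqs "- 1" weight "kernel (- u) \<kappa>'" by (rule vv_side) (use assms in auto)
  show ?thesis by unfold_locales (rule kernel_commute kernel_orthogonal; assumption?)+
qed

end

section \<open>Character sums supported on square classes\<close>

definition char_sum :: "nat \<Rightarrow> int set \<Rightarrow> (int \<Rightarrow> complex) \<Rightarrow> int \<Rightarrow> complex" where
  "char_sum n C z j = (\<Sum>c\<in>C. z c * root_exp n (c * j))"

text \<open>A residue class modulo \<open>d\<close> missed by \<open>C\<close> is a linear relation between the values of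
  the character sum on a coset of order \<open>d\<close>.  With one missing class for each odd \<open>p\<close> and two for
  \<open>d = 4\<close>, these relations determine all values from those at units.\<close>

lemma char_sum_missing_residue:
  assumes "d > 0" "k > 0" and miss: "\<forall>c\<in>C. \<not> int d dvd c - c0"
  shows "(\<Sum>t=0..<int d. char_sum (d * k) C z (j + t * int k) * root_exp d (- (c0 * t))) = 0"
proof -
  have "(\<Sum>t=0..<int d. char_sum (d * k) C z (j + t * int k) * root_exp d (- (c0 * t))) =
      (\<Sum>t=0..<int d. \<Sum>c\<in>C. z c * root_exp (d * k) (c * j) * root_exp d ((c - c0) * t))"
  proof (rule sum.cong[OF refl])
    fix t
    have "root_exp (d * k) (c * (j + t * int k)) = root_exp (d * k) (c * j) * root_exp d (c * t)" for c
    proof -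
      have "c * (j + t * int k) = c * j + (c * t) * int k" by (simp add: algebra_simps)
      then show ?thesis using root_exp_mult_cancel[OF assms(2), of d "c * t"] by (simp add: root_exp_add)
    qed
    moreover have "root_exp d (c * t) * root_exp d (- (c0 * t)) = root_exp d ((c - c0) * t)" for c
      by (simp add: root_exp_add[symmetric] algebra_simps)
    ultimately show "char_sum (d * k) C z (j + t * int k) * root_exp d (- (c0 * t)) =
        (\<Sum>c\<in>C. z c * root_exp (d * k) (c * j) * root_exp d ((c - c0) * t))"
      unfolding char_sum_def sum_distrib_right by (intro sum.cong refl) (simp add: mult.assoc)
  qed
  also have "\<dots> = (\<Sum>c\<in>C. z c * root_exp (d * k) (c * j) * (\<Sum>t=0..<int d. root_exp d ((c - c0) * t)))"
    by (subst sum.swap) (simp only: sum_distrib_left)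
  also have "\<dots> = 0"
    using miss by (intro sum.neutral ballI) (simp add: sum_root_exp[OF assms(1)])
  finally show ?thesis .
qed

text \<open>1 and \<open>p - 1\<close> have the same square, so \<open>u x^2\<close> is not
  injective modulo \<open>p\<close>, hence not surjective.\<close>

lemma missing_square_class:
  assumes "prime p" "2 < p"
  obtains c0 where "\<forall>x. \<not> int p dvd u * x^2 - c0"
proof -
  let ?f = "\<lambda>x. (u * x^2) mod int p"
  have "\<exists>c0\<in>{0..<int p}. c0 \<notin> ?f ` {0..<int p}"
  proof (rule ccontr)
    assume "\<not> ?thesis"
    then have "{0..<int p} \<subseteq> ?f ` {0..<int p}" by blast
    moreover have "?f ` {0..<int p} \<subseteq> {0..<int p}" using assms by auto
    ultimately have "?f ` {0..<int p} = {0..<int p}" by (rule antisym[rotated])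
    then have i: "inj_on ?f {0..<int p}" by (intro eq_card_imp_inj_on) simp_all
    have "int p dvd u * 1^2 - u * (int p - 1)^2"
    proof
      show "u * 1^2 - u * (int p - 1)^2 = int p * (u * (2 - int p))" by (simp add: power2_eq_square algebra_simps)
    qed
    then have "?f 1 = ?f (int p - 1)" by (simp only: mod_eq_dvd_iff)
    from inj_onD[OF i this] have "1 = int p - 1" using assms by simp
    with assms show False by simp
  qed
  then obtain c0 where c0: "c0 \<in> {0..<int p}" "c0 \<notin> ?f ` {0..<int p}" by blast
  have "\<not> int p dvd u * x^2 - c0" for x
  proof
    assume "int p dvd u * x^2 - c0"
    then have "?f x = c0 mod int p" by (simp only: mod_eq_dvd_iff)
    moreover have "?f x = ?f (x mod int p)"
      using mod_mult_right_eq[of u "x^2" "int p"] mod_mult_right_eq[of u "(x mod int p)^2" "int p"] power_mod[of x "int p" 2]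
      by (simp only:)
    moreover have "?f (x mod int p) \<in> ?f ` {0..<int p}" using assms by (intro imageI) simp
    ultimately show False using c0 by simp
  qed
  then show ?thesis using that by blast
qed

context square_classes
begin

lemma sqs_square: "c \<in> sqs \<Longrightarrow> \<exists>x. int (4 * M) dvd u * x^2 - c"
  unfolding sqs_def cls_def by (auto simp: mod_eq_dvd_iff[symmetric])

text \<open>The sum is known to vanish at those \<open>j + t q\<close> not divisible by
  \<open>p\<close>. For odd \<open>p\<close> a missing class gives a relation in which only
  \<open>t = 0\<close> is left. For \<open>p = 2\<close> both \<open>t = 0\<close> and
  \<open>t = 2\<close> are left, and two relations are needed.\<close>

lemma char_sum_eq_0_step:
  assumes p: "prime p" "p dvd 4 * M" "int p dvd j"
    and z: "\<And>t. \<lbrakk>\<not> int p dvd j + t * int q\<rbrakk> \<Longrightarrow> char_sum (4 * M) sqs z (j + t * int q) = 0"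
    and q: "q = (if p = 2 then M else 4 * M div p)"
  shows "char_sum (4 * M) sqs z j = 0"
proof (cases "p = 2")
  case False
  then have p2: "2 < p" using prime_ge_2_nat[OF p(1)] by simp
  have pM: "p dvd M"
  proof -
    have "coprime p 4"
      using p2 prime_odd_nat[OF p(1)] by (metis coprime_commute coprime_left_2_iff_odd coprime_power_left_iff num_double numeral_times_numeral power2_eq_square)
    then show ?thesis using p(2) by (simp add: coprime_dvd_mult_right_iff)
  qed
  then obtain n where n: "M = p * n" by auto
  have np: "\<not> p dvd n"
  proof
    assume "p dvd n"
    then have "p^2 dvd M" unfolding n power2_eq_square by simp
    then have "p dvd 1" using squarefree_M squarefreeD by blast
    then show False using p2 by simp
  qed
  have q': "q = 4 * n" using q False n p2 by simp
  have q0: "q > 0" using q' M_pos n by simp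
  have pq: "\<not> int p dvd int q"
  proof
    assume "int p dvd int q"
    then have "p dvd 4 * n" unfolding q' int_dvd_int_iff .
    then have "p dvd 4" using prime_dvd_multD[OF p(1)] np by blast
    then have "p dvd 2 ^ 2" by simp
    then have "p dvd 2" using prime_dvd_power[OF p(1)] by blast
    then show False using p2 by (auto dest: dvd_imp_le)
  qed
  have N: "4 * M = p * q" by (simp add: q' n)
  obtain c0 where c0: "\<forall>x. \<not> int p dvd u * x^2 - c0" using missing_square_class[OF p(1) p2] by metis
  have "(\<Sum>t=0..<int p. char_sum (p * q) sqs z (j + t * int q) * root_exp p (- (c0 * t))) = 0"
  proof (rule char_sum_missing_residue[OF _ q0])
    show "p > 0" using p2 by simp
    show "\<forall>c\<in>sqs. \<not> int p dvd c - c0"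
    proof (intro ballI notI)
      fix c assume c: "c \<in> sqs" and d: "int p dvd c - c0"
      obtain x where "int (4 * M) dvd u * x^2 - c" using sqs_square[OF c] by auto
      then have "int p dvd u * x^2 - c" unfolding N of_nat_mult by (rule dvd_mult_left)
      then have "int p dvd (u * x^2 - c) + (c - c0)" using d by (rule dvd_add)
      then show False using c0 by simp
    qed
  qed
  also have "(\<Sum>t=0..<int p. char_sum (p * q) sqs z (j + t * int q) * root_exp p (- (c0 * t))) =
      (\<Sum>t=0..<int p. if t = 0 then char_sum (p * q) sqs z j else 0)"
  proof (rule sum.cong[OF refl])
    fix t assume t: "t \<in> {0..<int p}"
    show "char_sum (p * q) sqs z (j + t * int q) * root_exp p (- (c0 * t)) = (if t = 0 then char_sum (p * q) sqs z j else 0)"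
    proof (cases "t = 0")
      case False
      then have "\<not> int p dvd t" using t zdvd_not_zless[of t "int p"] by force
      then have "\<not> int p dvd t * int q"
        using pq p(1) by (simp add: prime_dvd_mult_iff)
      then have "\<not> int p dvd j + t * int q" using p(3) by (simp add: dvd_add_right_iff)
      from z[OF this] show ?thesis using False N by simp
    qed simp
  qed
  also have "\<dots> = char_sum (4 * M) sqs z j" using p2 unfolding N by simp
  finally show ?thesis .
next
  case True
  then have qM: "q = M" using q by simp
  have odd0: "char_sum (4 * M) sqs z (j + t * int M) = 0" if "odd t" for t
    using z[of t] that p(3) odd_M unfolding True qM by simp
  have E: "{0..<int 4} = {0, 1, 2, 3}" by auto
  have main: "char_sum (4 * M) sqs z j + char_sum (4 * M) sqs z (j + 2 * int M) * root_exp 4 (- (c0 * 2)) = 0"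
    if "\<forall>x. \<not> 4 dvd u * x^2 - c0" for c0
  proof -
    have "(\<Sum>t=0..<int 4. char_sum (4 * M) sqs z (j + t * int M) * root_exp 4 (- (c0 * t))) = 0"
    proof (rule char_sum_missing_residue[OF _ M_pos])
      show "\<forall>c\<in>sqs. \<not> int 4 dvd c - c0"
      proof (intro ballI notI)
        fix c assume c: "c \<in> sqs" and d: "int 4 dvd c - c0"
        obtain x where "int (4 * M) dvd u * x^2 - c" using sqs_square[OF c] by auto
        then have "int 4 dvd u * x^2 - c" unfolding of_nat_mult by (rule dvd_mult_left)
        then have "int 4 dvd (u * x^2 - c) + (c - c0)" using d by (rule dvd_add)
        then show False using that by simp
      qed
    qed simp
    then show ?thesis unfolding E using odd0[of 1] odd0[of 3] by simp
  qed
  note sq = square_mod_4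
  have um: "u mod 4 = 1 \<or> u mod 4 = 3" using odd_u by presburger
  have ux: "4 dvd u * x^2 - c0 \<longleftrightarrow> c0 mod 4 = (u mod 4) * (x^2 mod 4) mod 4" for x c0
    by (metis mod_eq_dvd_iff mod_mult_eq)
  \<comment> \<open>Modulo 4 the values \<open>u x^2\<close> miss 2 and \<open>- u\<close>. The two
    relations have coefficients 1 and \<open>- 1\<close> at \<open>t = 2\<close>, so together they
    give the claim.\<close>
  have 1: "char_sum (4 * M) sqs z j + char_sum (4 * M) sqs z (j + 2 * int M) * root_exp 4 (- (2 * 2)) = 0"
  proof (rule main, intro allI)
    fix x
    show "\<not> 4 dvd u * x^2 - 2" unfolding ux using um sq[of x] by auto
  qed
  have 2: "char_sum (4 * M) sqs z j + char_sum (4 * M) sqs z (j + 2 * int M) * root_exp 4 (- (- u * 2)) = 0"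
  proof (rule main, intro allI)
    fix x
    have "(- u) mod 4 = (if u mod 4 = 1 then 3 else 1)" using um by presburger
    then show "\<not> 4 dvd u * x^2 - (- u)" unfolding ux using um sq[of x] by auto
  qed
  have r1: "root_exp 4 (- (2 * 2)) = 1"
    using root_exp_cong[of 4 "- (2 * 2)" 0] by (simp add: cong_def)
  have r2: "root_exp 4 (- (- u * 2)) = - 1"
  proof -
    obtain k where k: "u = 2 * k + 1" using odd_u by (auto elim: oddE)
    have "root_exp 4 (- (- u * 2)) = root_exp 4 2"
      by (rule root_exp_cong) (simp_all add: k cong_iff_dvd_diff algebra_simps)
    also have "\<dots> = exp (of_real pi * \<i>)" unfolding root_exp_def by (simp add: field_simps)
    finally show ?thesis by simp
  qed
  from 1 2 show ?thesis unfolding r1 r2 by simp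
qed

text \<open>Induction on the set of primes allowed to divide \<open>j\<close>. Among the primes
  dividing \<open>4 M\<close>, a step by \<open>q\<close> alters divisibility only at
  \<open>p\<close>.\<close>

lemma char_sum_coprime_zero:
  assumes z: "\<And>j. coprime j (int (4 * M)) \<Longrightarrow> char_sum (4 * M) sqs z j = 0"
  shows "char_sum (4 * M) sqs z j = 0"
proof -
  have N0: "4 * M > 0" using M_pos by simp
  have fin: "finite (prime_factors (4 * M))" by simp
  have "\<forall>j. (\<forall>p\<in>prime_factors (4 * M) - S. \<not> int p dvd j) \<longrightarrow> char_sum (4 * M) sqs z j = 0"
    if "finite S" "S \<subseteq> prime_factors (4 * M)" for S
    using that
  proof (induction S rule: finite_induct)
    case empty
    show ?case
    proof (intro allI impI)
      fix j assume j: "\<forall>p\<in>prime_factors (4 * M) - {}. \<not> int p dvd j"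
      have "coprime j (int (4 * M))"
      proof (rule ccontr)
        assume "\<not> coprime j (int (4 * M))"
        then have "nat (gcd j (int (4 * M))) \<noteq> 1" by (auto simp: coprime_iff_gcd_eq_1)
        then obtain p where p: "prime p" "p dvd nat (gcd j (int (4 * M)))" using prime_factor_nat by blast
        from p(2) have "int p dvd int (nat (gcd j (int (4 * M))))" by (simp only: int_dvd_int_iff)
        then have d: "int p dvd gcd j (int (4 * M))" by simp
        then have "int p dvd j" by (rule dvd_trans) simp
        moreover from d have "int p dvd int (4 * M)" by (rule dvd_trans) (rule gcd_dvd2)
        then have "p dvd 4 * M" by (simp only: int_dvd_int_iff)
        ultimately show False using j p(1) N0 by (auto simp: prime_factors_dvd)
      qed
      then show "char_sum (4 * M) sqs z j = 0" by (rule z)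
    qed
  next
    case (insert p S)
    show ?case
    proof (intro allI impI)
      fix j assume j: "\<forall>r\<in>prime_factors (4 * M) - insert p S. \<not> int r dvd j"
      have pp: "prime p" "p dvd 4 * M" using insert.prems by (auto simp: prime_factors_dvd)
      show "char_sum (4 * M) sqs z j = 0"
      proof (cases "int p dvd j")
        case False
        then have "\<forall>r\<in>prime_factors (4 * M) - S. \<not> int r dvd j" using j by blast
        then show ?thesis using insert.IH insert.prems by blast
      next
        case True
        define q where "q = (if p = 2 then M else 4 * M div p)"
        show ?thesis
        proof (rule char_sum_eq_0_step[OF pp True _ q_def])
          fix t assume t: "\<not> int p dvd j + t * int q"
          have "\<not> int r dvd j + t * int q" if r: "r \<in> prime_factors (4 * M) - S" for r
          proof (cases "r = p")
            case False
            have rr: "prime r" "r dvd 4 * M" using r by (auto simp: prime_factors_dvd)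
            have "coprime r p" using rr(1) pp(1) False by (simp add: primes_coprime)
            have "r dvd q"
            proof (cases "p = 2")
              case True
              then have "coprime r (2^2)" using \<open>coprime r p\<close> by (auto simp only: coprime_power_right_iff)
              then have "coprime r 4" by simp
              then show ?thesis using rr(2) True by (simp add: q_def coprime_dvd_mult_right_iff)
            next
              case p2: False
              have "4 * M = p * q" using p2 pp(2) by (simp add: q_def)
              then show ?thesis using rr(2) \<open>coprime r p\<close> by (simp add: coprime_dvd_mult_right_iff)
            qed
            then have "int r dvd t * int q" by simp
            moreover have "\<not> int r dvd j" using j r False by blast
            ultimately show ?thesis by (simp add: dvd_add_left_iff)
          qed (use t in simp)
          then show "char_sum (4 * M) sqs z (j + t * int q) = 0"
            using insert.IH insert.prems by blast
        qed
      qed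
    qed
  qed
  from this[OF fin order.refl] show ?thesis by simp
qed

text \<open>Fourier inversion modulo \<open>4 M\<close>, where the classes in \<open>sqs\<close> are
  distinct.\<close>

lemma char_sum_separates:
  assumes z: "\<And>j. coprime j (int (4 * M)) \<Longrightarrow> char_sum (4 * M) sqs z j = 0" and c: "c \<in> sqs"
  shows "z c = 0"
proof -
  have N0: "4 * M > 0" using M_pos by simp
  have "(0::complex) = (\<Sum>j=0..<int (4 * M). char_sum (4 * M) sqs z j * root_exp (4 * M) (- (c * j)))"
    by (rule sum.neutral[symmetric]) (simp only: char_sum_coprime_zero[OF z] mult_zero_left simp_thms Ball_def)
  also have "\<dots> = (\<Sum>j=0..<int (4 * M). \<Sum>c'\<in>sqs. z c' * root_exp (4 * M) ((c' - c) * j))"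
    unfolding char_sum_def sum_distrib_right
    by (intro sum.cong refl) (simp add: root_exp_add[symmetric] algebra_simps)
  also have "\<dots> = (\<Sum>c'\<in>sqs. z c' * (\<Sum>j=0..<int (4 * M). root_exp (4 * M) ((c' - c) * j)))"
    by (subst sum.swap) (simp only: sum_distrib_left)
  also have "\<dots> = (\<Sum>c'\<in>sqs. if c' = c then z c' * of_nat (4 * M) else 0)"
  proof (rule sum.cong[OF refl])
    fix c' assume c': "c' \<in> sqs"
    have "int (4 * M) dvd c' - c \<longleftrightarrow> c' = c"
      using sqs_dist[OF c' c] by (auto simp: cong_iff_dvd_diff)
    then show "z c' * (\<Sum>j=0..<int (4 * M). root_exp (4 * M) ((c' - c) * j)) = (if c' = c then z c' * of_nat (4 * M) else 0)"
      unfolding sum_root_exp[OF N0] by simp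
  qed
  also have "\<dots> = z c * of_nat (4 * M)" using c by (simp add: sum.delta)
  finally show ?thesis using N0 by simp
qed

end

text \<open>With these two constants the quotient of the theta multiplier by the Gauss sum in
  \<open>theta_mult_twisted_gauss\<close> is independent of the upper left entry of the matrix.\<close>

definition parity_value :: "nat \<Rightarrow> int \<Rightarrow> int \<Rightarrow> complex" where
  "parity_value m v K = - of_int (sgn34 m 3) * root_exp 4 (- K - v * int m)"

definition kernel_scale :: "nat \<Rightarrow> int \<Rightarrow> int \<Rightarrow> complex" where
  "kernel_scale m v K = 1 / (gauss_sum m v * (1 + parity_value m v K * root_exp 4 (v * int m)))"

lemma root_exp_4_cong: "[m = n] (mod 4) \<Longrightarrow> root_exp 4 m = root_exp 4 n"
  using root_exp_cong[of 4 m n] by simp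

lemma root_exp_4_2: "root_exp 4 2 = - 1"
proof -
  have "root_exp 4 2 = exp (of_real pi * \<i>)" unfolding root_exp_def by (simp add: field_simps)
  then show ?thesis by simp
qed

lemma root_exp_4_1: "root_exp 4 1 = \<i>"
proof -
  have "root_exp 4 1 = cis (pi / 2)" unfolding root_exp_def cis_conv_exp by (simp add: field_simps)
  then show ?thesis by simp
qed

lemma root_exp_4_even: "even n \<Longrightarrow> root_exp 4 n = 1 \<or> root_exp 4 n = - 1"
proof -
  assume "even n"
  then have "n mod 4 = 0 \<or> n mod 4 = 2" by presburger
  then have "[n = 0] (mod 4) \<or> [n = 2] (mod 4)" by (auto simp: cong_def)
  then show ?thesis using root_exp_4_cong[of n 0] root_exp_4_cong[of n 2] root_exp_4_2 by auto
qed

lemma root_exp_4_odd_square: "odd n \<Longrightarrow> root_exp 4 n * root_exp 4 n = - 1"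
proof -
  assume "odd n"
  then have "(n + n) mod 4 = 2" by presburger
  then have "[n + n = 2] (mod 4)" by (simp add: cong_def)
  then show ?thesis unfolding root_exp_add[symmetric] using root_exp_4_cong root_exp_4_2 by simp
qed

lemma parity_value_sign: "odd K \<Longrightarrow> odd v \<Longrightarrow> odd m \<Longrightarrow> parity_value m v K = 1 \<or> parity_value m v K = - 1"
  using root_exp_4_even[of "- K - v * int m"] by (auto simp: parity_value_def sgn34_def)

text \<open>The exponents differ by \<open>2 (K + v m) - 4\<close>, a multiple of 4 as
  \<open>K + v m\<close> is even. Hence one sign \<open>\<eta>\<close>, and one instance of
  \<open>square_classes\<close>, serves both a form and its dual.\<close>

lemma parity_value_dual:
  assumes "odd K" "odd v" "odd m"
  shows "parity_value m (- v) (4 - K) = parity_value m v K"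
proof -
  obtain a where a: "K = 2 * a + 1" using assms(1) by (auto elim: oddE)
  have "odd (v * int m)" using assms by simp
  then obtain b where b: "v * int m = 2 * b + 1" by (elim oddE)
  have "[- (4 - K) - (- v) * int m = - K - v * int m] (mod 4)"
    unfolding cong_iff_dvd_diff
  proof
    show "- (4 - K) - - v * int m - (- K - v * int m) = 4 * (a + b)" by (simp add: a b)
  qed
  then show ?thesis unfolding parity_value_def by (simp add: root_exp_4_cong)
qed

lemma prod_signs:
  fixes f :: "'b \<Rightarrow> int"
  assumes "\<And>x. x \<in> A \<Longrightarrow> f x = 1 \<or> f x = - 1"
  shows "prod f A = 1 \<or> prod f A = - 1"
  using assms
proof (induction A rule: infinite_finite_induct)
  case (insert x A)
  have "prod f A = 1 \<or> prod f A = - 1" by (rule insert.IH) (use insert.prems in simp)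
  moreover have "f x = 1 \<or> f x = - 1" using insert.prems by simp
  ultimately show ?case using insert.hyps by auto
qed simp_all

text \<open>\<open>parity_value\<close> is a sign and the root of unity is \<open>\<i>\<close> or
  \<open>- \<i>\<close>, so the second factor of the denominator is \<open>1 + i\<close> or
  \<open>1 - i\<close>.\<close>

lemma kernel_scale_nonzero:
  assumes "odd m" "squarefree m" "coprime v (int (4 * m))" "odd K"
  shows "kernel_scale m v K \<noteq> 0"
proof -
  have ov: "odd v" by (rule coprime_4_mult_odd[OF assms(3)])
  have "coprime v (int m)" using assms(3) by simp
  from gauss_sum_twist[OF assms(1,2) this, of 1] have g: "gauss_sum m v \<noteq> 0" by simp
  have "parity_value m v K * root_exp 4 (v * int m) \<noteq> - 1"
  proof
    assume e: "parity_value m v K * root_exp 4 (v * int m) = - 1"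
    have "parity_value m v K * parity_value m v K = 1" using parity_value_sign[OF assms(4) ov assms(1)] by auto
    moreover have "root_exp 4 (v * int m) * root_exp 4 (v * int m) = - 1"
      using ov assms(1) by (intro root_exp_4_odd_square) simp
    ultimately have "(parity_value m v K * root_exp 4 (v * int m)) * (parity_value m v K * root_exp 4 (v * int m)) = - 1"
      by (simp add: mult_ac)
    then show False unfolding e by simp
  qed
  then have "1 + parity_value m v K * root_exp 4 (v * int m) \<noteq> 0" by (simp add: add_eq_0_iff)
  then show ?thesis using g by (simp add: kernel_scale_def)
qed

lemma legendre_prod_sign: "coprime a (int m) \<Longrightarrow> legendre_prod a m = 1 \<or> legendre_prod a m = - 1"
proof -
  assume c: "coprime a (int m)"
  have "Legendre a (int p) = 1 \<or> Legendre a (int p) = - 1" if "p \<in> prime_factors m" for p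
  proof -
    have p: "prime p" "p dvd m" using that by auto
    have "coprime a (int p)" using coprime_divisors[OF dvd_refl _ c, of "int p"] p by simp
    then have "\<not> int p dvd a" using coprime_int_prime[OF p(1)] by simp
    then show ?thesis using Legendre_values[of a "int p"] Legendre_eq_0_iff[of a "int p"] by auto
  qed
  then show ?thesis unfolding legendre_prod_def by (rule prod_signs)
qed

lemma kronecker_odd:
  assumes "odd (n::nat)"
  shows "kronecker a (int n) = jacobi a n"
proof -
  have "n \<noteq> 0" using assms by (cases n) auto
  moreover have "kronecker_prime a p = Legendre a (int p)" if "p \<in> prime_factors n" for p
    using that assms by (auto simp: kronecker_prime_def)
  ultimately show ?thesis by (simp add: kronecker_def jacobi_def)
qed

lemma powi_odd_sign: "odd K \<Longrightarrow> s = 1 \<or> s = - 1 \<Longrightarrow> (s::complex) powi K = s"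
  by (auto simp: power_int_minus_left)

context square_classes
begin

definition twisted_gauss :: "int \<Rightarrow> complex" where
  "twisted_gauss a = (\<Sum>x=0..<int (2 * M). parity_sign x * root_exp (4 * M) (a * x^2))"

lemma twisted_gauss_term_cong:
  "[x = y] (mod int (2 * M)) \<Longrightarrow>
    parity_sign x * root_exp (4 * M) (a * x^2) = parity_sign y * root_exp (4 * M) (a * y^2)"
  using parity_sign_cong[OF even_diff_cong] root_exp_cong[OF N_pos cong_scalar_left[OF cong_square_mod_4M]]
  by metis

text \<open>With \<open>x = M y + 2 z\<close> the sum splits into a factor at 2, whose two terms are
  written out, and the Gauss sum modulo \<open>M\<close>.\<close>

lemma twisted_gauss_eq: "twisted_gauss a = (1 + \<eta> * root_exp 4 (a * int M)) * gauss_sum M a"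
proof -
  have "twisted_gauss a = (\<Sum>y=0..<int 2. \<Sum>z=0..<int M. parity_sign (int M * y + int 2 * z) *
      root_exp (4 * M) (a * (int M * y + int 2 * z)^2))"
    unfolding twisted_gauss_def
    by (rule sum_mod_product) (use M_pos odd_M twisted_gauss_term_cong in auto)
  also have "\<dots> = (\<Sum>y=0..<int 2. \<Sum>z=0..<int M. parity_sign y * root_exp 4 (a * int M * y^2) * root_exp M (a * z^2))"
  proof (intro sum.cong refl)
    fix y z :: int
    have 1: "parity_sign (int M * y + int 2 * z) = parity_sign y"
      using odd_M by (simp add: parity_sign_def)
    have 2: "a * (int M * y + int 2 * z)^2 = (a * int M * y^2) * int M + (a * y * z) * int (4 * M) + (a * z^2) * int 4"
      by (simp add: power2_eq_square algebra_simps)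
    have "root_exp (4 * M) (a * (int M * y + int 2 * z)^2) =
        root_exp (4 * M) ((a * int M * y^2) * int M) * root_exp (4 * M) ((a * y * z) * int (4 * M)) * root_exp (M * 4) ((a * z^2) * int 4)"
      unfolding 2 root_exp_add by (simp only: mult.commute[of 4 M])
    also have "root_exp (4 * M) ((a * y * z) * int (4 * M)) = 1"
      using root_exp_cong[OF N_pos, of "(a * y * z) * int (4 * M)" 0] by (simp add: cong_0_iff)
    also have "root_exp (4 * M) ((a * int M * y^2) * int M) = root_exp 4 (a * int M * y^2)"
      by (rule root_exp_mult_cancel[OF M_pos])
    also have "root_exp (M * 4) ((a * z^2) * int 4) = root_exp M (a * z^2)"
      by (rule root_exp_mult_cancel) simp
    finally show "parity_sign (int M * y + int 2 * z) * root_exp (4 * M) (a * (int M * y + int 2 * z)^2) =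
        parity_sign y * root_exp 4 (a * int M * y^2) * root_exp M (a * z^2)"
      by (simp only: 1 mult_1_right mult.assoc)
  qed
  also have "\<dots> = (\<Sum>y=0..<int 2. parity_sign y * root_exp 4 (a * int M * y^2)) * gauss_sum M a"
    unfolding gauss_sum_def by (simp only: sum_product)
  also have "{0..<int 2} = {0, 1}" by auto
  finally show ?thesis by (simp add: parity_sign_def)
qed

text \<open>The inversion followed by translation by \<open>j\<close>, summed over all classes.
  Completing the square with \<open>D\<close>, the inverse of \<open>j\<close>, leaves a Gauss sum
  times the translation by \<open>- D\<close>.\<close>

lemma kernel_twist:
  assumes c': "c' \<in> sqs" and jD: "[j * D = 1] (mod int (4 * M))"
  shows "(\<Sum>c\<in>sqs. kernel (\<sigma> * u) \<kappa> c c' * weight c' * root_exp (4 * M) (\<sigma> * c * j)) =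
    \<kappa> * twisted_gauss (\<sigma> * u * j) * root_exp (4 * M) (- (\<sigma> * c' * D))"
proof -
  let ?v = "\<sigma> * u"
  obtain y where y: "y \<in> fibre c'" using fibre_nonempty[OF c'] by auto
  have even4: "2 dvd int (4 * M)" by simp
  have "2 dvd j * D - 1" using jD even4 dvd_trans unfolding cong_iff_dvd_diff by blast
  then have oddD: "odd D" by auto
  have summand: "phase ?v x y * root_exp (4 * M) (\<sigma> * cls x * j) =
     root_exp (4 * M) (- (\<sigma> * c' * D)) * (parity_sign (x - D * y) * root_exp (4 * M) (?v * j * (x - D * y)^2))" for x
  proof -
    have 1: "parity_sign (x + y) = parity_sign (x - D * y)"
      using oddD by (simp add: parity_sign_def)
    have "root_exp (2 * M) (- (?v * x * y)) = root_exp (2 * M * 2) (- (?v * x * y) * int 2)"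
      by (rule root_exp_mult_cancel[symmetric]) simp
    also have "2 * M * 2 = 4 * M" by simp
    finally have 2: "root_exp (2 * M) (- (?v * x * y)) = root_exp (4 * M) (- (?v * x * y) * 2)" by simp
    have cy: "[c' = u * y^2] (mod int (4 * M))" using y by (intro cls_mod) (simp add: fibre_def)
    have cx: "[cls x = u * x^2] (mod int (4 * M))" by (rule cls_mod) simp
    have "root_exp (4 * M) (- (?v * x * y) * 2) * root_exp (4 * M) (\<sigma> * cls x * j) =
        root_exp (4 * M) (- (\<sigma> * c' * D)) * root_exp (4 * M) (?v * j * (x - D * y)^2)"
      unfolding root_exp_add[symmetric]
    proof (rule root_exp_cong[OF N_pos])
      have L: "[- (?v * x * y) * 2 + \<sigma> * cls x * j = - (?v * x * y) * 2 + \<sigma> * (u * x^2) * j] (mod int (4 * M))"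
        by (intro cong_add cong_mult cong_refl cx)
      have R: "[- (\<sigma> * c' * D) + ?v * j * (x - D * y)^2 = - (\<sigma> * (u * y^2) * D) + ?v * j * (x - D * y)^2] (mod int (4 * M))"
        by (intro cong_add cong_mult cong_uminus cong_refl cy)
      have "[- (?v * x * y) * 2 + \<sigma> * (u * x^2) * j = - (\<sigma> * (u * y^2) * D) + ?v * j * (x - D * y)^2] (mod int (4 * M))"
      proof -
        obtain t where t: "j * D - 1 = int (4 * M) * t" using jD by (auto simp: cong_iff_dvd_diff)
        have "- (\<sigma> * (u * y^2) * D) + ?v * j * (x - D * y)^2 - (- (?v * x * y) * 2 + \<sigma> * (u * x^2) * j)
            = ?v * (D * y^2 - 2 * x * y) * (j * D - 1)"
          by (simp add: power2_eq_square algebra_simps)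
        then have "int (4 * M) dvd - (\<sigma> * (u * y^2) * D) + ?v * j * (x - D * y)^2 - (- (?v * x * y) * 2 + \<sigma> * (u * x^2) * j)"
          unfolding t by (simp only: dvd_mult dvd_triv_left)
        then show ?thesis by (simp only: cong_iff_dvd_diff dvd_diff_commute)
      qed
      with L R show "[- (?v * x * y) * 2 + \<sigma> * cls x * j = - (\<sigma> * c' * D) + ?v * j * (x - D * y)^2] (mod int (4 * M))"
        by (meson cong_sym cong_trans)
    qed
    then show ?thesis unfolding phase_def 1 2 by (simp only: mult_ac)
  qed
  have "(\<Sum>c\<in>sqs. kernel ?v \<kappa> c c' * weight c' * root_exp (4 * M) (\<sigma> * c * j)) =
      (\<Sum>c\<in>sqs. \<Sum>x\<in>fibre c. \<kappa> * (phase ?v x y * root_exp (4 * M) (\<sigma> * cls x * j)))"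
  proof (rule sum.cong[OF refl])
    fix c assume "c \<in> sqs"
    have "kernel ?v \<kappa> c c' * weight c' = \<kappa> * (\<Sum>x\<in>fibre c. phase ?v x y)"
      unfolding kernel_commute[of ?v \<kappa> c c'] weight_kernel[OF c' y]
      by (intro arg_cong[where f="\<lambda>x. \<kappa> * x"] sum.cong refl) (rule phase_commute)
    then have "kernel ?v \<kappa> c c' * weight c' * root_exp (4 * M) (\<sigma> * c * j) =
        (\<Sum>x\<in>fibre c. \<kappa> * (phase ?v x y * root_exp (4 * M) (\<sigma> * c * j)))"
      by (simp only: sum_distrib_left sum_distrib_right mult.assoc)
    also have "\<dots> = (\<Sum>x\<in>fibre c. \<kappa> * (phase ?v x y * root_exp (4 * M) (\<sigma> * cls x * j)))"
      by (rule sum.cong[OF refl]) (simp add: fibre_def)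
    finally show "kernel ?v \<kappa> c c' * weight c' * root_exp (4 * M) (\<sigma> * c * j) = \<dots>" .
  qed
  also have "\<dots> = (\<Sum>x=0..<int (2 * M). \<kappa> * (phase ?v x y * root_exp (4 * M) (\<sigma> * cls x * j)))"
    by (rule sum_fibres)
  also have "\<dots> = \<kappa> * root_exp (4 * M) (- (\<sigma> * c' * D)) *
     (\<Sum>x=0..<int (2 * M). parity_sign (x - D * y) * root_exp (4 * M) (?v * j * (x - D * y)^2))"
    unfolding summand by (simp only: sum_distrib_left mult.assoc)
  also have "(\<Sum>x=0..<int (2 * M). parity_sign (x - D * y) * root_exp (4 * M) (?v * j * (x - D * y)^2)) = twisted_gauss (?v * j)"
    unfolding twisted_gauss_def
    by (rule sum_mod_reindex[where f="\<lambda>x. parity_sign x * root_exp (4 * M) (?v * j * x^2)" and g="\<lambda>x. x - D * y"])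
       (use M_pos twisted_gauss_term_cong in \<open>auto simp: cong_iff_dvd_diff\<close>)
  finally show ?thesis
    by (simp only: mult.assoc mult.commute[of "root_exp (4 * M) (- (\<sigma> * c' * D))" "twisted_gauss (\<sigma> * u * j)"])
       (simp only: mult_ac)
qed

text \<open>Reciprocity turns the Kronecker symbol of \<open>4 M\<close> over \<open>D\<close> into
  the Jacobi symbol of \<open>j\<close> that the Gauss sum also produces; what remains is an
  identity between fourth roots of unity.\<close>

lemma theta_mult_twisted_gauss:
  assumes K: "odd K" and v: "coprime v (int (4 * M))" and eta: "\<eta> = parity_value M v K"
    and jD: "[j * D = 1] (mod int (4 * M))" and D: "D > 0"
  shows "theta_mult (int (4 * M)) D powi K = kernel_scale M v K * twisted_gauss (v * j)"
proof -
  define n where "n = nat D"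
  have n: "D = int n" using D by (simp add: n_def)
  have "[j * D = 1] (mod 4)" using jD by (rule cong_dvd_modulus) simp
  have odd_jD: "odd j" "odd D" 
  proof -
    have "4 dvd j * D - 1" using \<open>[j * D = 1] (mod 4)\<close> by (simp only: cong_iff_dvd_diff)
    then have "even (j * D - 1)" by (rule dvd_trans[rotated]) simp
    then have "odd (j * D)" by simp
    then show "odd j" "odd D" by simp_all
  qed
  have Dn: "D mod 4 = int (n mod 4)" by (simp add: n zmod_int)
  \<comment> \<open>Odd residues are their own inverses modulo 4.\<close>
  have jD4: "j mod 4 = D mod 4"
  proof -
    have jm: "j mod 4 = 1 \<or> j mod 4 = 3" "D mod 4 = 1 \<or> D mod 4 = 3" using odd_jD by presburger+
    have "(j mod 4) * (D mod 4) mod 4 = 1" using \<open>[j * D = 1] (mod 4)\<close> by (simp add: cong_def mod_mult_eq)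
    then show ?thesis using jm by auto
  qed
  have jDM: "[j * D = 1] (mod int M)" using jD by (rule cong_dvd_modulus) simp
  have cj: "coprime j (int M)" unfolding coprime_iff_invertible_int using jDM by blast
  have cD: "coprime D (int M)" unfolding coprime_iff_invertible_int using jDM by (metis mult.commute)
  have ov: "odd v" by (rule coprime_4_mult_odd[OF v])
  have cv: "coprime v (int M)" using v by simp
  have lp: "legendre_prod D M = legendre_prod j M"
    unfolding legendre_prod_def
  proof (rule prod.cong[OF refl])
    fix p assume "p \<in> prime_factors M"
    then have p: "prime p" "p dvd M" by auto
    have p2: "2 < p" by (rule odd_prime_divisor[OF odd_M p])
    have "Legendre (j * D) (int p) = Legendre 1 (int p)"
      by (rule Legendre_cong, rule cong_dvd_modulus[OF jDM]) (use p in simp)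
    also have "Legendre 1 (int p) = 1"
      using Legendre_square_prime[OF p(1), of 1] p2 by simp
    finally have "Legendre j (int p) * Legendre D (int p) = 1" by (simp add: Legendre_mult[OF p(1) p2])
    then show "Legendre D (int p) = Legendre j (int p)"
      using Legendre_values[of j "int p"] Legendre_values[of D "int p"] by auto
  qed
  have on: "odd n" using odd_jD n by simp
  have cop: "coprime M n" using cD n by (simp add: coprime_commute)
  have "kronecker (int (4 * M)) D = jacobi (2^2 * int M) n"
    unfolding n kronecker_odd[OF on] by simp
  also have "\<dots> = jacobi (int M) n"
  proof -
    have "coprime 2 (int n)" using on by simp
    then show ?thesis unfolding jacobi_mult[OF on] jacobi_square[OF on \<open>coprime 2 (int n)\<close>] by simp
  qed
  also have "\<dots> = sgn34 M n * legendre_prod j M"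
    using jacobi_reciprocity[OF odd_M squarefree_M on cop] lp n by simp
  finally have kr: "kronecker (int (4 * M)) D = sgn34 M n * legendre_prod j M" .
  have sg: "of_int (sgn34 M n * legendre_prod j M) powi K = (of_int (sgn34 M n) * of_int (legendre_prod j M) :: complex)"
    unfolding of_int_mult using legendre_prod_sign[OF cj]
    by (intro powi_odd_sign[OF K]) (auto simp: sgn34_def)
  have nm: "n mod 4 = 1 \<or> n mod 4 = 3" using on by presburger
  define z where "z = \<eta> * root_exp 4 (v * int M)"
  have z2: "z * z = - 1"
  proof -
    have "root_exp 4 (v * int M) * root_exp 4 (v * int M) = - 1"
      using ov odd_M by (intro root_exp_4_odd_square) simp
    then show ?thesis using square_classes.eta[OF square_classes_axioms] unfolding z_def by auto
  qed
  have z1: "1 + z \<noteq> 0"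
  proof
    assume "1 + z = 0"
    then have "z = - 1" by (simp add: add_eq_0_iff)
    then show False using z2 by simp
  qed
  have g0: "gauss_sum M v \<noteq> 0" using gauss_sum_twist[OF odd_M squarefree_M cv cj] by simp
  \<comment> \<open>If \<open>D\<close> is 1 modulo 4, both sides are \<open>1 + z\<close>. If
    \<open>D\<close> is 3, the root of unity is inverted and the right side becomes
    \<open>1 - z\<close>, while \<open>parity_value\<close> is chosen so that the multiplier equals
    \<open>- z\<close>; then \<open>z^2 = - 1\<close> gives
    \<open>- z (1 + z) = 1 - z\<close>.\<close>
  have key: "of_int (sgn34 M n) * inverse (eps_odd D) powi K * (1 + z) = 1 + \<eta> * root_exp 4 (v * j * int M)"
  proof (cases "n mod 4 = 1")
    case True
    then have "j mod 4 = 1" using jD4 Dn by simp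
    then have "[v * j * int M = v * 1 * int M] (mod 4)" by (intro cong_mult cong_refl) (simp add: cong_def)
    then have "root_exp 4 (v * j * int M) = root_exp 4 (v * int M)" using root_exp_4_cong by simp
    then show ?thesis using True Dn by (simp add: sgn34_def eps_odd_def z_def)
  next
    case False
    then have n3: "n mod 4 = 3" using nm by simp
    then have j3: "j mod 4 = 3" using jD4 Dn by simp
    then have "[v * j * int M = v * (- 1) * int M] (mod 4)" by (intro cong_mult cong_refl) (simp add: cong_def)
    then have r: "root_exp 4 (v * j * int M) = inverse (root_exp 4 (v * int M))"
      using root_exp_4_cong[of "v * j * int M" "v * (- 1) * int M"] by (simp add: root_exp_minus)
    have e2: "\<eta> * \<eta> = 1" using square_classes.eta[OF square_classes_axioms] by auto
    have "\<eta> * inverse (root_exp 4 (v * int M)) = - z"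
    proof -
      have "z * (\<eta> * inverse (root_exp 4 (v * int M))) = 1" using e2 unfolding z_def by (simp add: field_simps)
      then have "z * z * (\<eta> * inverse (root_exp 4 (v * int M))) = z" by (simp add: mult.assoc)
      then show ?thesis unfolding z2 by (simp add: minus_equation_iff)
    qed
    then have rhs: "1 + \<eta> * root_exp 4 (v * j * int M) = 1 - z" unfolding r by simp
    have "eps_odd D = \<i>" using n3 Dn by (simp add: eps_odd_def)
    then have "inverse (eps_odd D) powi K = root_exp 4 (- K)"
    proof -
      have "root_exp 4 (- K) = root_exp 4 1 powi (- K)"
        unfolding root_exp_def exp_power_int by (simp add: mult_ac)
      then show ?thesis using \<open>eps_odd D = \<i>\<close> by (simp add: root_exp_4_1 power_int_inverse power_int_minus del: inverse_i)
    qed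
    moreover have "z = - of_int (sgn34 M n) * root_exp 4 (- K)"
    proof -
      have "z = - of_int (sgn34 M 3) * (root_exp 4 (- K - v * int M) * root_exp 4 (v * int M))"
        unfolding z_def eta parity_value_def by simp
      also have "root_exp 4 (- K - v * int M) * root_exp 4 (v * int M) = root_exp 4 (- K)"
        by (simp add: root_exp_add[symmetric])
      also have "sgn34 M 3 = sgn34 M n" using n3 by (simp add: sgn34_def)
      finally show ?thesis .
    qed
    ultimately have "of_int (sgn34 M n) * inverse (eps_odd D) powi K = - z" by simp
    then have "of_int (sgn34 M n) * inverse (eps_odd D) powi K * (1 + z) = - z * (1 + z)" by simp
    also have "\<dots> = 1 - z" using z2 by (simp add: algebra_simps)
    finally show ?thesis using rhs by simp
  qed
  have "theta_mult (int (4 * M)) D powi K = of_int (sgn34 M n) * of_int (legendre_prod j M) * inverse (eps_odd D) powi K"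
    unfolding theta_mult_def kr power_int_mult_distrib sg ..
  also have "\<dots> = of_int (legendre_prod j M) * (1 + \<eta> * root_exp 4 (v * j * int M)) / (1 + z)"
    using z1 unfolding key[symmetric] by (simp only: eq_divide_eq mult_ac simp_thms if_False if_True if_cancel)
  also have "\<dots> = kernel_scale M v K * twisted_gauss (v * j)"
  proof -
    have "gauss_sum M (v * j) = of_int (legendre_prod j M) * gauss_sum M v"
      using gauss_sum_twist[OF odd_M squarefree_M cv cj] by simp
    moreover have "L * R / y = 1 / (g * y) * (R * (L * g))" if "g \<noteq> 0" "y \<noteq> 0" for L R y g :: complex
      using that by simp
    ultimately show ?thesis
      unfolding twisted_gauss_eq kernel_scale_def eta[symmetric] z_def[symmetric] using g0 z1 by simp
  qed
  finally show ?thesis .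
qed

end

section \<open>Scalar and vector-valued forms\<close>

context square_classes
begin

abbreviation vv_form :: "int \<Rightarrow> int \<Rightarrow> (int \<Rightarrow> complex fls) \<Rightarrow> bool" where
  "vv_form \<sigma> K \<equiv> vv_side.VV (4 * M) sqs \<sigma> weight (kernel (\<sigma> * u) (kernel_scale M (\<sigma> * u) K)) K"

lemma vv_side_kernel:
  assumes "\<sigma> = 1 \<or> \<sigma> = - 1" "odd K"
  shows "vv_side (4 * M) sqs \<sigma> weight (kernel (\<sigma> * u) (kernel_scale M (\<sigma> * u) K))"
proof (rule vv_side)
  have "coprime (\<sigma> * u) (int (4 * M))" using assms(1) coprime_u by auto
  then show "kernel_scale M (\<sigma> * u) K \<noteq> 0"
    using kernel_scale_nonzero[OF odd_M squarefree_M _ assms(2)] by simp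
qed (rule assms(1))

text \<open>The coefficient of \<open>q^n\<close> is kept at exponent \<open>n\<close> of the local
  parameter \<open>q^(1/(4 M))\<close>, hence the division of the argument by
  \<open>4 M\<close>.\<close>

lemma fls_of_expansion:
  assumes "has_q_expansion 1 f a"
  obtains A where "fls_conv_disc A" "fls_nth A = a" "\<And>\<tau>. \<tau> \<in> upper_half_plane \<Longrightarrow> ev A \<tau> = f (\<tau> / of_nat (4 * M))"
proof -
  obtain n0 where n0: "\<forall>n<n0. a n = 0" using assms by (auto simp: has_q_expansion_def)
  have hs: "((\<lambda>n. a n * exp (2 * of_real pi * \<i> * of_int n * \<tau>)) has_sum f \<tau>) UNIV"
    if "\<tau> \<in> upper_half_plane" for \<tau>
    using assms that by (simp add: has_q_expansion_def)
  have up: "\<tau> / of_nat (4 * M) \<in> upper_half_plane" if "\<tau> \<in> upper_half_plane" for \<tau>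
    using that M_pos by (simp add: upper_half_plane_def Im_divide_of_nat)
  have hq: "((\<lambda>n. a n * qx \<tau> powi n) has_sum f (\<tau> / of_nat (4 * M))) UNIV" if "\<tau> \<in> upper_half_plane" for \<tau>
    using hs[OF up[OF that]] unfolding qx_powi by simp
  have "(\<lambda>n. a n * x powi n) summable_on UNIV" if x: "norm x < 1" "x \<noteq> 0" for x
  proof -
    obtain \<tau> where "\<tau> \<in> upper_half_plane" "qx \<tau> = x" using qx_surj[OF x] by metis
    then show ?thesis using hq by (metis has_sum_imp_summable)
  qed
  from fls_of_has_sum[OF n0 this] obtain A where A: "fls_conv_disc A" "fls_nth A = a" by blast
  have "ev A \<tau> = f (\<tau> / of_nat (4 * M))" if "\<tau> \<in> upper_half_plane" for \<tau>
    by (rule ev_eqI[OF that A(1)]) (use hq[OF that] in \<open>simp add: A(2) qx_powi\<close>)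
  with A that show ?thesis by blast
qed

text \<open>The matrix with rows \<open>j, b\<close> and \<open>4 M, D\<close> is applied at
  \<open>(\<tau> - D) / (4 M)\<close>, where its denominator is just \<open>\<tau>\<close>.\<close>

lemma mod_form_transform:
  assumes f: "f \<in> mod_forms (4 * M) k" and jD: "j * D - b * int (4 * M) = 1" and \<tau>: "\<tau> \<in> upper_half_plane"
  shows "f ((- 1 / \<tau> + of_int j) / of_nat (4 * M)) =
    theta_mult (int (4 * M)) D powi \<lfloor>2 * k\<rfloor> * csqrt \<tau> powi \<lfloor>2 * k\<rfloor> * f ((\<tau> - of_int D) / of_nat (4 * M))"
proof -
  let ?N = "of_nat (4 * M) :: complex"
  have N0: "?N \<noteq> 0" using M_pos by simp
  let ?t = "(\<tau> - of_int D) / ?N"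
  have up: "?t \<in> upper_half_plane"
    using \<tau> M_pos by (simp add: upper_half_plane_def Im_divide_of_nat)
  have tr0: "\<forall>a b c d. a * d - b * c = 1 \<and> int (4 * M) dvd c \<longrightarrow>
        (\<forall>\<tau>\<in>upper_half_plane. f (moebius_int a b c d \<tau>) =
           (theta_mult c d * csqrt (of_int c * \<tau> + of_int d)) powi \<lfloor>2 * k\<rfloor> * f \<tau>)"
    using f unfolding mod_forms_def mem_Collect_eq by (elim conjE)
  have tr: "\<forall>\<tau>\<in>upper_half_plane. f (moebius_int j b (int (4 * M)) D \<tau>) =
     (theta_mult (int (4 * M)) D * csqrt (of_int (int (4 * M)) * \<tau> + of_int D)) powi \<lfloor>2 * k\<rfloor> * f \<tau>"
    using tr0[THEN spec[of _ j], THEN spec[of _ b], THEN spec[of _ "int (4 * M)"], THEN spec[of _ D]] jD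
    by (simp only: dvd_refl simp_thms)
  have den: "of_int (int (4 * M)) * ?t + of_int D = \<tau>" using N0 by simp
  have num: "moebius_int j b (int (4 * M)) D ?t = (- 1 / \<tau> + of_int j) / ?N"
  proof -
    have "of_int (j * D - b * int (4 * M)) = (1::complex)" unfolding jD by simp
    then have e: "of_int j * of_int D - of_int b * ?N = 1" by simp
    have "of_int j * ?t + of_int b = (of_int j * \<tau> - (of_int j * of_int D - of_int b * ?N)) / ?N"
      using N0 by (simp add: field_simps)
    also have "\<dots> = (of_int j * \<tau> - 1) / ?N" unfolding e ..
    finally have "moebius_int j b (int (4 * M)) D ?t = (of_int j * \<tau> - 1) / ?N / \<tau>"
      unfolding moebius_int_def den by simp
    also have "\<dots> = (- 1 / \<tau> + of_int j) / ?N"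
      using N0 uhp_nonzero[OF \<tau>] by (simp add: field_simps)
    finally show ?thesis .
  qed
  from bspec[OF tr up] show ?thesis unfolding num den power_int_mult_distrib by simp
qed

text \<open>The laws of \<open>f\<close> under matrices with upper left entry \<open>j\<close>,
  compared with \<open>kernel_twist\<close>, show that the defects of the inversion law have
  vanishing character sum at every unit \<open>j\<close>; \<open>char_sum_separates\<close> then
  kills each defect.\<close>

lemma vv_form_of_mod_form:
  assumes f: "f \<in> mod_forms (4 * M) k" and a: "has_q_expansion 1 f a"
    and supp: "\<And>n. a n \<noteq> 0 \<Longrightarrow> \<exists>c\<in>sqs. [n = \<sigma> * c] (mod int (4 * M))"
    and \<sigma>: "\<sigma> = 1 \<or> \<sigma> = - 1" and K: "K = \<lfloor>2 * k\<rfloor>" "odd K" and eta: "\<eta> = parity_value M (\<sigma> * u) K"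
  obtains F where "vv_form \<sigma> K F" "\<And>c n. c \<in> sqs \<Longrightarrow> F c $$ n = (if [n = \<sigma> * c] (mod int (4 * M)) then a n else 0)"
proof -
  interpret vv: vv_side "4 * M" sqs \<sigma> weight "kernel (\<sigma> * u) (kernel_scale M (\<sigma> * u) K)"
    by (rule vv_side_kernel[OF \<sigma> K(2)])
  obtain A where A: "fls_conv_disc A" "fls_nth A = a"
    "\<And>\<tau>. \<tau> \<in> upper_half_plane \<Longrightarrow> ev A \<tau> = f (\<tau> / of_nat (4 * M))"
    using fls_of_expansion[OF a] by metis
  define F where "F = (\<lambda>c. fls_scale_coeffs (\<lambda>n. if [n = \<sigma> * c] (mod int (4 * M)) then 1 else 0) A)"
  have F_nth: "F c $$ n = (if [n = \<sigma> * c] (mod int (4 * M)) then a n else 0)" for c n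
    by (simp add: F_def A(2))
  have F_conv: "fls_conv_disc (F c)" for c
    unfolding F_def by (rule fls_conv_disc_scale_coeffs[OF A(1), of _ 1]) simp
  have F_class: "fls_class (\<sigma> * c) (F c)" for c
    by (auto simp: fls_class_def F_nth split: if_splits)
  have sumF: "A = (\<Sum>c\<in>sqs. F c)"
  proof (rule fls_eqI)
    fix n
    have "(\<Sum>c\<in>sqs. F c) $$ n = (\<Sum>c\<in>sqs. if [n = \<sigma> * c] (mod int (4 * M)) then a n else 0)"
      by (simp add: fls_nth_sum F_nth)
    also have "\<dots> = a n" by (rule sum_class_indicator[OF \<sigma> supp])
    finally show "A $$ n = (\<Sum>c\<in>sqs. F c) $$ n" by (simp add: A(2))
  qed
  have ev_sumF: "ev A \<tau> = (\<Sum>c\<in>sqs. ev (F c) \<tau>)" if "\<tau> \<in> upper_half_plane" for \<tau>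
    unfolding sumF by (rule ev_sum[OF that F_conv])
  have shift: "ev (F c) (\<tau> + of_int j) = root_exp (4 * M) (\<sigma> * c * j) * ev (F c) \<tau>"
    if "\<tau> \<in> upper_half_plane" for c j \<tau>
    using ev_T_class[OF F_conv F_class that, of c j] unfolding root_exp_def .
  have "ev (F c) (- 1 / \<tau>) = csqrt \<tau> powi K *
      (\<Sum>c'\<in>sqs. kernel (\<sigma> * u) (kernel_scale M (\<sigma> * u) K) c c' * weight c' * ev (F c') \<tau>)"
    if c: "c \<in> sqs" and \<tau>: "\<tau> \<in> upper_half_plane" for c \<tau>
  proof -
    let ?k = "kernel (\<sigma> * u) (kernel_scale M (\<sigma> * u) K)" and ?q = "csqrt \<tau> powi K"
    define z where "z = (\<lambda>c. ev (F c) (- 1 / \<tau>) - ?q * (\<Sum>c'\<in>sqs. ?k c c' * weight c' * ev (F c') \<tau>))"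
    have sep: "(\<Sum>c\<in>sqs. z c * root_exp (4 * M) (\<sigma> * c * j)) = 0" if j: "coprime j (int (4 * M))" for j
    proof -
      obtain D0 where D0: "[j * D0 = 1] (mod int (4 * M))" using j by (auto simp: coprime_iff_invertible_int)
      \<comment> \<open>A positive representative, since \<open>theta_mult_twisted_gauss\<close>
        evaluates the multiplier for \<open>D > 0\<close>.\<close>
      define D where "D = D0 mod int (4 * M)"
      have D1: "[j * D = 1] (mod int (4 * M))" using D0 by (simp add: D_def cong_def mod_mult_right_eq)
      have "D \<noteq> 0"
      proof
        assume "D = 0"
        with D1 have "int (4 * M) dvd 1" by (auto simp: cong_iff_dvd_diff)
        then have "2 dvd (1::int)" by (rule dvd_trans[rotated]) simp
        then show False by simp
      qed
      moreover have "D \<ge> 0" unfolding D_def using M_pos by (intro pos_mod_sign) simp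
      ultimately have D: "D > 0" by linarith
      obtain b where b: "j * D - b * int (4 * M) = 1"
      proof -
        have "int (4 * M) dvd j * D - 1" using D1 by (simp only: cong_iff_dvd_diff)
        then obtain b where "j * D - 1 = int (4 * M) * b" by (elim dvdE)
        then show ?thesis by (intro that[of b]) (simp add: mult.commute)
      qed
      let ?\<theta> = "theta_mult (int (4 * M)) D powi K"
      have cv: "coprime (\<sigma> * u) (int (4 * M))" using \<sigma> coprime_u by auto
      have \<theta>: "?\<theta> = kernel_scale M (\<sigma> * u) K * twisted_gauss (\<sigma> * u * j)"
        by (rule theta_mult_twisted_gauss[OF K(2) cv eta D1 D])
      have up: "- 1 / \<tau> \<in> upper_half_plane" "- 1 / \<tau> + of_int j \<in> upper_half_plane" "\<tau> + of_int (- D) \<in> upper_half_plane"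
        using uhp_S[OF \<tau>] \<tau> by (simp_all only: uhp_add_of_int)
      have "(\<Sum>c\<in>sqs. ev (F c) (- 1 / \<tau>) * root_exp (4 * M) (\<sigma> * c * j)) = ev A (- 1 / \<tau> + of_int j)"
        unfolding ev_sumF[OF up(2)] shift[OF up(1)] by (simp only: mult.commute)
      also have "\<dots> = f ((- 1 / \<tau> + of_int j) / of_nat (4 * M))" by (rule A(3)[OF up(2)])
      also have "\<dots> = ?\<theta> * ?q * f ((\<tau> - of_int D) / of_nat (4 * M))"
        unfolding K(1) by (rule mod_form_transform[OF f b \<tau>])
      also have "f ((\<tau> - of_int D) / of_nat (4 * M)) = ev A (\<tau> + of_int (- D))"
        using A(3)[OF up(3)] by simp
      also have "\<dots> = (\<Sum>c'\<in>sqs. root_exp (4 * M) (- (\<sigma> * c' * D)) * ev (F c') \<tau>)"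
        unfolding ev_sumF[OF up(3)] shift[OF \<tau>] by simp
      finally have L: "(\<Sum>c\<in>sqs. ev (F c) (- 1 / \<tau>) * root_exp (4 * M) (\<sigma> * c * j)) =
          ?\<theta> * ?q * (\<Sum>c'\<in>sqs. root_exp (4 * M) (- (\<sigma> * c' * D)) * ev (F c') \<tau>)" .
      have "(\<Sum>c\<in>sqs. (?q * (\<Sum>c'\<in>sqs. ?k c c' * weight c' * ev (F c') \<tau>)) * root_exp (4 * M) (\<sigma> * c * j)) =
          (\<Sum>c\<in>sqs. \<Sum>c'\<in>sqs. ?q * ev (F c') \<tau> * (?k c c' * weight c' * root_exp (4 * M) (\<sigma> * c * j)))"
        by (simp only: sum_distrib_left sum_distrib_right mult_ac)
      also have "\<dots> = (\<Sum>c'\<in>sqs. ?q * ev (F c') \<tau> * (\<Sum>c\<in>sqs. ?k c c' * weight c' * root_exp (4 * M) (\<sigma> * c * j)))"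
        by (subst sum.swap) (simp only: sum_distrib_left)
      also have "\<dots> = (\<Sum>c'\<in>sqs. ?q * ev (F c') \<tau> * (?\<theta> * root_exp (4 * M) (- (\<sigma> * c' * D))))"
        by (intro sum.cong refl) (simp only: kernel_twist[OF _ D1] \<theta>)
      also have "\<dots> = ?\<theta> * ?q * (\<Sum>c'\<in>sqs. root_exp (4 * M) (- (\<sigma> * c' * D)) * ev (F c') \<tau>)"
        by (simp only: sum_distrib_left mult_ac)
      finally have R: "(\<Sum>c\<in>sqs. (?q * (\<Sum>c'\<in>sqs. ?k c c' * weight c' * ev (F c') \<tau>)) * root_exp (4 * M) (\<sigma> * c * j)) =
          ?\<theta> * ?q * (\<Sum>c'\<in>sqs. root_exp (4 * M) (- (\<sigma> * c' * D)) * ev (F c') \<tau>)" .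
      show ?thesis unfolding z_def left_diff_distrib sum_subtractf L R by simp
    qed
    have "z c = 0"
    proof (rule char_sum_separates[OF _ c])
      fix j assume j: "coprime j (int (4 * M))"
      \<comment> \<open>The components live on the classes \<open>\<sigma> * c\<close> whereas
        \<open>char_sum\<close> uses \<open>c\<close>; the sign is moved to
        \<open>j\<close>.\<close>
      then have "coprime (\<sigma> * j) (int (4 * M))" using \<sigma> by auto
      from sep[OF this] show "char_sum (4 * M) sqs z j = 0"
        using \<sigma> by (auto simp: char_sum_def)
    qed
    then show ?thesis by (simp add: z_def)
  qed
  then have "vv_form \<sigma> K F" unfolding vv.VV_def slaw_def using F_conv F_class by simp
  then show ?thesis using that F_nth by blast
qed

end

section \<open>The square root cocycle and the action of \<open>SL2(Z)\<close>\<close>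

lemma linear_form_nonzero:
  assumes "a * d - b * c = (1::int)" "\<tau> \<in> upper_half_plane"
  shows "of_int c * \<tau> + of_int d \<noteq> 0"
proof
  assume z: "of_int c * \<tau> + of_int d = 0"
  then have "Im (of_int c * \<tau> + of_int d) = 0" by simp
  then have c: "c = 0" using assms(2) by (auto simp: upper_half_plane_def)
  with z have "d = 0" by simp
  with c assms(1) show False by simp
qed

lemma moebius_uhp:
  assumes "a * d - b * c = 1" "\<tau> \<in> upper_half_plane"
  shows "moebius_int a b c d \<tau> \<in> upper_half_plane"
proof -
  let ?w = "of_int c * \<tau> + of_int d"
  have w: "?w \<noteq> 0" by (rule linear_form_nonzero[OF assms])
  then have pos: "(Re ?w)^2 + (Im ?w)^2 > 0" by (simp add: sum_power2_gt_zero_iff complex_eq_iff)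
  have "of_int a * of_int d - of_int b * of_int c = (1::real)"
    using assms(1) by (metis of_int_1 of_int_diff of_int_mult)
  moreover have "Im (of_int a * \<tau> + of_int b) * Re ?w - Re (of_int a * \<tau> + of_int b) * Im ?w =
      (of_int a * of_int d - of_int b * of_int c) * Im \<tau>"
    by (simp add: ring_distribs)
  ultimately have "Im (of_int a * \<tau> + of_int b) * Re ?w - Re (of_int a * \<tau> + of_int b) * Im ?w = Im \<tau>"
    by (simp only: mult_1_left)
  then have "Im (moebius_int a b c d \<tau>) = Im \<tau> / ((Re ?w)^2 + (Im ?w)^2)"
    unfolding moebius_int_def Im_divide by (simp add: mult.commute)
  then show ?thesis using pos assms(2) by (simp add: upper_half_plane_def)
qed

lemma continuous_csqrt_linear:
  "continuous_on upper_half_plane (\<lambda>\<tau>. csqrt (of_int c * \<tau> + of_int d))"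
proof (cases "c = 0")
  case False
  show ?thesis
  proof (rule continuous_on_compose2[OF holomorphic_on_imp_continuous_on[OF holomorphic_on_csqrt]], unfold image_subset_iff Compl_iff, intro continuous_intros, intro ballI)
    fix \<tau> assume "\<tau> \<in> upper_half_plane"
    then have "Im (of_int c * \<tau> + of_int d) \<noteq> 0" using False by (simp add: upper_half_plane_def)
    then show "of_int c * \<tau> + of_int d \<notin> \<real>\<^sub>\<le>\<^sub>0" by (auto simp: complex_nonpos_Reals_iff)
  qed
qed simp

lemma continuous_csqrt_uhp: "continuous_on upper_half_plane csqrt"
  using continuous_csqrt_linear[of 1 0] by simp

text \<open>The quotient of the two sides has square \<open>- 1\<close> and is continuous on a
  connected set, so it is constantly \<open>\<i>\<close> or \<open>- \<i>\<close>. This constant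
  takes the place of the metaplectic cocycle.\<close>

lemma csqrt_cocycle:
  assumes det: "a * d - b * c = 1"
  obtains s where "s \<noteq> 0" "\<And>\<tau>. \<tau> \<in> upper_half_plane \<Longrightarrow>
    csqrt (moebius_int a b c d \<tau>) * csqrt (of_int c * \<tau> + of_int d) = s * csqrt (of_int (- a) * \<tau> + of_int (- b))"
proof -
  define g where "g = (\<lambda>\<tau>. csqrt (moebius_int a b c d \<tau>) * csqrt (of_int c * \<tau> + of_int d) / csqrt (of_int (- a) * \<tau> + of_int (- b)))"
  have det': "c * (- b) - d * (- a) = 1" using det by (simp add: algebra_simps)
  have nz: "of_int c * \<tau> + of_int d \<noteq> 0" "of_int (- a) * \<tau> + of_int (- b) \<noteq> 0" if "\<tau> \<in> upper_half_plane" for \<tau>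
    using linear_form_nonzero[OF det that] linear_form_nonzero[OF det' that] by simp_all
  have m: "continuous_on upper_half_plane (moebius_int a b c d)"
    unfolding moebius_int_def[abs_def] using nz(1) by (intro continuous_intros) auto
  have "continuous_on upper_half_plane (\<lambda>\<tau>. csqrt (moebius_int a b c d \<tau>))"
    by (rule continuous_on_compose2[OF continuous_csqrt_uhp m]) (use moebius_uhp[OF det] in auto)
  then have cont: "continuous_on upper_half_plane g"
    unfolding g_def by (intro continuous_on_divide continuous_on_mult continuous_csqrt_linear) (use nz(2) in auto)
  have sq: "g \<tau> = \<i> \<or> g \<tau> = - \<i>" if "\<tau> \<in> upper_half_plane" for \<tau>
  proof -
    have "(g \<tau>)^2 = moebius_int a b c d \<tau> * (of_int c * \<tau> + of_int d) / (of_int (- a) * \<tau> + of_int (- b))"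
      unfolding g_def power_divide power_mult_distrib power2_csqrt ..
    also have "\<dots> = - 1"
    proof -
      have "x / y * y / (- x) = - 1" if "x \<noteq> 0" "y \<noteq> 0" for x y :: complex using that by simp
      from this[of "of_int a * \<tau> + of_int b" "of_int c * \<tau> + of_int d"] nz[OF that] show ?thesis
        unfolding moebius_int_def by (simp add: add_eq_0_iff)
    qed
    finally have "(g \<tau>)^2 = \<i>^2" by simp
    then show ?thesis by (simp only: power2_eq_iff)
  qed
  have "g constant_on upper_half_plane"
  proof (rule continuous_finite_range_constant[OF _ cont])
    show "connected upper_half_plane" by (rule convex_connected[OF convex_upper_half_plane])
    have "g ` upper_half_plane \<subseteq> {\<i>, - \<i>}" using sq by blast
    then show "finite (g ` upper_half_plane)" by (rule finite_subset) simp
  qed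
  then obtain s where s: "\<And>\<tau>. \<tau> \<in> upper_half_plane \<Longrightarrow> g \<tau> = s" by (auto simp: constant_on_def)
  have "\<i> \<in> upper_half_plane" by (simp add: upper_half_plane_def)
  from sq[OF this] s[OF this] have "s \<noteq> 0" by auto
  moreover have "csqrt (moebius_int a b c d \<tau>) * csqrt (of_int c * \<tau> + of_int d) = s * csqrt (of_int (- a) * \<tau> + of_int (- b))"
    if "\<tau> \<in> upper_half_plane" for \<tau>
    using s[OF that] nz(2)[OF that] unfolding g_def by (simp add: divide_eq_eq)
  ultimately show ?thesis using that by blast
qed

lemma csqrt_divide_pos: "x > 0 \<Longrightarrow> csqrt (z / of_real x) = csqrt z / of_real (sqrt x)"
proof (rule csqrt_unique)
  assume x: "x > 0"
  have "(of_real (sqrt x) :: complex)^2 = of_real x" using x by (simp flip: of_real_power)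
  then show "(csqrt z / of_real (sqrt x))^2 = z / of_real x" by (simp add: power_divide)
  have "0 < Re (csqrt z) \<or> Re (csqrt z) = 0 \<and> 0 \<le> Im (csqrt z)" by (rule csqrt_principal)
  then show "0 < Re (csqrt z / of_real (sqrt x)) \<or> Re (csqrt z / of_real (sqrt x)) = 0 \<and> 0 \<le> Im (csqrt z / of_real (sqrt x))"
    using x by (auto simp: Re_divide_of_real Im_divide_of_real)
qed

context vv_side
begin

text \<open>The matrix \<open>\<rho>\<close> is the same for all \<open>G\<close> with the given
  \<open>K\<close>, so that a multiplier can later be read off from one form and used for
  all.\<close>

definition SL2_law :: "int \<Rightarrow> int \<Rightarrow> int \<Rightarrow> int \<Rightarrow> int \<Rightarrow> (int \<Rightarrow> int \<Rightarrow> complex) \<Rightarrow> bool" where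
  "SL2_law K a b c d \<rho> \<longleftrightarrow> (\<forall>G. VV K G \<longrightarrow> (\<forall>e\<in>C. \<forall>\<tau>\<in>upper_half_plane.
     ev (G e) (moebius_int a b c d \<tau>) = csqrt (of_int c * \<tau> + of_int d) powi K * (\<Sum>e'\<in>C. \<rho> e e' * ev (G e') \<tau>)))"

lemma SL2_law_T:
  assumes "SL2_law K a b c d \<rho>" and det: "a * d - b * c = 1"
  shows "SL2_law K (a + j * c) (b + j * d) c d (\<lambda>e e'. root_exp N (\<sigma> * e * j) * \<rho> e e')"
  unfolding SL2_law_def
proof (intro allI impI ballI)
  fix G e \<tau> assume G: "VV K G" and e: "e \<in> C" and \<tau>: "\<tau> \<in> upper_half_plane"
  let ?m = "moebius_int a b c d \<tau>"
  have "moebius_int (a + j * c) (b + j * d) c d \<tau> = ?m + of_int j"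
    unfolding moebius_int_def using linear_form_nonzero[OF det \<tau>] by (simp add: field_simps)
  then have "ev (G e) (moebius_int (a + j * c) (b + j * d) c d \<tau>) = root_exp N (\<sigma> * e * j) * ev (G e) ?m"
    using ev_T_class[OF VV_D(1,2)[OF G e] moebius_uhp[OF det \<tau>], of j] by (simp add: root_exp_def)
  also have "ev (G e) ?m = csqrt (of_int c * \<tau> + of_int d) powi K * (\<Sum>e'\<in>C. \<rho> e e' * ev (G e') \<tau>)"
    using assms(1) G e \<tau> unfolding SL2_law_def by blast
  finally show "ev (G e) (moebius_int (a + j * c) (b + j * d) c d \<tau>) =
      csqrt (of_int c * \<tau> + of_int d) powi K * (\<Sum>e'\<in>C. root_exp N (\<sigma> * e * j) * \<rho> e e' * ev (G e') \<tau>)"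
    by (simp only: sum_distrib_left mult_ac)
qed

lemma SL2_law_S:
  assumes "SL2_law K a b c d \<rho>" and det: "a * d - b * c = 1"
  shows "\<exists>\<rho>'. SL2_law K c d (- a) (- b) \<rho>'"
proof -
  obtain s where s: "s \<noteq> 0" "\<And>\<tau>. \<tau> \<in> upper_half_plane \<Longrightarrow>
    csqrt (moebius_int a b c d \<tau>) * csqrt (of_int c * \<tau> + of_int d) = s * csqrt (of_int (- a) * \<tau> + of_int (- b))"
    using csqrt_cocycle[OF det] by metis
  have "SL2_law K c d (- a) (- b) (\<lambda>e e'. \<Sum>e1\<in>C. s powi K * (P e e1 * w e1 * \<rho> e1 e'))"
    unfolding SL2_law_def
  proof (intro allI impI ballI)
    fix G e \<tau> assume G: "VV K G" and e: "e \<in> C" and \<tau>: "\<tau> \<in> upper_half_plane"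
    let ?m = "moebius_int a b c d \<tau>"
    have m: "?m \<in> upper_half_plane" by (rule moebius_uhp[OF det \<tau>])
    have "moebius_int c d (- a) (- b) \<tau> = - 1 / ?m"
    proof -
      have "of_int (- a) * \<tau> + of_int (- b) = - (of_int a * \<tau> + of_int b)" by simp
      moreover have "y / (- x) = - 1 / (x / y)" for x y :: complex by simp
      ultimately show ?thesis unfolding moebius_int_def by metis
    qed
    then have "ev (G e) (moebius_int c d (- a) (- b) \<tau>) = csqrt ?m powi K * (\<Sum>e1\<in>C. P e e1 * w e1 * ev (G e1) ?m)"
      using VV_D(3)[OF G e m] by simp
    also have "\<dots> = csqrt ?m powi K * (\<Sum>e1\<in>C. P e e1 * w e1 *
        (csqrt (of_int c * \<tau> + of_int d) powi K * (\<Sum>e'\<in>C. \<rho> e1 e' * ev (G e') \<tau>)))"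
      using assms(1) G \<tau> unfolding SL2_law_def by simp
    also have "\<dots> = (csqrt ?m powi K * csqrt (of_int c * \<tau> + of_int d) powi K) * (\<Sum>e1\<in>C. \<Sum>e'\<in>C. P e e1 * w e1 * \<rho> e1 e' * ev (G e') \<tau>)"
      by (simp only: sum_distrib_left mult_ac)
    also have "csqrt ?m powi K * csqrt (of_int c * \<tau> + of_int d) powi K = csqrt (of_int (- a) * \<tau> + of_int (- b)) powi K * s powi K"
      unfolding power_int_mult_distrib[symmetric] s(2)[OF \<tau>] by (simp only: mult.commute)
    also have "(\<Sum>e1\<in>C. \<Sum>e'\<in>C. P e e1 * w e1 * \<rho> e1 e' * ev (G e') \<tau>) = (\<Sum>e'\<in>C. \<Sum>e1\<in>C. P e e1 * w e1 * \<rho> e1 e' * ev (G e') \<tau>)"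
      by (rule sum.swap)
    finally show "ev (G e) (moebius_int c d (- a) (- b) \<tau>) = csqrt (of_int (- a) * \<tau> + of_int (- b)) powi K *
        (\<Sum>e'\<in>C. (\<Sum>e1\<in>C. s powi K * (P e e1 * w e1 * \<rho> e1 e')) * ev (G e') \<tau>)"
      by (simp only: sum_distrib_left sum_distrib_right mult_ac)
  qed
  then show ?thesis by blast
qed

lemma SL2_law_upper_triangular:
  assumes "a * d = 1"
  shows "\<exists>\<rho>. SL2_law K a b 0 d \<rho>"
proof -
  have ad: "a = d" "d * d = 1" using assms by (auto simp: zmult_eq_1_iff)
  \<comment> \<open>For \<open>d = - 1\<close> the automorphy factor is a power of
    \<open>csqrt (- 1)\<close> although the action is a translation; this constant cancels
    it.\<close>
  let ?q = "csqrt (of_int d) powi (- K)"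
  have q: "csqrt (of_int d) powi K * ?q = 1"
  proof -
    have "d \<noteq> 0" using ad by auto
    then show ?thesis by (simp flip: power_int_add)
  qed
  have "SL2_law K a b 0 d (\<lambda>e e'. if e' = e then ?q * root_exp N (\<sigma> * e * (b * d)) else 0)"
    unfolding SL2_law_def
  proof (intro allI impI ballI)
    fix G e \<tau> assume G: "VV K G" and e: "e \<in> C" and \<tau>: "\<tau> \<in> upper_half_plane"
    have dd: "of_int d * of_int d = (1::complex)" using ad(2) by (metis of_int_1 of_int_mult)
    then have d0: "of_int d \<noteq> (0::complex)" by auto
    have "moebius_int a b 0 d \<tau> = \<tau> + of_int (b * d)"
    proof -
      have "of_int d * \<tau> + of_int b = (\<tau> + of_int b * of_int d) * of_int d"
        using dd by (simp add: algebra_simps)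
      then show ?thesis unfolding moebius_int_def ad(1) using d0 by simp
    qed
    then have "ev (G e) (moebius_int a b 0 d \<tau>) = root_exp N (\<sigma> * e * (b * d)) * ev (G e) \<tau>"
      using ev_T_class[OF VV_D(1,2)[OF G e] \<tau>, of "b * d"] by (simp only: root_exp_def)
    also have "\<dots> = (csqrt (of_int d) powi K * ?q) * (root_exp N (\<sigma> * e * (b * d)) * ev (G e) \<tau>)"
      unfolding q by simp
    also have "\<dots> = csqrt (of_int 0 * \<tau> + of_int d) powi K *
        (\<Sum>e'\<in>C. if e' = e then ?q * root_exp N (\<sigma> * e * (b * d)) * ev (G e') \<tau> else 0)"
      using e fin by (simp add: sum.delta)
    finally show "ev (G e) (moebius_int a b 0 d \<tau>) = csqrt (of_int 0 * \<tau> + of_int d) powi K *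
        (\<Sum>e'\<in>C. (if e' = e then ?q * root_exp N (\<sigma> * e * (b * d)) else 0) * ev (G e') \<tau>)"
      by (simp only: if_distrib[of "\<lambda>x. x * _"] mult_zero_left)
  qed
  then show ?thesis by blast
qed

text \<open>The Euclidean algorithm on the first column: a translation reduces \<open>a\<close>
  modulo \<open>c\<close>, and an inversion exchanges the rows.\<close>

lemma SL2_law_exists:
  assumes "a * d - b * c = 1"
  shows "\<exists>\<rho>. SL2_law K a b c d \<rho>"
  using assms
proof (induction "nat \<bar>c\<bar>" arbitrary: a b c d rule: less_induct)
  case less
  show ?case
  proof (cases "c = 0")
    case True
    then show ?thesis using SL2_law_upper_triangular[of a d K b] less.prems by simp
  next
    case False
    let ?j = "a div c"
    let ?r = "a - ?j * c" and ?s = "b - ?j * d"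
    have r: "?r = a mod c" by (simp add: minus_div_mult_eq_mod)
    \<comment> \<open>The signs are placed so that \<open>SL2_law_S\<close> leads from this matrix
      to the one with rows \<open>?r, ?s\<close> and \<open>c, d\<close>.\<close>
    have det1: "(- c) * ?s - (- d) * ?r = 1" using less.prems by (simp add: algebra_simps)
    have "\<bar>?r\<bar> < \<bar>c\<bar>" unfolding r using False by (simp add: abs_mod_less)
    then have "nat \<bar>?r\<bar> < nat \<bar>c\<bar>" by simp
    from less.hyps[OF this det1] obtain \<rho> where "SL2_law K (- c) (- d) ?r ?s \<rho>" by blast
    from SL2_law_S[OF this det1] obtain \<rho>' where 1: "SL2_law K ?r ?s c d \<rho>'" by auto
    have det2: "?r * d - ?s * c = 1" using less.prems by (simp add: algebra_simps)
    from SL2_law_T[OF 1 det2, of ?j] show ?thesis by (simp add: exI)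
  qed
qed

end

section \<open>Scalar forms assembled from vector-valued ones, and their cusps\<close>

lemma has_q_expansion_lincomb:
  assumes "finite I" "\<And>i. i \<in> I \<Longrightarrow> has_q_expansion h (f i) (v i)"
  shows "has_q_expansion h (\<lambda>\<tau>. \<Sum>i\<in>I. z i * f i \<tau>) (\<lambda>n. \<Sum>i\<in>I. z i * v i n)"
  unfolding has_q_expansion_def
proof (intro conjI ballI)
  have "\<exists>n0. \<forall>n<n0. \<forall>i\<in>I. v i n = 0"
    using assms
  proof (induction I rule: finite_induct)
    case (insert j I)
    obtain n1 where n1: "\<forall>n<n1. \<forall>i\<in>I. v i n = 0" using insert by auto
    obtain n2 where n2: "\<forall>n<n2. v j n = 0" using insert.prems[of j] by (auto simp: has_q_expansion_def)
    show ?case by (rule exI[of _ "min n1 n2"]) (use n1 n2 in auto)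
  qed simp
  then obtain n0 where n0: "\<forall>n<n0. \<forall>i\<in>I. v i n = 0" by blast
  show "\<exists>n0. \<forall>n<n0. (\<Sum>i\<in>I. z i * v i n) = 0"
    by (rule exI[of _ n0]) (use n0 in \<open>auto intro!: sum.neutral\<close>)
  fix \<tau> assume \<tau>: "\<tau> \<in> upper_half_plane"
  have "((\<lambda>n. \<Sum>i\<in>I. z i * (v i n * exp (2 * of_real pi * \<i> * of_int n * \<tau> / of_nat h))) has_sum (\<Sum>i\<in>I. z i * f i \<tau>)) UNIV"
    using assms
  proof (induction I rule: finite_induct)
    case (insert j I)
    have "((\<lambda>n. v j n * exp (2 * of_real pi * \<i> * of_int n * \<tau> / of_nat h)) has_sum f j \<tau>) UNIV"
      using insert.prems[of j] \<tau> by (simp add: has_q_expansion_def)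
    then show ?case
      unfolding sum.insert[OF insert.hyps] using insert by (intro has_sum_add has_sum_cmult_right) auto
  qed (simp add: has_sum_0)
  then show "((\<lambda>n. (\<Sum>i\<in>I. z i * v i n) * exp (2 * of_real pi * \<i> * of_int n * \<tau> / of_nat h)) has_sum (\<Sum>i\<in>I. z i * f i \<tau>)) UNIV"
    by (simp only: sum_distrib_right mult.assoc)
qed

lemma has_q_expansion_cong:
  assumes "has_q_expansion h f v" "\<And>\<tau>. \<tau> \<in> upper_half_plane \<Longrightarrow> f \<tau> = g \<tau>"
  shows "has_q_expansion h g v"
  using assms by (simp add: has_q_expansion_def)

lemma has_q_expansion_unique_value:
  assumes "has_q_expansion h f v" "has_q_expansion h g v" "\<tau> \<in> upper_half_plane"
  shows "f \<tau> = g \<tau>"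
  using assms unfolding has_q_expansion_def by (meson has_sum_unique)

text \<open>A Hermite normal form: \<open>diag (n, 1)\<close> times the given matrix equals an
  element of \<open>SL2(Z)\<close> times the upper triangular matrix with rows
  \<open>\<alpha>, \<beta>\<close> and \<open>0, \<delta>\<close>. It carries the scaling by
  \<open>4 M\<close> past an arbitrary cusp.\<close>

lemma scaled_SL2_decomposition:
  assumes det: "a * d - b * c = 1" and n: "n > 0"
  obtains A B C D \<beta> :: int and \<alpha> \<delta> :: nat where "A * D - B * C = 1" "\<alpha> > 0" "\<delta> > 0"
    "A * int \<alpha> = int n * a" "A * \<beta> + B * int \<delta> = int n * b" "C * int \<alpha> = c" "C * \<beta> + D * int \<delta> = d"
proof -
  have "gcd (int n * a) c dvd int n"
  proof -
    have "int n = int n * a * d - int n * b * c" using det by (metis mult.assoc mult.right_neutral right_diff_distrib)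
    moreover have "gcd (int n * a) c dvd int n * a * d - int n * b * c" by (intro dvd_diff dvd_mult2[OF gcd_dvd1] dvd_mult[OF gcd_dvd2])
    ultimately show ?thesis by simp
  qed
  \<comment> \<open>The first column of the scaled matrix determines the diagonal:
    \<open>\<alpha>\<close> is its gcd, and \<open>\<delta> = n / \<alpha>\<close>.\<close>
  define g where "g = gcd (int n * a) c"
  obtain d1 where d1: "int n = g * d1" using \<open>gcd (int n * a) c dvd int n\<close> by (auto simp: g_def)
  have g0: "g > 0"
  proof -
    have "g \<noteq> 0" using d1 n by auto
    moreover have "g \<ge> 0" unfolding g_def by (rule gcd_ge_0_int)
    ultimately show ?thesis by linarith
  qed
  have d10: "d1 > 0" using d1 g0 n by (metis of_nat_0_less_iff zero_less_mult_pos)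
  have "g dvd int n * a" "g dvd c" by (simp_all add: g_def)
  then obtain A C where A: "int n * a = g * A" and C: "c = g * C" by (elim dvdE)
  have "g * gcd A C = g" using g0 unfolding g_def[symmetric] gcd_mult_distrib_int[symmetric]
    by (metis A C abs_of_pos g_def gcd_mult_distrib_int)
  then have "gcd A C = 1" using g0 by simp
  then obtain x y where xy: "x * A + y * C = 1" using bezout_int by metis
  define D where "D = x"
  define B where "B = - y"
  have AB: "A * D - B * C = 1" using xy by (simp add: B_def D_def algebra_simps)
  define \<beta> where "\<beta> = D * (int n * b) - B * d"
  have e1: "A * \<beta> + B * d1 = int n * b"
  proof -
    have "g * (A * \<beta> + B * d1) = g * (int n * b)"
    proof -
      have "g * (A * \<beta> + B * d1) = (g * A) * \<beta> + B * (g * d1)" by (simp add: algebra_simps)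
      also have "\<dots> = int n * a * (D * (int n * b) - B * d) + B * int n" unfolding A[symmetric] d1[symmetric] \<beta>_def ..
      also have "\<dots> = int n * b * (D * (int n * a)) - int n * B * (a * d - 1)" by (simp add: algebra_simps)
      also have "a * d - 1 = b * c" using det by simp
      also have "int n * b * (D * (int n * a)) - int n * B * (b * c) = int n * b * g * (A * D - B * C)"
        unfolding A C by (simp add: algebra_simps)
      finally show ?thesis unfolding AB by simp
    qed
    then show ?thesis using g0 by simp
  qed
  have e2: "C * \<beta> + D * d1 = d"
  proof -
    have "g * (C * \<beta> + D * d1) = g * d"
    proof -
      have "g * (C * \<beta> + D * d1) = (g * C) * \<beta> + D * (g * d1)" by (simp add: algebra_simps)
      also have "\<dots> = c * (D * (int n * b) - B * d) + D * int n" unfolding C[symmetric] d1[symmetric] \<beta>_def ..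
      also have "\<dots> = D * int n * (1 + b * c) - c * B * d" by (simp add: algebra_simps)
      also have "1 + b * c = a * d" using det by simp
      also have "D * int n * (a * d) - c * B * d = d * (D * (int n * a) - B * c)" by (simp add: algebra_simps)
      also have "\<dots> = d * (g * (A * D - B * C))" unfolding A C by (simp add: algebra_simps)
      finally show ?thesis unfolding AB by simp
    qed
    then show ?thesis using g0 by simp
  qed
  show ?thesis
    by (rule that[of A D B C "nat g" "nat d1" \<beta>]) (use AB g0 d10 e1 e2 A C in \<open>simp_all add: mult.commute\<close>)
qed

context q_width
begin

lemma ev_affine_expansion:
  assumes A: "fls_conv_disc A" and pos: "\<alpha> > 0" "\<delta> > 0"
  shows "has_q_expansion (\<delta> * N) (\<lambda>\<tau>. ev A ((of_nat \<alpha> * \<tau> + of_int \<beta>) / of_nat \<delta>))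
    (\<lambda>n. if int \<alpha> dvd n then A $$ (n div int \<alpha>) * root_exp (\<delta> * N) (n div int \<alpha> * \<beta>) else 0)"
  unfolding has_q_expansion_def
proof (intro conjI ballI)
  let ?v = "\<lambda>n. if int \<alpha> dvd n then A $$ (n div int \<alpha>) * root_exp (\<delta> * N) (n div int \<alpha> * \<beta>) else 0"
  show "\<exists>n0. \<forall>n<n0. ?v n = 0"
  proof (intro exI allI impI)
    fix n assume n: "n < int \<alpha> * fls_subdegree A"
    show "?v n = 0"
    proof (cases "int \<alpha> dvd n")
      case True
      then obtain k where k: "n = int \<alpha> * k" by (elim dvdE)
      then have "k < fls_subdegree A" using n pos by simp
      then show ?thesis using k pos by simp
    qed simp
  qed
  fix \<tau> assume \<tau>: "\<tau> \<in> upper_half_plane"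
  let ?w = "(of_nat \<alpha> * \<tau> + of_int \<beta>) / of_nat \<delta>"
  let ?g = "\<lambda>n. ?v n * exp (2 * of_real pi * \<i> * of_int n * \<tau> / of_nat (\<delta> * N))"
  have w: "?w \<in> upper_half_plane"
    using \<tau> pos by (simp add: upper_half_plane_def Im_divide_of_nat)
  have g: "?g (int \<alpha> * n) = A $$ n * exp (2 * of_real pi * \<i> * of_int n * ?w / of_nat N)" for n
  proof -
    have "root_exp (\<delta> * N) (n * \<beta>) * exp (2 * of_real pi * \<i> * of_int (int \<alpha> * n) * \<tau> / of_nat (\<delta> * N)) =
        exp (2 * of_real pi * \<i> * of_int n * ?w / of_nat N)"
      unfolding root_exp_def exp_add[symmetric] using pos N_pos
      by (intro arg_cong[where f=exp]) (simp add: field_simps)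
    then show ?thesis using pos by simp
  qed
  have "((\<lambda>n. ?g (int \<alpha> * n)) has_sum ev A ?w) UNIV"
    unfolding g by (rule ev_has_sum[OF w A])
  then have "(?g has_sum ev A ?w) (range ((*) (int \<alpha>)))"
    using pos by (subst has_sum_reindex) (auto simp: inj_on_def o_def)
  then show "(?g has_sum ev A ?w) UNIV"
    by (rule has_sum_cong_neutral[THEN iffD1, rotated -1]) (auto elim!: dvdE)
qed

end

context square_classes
begin

text \<open>The scaling undoes the division by \<open>4 M\<close> in
  \<open>fls_of_expansion\<close>.\<close>

definition assembled :: "(int \<Rightarrow> complex fls) \<Rightarrow> complex \<Rightarrow> complex" where
  "assembled G \<tau> = (\<Sum>c\<in>sqs. ev (G c) (of_nat (4 * M) * \<tau>))"

lemma assembled_expansion: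
  assumes "\<forall>c\<in>sqs. fls_conv_disc (G c)"
  shows "has_q_expansion 1 (assembled G) (\<lambda>n. \<Sum>c\<in>sqs. G c $$ n)"
proof -
  have up: "of_nat (4 * M) * \<tau> \<in> upper_half_plane" if "\<tau> \<in> upper_half_plane" for \<tau>
    using that M_pos by (simp add: upper_half_plane_def)
  have "has_q_expansion 1 (\<lambda>\<tau>. ev (G c) (of_nat (4 * M) * \<tau>)) (fls_nth (G c))" if "c \<in> sqs" for c
    unfolding has_q_expansion_def
  proof (intro conjI ballI)
    show "\<exists>n0. \<forall>n<n0. G c $$ n = 0" by (rule exI[of _ "fls_subdegree (G c)"]) simp
    fix \<tau> assume "\<tau> \<in> upper_half_plane"
    from ev_has_sum[OF up[OF this]] assms that
    have "((\<lambda>n. G c $$ n * exp (2 * of_real pi * \<i> * of_int n * (of_nat (4 * M) * \<tau>) / of_nat (4 * M))) has_sum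
        ev (G c) (of_nat (4 * M) * \<tau>)) UNIV" by blast
    moreover have "2 * of_real pi * \<i> * of_int n * (of_nat (4 * M) * \<tau>) / of_nat (4 * M) = 2 * of_real pi * \<i> * of_int n * \<tau> / of_nat 1" for n
      using M_pos by simp
    ultimately show "((\<lambda>n. G c $$ n * exp (2 * of_real pi * \<i> * of_int n * \<tau> / of_nat 1)) has_sum ev (G c) (of_nat (4 * M) * \<tau>)) UNIV"
      by (simp only:)
  qed
  then have "has_q_expansion 1 (\<lambda>\<tau>. \<Sum>c\<in>sqs. 1 * ev (G c) (of_nat (4 * M) * \<tau>)) (\<lambda>n. \<Sum>c\<in>sqs. 1 * G c $$ n)"
    by (rule has_q_expansion_lincomb[OF finite_sqs])
  then show ?thesis unfolding assembled_def[abs_def] by simp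
qed

text \<open>The law under a given matrix holds with the same coefficients for all forms, so the
  multiplier on \<open>\<Gamma>\<^sub>0(4 M)\<close> is inherited from one nonzero form \<open>f0\<close>.\<close>

lemma assembled_mod_form:
  assumes \<sigma>: "\<sigma> = 1 \<or> \<sigma> = - 1" and K: "K = \<lfloor>2 * k\<rfloor>" "odd K"
    and G: "vv_form \<sigma> K G" and F0: "vv_form \<sigma> K F0" "\<exists>c\<in>sqs. F0 c \<noteq> 0"
    and f0: "f0 \<in> mod_forms (4 * M) k" "\<And>\<tau>. \<tau> \<in> upper_half_plane \<Longrightarrow> f0 \<tau> = assembled F0 \<tau>"
  shows "assembled G \<in> mod_forms (4 * M) k"
proof -
  interpret vv: vv_side "4 * M" sqs \<sigma> weight "kernel (\<sigma> * u) (kernel_scale M (\<sigma> * u) K)"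
    by (rule vv_side_kernel[OF \<sigma> K(2)])
  let ?N = "of_nat (4 * M) :: complex"
  have N0: "?N \<noteq> 0" using M_pos by simp
  have up: "?N * \<tau> \<in> upper_half_plane" if "\<tau> \<in> upper_half_plane" for \<tau>
    using that M_pos by (simp add: upper_half_plane_def)
  have conv: "\<forall>c\<in>sqs. fls_conv_disc (G c)" by (rule vv.VV_conv[OF G])
  have hol: "assembled G holomorphic_on upper_half_plane"
    unfolding assembled_def[abs_def]
  proof (intro holomorphic_intros)
    fix c assume c: "c \<in> sqs"
    show "(\<lambda>\<tau>. ev (G c) (?N * \<tau>)) holomorphic_on upper_half_plane"
      by (rule holomorphic_on_compose_gen[unfolded o_def, OF _ ev_holomorphic])
         (use conv c up in \<open>auto intro!: holomorphic_intros\<close>)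
  qed
  have trans: "assembled G (moebius_int a b c d \<tau>) =
      (theta_mult c d * csqrt (of_int c * \<tau> + of_int d)) powi \<lfloor>2 * k\<rfloor> * assembled G \<tau>"
    if det: "a * d - b * c = 1" "int (4 * M) dvd c" and \<tau>: "\<tau> \<in> upper_half_plane" for a b c d \<tau>
  proof -
    obtain c1 where c1: "c = int (4 * M) * c1" using det(2) by (elim dvdE)
    have det': "a * d - (b * int (4 * M)) * c1 = 1" using det(1) unfolding c1 by (simp add: mult_ac)
    obtain \<rho> where \<rho>: "vv.SL2_law K a (b * int (4 * M)) c1 d \<rho>" using vv.SL2_law_exists[OF det'] by metis
    have cN: "of_int c1 * (?N * \<tau>) + of_int d = of_int c * \<tau> + of_int d" for \<tau> :: complex
      unfolding c1 by (simp add: mult_ac)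
    have m: "moebius_int a (b * int (4 * M)) c1 d (?N * \<tau>) = ?N * moebius_int a b c d \<tau>" for \<tau>
      unfolding moebius_int_def cN by (simp add: ring_distribs add_divide_distrib mult_ac)
    have law: "assembled H (moebius_int a b c d \<tau>) = csqrt (of_int c * \<tau> + of_int d) powi K *
        (\<Sum>e'\<in>sqs. (\<Sum>e\<in>sqs. \<rho> e e') * ev (H e') (?N * \<tau>))"
      if H: "vv_form \<sigma> K H" and \<tau>: "\<tau> \<in> upper_half_plane" for H \<tau>
    proof -
      have "assembled H (moebius_int a b c d \<tau>) = (\<Sum>e\<in>sqs. csqrt (of_int c * \<tau> + of_int d) powi K * (\<Sum>e'\<in>sqs. \<rho> e e' * ev (H e') (?N * \<tau>)))"
        unfolding assembled_def m[symmetric]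
        using \<rho> H up[OF \<tau>] unfolding vv.SL2_law_def cN[symmetric] by (intro sum.cong refl) blast
      also have "\<dots> = csqrt (of_int c * \<tau> + of_int d) powi K * (\<Sum>e\<in>sqs. \<Sum>e'\<in>sqs. \<rho> e e' * ev (H e') (?N * \<tau>))"
        by (simp only: sum_distrib_left)
      also have "(\<Sum>e\<in>sqs. \<Sum>e'\<in>sqs. \<rho> e e' * ev (H e') (?N * \<tau>)) = (\<Sum>e'\<in>sqs. \<Sum>e\<in>sqs. \<rho> e e' * ev (H e') (?N * \<tau>))"
        by (rule sum.swap)
      finally show ?thesis by (simp only: sum_distrib_right)
    qed
    have f0_trans: "\<forall>a b c d. a * d - b * c = 1 \<and> int (4 * M) dvd c \<longrightarrow>
        (\<forall>\<tau>\<in>upper_half_plane. f0 (moebius_int a b c d \<tau>) =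
           (theta_mult c d * csqrt (of_int c * \<tau> + of_int d)) powi \<lfloor>2 * k\<rfloor> * f0 \<tau>)"
      using f0(1) unfolding mod_forms_def mem_Collect_eq by (elim conjE)
    \<comment> \<open>The two laws known for \<open>f0\<close> are compared; independence of the
      components of \<open>F0\<close> forces every column sum of \<open>\<rho>\<close> to be the
      theta multiplier.\<close>
    have row: "(\<Sum>e\<in>sqs. \<rho> e e') - theta_mult c d powi K = 0" if e': "e' \<in> sqs" for e'
    proof (rule vv.VV_independent[OF F0 _ e'])
      fix w assume w: "w \<in> upper_half_plane"
      define \<tau> where "\<tau> = w / ?N"
      have \<tau>: "\<tau> \<in> upper_half_plane" using w M_pos by (simp add: \<tau>_def upper_half_plane_def Im_divide_of_nat)
      have wN: "w = ?N * \<tau>" using N0 by (simp add: \<tau>_def)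
      have q0: "csqrt (of_int c * \<tau> + of_int d) powi K \<noteq> 0"
        using linear_form_nonzero[OF det(1) \<tau>] by simp
      have "csqrt (of_int c * \<tau> + of_int d) powi K * (\<Sum>e'\<in>sqs. (\<Sum>e\<in>sqs. \<rho> e e') * ev (F0 e') w) = f0 (moebius_int a b c d \<tau>)"
        unfolding wN f0(2)[OF moebius_uhp[OF det(1) \<tau>]] by (rule law[OF F0(1) \<tau>, symmetric])
      also have "\<dots> = (theta_mult c d * csqrt (of_int c * \<tau> + of_int d)) powi K * f0 \<tau>"
        unfolding K(1) using f0_trans det \<tau> by blast
      also have "f0 \<tau> = (\<Sum>e'\<in>sqs. ev (F0 e') w)" unfolding f0(2)[OF \<tau>] assembled_def wN ..
      finally have "(\<Sum>e'\<in>sqs. (\<Sum>e\<in>sqs. \<rho> e e') * ev (F0 e') w) = theta_mult c d powi K * (\<Sum>e'\<in>sqs. ev (F0 e') w)"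
      proof -
        assume e: "csqrt (of_int c * \<tau> + of_int d) powi K * (\<Sum>e'\<in>sqs. (\<Sum>e\<in>sqs. \<rho> e e') * ev (F0 e') w) =
          (theta_mult c d * csqrt (of_int c * \<tau> + of_int d)) powi K * (\<Sum>e'\<in>sqs. ev (F0 e') w)"
        have "x = y * z" if "q * x = y * q * z" "q \<noteq> 0" for q x y z :: complex using that by simp
        from this[OF e[unfolded power_int_mult_distrib] q0] show ?thesis .
      qed
      then show "(\<Sum>e'\<in>sqs. ((\<Sum>e\<in>sqs. \<rho> e e') - theta_mult c d powi K) * ev (F0 e') w) = 0"
        by (simp only: left_diff_distrib sum_subtractf sum_distrib_left) simp
    qed
    have "(\<Sum>e'\<in>sqs. (\<Sum>e\<in>sqs. \<rho> e e') * ev (G e') (?N * \<tau>)) = (\<Sum>e'\<in>sqs. theta_mult c d powi K * ev (G e') (?N * \<tau>))"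
      by (rule sum.cong[OF refl]) (use row in simp)
    also have "\<dots> = theta_mult c d powi K * assembled G \<tau>"
      unfolding assembled_def by (rule sum_distrib_left[symmetric])
    finally show ?thesis unfolding law[OF G \<tau>] K(1)[symmetric] power_int_mult_distrib by (simp only: mult_ac)
  qed
  have cusp: "\<exists>h>0. \<exists>v. has_q_expansion h
      (\<lambda>\<tau>. csqrt (of_int c * \<tau> + of_int d) powi (- \<lfloor>2 * k\<rfloor>) * assembled G (moebius_int a b c d \<tau>)) v"
    if det: "a * d - b * c = 1" for a b c d
  proof -
    have N1: "4 * M > 0" using M_pos by simp
    obtain A B C D \<beta> :: int and \<alpha> \<delta> :: nat where dec: "A * D - B * C = 1" "\<alpha> > 0" "\<delta> > 0"
      "A * int \<alpha> = int (4 * M) * a" "A * \<beta> + B * int \<delta> = int (4 * M) * b" "C * int \<alpha> = c" "C * \<beta> + D * int \<delta> = d"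
      using scaled_SL2_decomposition[OF det N1] by metis
    obtain \<rho> where \<rho>: "vv.SL2_law K A B C D \<rho>" using vv.SL2_law_exists[OF dec(1)] by metis
    \<comment> \<open>The factor between the powers of \<open>csqrt (c \<tau> + d)\<close> and of
      \<open>csqrt ((c \<tau> + d) / \<delta>)\<close>.\<close>
    let ?s = "(of_real (sqrt (real \<delta>)) :: complex) powi K"
    let ?w = "\<lambda>\<tau>. (of_nat \<alpha> * \<tau> + of_int \<beta>) / of_nat \<delta> :: complex"
    have s0: "?s \<noteq> 0" using dec(3) by simp
    have "has_q_expansion (\<delta> * (4 * M)) (\<lambda>\<tau>. \<Sum>e'\<in>sqs. ((\<Sum>e\<in>sqs. \<rho> e e') / ?s) * ev (G e') (?w \<tau>))
      (\<lambda>n. \<Sum>e'\<in>sqs. ((\<Sum>e\<in>sqs. \<rho> e e') / ?s) *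
        (if int \<alpha> dvd n then G e' $$ (n div int \<alpha>) * root_exp (\<delta> * (4 * M)) (n div int \<alpha> * \<beta>) else 0))"
      by (rule has_q_expansion_lincomb[OF finite_sqs]) (rule ev_affine_expansion, use conv dec in auto)
    moreover have "(\<Sum>e'\<in>sqs. ((\<Sum>e\<in>sqs. \<rho> e e') / ?s) * ev (G e') (?w \<tau>)) =
        csqrt (of_int c * \<tau> + of_int d) powi (- \<lfloor>2 * k\<rfloor>) * assembled G (moebius_int a b c d \<tau>)"
      if \<tau>: "\<tau> \<in> upper_half_plane" for \<tau>
    proof -
      have \<delta>0: "of_nat \<delta> \<noteq> (0::complex)" using dec(3) by simp
      have w: "?w \<tau> \<in> upper_half_plane"
        using \<tau> dec by (simp add: upper_half_plane_def Im_divide_of_nat)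
      have den: "of_int C * ?w \<tau> + of_int D = (of_int c * \<tau> + of_int d) / of_nat \<delta>"
        unfolding dec(6,7)[symmetric] using \<delta>0 by (simp add: field_simps)
      have num: "of_int A * ?w \<tau> + of_int B = (of_int (int (4 * M) * a) * \<tau> + of_int (int (4 * M) * b)) / of_nat \<delta>"
        unfolding dec(4,5)[symmetric] using \<delta>0 by (simp add: field_simps)
      have m: "moebius_int A B C D (?w \<tau>) = ?N * moebius_int a b c d \<tau>"
        unfolding moebius_int_def num den using \<delta>0 by (simp add: ring_distribs add_divide_distrib)
      have q0: "csqrt (of_int c * \<tau> + of_int d) \<noteq> 0" using linear_form_nonzero[OF det \<tau>] by simp
      have "assembled G (moebius_int a b c d \<tau>) =
          (\<Sum>e\<in>sqs. csqrt ((of_int c * \<tau> + of_int d) / of_nat \<delta>) powi K * (\<Sum>e'\<in>sqs. \<rho> e e' * ev (G e') (?w \<tau>)))"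
        unfolding assembled_def m[symmetric] den[symmetric]
        using \<rho> G w unfolding vv.SL2_law_def by (intro sum.cong refl) blast
      also have "csqrt ((of_int c * \<tau> + of_int d) / of_nat \<delta>) = csqrt (of_int c * \<tau> + of_int d) / of_real (sqrt (real \<delta>))"
        using csqrt_divide_pos[of "real \<delta>"] dec(3) by simp
      finally have "assembled G (moebius_int a b c d \<tau>) =
          csqrt (of_int c * \<tau> + of_int d) powi K / ?s * (\<Sum>e\<in>sqs. \<Sum>e'\<in>sqs. \<rho> e e' * ev (G e') (?w \<tau>))"
        by (simp only: power_int_divide_distrib sum_distrib_left)
      also have "(\<Sum>e\<in>sqs. \<Sum>e'\<in>sqs. \<rho> e e' * ev (G e') (?w \<tau>)) = (\<Sum>e'\<in>sqs. \<Sum>e\<in>sqs. \<rho> e e' * ev (G e') (?w \<tau>))"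
        by (rule sum.swap)
      also have "\<dots> = ?s * (\<Sum>e'\<in>sqs. ((\<Sum>e\<in>sqs. \<rho> e e') / ?s) * ev (G e') (?w \<tau>))"
        unfolding sum_distrib_left using s0 by (intro sum.cong refl) (simp add: sum_distrib_right)
      finally show ?thesis
        unfolding K(1)[symmetric] using s0 q0 by (simp add: power_int_minus)
    qed
    ultimately have "has_q_expansion (\<delta> * (4 * M))
        (\<lambda>\<tau>. csqrt (of_int c * \<tau> + of_int d) powi (- \<lfloor>2 * k\<rfloor>) * assembled G (moebius_int a b c d \<tau>))
      (\<lambda>n. \<Sum>e'\<in>sqs. ((\<Sum>e\<in>sqs. \<rho> e e') / ?s) *
        (if int \<alpha> dvd n then G e' $$ (n div int \<alpha>) * root_exp (\<delta> * (4 * M)) (n div int \<alpha> * \<beta>) else 0))"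
      by (rule has_q_expansion_cong)
    moreover have "\<delta> * (4 * M) > 0" using dec(3) M_pos by simp
    ultimately show ?thesis by blast
  qed
  show ?thesis unfolding mod_forms_def mem_Collect_eq using hol trans cusp by blast
qed

end

section \<open>Sign vectors\<close>

lemma nsmul_in_component:
  assumes "df_component_cyclic p (\<gamma>::'a::ab_group_add)" "df_component_cyclic p \<gamma>'"
  obtains n where "\<gamma>' = nsmul n \<gamma>"
proof -
  have "nsmul 1 \<gamma>' = \<gamma>'" by (simp add: nsmul_def)
  then have "\<gamma>' \<in> range (\<lambda>n. nsmul n \<gamma>')" by (metis rangeI)
  then have "\<gamma>' \<in> range (\<lambda>n. nsmul n \<gamma>)" using assms by (simp add: df_component_cyclic_def)
  then show ?thesis using that by blast
qed

lemma qz_eq_fraction_iff: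
  assumes "d > 0"
  shows "qz_eq (of_int x / of_nat d) (of_int y / of_nat d) \<longleftrightarrow> [x = y] (mod int d)"
proof
  assume "qz_eq (of_int x / of_nat d) (of_int y / of_nat d)"
  then obtain k where "of_int x / of_nat d - of_int y / of_nat d = (of_int k :: rat)"
    unfolding qz_eq_def by (elim Ints_cases)
  then have "(of_int (x - y) :: rat) = of_int (int d * k)" using assms by (simp add: field_simps)
  then have "x - y = int d * k" by (simp only: of_int_eq_iff)
  then show "[x = y] (mod int d)" by (simp add: cong_iff_dvd_diff)
next
  assume "[x = y] (mod int d)"
  then obtain k where k: "x - y = int d * k" by (auto simp: cong_iff_dvd_diff)
  then have "(of_int x - of_int y :: rat) = of_nat d * of_int k" by (metis of_int_diff of_int_mult of_int_of_nat_eq)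
  then have "of_int x / of_nat d - of_int y / of_nat d = (of_int k :: rat)" using assms by (simp add: field_simps)
  then show "qz_eq (of_int x / of_nat d) (of_int y / of_nat d)" unfolding qz_eq_def by simp
qed

lemma qz_eq_sym: "qz_eq x y \<Longrightarrow> qz_eq y x"
  unfolding qz_eq_def using Ints_minus[of "x - y"] by simp

lemma qz_eq_trans: "qz_eq x y \<Longrightarrow> qz_eq y z \<Longrightarrow> qz_eq x z"
  unfolding qz_eq_def using Ints_add[of "x - y" "y - z"] by simp

lemma qz_eq_mult_nat: "qz_eq x y \<Longrightarrow> qz_eq (of_nat n * x) (of_nat n * y)"
  unfolding qz_eq_def using Ints_mult[of "of_nat n" "x - y"] by (simp add: right_diff_distrib)

text \<open>The two generators of the cyclic component differ by a factor \<open>n\<close>, hence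
  their norms by \<open>n^2\<close>, with a sign from dualising.\<close>

lemma dual_component_norm:
  assumes q: "discriminant_form q" and p: "p > 0"
    and \<gamma>: "df_component_cyclic p' \<gamma>" "qz_eq (q \<gamma>) (of_int x / of_nat p)"
    and \<gamma>': "df_component_cyclic p' \<gamma>'" "qz_eq (df_dual q \<gamma>') (of_int y / of_nat p)"
  obtains n where "[y = - (int n^2 * x)] (mod int p)"
proof -
  obtain n where n: "\<gamma>' = nsmul n \<gamma>" using nsmul_in_component[OF \<gamma>(1) \<gamma>'(1)] by metis
  have "qz_eq (q \<gamma>') (of_nat (n^2) * q \<gamma>)" using q unfolding discriminant_form_def n by blast
  moreover have "qz_eq (of_nat (n^2) * q \<gamma>) (of_nat (n^2) * (of_int x / of_nat p))"
    by (rule qz_eq_mult_nat[OF \<gamma>(2)])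
  ultimately have "qz_eq (q \<gamma>') (of_nat (n^2) * (of_int x / of_nat p))" by (rule qz_eq_trans)
  then have "qz_eq (df_dual q \<gamma>') (of_int (- (int n^2 * x)) / of_nat p)"
    unfolding qz_eq_def df_dual_def using Ints_minus[of "q \<gamma>' - of_nat (n^2) * (of_int x / of_nat p)"] by simp
  from qz_eq_trans[OF qz_eq_sym[OF \<gamma>'(2)] this] have "[y = - (int n^2 * x)] (mod int p)"
    unfolding qz_eq_fraction_iff[OF p] .
  then show ?thesis using that by blast
qed

lemma mod_4_signs:
  assumes "e = 1 \<or> e = (- 1::int)" "n mod 4 \<noteq> 2" "n mod 4 \<noteq> (- e) mod 4"
  shows "n mod 4 = 0 \<or> n mod 4 = e mod 4"
  using assms by auto

text \<open>The generators behind the two sign vectors are chosen independently; the square factor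
  between their norms is invisible to the signs.\<close>

lemma dual_sign_vector:
  assumes q: "discriminant_form q" and M: "odd M" "squarefree M"
    and e: "sign_vector q M \<epsilon>" and e': "sign_vector (df_dual q) M \<epsilon>'"
  shows "\<epsilon> 2 = 1 \<or> \<epsilon> 2 = - 1" "\<epsilon>' 2 = - \<epsilon> 2"
    "\<And>p. prime p \<Longrightarrow> p dvd M \<Longrightarrow> \<epsilon> p = 1 \<or> \<epsilon> p = - 1"
    "\<And>p. prime p \<Longrightarrow> p dvd M \<Longrightarrow> \<epsilon>' p = Legendre (- 1) (int p) * \<epsilon> p"
proof -
  have M0: "M > 0" using M(1) by (cases M) auto
  obtain t where t: "t \<in> {1, -1}" "df_two_component q t" "\<epsilon> 2 = t * kronecker (-1) (4 * int M)"
    using e unfolding sign_vector_def by blast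
  obtain t' where t': "t' \<in> {1, -1}" "df_two_component (df_dual q) t'" "\<epsilon>' 2 = t' * kronecker (-1) (4 * int M)"
    using e' unfolding sign_vector_def by blast
  have kr: "kronecker (-1) (4 * int M) = 1 \<or> kronecker (-1) (4 * int M) = - 1"
  proof -
    have nM: "nat \<bar>4 * int M\<bar> = 4 * M" by simp
    have "kronecker_prime (-1) p ^ multiplicity p (4 * M) = 1 \<or> kronecker_prime (-1) p ^ multiplicity p (4 * M) = - 1"
      if "p \<in> prime_factors (4 * M)" for p
    proof -
      have p: "prime p" using that by auto
      have "kronecker_prime (-1) p = 1 \<or> kronecker_prime (-1) p = - 1"
      proof (cases "p = 2")
        case False
        have "\<not> int p dvd - 1" using p by (auto simp: prime_nat_iff)
        then show ?thesis using False Legendre_values[of "-1" "int p"] Legendre_eq_0_iff[of "-1" "int p"]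
          by (auto simp: kronecker_prime_def)
      qed (simp add: kronecker_prime_def)
      then show ?thesis by (cases "even (multiplicity p (4 * M))") auto
    qed
    then have "(\<Prod>p\<in>prime_factors (4 * M). kronecker_prime (-1) p ^ multiplicity p (4 * M)) = 1 \<or>
        (\<Prod>p\<in>prime_factors (4 * M). kronecker_prime (-1) p ^ multiplicity p (4 * M)) = - 1"
      by (rule prod_signs)
    then show ?thesis unfolding kronecker_def nM using M0 by simp
  qed
  show "\<epsilon> 2 = 1 \<or> \<epsilon> 2 = - 1" using t kr by auto
  have "t' = - t"
  proof -
    obtain \<gamma> where \<gamma>: "df_component_cyclic 2 \<gamma>" "qz_eq (q \<gamma>) (of_int t / 4)"
      using t(2) by (auto simp: df_two_component_def)
    obtain \<gamma>' where \<gamma>': "df_component_cyclic 2 \<gamma>'" "qz_eq (df_dual q \<gamma>') (of_int t' / 4)"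
      using t'(2) by (auto simp: df_two_component_def)
    obtain n where "[t' = - (int n^2 * t)] (mod int 4)"
      using dual_component_norm[OF q _ \<gamma>(1) _ \<gamma>'(1), of 4 t t'] \<gamma>(2) \<gamma>'(2) by auto
    then have "4 dvd t' + int n^2 * t" by (simp add: cong_iff_dvd_diff)
    \<comment> \<open>\<open>z\<close> stands for \<open>n^2\<close>; residue 0 modulo 4 is
      impossible because \<open>t'\<close> is odd.\<close>
    moreover have "t' = - t" if "4 dvd t' + z * t" "z mod 4 = 0 \<or> z mod 4 = 1" for z
      using t(1) t'(1) that by auto presburger+
    ultimately show ?thesis using square_mod_4[of "int n"] by metis
  qed
  then show "\<epsilon>' 2 = - \<epsilon> 2" using t(3) t'(3) by simp
  fix p assume p: "prime p" "p dvd M"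
  have p2: "2 < p" by (rule odd_prime_divisor[OF M(1) p])
  obtain \<delta> where \<delta>: "\<delta> \<in> {1, -1}" "df_odd_component q p \<delta>" "\<epsilon> p = Legendre (int (2 * M div p)) (int p) * \<delta>"
    using e p unfolding sign_vector_def by blast
  obtain \<delta>' where \<delta>': "\<delta>' \<in> {1, -1}" "df_odd_component (df_dual q) p \<delta>'" "\<epsilon>' p = Legendre (int (2 * M div p)) (int p) * \<delta>'"
    using e' p unfolding sign_vector_def by blast
  have nd: "\<not> int p dvd int (2 * M div p)"
  proof -
    obtain m where m: "M = p * m" using p(2) by (elim dvdE)
    have "\<not> p dvd m"
    proof
      assume "p dvd m"
      then have "p^2 dvd M" unfolding m power2_eq_square by simp
      then have "p dvd 1" using M(2) squarefreeD by blast
      then show False using p2 by simp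
    qed
    moreover have "\<not> p dvd 2" using p2 by (auto dest: dvd_imp_le)
    moreover have "2 * M div p = 2 * m" using m p2 by simp
    ultimately show ?thesis using p(1) by (simp add: prime_dvd_mult_iff del: of_nat_mult)
  qed
  have L: "Legendre (int (2 * M div p)) (int p) = 1 \<or> Legendre (int (2 * M div p)) (int p) = - 1"
    using nd Legendre_values[of "int (2 * M div p)" "int p"] Legendre_eq_0_iff[of "int (2 * M div p)" "int p"] by auto
  show "\<epsilon> p = 1 \<or> \<epsilon> p = - 1" using L \<delta>(1) unfolding \<delta>(3) by auto
  obtain \<gamma> x where x: "df_component_cyclic p \<gamma>" "qz_eq (q \<gamma>) (of_int x / of_nat p)" "\<delta> = Legendre (2 * x) (int p)"
    using \<delta>(2) by (auto simp: df_odd_component_def)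
  obtain \<gamma>' y where y: "df_component_cyclic p \<gamma>'" "qz_eq (df_dual q \<gamma>') (of_int y / of_nat p)" "\<delta>' = Legendre (2 * y) (int p)"
    using \<delta>'(2) by (auto simp: df_odd_component_def)
  have p0: "p > 0" using p2 by simp
  obtain n where n: "[y = - (int n^2 * x)] (mod int p)"
    using dual_component_norm[OF q p0 x(1,2) y(1,2)] by metis
  have "[2 * y = 2 * (- (int n^2 * x))] (mod int p)" by (rule cong_scalar_left[OF n])
  also have "2 * (- (int n^2 * x)) = - 1 * (int n^2 * (2 * x))" by simp
  finally have "\<delta>' = Legendre (- 1) (int p) * (Legendre (int n^2) (int p) * \<delta>)"
    unfolding y(3) x(3) Legendre_mult[OF p(1) p2, of "int n^2" "2 * x", symmetric]
      Legendre_mult[OF p(1) p2, of "- 1", symmetric] by (rule Legendre_cong)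
  \<comment> \<open>\<open>p\<close> cannot divide \<open>n\<close>, since \<open>\<delta>'\<close>
    would then be 0.\<close>
  moreover have "Legendre (int n^2) (int p) = 1"
  proof (rule Legendre_square_prime[OF p(1)], rule notI)
    assume "int p dvd int n"
    then have "int p dvd int n^2" unfolding power2_eq_square by (rule dvd_mult)
    then have "Legendre (int n^2) (int p) = 0" by (simp only: Legendre_eq_0_iff)
    with calculation \<delta>'(1) show False by auto
  qed
  ultimately show "\<epsilon>' p = Legendre (- 1) (int p) * \<epsilon> p" unfolding \<delta>(3) \<delta>'(3) by simp
qed

section \<open>Units with prescribed signs, and the support condition\<close>

lemma Legendre_sign_exists:
  assumes "prime p" "2 < p" "s = 1 \<or> s = - 1"
  obtains x where "Legendre x (int p) = s"
proof (cases "s = 1")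
  case True
  have "Legendre (1^2) (int p) = 1" using assms(1,2) by (intro Legendre_square_prime) auto
  then show ?thesis using that True by blast
next
  case False
  obtain x where x: "\<forall>y. \<not> int p dvd 1 * y^2 - x" using missing_square_class[OF assms(1,2)] by metis
  have "\<not> int p dvd x" using x[THEN spec[of _ 0]] by simp
  moreover have "\<not> (\<exists>t. [x = t^2] (mod int p))"
    using x by (auto simp: cong_iff_dvd_diff dvd_diff_commute)
  ultimately have "Legendre x (int p) = - 1"
    using Legendre_1I[of x "int p"] Legendre_values[of x "int p"] Legendre_eq_0_iff[of x "int p"] by auto
  then show ?thesis using that False assms(3) by blast
qed

lemma crt_int:
  fixes m n :: nat
  assumes "coprime m n"
  obtains x where "[x = a] (mod int m)" "[x = b] (mod int n)"
  using binary_chinese_remainder_int[of "int m" "int n" a b] assms by auto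

lemma Legendre_signs_exist:
  assumes "odd m" "squarefree m" "\<And>p. prime p \<Longrightarrow> p dvd m \<Longrightarrow> s p = 1 \<or> s p = - 1"
  shows "\<exists>x. \<forall>p. prime p \<and> p dvd m \<longrightarrow> Legendre x (int p) = s p"
  using assms
proof (induction m rule: odd_squarefree_induct)
  case (prime p n)
  obtain x where x: "\<forall>r. prime r \<and> r dvd n \<longrightarrow> Legendre x (int r) = s r"
    using prime.IH prime.prems by auto
  obtain y where y: "Legendre y (int p) = s p"
    using Legendre_sign_exists[OF prime.hyps(1,2)] prime.prems[of p] prime.hyps(1) by (metis dvd_triv_left)
  obtain z where z: "[z = y] (mod int p)" "[z = x] (mod int n)" using crt_int[OF prime.hyps(5)] by metis
  show ?case
  proof (intro exI allI impI)
    fix r assume r: "prime r \<and> r dvd p * n"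
    then consider "r dvd p" | "r dvd n" by (auto simp: prime_dvd_mult_iff)
    then show "Legendre z (int r) = s r"
    proof cases
      case 1
      then have "r = p" using r prime.hyps(1) by (simp add: primes_dvd_imp_eq)
      then show ?thesis using y Legendre_cong[OF z(1)] by simp
    next
      case 2
      then have "[z = x] (mod int r)" by (intro cong_dvd_modulus[OF z(2)]) simp
      then show ?thesis using x r 2 Legendre_cong by metis
    qed
  qed
qed (auto dest: prime_nat_iff[THEN iffD1])

text \<open>A single unit \<open>v\<close> modulo \<open>4 M\<close> carries all the signs, so that
  the condition on the coefficients can be stated as \<open>n\<close> being \<open>v\<close> times a
  square modulo \<open>4 M\<close>; see \<open>square_class_iff\<close>.\<close>

lemma sign_unit_exists:
  assumes M: "odd M" "squarefree M" and e2: "e = 1 \<or> e = (- 1::int)"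
    and s: "\<And>p. prime p \<Longrightarrow> p dvd M \<Longrightarrow> s p = 1 \<or> s p = - 1"
  obtains v where "coprime v (int (4 * M))" "[v = e] (mod 4)" "\<And>p. prime p \<Longrightarrow> p dvd M \<Longrightarrow> Legendre v (int p) = s p"
proof -
  obtain x where x: "\<forall>p. prime p \<and> p dvd M \<longrightarrow> Legendre x (int p) = s p"
    using Legendre_signs_exist[of M s, OF M s] by blast
  have c4: "coprime 4 M" by (rule coprime_4_odd[OF M(1)])
  obtain v where v: "[v = e] (mod int 4)" "[v = x] (mod int M)" using crt_int[OF c4] by metis
  have L: "Legendre v (int p) = s p" if "prime p" "p dvd M" for p
  proof -
    have "[v = x] (mod int p)" by (rule cong_dvd_modulus[OF v(2)]) (use that in simp)
    then show ?thesis using x that Legendre_cong by metis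
  qed
  have "coprime v (int (4 * M))"
  proof (rule ccontr)
    assume "\<not> coprime v (int (4 * M))"
    then have "nat (gcd v (int (4 * M))) \<noteq> 1" by (auto simp: coprime_iff_gcd_eq_1)
    then obtain p where p: "prime p" "p dvd nat (gcd v (int (4 * M)))" using prime_factor_nat by blast
    then have "int p dvd int (nat (gcd v (int (4 * M))))" by (simp only: int_dvd_int_iff)
    then have d: "int p dvd gcd v (int (4 * M))" by simp
    have d1: "int p dvd v" by (rule dvd_trans[OF d gcd_dvd1])
    have "int p dvd int (4 * M)" by (rule dvd_trans[OF d gcd_dvd2])
    then have "p dvd 2 ^ 2 * M" by (simp only: int_dvd_int_iff) simp
    then consider "p dvd 2" | "p dvd M" using p(1) by (metis prime_dvd_mult_iff prime_dvd_power)
    then show False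
    proof cases
      case 1
      then have "p = 2" using p(1) by (metis primes_dvd_imp_eq two_is_prime_nat)
      then have "even v" using d1 by simp
      moreover have "odd v"
      proof -
        have "v mod 4 = e mod 4" using v(1) by (simp add: cong_def)
        then show ?thesis using e2 by presburger
      qed
      ultimately show False by simp
    next
      case 2
      then have "Legendre v (int p) = s p" by (rule L[OF p(1)])
      moreover have "Legendre v (int p) = 0" using d1 by (simp only: Legendre_eq_0_iff)
      ultimately show False using s[OF p(1) 2] by auto
    qed
  qed
  then show ?thesis using that v(1) L by simp
qed

context square_classes
begin

lemma square_class_of_local_squares:
  assumes "\<exists>x. [n = v * x^2] (mod 4)" "\<And>p. prime p \<Longrightarrow> p dvd M \<Longrightarrow> \<exists>x. [n = v * x^2] (mod int p)"
  shows "\<exists>x. [n = v * x^2] (mod int (4 * M))"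
proof -
  have combine: "\<exists>x. [n = v * x^2] (mod int (a * b))"
    if co: "coprime a b" and "[n = v * x^2] (mod int a)" "[n = v * y^2] (mod int b)" for a b x y
  proof -
    obtain z where z: "[z = x] (mod int a)" "[z = y] (mod int b)" using crt_int[OF co] by metis
    have "[v * z^2 = v * x^2] (mod int a)" "[v * z^2 = v * y^2] (mod int b)"
      by (intro cong_scalar_left cong_pow z)+
    then have "[n = v * z^2] (mod int a)" "[n = v * z^2] (mod int b)" using that by (meson cong_sym cong_trans)+
    moreover have "coprime (int a) (int b)" using co by simp
    ultimately have "[n = v * z^2] (mod (int a * int b))" by (rule coprime_cong_mult)
    then show ?thesis by auto
  qed
  have "\<exists>x. [n = v * x^2] (mod int m)" if "odd m" "squarefree m" "m dvd M" for m
    using that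
  proof (induction m rule: odd_squarefree_induct)
    case (prime p m)
    obtain x where "[n = v * x^2] (mod int p)" using assms(2)[of p] prime by (auto intro: dvd_mult_left)
    moreover obtain y where "[n = v * y^2] (mod int m)" using prime.IH prime.prems by (auto intro: dvd_mult_right)
    ultimately show ?case by (intro combine[OF prime.hyps(5)])
  qed simp
  from this[OF odd_M squarefree_M] obtain y where y: "[n = v * y^2] (mod int M)" by auto
  obtain x where x: "[n = v * x^2] (mod int 4)" using assms(1) by auto
  from combine[OF coprime_4_odd[OF odd_M] x y] show ?thesis .
qed

text \<open>Checked prime by prime. Modulo 4 the excluded residues leave 0 and \<open>e 2\<close>,
  the values of \<open>e 2 * x^2\<close>; modulo \<open>p\<close> the symbol of \<open>n\<close>
  must be 0 or that of \<open>\<sigma> * u\<close>.\<close>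

lemma square_class_iff:
  assumes \<sigma>: "\<sigma> = 1 \<or> \<sigma> = - 1" and e2: "e 2 = 1 \<or> e 2 = (- 1::int)" "[\<sigma> * u = e 2] (mod 4)"
    and ep: "\<And>p. prime p \<Longrightarrow> p dvd M \<Longrightarrow> Legendre (\<sigma> * u) (int p) = e p"
  shows "(\<exists>c\<in>sqs. [n = \<sigma> * c] (mod int (4 * M))) \<longleftrightarrow>
    \<not> ([n = 2] (mod 4) \<or> [n = - e 2] (mod 4) \<or> (\<exists>p. prime p \<and> p dvd M \<and> Legendre n (int p) = - e p))"
    (is "?L \<longleftrightarrow> \<not> ?R")
proof -
  let ?v = "\<sigma> * u"
  have cv: "coprime ?v (int (4 * M))" using \<sigma> coprime_u by auto
  have p_props: "2 < p" "\<not> int p dvd ?v" if "prime p" "p dvd M" for p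
  proof -
    show "2 < p" by (rule odd_prime_divisor[OF odd_M that])
    have "coprime ?v (int p)" by (rule coprime_divisors[OF dvd_refl _ cv]) (use that in simp)
    then show "\<not> int p dvd ?v" using coprime_int_prime[OF that(1)] by simp
  qed
  have L: "?L \<longleftrightarrow> (\<exists>x. [n = ?v * x^2] (mod int (4 * M)))"
  proof
    assume ?L
    then obtain c where c: "c \<in> sqs" "[n = \<sigma> * c] (mod int (4 * M))" by blast
    obtain x where "cls x = c" using c(1) by (auto simp: sqs_def)
    then have "[\<sigma> * c = \<sigma> * (u * x^2)] (mod int (4 * M))" by (intro cong_scalar_left cls_mod)
    then show "\<exists>x. [n = ?v * x^2] (mod int (4 * M))" using cong_trans[OF c(2)] by (metis mult.assoc)
  next
    assume "\<exists>x. [n = ?v * x^2] (mod int (4 * M))"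
    then obtain x where x: "[n = ?v * x^2] (mod int (4 * M))" by blast
    have "[\<sigma> * cls x = \<sigma> * (u * x^2)] (mod int (4 * M))" by (intro cong_scalar_left cls_mod) simp
    then have "[n = \<sigma> * cls x] (mod int (4 * M))" using x by (metis cong_sym cong_trans mult.assoc)
    then show ?L using cls_in_sqs by blast
  qed
  have v4: "?v mod 4 = e 2 mod 4" using e2(2) by (simp add: cong_def)
  show ?thesis
    unfolding L
  proof
    assume "\<exists>x. [n = ?v * x^2] (mod int (4 * M))"
    then obtain x where x: "[n = ?v * x^2] (mod int (4 * M))" by blast
    have "[n = ?v * x^2] (mod 4)" by (rule cong_dvd_modulus[OF x]) simp
    then have "n mod 4 = (?v mod 4) * (x^2 mod 4) mod 4" by (simp add: cong_def mod_mult_eq)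
    then have "n mod 4 = 0 \<or> n mod 4 = e 2 mod 4" unfolding v4 using square_mod_4[of x] by auto
    then have "\<not> [n = 2] (mod 4)" "\<not> [n = - e 2] (mod 4)" using e2(1) by (auto simp: cong_def)
    moreover have "Legendre n (int p) \<noteq> - e p" if p: "prime p" "p dvd M" for p
    proof -
      have "[n = ?v * x^2] (mod int p)" by (rule cong_dvd_modulus[OF x]) (use p in simp)
      then have "Legendre n (int p) = e p * Legendre (x^2) (int p)"
        using Legendre_cong ep[OF p] Legendre_mult[OF p(1) p_props(1)[OF p]] by metis
      moreover have "Legendre (x^2) (int p) = 0 \<or> Legendre (x^2) (int p) = 1"
        using Legendre_square_prime[OF p(1)] by (cases "int p dvd x") (auto simp: Legendre_eq_0_iff power2_eq_square)
      moreover have "e p \<noteq> 0" using p_props(2)[OF p] ep[OF p] Legendre_eq_0_iff[of ?v "int p"] by metis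
      ultimately show ?thesis by auto
    qed
    ultimately show "\<not> ?R" by blast
  next
    assume nR: "\<not> ?R"
    show "\<exists>x. [n = ?v * x^2] (mod int (4 * M))"
    proof (rule square_class_of_local_squares)
      have "n mod 4 \<noteq> 2" "n mod 4 \<noteq> (- e 2) mod 4" using nR by (auto simp: cong_def)
      then have "n mod 4 = 0 \<or> n mod 4 = ?v mod 4" unfolding v4 by (rule mod_4_signs[OF e2(1)])
      then have "[n = ?v * 0^2] (mod 4) \<or> [n = ?v * 1^2] (mod 4)" by (simp add: cong_def)
      then show "\<exists>x. [n = ?v * x^2] (mod 4)" by blast
    next
      fix p assume p: "prime p" "p dvd M"
      show "\<exists>x. [n = ?v * x^2] (mod int p)"
      proof (cases "int p dvd n")
        case True
        then have "[n = ?v * 0^2] (mod int p)" by (simp add: cong_0_iff)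
        then show ?thesis by blast
      next
        case False
        have "Legendre n (int p) \<noteq> - e p" using nR p by blast
        moreover have "Legendre n (int p) \<noteq> 0" using False Legendre_eq_0_iff by metis
        moreover have "e p \<noteq> 0" using p_props(2)[OF p] ep[OF p] Legendre_eq_0_iff[of ?v "int p"] by metis
        moreover have "e p \<in> {-1, 0, 1}" using Legendre_values[of ?v "int p"] ep[OF p] by simp
        ultimately have "Legendre n (int p) * e p = 1" using Legendre_values[of n "int p"] by auto
        then have "Legendre (n * ?v) (int p) = 1"
          using Legendre_mult[OF p(1) p_props(1)[OF p]] ep[OF p] by simp
        then obtain t where t: "[n * ?v = t^2] (mod int p)" using Legendre_1I by blast
        \<comment> \<open>With \<open>w\<close> inverse to \<open>?v\<close>, the congruence
          \<open>n ?v = t^2\<close> becomes \<open>n = ?v (t w)^2\<close>.\<close>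
        obtain w where w: "[?v * w = 1] (mod int p)"
          using p_props(2)[OF p] coprime_int_prime[OF p(1), of ?v] by (auto simp: coprime_iff_invertible_int)
        have "[n * (?v * w) * (?v * w) = n * 1 * 1] (mod int p)" by (intro cong_mult cong_refl w)
        moreover have "[(n * ?v) * (?v * w * w) = t^2 * (?v * w * w)] (mod int p)" by (intro cong_mult cong_refl t)
        ultimately have "[n = ?v * (t * w)^2] (mod int p)"
          by (simp add: power2_eq_square mult_ac) (meson cong_sym cong_trans)
        then show ?thesis by blast
      qed
    qed
  qed
qed

end

section \<open>Reduced forms\<close>

text \<open>The existential clause of \<open>reduced_form\<close>, isolated because duality is
  applied to its negation.\<close>

definition leading_form :: "nat \<Rightarrow> real \<Rightarrow> (nat \<Rightarrow> int) \<Rightarrow> int \<Rightarrow> bool" where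
  "leading_form M k \<epsilon> n \<longleftrightarrow>
     (\<exists>g\<in>eps_forms M k \<epsilon>. \<exists>b. has_q_expansion 1 g b \<and> b n = 1 \<and> (\<forall>j<n. b j = 0))"

lemma has_q_expansion_unique_coeffs:
  assumes "has_q_expansion 1 f a" "has_q_expansion 1 f b"
  shows "a = b"
proof -
  \<comment> \<open>Coefficients do not depend on the level; any instance supplies the evaluation of
    Laurent series.\<close>
  interpret square_classes 1 1 1 by standard auto
  obtain A where A: "fls_conv_disc A" "fls_nth A = a" "\<And>\<tau>. \<tau> \<in> upper_half_plane \<Longrightarrow> ev A \<tau> = f (\<tau> / of_nat (4 * 1))"
    using fls_of_expansion[OF assms(1)] by metis
  obtain B where B: "fls_conv_disc B" "fls_nth B = b" "\<And>\<tau>. \<tau> \<in> upper_half_plane \<Longrightarrow> ev B \<tau> = f (\<tau> / of_nat (4 * 1))"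
    using fls_of_expansion[OF assms(2)] by metis
  have "A = B" by (rule ev_cong_fls[OF A(1) B(1)]) (rule trans[OF A(3) B(3)[symmetric]])
  then show ?thesis using A(2) B(2) by simp
qed

text \<open>\<open>eps_forms\<close> asserts the vanishing for some expansion; uniqueness transfers
  it to the given one.\<close>

lemma eps_forms_supp:
  assumes "f \<in> eps_forms M k \<epsilon>" "has_q_expansion 1 f a"
    "[n = 2] (mod 4) \<or> [n = - \<epsilon> 2] (mod 4) \<or> (\<exists>p. prime p \<and> p dvd M \<and> Legendre n (int p) = - \<epsilon> p)"
  shows "a n = 0"
proof -
  obtain b where b: "has_q_expansion 1 f b"
    "\<forall>n. [n = 2] (mod 4) \<or> [n = - \<epsilon> 2] (mod 4) \<or> (\<exists>p. prime p \<and> p dvd M \<and> Legendre n (int p) = - \<epsilon> p) \<longrightarrow> b n = 0"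
    using assms(1) unfolding eps_forms_def by blast
  from has_q_expansion_unique_coeffs[OF assms(2) b(1)] b(2) assms(3) show ?thesis by blast
qed

context square_classes
begin

lemma eps_form_components:
  assumes \<sigma>: "\<sigma> = 1 \<or> \<sigma> = - 1" and e2: "\<epsilon> 2 = 1 \<or> \<epsilon> 2 = - 1" "[\<sigma> * u = \<epsilon> 2] (mod 4)"
    and ep: "\<And>p. prime p \<Longrightarrow> p dvd M \<Longrightarrow> Legendre (\<sigma> * u) (int p) = \<epsilon> p"
    and K: "K = \<lfloor>2 * k\<rfloor>" "odd K" and eta: "\<eta> = parity_value M (\<sigma> * u) K"
    and f: "f \<in> eps_forms M k \<epsilon>" "has_q_expansion 1 f a"
  obtains F where "vv_form \<sigma> K F" "\<And>c n. c \<in> sqs \<Longrightarrow> F c $$ n = (if [n = \<sigma> * c] (mod int (4 * M)) then a n else 0)"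
    "\<And>n. a n \<noteq> 0 \<Longrightarrow> \<exists>c\<in>sqs. [n = \<sigma> * c] (mod int (4 * M))"
    "\<And>\<tau>. \<tau> \<in> upper_half_plane \<Longrightarrow> f \<tau> = assembled F \<tau>"
proof -
  interpret vv: vv_side "4 * M" sqs \<sigma> weight "kernel (\<sigma> * u) (kernel_scale M (\<sigma> * u) K)"
    by (rule vv_side_kernel[OF \<sigma> K(2)])
  have supp: "\<exists>c\<in>sqs. [n = \<sigma> * c] (mod int (4 * M))" if "a n \<noteq> 0" for n
    using eps_forms_supp[OF f, of n] that square_class_iff[OF \<sigma> e2 ep, of n] by blast
  have fm: "f \<in> mod_forms (4 * M) k" using f(1) by (simp add: eps_forms_def)
  obtain F where F: "vv_form \<sigma> K F" "\<And>c n. c \<in> sqs \<Longrightarrow> F c $$ n = (if [n = \<sigma> * c] (mod int (4 * M)) then a n else 0)"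
    using vv_form_of_mod_form[OF fm f(2) supp \<sigma> K eta] by metis
  have "(\<Sum>c\<in>sqs. F c $$ n) = a n" for n
  proof -
    have "(\<Sum>c\<in>sqs. F c $$ n) = (\<Sum>c\<in>sqs. if [n = \<sigma> * c] (mod int (4 * M)) then a n else 0)"
      by (intro sum.cong refl F(2))
    also have "\<dots> = a n" by (rule sum_class_indicator[OF \<sigma> supp])
    finally show ?thesis .
  qed
  then have "has_q_expansion 1 (assembled F) a"
    using assembled_expansion[OF vv.VV_conv[OF F(1)]] by simp
  then have "f \<tau> = assembled F \<tau>" if "\<tau> \<in> upper_half_plane" for \<tau>
    using has_q_expansion_unique_value[OF f(2) _ that] by blast
  with F supp that show ?thesis by blast
qed

text \<open>\<open>G\<close> is scaled to leading coefficient 1, and its multiplier on Gamma0(4 M)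
  is inherited from \<open>f0\<close> through \<open>assembled_mod_form\<close>.\<close>

lemma leading_form_of_vv_form:
  assumes \<sigma>: "\<sigma> = 1 \<or> \<sigma> = - 1" and e2: "\<epsilon> 2 = 1 \<or> \<epsilon> 2 = - 1" "[\<sigma> * u = \<epsilon> 2] (mod 4)"
    and ep: "\<And>p. prime p \<Longrightarrow> p dvd M \<Longrightarrow> Legendre (\<sigma> * u) (int p) = \<epsilon> p"
    and K: "K = \<lfloor>2 * k\<rfloor>" "odd K"
    and F0: "vv_form \<sigma> K F0" "\<exists>c\<in>sqs. F0 c \<noteq> 0"
    and f0: "f0 \<in> mod_forms (4 * M) k" "\<And>\<tau>. \<tau> \<in> upper_half_plane \<Longrightarrow> f0 \<tau> = assembled F0 \<tau>"
    and G: "vv_form \<sigma> K G" "(\<Sum>c\<in>sqs. G c) $$ n \<noteq> 0" "\<And>i. i < n \<Longrightarrow> (\<Sum>c\<in>sqs. G c) $$ i = 0"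
  shows "leading_form M k \<epsilon> n"
proof -
  interpret vv: vv_side "4 * M" sqs \<sigma> weight "kernel (\<sigma> * u) (kernel_scale M (\<sigma> * u) K)"
    by (rule vv_side_kernel[OF \<sigma> K(2)])
  define z where "z = 1 / (\<Sum>c\<in>sqs. G c) $$ n"
  define H where "H = (\<lambda>c. fls_const z * G c)"
  have H: "vv_form \<sigma> K H" unfolding H_def by (rule vv.VV_cmult[OF G(1)])
  have Hn: "(\<Sum>c\<in>sqs. H c $$ j) = z * (\<Sum>c\<in>sqs. G c) $$ j" for j
    by (simp add: H_def fls_nth_sum sum_distrib_left)
  have x: "has_q_expansion 1 (assembled H) (\<lambda>n. \<Sum>c\<in>sqs. H c $$ n)"
    by (rule assembled_expansion[OF vv.VV_conv[OF H]])
  have "(\<Sum>c\<in>sqs. H c $$ j) = 0"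
    if j: "[j = 2] (mod 4) \<or> [j = - \<epsilon> 2] (mod 4) \<or> (\<exists>p. prime p \<and> p dvd M \<and> Legendre j (int p) = - \<epsilon> p)" for j
  proof (rule sum.neutral, rule ballI)
    fix c assume c: "c \<in> sqs"
    have "\<not> [j = \<sigma> * c] (mod int (4 * M))" using square_class_iff[OF \<sigma> e2 ep, of j] j c by blast
    then show "H c $$ j = 0" using vv.VV_D(2)[OF H c] unfolding fls_class_def by blast
  qed
  moreover have "assembled H \<in> mod_forms (4 * M) k" by (rule assembled_mod_form[OF \<sigma> K H F0 f0])
  ultimately have "assembled H \<in> eps_forms M k \<epsilon>" unfolding eps_forms_def using x by blast
  moreover have "(\<Sum>c\<in>sqs. H c $$ n) = 1" using G(2) by (simp add: Hn z_def)
  moreover have "\<forall>j<n. (\<Sum>c\<in>sqs. H c $$ j) = 0" using G(3) by (simp add: Hn)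
  ultimately show ?thesis unfolding leading_form_def using x by blast
qed

theorem reduced_coefficient_duality:
  assumes K: "K = \<lfloor>2 * k\<rfloor>" "odd K" "4 - K = \<lfloor>2 * (2 - k)\<rfloor>"
    and e2: "\<epsilon> 2 = 1 \<or> \<epsilon> 2 = - 1" "[u = \<epsilon> 2] (mod 4)" "\<epsilon>' 2 = - \<epsilon> 2"
    and ep: "\<And>p. prime p \<Longrightarrow> p dvd M \<Longrightarrow> Legendre u (int p) = \<epsilon> p"
      "\<And>p. prime p \<Longrightarrow> p dvd M \<Longrightarrow> \<epsilon>' p = Legendre (- 1) (int p) * \<epsilon> p"
    and eta: "\<eta> = parity_value M u K"
    and f: "reduced_form M k \<epsilon> m f a" and f': "reduced_form M (2 - k) \<epsilon>' d f' a'"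
  shows "a (- d) = - a' (- m)"
proof -
  have f_eps: "f \<in> eps_forms M k \<epsilon>" and f_exp: "has_q_expansion 1 f a" and am: "a m = 1 / of_nat (s_num M m)"
    and a0: "\<And>n. n < m \<Longrightarrow> a n = 0" and red: "\<And>n. n > m \<Longrightarrow> a n \<noteq> 0 \<Longrightarrow> \<not> leading_form M k \<epsilon> n"
    using f[unfolded reduced_form_def, folded leading_form_def] by simp_all
  have f'_eps: "f' \<in> eps_forms M (2 - k) \<epsilon>'" and f'_exp: "has_q_expansion 1 f' a'" and am': "a' d = 1 / of_nat (s_num M d)"
    and a'0: "\<And>n. n < d \<Longrightarrow> a' n = 0" and red': "\<And>n. n > d \<Longrightarrow> a' n \<noteq> 0 \<Longrightarrow> \<not> leading_form M (2 - k) \<epsilon>' n"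
    using f'[unfolded reduced_form_def, folded leading_form_def] by simp_all
  have s_pos: "of_nat (s_num M n) \<noteq> (0::complex)" for n
  proof -
    have "1 \<in> {e. e dvd M \<and> int e dvd n}" by simp
    then have "{e. e dvd M \<and> int e dvd n} \<noteq> {}" by (metis empty_iff)
    then have "card {e. e dvd M \<and> int e dvd n} > 0" by (simp add: card_gt_0_iff finite_divisors_with[OF M_pos])
    then show ?thesis by (simp add: s_num_alt)
  qed
  have s_minus: "s_num M (- n) = s_num M n" for n by (simp add: s_num_alt)
  have s_cong: "s_num M n = s_num M c" if "[n = c] (mod int (4 * M))" for n c
  proof -
    have "int e dvd n \<longleftrightarrow> int e dvd c" if e: "e dvd M" for e
    proof -
      have "int e dvd int (4 * M)" using e by simp
      then have "[n = c] (mod int e)" using \<open>[n = c] (mod int (4 * M))\<close> cong_dvd_modulus by blast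
      then show ?thesis by (rule cong_dvd_iff)
    qed
    then show ?thesis unfolding s_num_alt by (intro arg_cong[where f=card]) auto
  qed
  let ?pos = "kernel (1 * u) (kernel_scale M (1 * u) K)" and ?neg = "kernel (- 1 * u) (kernel_scale M (- 1 * u) (4 - K))"
  have oK: "odd (4 - K)" using K(2) by simp
  have e2p: "[1 * u = \<epsilon> 2] (mod 4)" using e2(2) by simp
  have epp: "Legendre (1 * u) (int p) = \<epsilon> p" if "prime p" "p dvd M" for p using ep(1)[OF that] by simp
  have e2n: "\<epsilon>' 2 = 1 \<or> \<epsilon>' 2 = - 1" using e2 by auto
  have e2n': "[- 1 * u = \<epsilon>' 2] (mod 4)" unfolding e2(3) using e2(2) by (simp add: cong_minus_minus_iff)
  have epn: "Legendre (- 1 * u) (int p) = \<epsilon>' p" if p: "prime p" "p dvd M" for p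
  proof -
    have "2 < p" by (rule odd_prime_divisor[OF odd_M p])
    then show ?thesis using Legendre_mult[OF p(1), of "- 1" u] ep(1)[OF p] ep(2)[OF p] by (simp only:)
  qed
  have etap: "\<eta> = parity_value M (1 * u) K" using eta by simp
  have etan: "\<eta> = parity_value M (- 1 * u) (4 - K)"
    using parity_value_dual[OF K(2) odd_u odd_M] eta by simp
  interpret pair: vv_pair "4 * M" sqs weight ?pos ?neg
    "of_nat (2 * M) * kernel_scale M u K * kernel_scale M (- u) (4 - K)"
  proof -
    have "coprime (- u) (int (4 * M))" using coprime_u by simp
    then have "kernel_scale M u K \<noteq> 0" "kernel_scale M (- u) (4 - K) \<noteq> 0"
      using kernel_scale_nonzero[OF odd_M squarefree_M] coprime_u K(2) oK by blast+
    from vv_pair[OF this] show "vv_pair (4 * M) sqs weight ?pos ?neg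
      (of_nat (2 * M) * kernel_scale M u K * kernel_scale M (- u) (4 - K))" by simp
  qed
  obtain F where F: "pair.pos.VV K F"
    and Fn: "\<And>c n. c \<in> sqs \<Longrightarrow> F c $$ n = (if [n = 1 * c] (mod int (4 * M)) then a n else 0)"
    and Fs: "\<And>n. a n \<noteq> 0 \<Longrightarrow> \<exists>c\<in>sqs. [n = 1 * c] (mod int (4 * M))"
    and Fa: "\<And>\<tau>. \<tau> \<in> upper_half_plane \<Longrightarrow> f \<tau> = assembled F \<tau>"
    using eps_form_components[OF disjI1[OF refl] e2(1) e2p epp K(1,2) etap f_eps f_exp] by metis
  obtain F' where F': "pair.neg.VV (4 - K) F'"
    and F'n: "\<And>c n. c \<in> sqs \<Longrightarrow> F' c $$ n = (if [n = - 1 * c] (mod int (4 * M)) then a' n else 0)"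
    and F's: "\<And>n. a' n \<noteq> 0 \<Longrightarrow> \<exists>c\<in>sqs. [n = - 1 * c] (mod int (4 * M))"
    and F'a: "\<And>\<tau>. \<tau> \<in> upper_half_plane \<Longrightarrow> f' \<tau> = assembled F' \<tau>"
    using eps_form_components[OF disjI2[OF refl] e2n e2n' epn K(3) oK etan f'_eps f'_exp] by metis
  have fm: "f \<in> mod_forms (4 * M) k" "f' \<in> mod_forms (4 * M) (2 - k)"
    using f_eps f'_eps by (simp_all add: eps_forms_def)
  have F_nz: "\<exists>c\<in>sqs. F c \<noteq> 0"
  proof -
    have "a m \<noteq> 0" using am s_pos by simp
    then obtain c where "c \<in> sqs" "[m = 1 * c] (mod int (4 * M))" using Fs by blast
    then have "F c $$ m \<noteq> 0" using Fn \<open>a m \<noteq> 0\<close> by simp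
    then show ?thesis using \<open>c \<in> sqs\<close> by (metis fls_zero_nth)
  qed
  have F'_nz: "\<exists>c\<in>sqs. F' c \<noteq> 0"
  proof -
    have "a' d \<noteq> 0" using am' s_pos by simp
    then obtain c where "c \<in> sqs" "[d = - 1 * c] (mod int (4 * M))" using F's by blast
    then have "F' c $$ d \<noteq> 0" using F'n \<open>a' d \<noteq> 0\<close> by simp
    then show ?thesis using \<open>c \<in> sqs\<close> by (metis fls_zero_nth)
  qed
  \<comment> \<open>Both reduced forms supply nonzero vector-valued forms, and this pins down the
    scalar of the pairing.\<close>
  note gamma = pair.gamma_eq_1[OF F F_nz F' F'_nz]
  \<comment> \<open>If \<open>a n \<noteq> 0\<close>, reducedness of \<open>f\<close> forbids a form
    starting at \<open>n\<close>, so duality yields a dual form starting at \<open>- n > d\<close>,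
    and reducedness of \<open>f'\<close> then gives \<open>a' (- n) = 0\<close>.\<close>
  have middle: "a n = 0 \<or> a' (- n) = 0" if n: "m < n" "n < - d" for n
  proof (rule ccontr)
    assume "\<not> ?thesis"
    then have nz: "a n \<noteq> 0" "a' (- n) \<noteq> 0" by auto
    obtain c0 where c0: "c0 \<in> sqs" "[n = c0] (mod int (4 * M))" using Fs[OF nz(1)] by auto
    have "(\<Sum>c\<in>sqs. H c) $$ n = 0" if "pair.pos.VV K H" "\<And>i. i < n \<Longrightarrow> (\<Sum>c\<in>sqs. H c) $$ i = 0" for H
      using red[OF n(1) nz(1)] leading_form_of_vv_form[OF disjI1[OF refl] e2(1) e2p epp K(1,2) F F_nz fm(1) Fa that(1) _ that(2)]
      by blast
    from pair.dual_leading_form_exists[OF gamma F F_nz c0 this]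
    obtain G where G: "pair.neg.VV (4 - K) G" "\<forall>i<(- n). (\<Sum>c\<in>sqs. G c) $$ i = 0" "(\<Sum>c\<in>sqs. G c) $$ (- n) \<noteq> 0"
      by blast
    have "leading_form M (2 - k) \<epsilon>' (- n)"
      by (rule leading_form_of_vv_form[OF disjI2[OF refl] e2n e2n' epn K(3) oK F' F'_nz fm(2) F'a G(1,3)])
         (use G(2) in blast)+
    moreover have "- n > d" using n(2) by simp
    ultimately show False using red'[OF _ nz(2)] by blast
  qed
  \<comment> \<open>\<open>f\<close> starts at \<open>m\<close> and \<open>f'\<close> at
    \<open>d\<close>, so the constant term of the pairing is a sum over
    \<open>m \<le> n \<le> - d\<close>; \<open>s\<close> depends only on the class modulo
    \<open>4 M\<close>, which turns \<open>weight c\<close> into \<open>s_num M n\<close>.\<close>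
  have zero: "(\<Sum>n=m..- d. of_nat (s_num M n) * (a n * a' (- n))) = 0"
  proof -
    have "0 = (\<Sum>c\<in>sqs. weight c * (F c * F' c) $$ 0)"
      using pair.pairing_constant_term[OF gamma F F'] by (simp add: pair.pairing_def fls_nth_sum)
    also have "\<dots> = (\<Sum>c\<in>sqs. weight c * (\<Sum>n=m..- d. F c $$ n * F' c $$ (- n)))"
    proof (intro sum.cong refl arg_cong[where f="\<lambda>x. _ * x"] fls_mult_nth_0_sum)
      fix c i assume c: "c \<in> sqs"
      show "F c $$ i = 0" if "i < m" using Fn[OF c, of i] a0[OF that] by simp
      show "F' c $$ i = 0" if "i < - (- d)" using F'n[OF c, of i] a'0[of i] that by simp
    qed
    also have "\<dots> = (\<Sum>n=m..- d. \<Sum>c\<in>sqs. weight c * (F c $$ n * F' c $$ (- n)))"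
      by (simp only: sum_distrib_left) (rule sum.swap)
    also have "\<dots> = (\<Sum>n=m..- d. of_nat (s_num M n) * (a n * a' (- n)))"
    proof (rule sum.cong[OF refl])
      fix n
      have "weight c * (F c $$ n * F' c $$ (- n)) =
          (if [n = c] (mod int (4 * M)) then of_nat (s_num M n) * (a n * a' (- n)) else 0)" if c: "c \<in> sqs" for c
      proof -
        have "[- n = - 1 * c] (mod int (4 * M)) \<longleftrightarrow> [n = c] (mod int (4 * M))"
          by (simp add: cong_minus_minus_iff)
        then show ?thesis using Fn[OF c, of n] F'n[OF c, of "- n"] s_cong[of n c] by (auto simp: weight_def)
      qed
      then have "(\<Sum>c\<in>sqs. weight c * (F c $$ n * F' c $$ (- n))) =
          (\<Sum>c\<in>sqs. if [n = c] (mod int (4 * M)) then of_nat (s_num M n) * (a n * a' (- n)) else 0)"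
        by (intro sum.cong refl)
      also have "\<dots> = of_nat (s_num M n) * (a n * a' (- n))"
        using sum_class_indicator[of 1 "of_nat (s_num M n) * (a n * a' (- n))" n] Fs[of n] by auto
      finally show "(\<Sum>c\<in>sqs. weight c * (F c $$ n * F' c $$ (- n))) = of_nat (s_num M n) * (a n * a' (- n))" .
    qed
    finally show ?thesis by simp
  qed
  show ?thesis
  proof (cases "m < - d")
    case True
    have "(\<Sum>n=m..- d. of_nat (s_num M n) * (a n * a' (- n))) =
        (\<Sum>n\<in>{m, - d}. of_nat (s_num M n) * (a n * a' (- n)))"
    proof (rule sum.mono_neutral_right)
      show "\<forall>n\<in>{m..- d} - {m, - d}. of_nat (s_num M n) * (a n * a' (- n)) = 0"
      proof
        fix n assume "n \<in> {m..- d} - {m, - d}"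
        then have "m < n" "n < - d" by auto
        from middle[OF this] show "of_nat (s_num M n) * (a n * a' (- n)) = 0" by auto
      qed
    qed (use True in auto)
    also have "\<dots> = a' (- m) + a (- d)"
      using True s_pos[of m] s_pos[of d] by (simp add: am am' s_minus)
    finally show ?thesis using zero by (simp add: add_eq_0_iff)
  next
    case False
    then consider "m = - d" | "- d < m" by linarith
    then show ?thesis
    proof cases
      case 1
      \<comment> \<open>The sum consists of one term, equal to \<open>1 / s(m)\<close> and not 0, so
        this case is contradictory.\<close>
      then have "of_nat (s_num M m) * (a m * a' d) = 0" using zero by simp
      then show ?thesis using s_pos[of m] s_pos[of d] by (simp add: am am')
    next
      case 2
      \<comment> \<open>Both coefficients lie below the leading exponents.\<close>
      then show ?thesis using a0[of "- d"] a'0[of "- m"] by simp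
    qed
  qed
qed

end

lemma half_integer_weight:
  assumes "k - 1 / 2 \<in> \<int>"
  shows "odd \<lfloor>2 * k :: real\<rfloor>" "4 - \<lfloor>2 * k\<rfloor> = \<lfloor>2 * (2 - k)\<rfloor>"
proof -
  obtain j where j: "k - 1 / 2 = of_int j" using assms by (elim Ints_cases)
  have 1: "2 * k = of_int (2 * j + 1)" "2 * (2 - k) = of_int (4 - (2 * j + 1))" using j by (simp_all add: algebra_simps)
  show "odd \<lfloor>2 * k\<rfloor>" "4 - \<lfloor>2 * k\<rfloor> = \<lfloor>2 * (2 - k)\<rfloor>" unfolding 1 floor_of_int by simp_all
qed

theorem theorem6p2:
  fixes q :: "'a::{finite,ab_group_add} \<Rightarrow> rat"
    and M N :: nat and t r m d :: int and \<delta> \<epsilon> \<epsilon>' :: "nat \<Rightarrow> int" and k :: real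
    and f f' :: "complex \<Rightarrow> complex" and a a' :: "int \<Rightarrow> complex"
  assumes "discriminant_form q"
    and "df_transitive q"
    and "df_signature q r"
    and "df_level q = N"
    and "N = 4 * M" and "odd M" and "squarefree M"
    and "t \<in> {1, -1}" and "df_two_component q t"
    and "\<forall>p. prime p \<and> p dvd M \<longrightarrow> \<delta> p \<in> {1, -1} \<and> df_odd_component q p (\<delta> p)"
    and "k - 1 / 2 \<in> \<int>" and "[\<lfloor>2 * k\<rfloor> = r] (mod 4)"
    and "sign_vector q M \<epsilon>" and "sign_vector (df_dual q) M \<epsilon>'"
    and "reduced_form M k \<epsilon> m f a"
    and "reduced_form M (2 - k) \<epsilon>' d f' a'"
  shows "a (- d) = - a' (- m)"
proof -
  note signs = dual_sign_vector[OF \<open>discriminant_form q\<close> \<open>odd M\<close> \<open>squarefree M\<close> \<open>sign_vector q M \<epsilon>\<close>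
    \<open>sign_vector (df_dual q) M \<epsilon>'\<close>]
  note weight = half_integer_weight[OF \<open>k - 1 / 2 \<in> \<int>\<close>]
  obtain u where u: "coprime u (int (4 * M))" "[u = \<epsilon> 2] (mod 4)"
    "\<And>p. prime p \<Longrightarrow> p dvd M \<Longrightarrow> Legendre u (int p) = \<epsilon> p"
    using sign_unit_exists[of M "\<epsilon> 2" \<epsilon>, OF \<open>odd M\<close> \<open>squarefree M\<close> signs(1) signs(3)] by metis
  \<comment> \<open>The sign \<open>\<eta>\<close> is the value that
    \<open>theta_mult_twisted_gauss\<close> demands for this weight and this unit.\<close>
  interpret square_classes M u "parity_value M u \<lfloor>2 * k\<rfloor>"
    using parity_value_sign[OF weight(1) coprime_4_mult_odd[OF u(1)] \<open>odd M\<close>] \<open>odd M\<close> \<open>squarefree M\<close> u(1)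
    by unfold_locales
  show ?thesis
    by (rule reduced_coefficient_duality[OF refl weight signs(1) u(2) signs(2) u(3) signs(4) refl])
       (use \<open>reduced_form M k \<epsilon> m f a\<close> \<open>reduced_form M (2 - k) \<epsilon>' d f' a'\<close> in auto)
qed

end
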